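(* Let $\ell,h_0,\mathtt g>0$ and let $b$ be a smooth function on $[0,\ell]$ such that, with $h_b=h_0-b$, $$\inf_{(0,\ell)} h_b>0\qquad\text{and}\qquad \inf_{(0,\ell)}\Big(1+\tfrac14(\partial_x b)^2+\tfrac16 h_b\,\partial_x^2 b\Big)>0 .$$ Let $g_0,g_\ell\in C^\infty(\mathbb R^+)$. Let $n\in\mathbb N\setminus\{0\}$ and let $(\zeta^{\rm in},q^{\rm in})\in H^n(0,\ell)\times H^{n+1}(0,\ell)$ be such that $\inf_{[0,\ell]}(h_0-b+\zeta^{\rm in})>0$, and assume the compatibility conditions $$\zeta^{\rm in}(0)=g_0(0),\quad -\partial_xq^{\rm in}(0)=\dot g_0(0),\quad \zeta^{\rm in}(\ell)=g_\ell(0),\quad -\partial_xq^{\rm in}(\ell)=\dot g_\ell(0).$$ Then there exist a maximal existence time $T^*>0$ and a unique solution $(\zeta,q,q_0,q_\ell)\in C^\infty([0,T^* );H^n(0,\ell)\times H^{n+1}(0,\ell)\times\mathbb R^2)$ of the system $$\begin{cases}\partial_t\zeta+\partial_xq=0,\\ \partial_tq+\sqrt3\,\dfrac{h_b}{\alpha_b}(h_bS)^*\Big(R_b^1\big(\tfrac1{h_b^2}f_{\rm NSW}\big)\Big)=R_b^0B+\dot q_0\,\mathfrak s^{(b,0)}+\dot q_\ell\,\mathfrak s^{(b,\ell)}\end{cases}\qquad\text{in }(0,\ell),$$ $$\mathfrak S_b'\begin{pmatrix}\dot q_0\\ \dot q_\ell\end{pmatrix}+V_{\rm bdry}(g_0,q_0,g_\ell,q_\ell)=V_{\rm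 int}[\zeta,q]-\begin{pmatrix}\ddot g_0\\ \ddot g_\ell\end{pmatrix},$$ with initial conditions $(\zeta,q)(0,\cdot)=(\zeta^{\rm in},q^{\rm in})$, $q_0(0)=q^{\rm in}(0)$ and $q_\ell(0)=q^{\rm in}(\ell)$; and for all $t\in[0,T^* )$ one has $q_0(t)=q(t,0)$, $q_\ell(t)=q(t,\ell)$ and $\inf_{[0,\ell]}(h_0-b+\zeta(t,\cdot))>0$.
   Context: Constants: $\ell,h_0,\mathtt g>0$. Unknowns $\zeta(t,x)$, $q(t,x)$; $h=h_0+\zeta-b$; $h_b=h_0-b$; $\alpha_b=1+\frac14(\partial_xb)^2$. A dot denotes $\frac{\rm d}{{\rm d}t}$. Shallow water flux: $f_{\rm NSW}=f_{\rm NSW}(\zeta,q)=\frac12\mathtt g(h^2-h_0^2)+\frac1hq^2$ (at a boundary point $x\in\{0,\ell\}$, $f_{\rm NSW}(\zeta_x,q_x)$ is computed with $h=h_0+\zeta_x-b(x)$). Operators: $\mathcal T_bu=-\frac1{3h_b}\partial_x\big(h_b^3\partial_x\frac u{h_b}\big)+\frac12(\partial_x^2b)u$; $S u=-\frac1{\sqrt3}h_b\partial_x(\frac u{h_b})+\frac{\sqrt3}2\frac{\partial_xb}{h_b}u$; $(h_bS)u=h_b\,Su$; $(h_bS)^*$ is the formal $L^2$-adjoint, $(h_bS)^*u=\frac1{\sqrt3}\frac1{h_b}\partial_x(h_b^2u)+\frac{\sqrt3}2(\partial_xb)u$. $R_b^0:f\in L^2(0,\ell)\mapsto u\in H^2(0,\ell)$,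 where $u$ solves $(1+h_b\mathcal T_b)u=f$, $u(0)=u(\ell)=0$. $R_b^1:f\in L^2(0,\ell)\mapsto u\in H^2(0,\ell)$, where $u$ solves $\big[1+\frac1{h_b}(h_bS)\big(\frac{h_b}{\alpha_b}(h_bS)^*\big)\big]u=f$ with $((h_bS)^*u)(0)=((h_bS)^*u)(\ell)=0$. $\mathfrak s^{(b,0)}$ and $\mathfrak s^{(b,\ell)}$ solve $(1+h_b\mathcal T_b)\mathfrak s=0$ on $(0,\ell)$ with $\mathfrak s^{(b,0)}(0)=1$, $\mathfrak s^{(b,0)}(\ell)=0$ and $\mathfrak s^{(b,\ell)}(0)=0$, $\mathfrak s^{(b,\ell)}(\ell)=1$; and $$\mathfrak S_b'=\begin{pmatrix}(\mathfrak s^{(b,0)})'(0)&(\mathfrak s^{(b,\ell)})'(0)\\(\mathfrak s^{(b,0)})'(\ell)&(\mathfrak s^{(b,\ell)})'(\ell)\end{pmatrix}.$$ Further, $$B=B(\zeta,q)=-\mathtt gh\,\partial_xb+\frac32\frac{\partial_xb}{h_b}f_{\rm NSW},\qquad V_{\rm bdry}(\zeta_0,q_0,\zeta_\ell,q_\ell)=\begin{pmatrix}\frac3{h_b(0)^2}f_{\rm NSW}(\zeta_0,q_0)\\ \frac3{h_b(\ell)^2}f_{\rm NSW}(\zeta_\ell,q_\ell)\end{pmatrix},$$ $$V_{\rm int}[\zeta,q]=\begin{pmatrix}3\big(R_b^1(\frac1{h_b^2}f_{\rm NSW})\big)_{|x=0}-\big(\partial_x(R_b^0B)\big)_{|x=0}\\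 3\big(R_b^1(\frac1{h_b^2}f_{\rm NSW})\big)_{|x=\ell}-\big(\partial_x(R_b^0B)\big)_{|x=\ell}\end{pmatrix}.$$ *)

theory Defs
  imports "HOL-Analysis.Analysis"
begin

section \<open>Classical derivatives and smoothness\<close>

text \<open>Derivative relative to a set \<open>A\<close>; one-sided at an endpoint of an interval \<open>A\<close>.\<close>

definition Dcl :: "real set \<Rightarrow> (real \<Rightarrow> real) \<Rightarrow> real \<Rightarrow> real" where
  "Dcl A f x = vector_derivative f (at x within A)"

definition smooth_on :: "real set \<Rightarrow> (real \<Rightarrow> real) \<Rightarrow> bool" where
  "smooth_on A f \<longleftrightarrow> (\<exists>D. (\<forall>x\<in>A. D (0::nat) x = f x) \<and>
     (\<forall>k. \<forall>x\<in>A. (D k has_real_derivative D (Suc k) x) (at x within A)))"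


section \<open>Sobolev spaces on the interval from 0 to \<open>l\<close>\<close>

text \<open>Elements of function spaces are represented by functions on \<^typ>\<open>real\<close>; only their
  values on the interval matter.\<close>

definition L2 :: "real \<Rightarrow> (real \<Rightarrow> real) \<Rightarrow> bool" where
  "L2 l f \<longleftrightarrow> f \<in> borel_measurable (lebesgue_on {0<..<l}) \<and>
     integrable (lebesgue_on {0<..<l}) (\<lambda>x. (f x)\<^sup>2)"

definition test_fun :: "real \<Rightarrow> (real \<Rightarrow> real) \<Rightarrow> bool" where
  "test_fun l \<phi> \<longleftrightarrow> smooth_on UNIV \<phi> \<and>
     (\<exists>c d. 0 < c \<and> d < l \<and> (\<forall>x. x \<notin> {c..d} \<longrightarrow> \<phi> x = 0))"

definition weak_deriv :: "real \<Rightarrow> (real \<Rightarrow> real) \<Rightarrow> (real \<Rightarrow> real) \<Rightarrow> bool" where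
  "weak_deriv l f f' \<longleftrightarrow> L2 l f \<and> L2 l f' \<and>
     (\<forall>\<phi>. test_fun l \<phi> \<longrightarrow>
        (LINT x|lebesgue_on {0<..<l}. f x * deriv \<phi> x)
        = - (LINT x|lebesgue_on {0<..<l}. f' x * \<phi> x))"

text \<open>An element of a Sobolev space of positive order is represented by its representative that is
  continuous up to the boundary, so that boundary values are plain function values.\<close>

fun Hs :: "real \<Rightarrow> nat \<Rightarrow> (real \<Rightarrow> real) set" where
  "Hs l 0 = {f. L2 l f}"
| "Hs l (Suc n) = {f. continuous_on {0..l} f \<and> (\<exists>f'\<in>Hs l n. weak_deriv l f f')}"

text \<open>A representative of the weak derivative: the continuous one whenever there is one (it is then
  unique on the closed interval, and is the classical derivative there), an arbitrary one
  otherwise.\<close>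

definition Dw :: "real \<Rightarrow> (real \<Rightarrow> real) \<Rightarrow> real \<Rightarrow> real" where
  "Dw l f = (SOME f'. weak_deriv l f f' \<and>
     ((\<exists>k. weak_deriv l f k \<and> continuous_on {0..l} k) \<longrightarrow> continuous_on {0..l} f'))"

definition Hnorm :: "real \<Rightarrow> nat \<Rightarrow> (real \<Rightarrow> real) \<Rightarrow> real" where
  "Hnorm l n f = sqrt (\<Sum>k\<le>n. LINT x|lebesgue_on {0<..<l}. ((Dw l ^^ k) f x)\<^sup>2)"

text \<open>The class of curves \<open>u\<close> on the time set \<open>I\<close> that are infinitely differentiable with values in
  the normed space \<open>Hs l n\<close>: \<open>U k\<close> is the \<open>k\<close>-th time derivative of \<open>u\<close>, difference quotients
  converging in the norm.\<close>

definition smooth_curve :: "real \<Rightarrow> nat \<Rightarrow> real set \<Rightarrow> (real \<Rightarrow> real \<Rightarrow> real) \<Rightarrow> bool" where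
  "smooth_curve l n I u \<longleftrightarrow> (\<exists>U. (\<forall>t\<in>I. U (0::nat) t = u t) \<and>
     (\<forall>k. \<forall>t\<in>I. U k t \<in> Hs l n \<and>
        ((\<lambda>s. Hnorm l n (\<lambda>x. (U k s x - U k t x) / (s - t) - U (Suc k) t x)) \<longlongrightarrow> 0)
          (at t within I)))"


section \<open>Coefficients and operators\<close>

text \<open>The bottom \<open>b\<close> is smooth on the closed interval, so it is differentiated classically; all other
  space derivatives are weak.\<close>

definition hb :: "real \<Rightarrow> (real \<Rightarrow> real) \<Rightarrow> real \<Rightarrow> real" where
  "hb h0 b x = h0 - b x"

definition alphab :: "real \<Rightarrow> (real \<Rightarrow> real) \<Rightarrow> real \<Rightarrow> real" where
  "alphab l b x = 1 + 1/4 * (Dcl {0..l} b x)\<^sup>2"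

definition Tb :: "real \<Rightarrow> real \<Rightarrow> (real \<Rightarrow> real) \<Rightarrow> (real \<Rightarrow> real) \<Rightarrow> real \<Rightarrow> real" where
  "Tb l h0 b u x =
     - 1 / (3 * hb h0 b x) * Dw l (\<lambda>y. hb h0 b y ^ 3 * Dw l (\<lambda>z. u z / hb h0 b z) y) x
     + 1/2 * Dcl {0..l} (Dcl {0..l} b) x * u x"

definition S :: "real \<Rightarrow> real \<Rightarrow> (real \<Rightarrow> real) \<Rightarrow> (real \<Rightarrow> real) \<Rightarrow> real \<Rightarrow> real" where
  "S l h0 b u x = - 1 / sqrt 3 * hb h0 b x * Dw l (\<lambda>y. u y / hb h0 b y) x
     + sqrt 3 / 2 * (Dcl {0..l} b x / hb h0 b x) * u x"

definition hbS :: "real \<Rightarrow> real \<Rightarrow> (real \<Rightarrow> real) \<Rightarrow> (real \<Rightarrow> real) \<Rightarrow> real \<Rightarrow> real" where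
  "hbS l h0 b u x = hb h0 b x * S l h0 b u x"

text \<open>The formal adjoint of \<^const>\<open>hbS\<close>.\<close>

definition hbS_adj :: "real \<Rightarrow> real \<Rightarrow> (real \<Rightarrow> real) \<Rightarrow> (real \<Rightarrow> real) \<Rightarrow> real \<Rightarrow> real" where
  "hbS_adj l h0 b u x = 1 / sqrt 3 * (1 / hb h0 b x) * Dw l (\<lambda>y. (hb h0 b y)\<^sup>2 * u y) x
     + sqrt 3 / 2 * Dcl {0..l} b x * u x"

text \<open>The solution \<open>u\<close> of \<open>(1 + hb Tb) u = f\<close> with boundary values \<open>c\<close> at 0 and \<open>d\<close> at \<open>l\<close>. The
  choice operator only chooses the irrelevant values outside the closed interval when the boundary
  value problem is uniquely solvable.\<close>

definition dirichlet_sol ::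
    "real \<Rightarrow> real \<Rightarrow> (real \<Rightarrow> real) \<Rightarrow> (real \<Rightarrow> real) \<Rightarrow> real \<Rightarrow> real \<Rightarrow> real \<Rightarrow> real" where
  "dirichlet_sol l h0 b f c d = (SOME u. u \<in> Hs l 2 \<and>
     (AE x in lebesgue_on {0<..<l}. u x + hb h0 b x * Tb l h0 b u x = f x) \<and>
     u 0 = c \<and> u l = d)"

definition R0 :: "real \<Rightarrow> real \<Rightarrow> (real \<Rightarrow> real) \<Rightarrow> (real \<Rightarrow> real) \<Rightarrow> real \<Rightarrow> real" where
  "R0 l h0 b f = dirichlet_sol l h0 b f 0 0"

definition s_left :: "real \<Rightarrow> real \<Rightarrow> (real \<Rightarrow> real) \<Rightarrow> real \<Rightarrow> real" where
  "s_left l h0 b = dirichlet_sol l h0 b (\<lambda>x. 0) 1 0"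

definition s_right :: "real \<Rightarrow> real \<Rightarrow> (real \<Rightarrow> real) \<Rightarrow> real \<Rightarrow> real" where
  "s_right l h0 b = dirichlet_sol l h0 b (\<lambda>x. 0) 0 1"

definition R1 :: "real \<Rightarrow> real \<Rightarrow> (real \<Rightarrow> real) \<Rightarrow> (real \<Rightarrow> real) \<Rightarrow> real \<Rightarrow> real" where
  "R1 l h0 b f = (SOME u. u \<in> Hs l 2 \<and>
     (AE x in lebesgue_on {0<..<l}.
        u x + 1 / hb h0 b x
          * hbS l h0 b (\<lambda>y. hb h0 b y / alphab l b y * hbS_adj l h0 b u y) x = f x) \<and>
     hbS_adj l h0 b u 0 = 0 \<and> hbS_adj l h0 b u l = 0)"

definition Sb' :: "real \<Rightarrow> real \<Rightarrow> (real \<Rightarrow> real) \<Rightarrow> real^2^2" where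
  "Sb' l h0 b = vector
     [vector [Dw l (s_left l h0 b) 0, Dw l (s_right l h0 b) 0],
      vector [Dw l (s_left l h0 b) l, Dw l (s_right l h0 b) l]]"


section \<open>The reduced Boussinesq--Abbott system\<close>

text \<open>Here \<open>gr\<close> is the gravity constant, and \<open>z\<close>, \<open>p\<close> are the values of the surface elevation and of
  the discharge at the point \<open>x\<close>.\<close>

definition fNSW :: "real \<Rightarrow> real \<Rightarrow> (real \<Rightarrow> real) \<Rightarrow> real \<Rightarrow> real \<Rightarrow> real \<Rightarrow> real" where
  "fNSW h0 gr b x z p =
     (let h = h0 + z - b x in 1/2 * gr * (h\<^sup>2 - h0\<^sup>2) + 1 / h * p\<^sup>2)"

definition Bsrc ::
    "real \<Rightarrow> real \<Rightarrow> real \<Rightarrow> (real \<Rightarrow> real) \<Rightarrow> (real \<Rightarrow> real) \<Rightarrow> (real \<Rightarrow> real) \<Rightarrow> real \<Rightarrow> real" where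
  "Bsrc l h0 gr b z p x = - gr * (h0 + z x - b x) * Dcl {0..l} b x
     + 3/2 * (Dcl {0..l} b x / hb h0 b x) * fNSW h0 gr b x (z x) (p x)"

definition Rf ::
    "real \<Rightarrow> real \<Rightarrow> real \<Rightarrow> (real \<Rightarrow> real) \<Rightarrow> (real \<Rightarrow> real) \<Rightarrow> (real \<Rightarrow> real) \<Rightarrow> real \<Rightarrow> real" where
  "Rf l h0 gr b z p = R1 l h0 b (\<lambda>x. 1 / (hb h0 b x)\<^sup>2 * fNSW h0 gr b x (z x) (p x))"

definition Vbdry ::
    "real \<Rightarrow> real \<Rightarrow> real \<Rightarrow> (real \<Rightarrow> real) \<Rightarrow> real \<Rightarrow> real \<Rightarrow> real \<Rightarrow> real \<Rightarrow> real^2" where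
  "Vbdry l h0 gr b z0 p0 zl pl = vector
     [3 / (hb h0 b 0)\<^sup>2 * fNSW h0 gr b 0 z0 p0,
      3 / (hb h0 b l)\<^sup>2 * fNSW h0 gr b l zl pl]"

definition Vint ::
    "real \<Rightarrow> real \<Rightarrow> real \<Rightarrow> (real \<Rightarrow> real) \<Rightarrow> (real \<Rightarrow> real) \<Rightarrow> (real \<Rightarrow> real) \<Rightarrow> real^2" where
  "Vint l h0 gr b z p = vector
     [3 * Rf l h0 gr b z p 0 - Dw l (R0 l h0 b (Bsrc l h0 gr b z p)) 0,
      3 * Rf l h0 gr b z p l - Dw l (R0 l h0 b (Bsrc l h0 gr b z p)) l]"

text \<open>The time interval from 0 (included) to \<open>T\<close> (excluded), where \<open>T\<close> may be infinite.\<close>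

definition time_ivl :: "ereal \<Rightarrow> real set" where
  "time_ivl T = {t. 0 \<le> t \<and> ereal t < T}"

text \<open>The two conditions that heights do not vanish only say that all
  terms of the system are defined (in HOL, division by zero would give zero); positivity of the
  height and the identification of the boundary values of \<open>q\<close> with \<open>q0\<close>, \<open>ql\<close> are not part of the
  notion of solution.\<close>

definition is_solution ::
    "real \<Rightarrow> real \<Rightarrow> real \<Rightarrow> (real \<Rightarrow> real) \<Rightarrow> (real \<Rightarrow> real) \<Rightarrow> (real \<Rightarrow> real) \<Rightarrow> nat
     \<Rightarrow> (real \<Rightarrow> real) \<Rightarrow> (real \<Rightarrow> real) \<Rightarrow> ereal
     \<Rightarrow> (real \<Rightarrow> real \<Rightarrow> real) \<Rightarrow> (real \<Rightarrow> real \<Rightarrow> real) \<Rightarrow> (real \<Rightarrow> real) \<Rightarrow> (real \<Rightarrow> real) \<Rightarrow> bool" where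
  "is_solution l h0 gr b g0 gl n \<zeta>in qin T \<zeta> q q0 ql \<longleftrightarrow>
     (let I = time_ivl T in
      smooth_curve l n I \<zeta> \<and> smooth_curve l (n + 1) I q \<and> smooth_on I q0 \<and> smooth_on I ql \<and>
      (\<forall>t\<in>I. \<forall>x\<in>{0..l}. h0 + \<zeta> t x - b x \<noteq> 0) \<and>
      (\<forall>t\<in>I. h0 + g0 t - b 0 \<noteq> 0 \<and> h0 + gl t - b l \<noteq> 0) \<and>
      (\<forall>t\<in>I. \<forall>x\<in>{0<..<l}.
         Dcl I (\<lambda>s. \<zeta> s x) t + Dw l (q t) x = 0 \<and>
         Dcl I (\<lambda>s. q s x) t
           + sqrt 3 * (hb h0 b x / alphab l b x) * hbS_adj l h0 b (Rf l h0 gr b (\<zeta> t) (q t)) x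
         = R0 l h0 b (Bsrc l h0 gr b (\<zeta> t) (q t)) x
           + Dcl I q0 t * s_left l h0 b x + Dcl I ql t * s_right l h0 b x) \<and>
      (\<forall>t\<in>I.
         Sb' l h0 b *v vector [Dcl I q0 t, Dcl I ql t]
           + Vbdry l h0 gr b (g0 t) (q0 t) (gl t) (ql t)
         = Vint l h0 gr b (\<zeta> t) (q t)
           - vector [Dcl {0..} (Dcl {0..} g0) t, Dcl {0..} (Dcl {0..} gl) t]) \<and>
      (\<forall>x\<in>{0..l}. \<zeta> 0 x = \<zeta>in x \<and> q 0 x = qin x) \<and>
      q0 0 = qin 0 \<and> ql 0 = qin l)"

end

theory Submission
  imports Defs
begin

text \<open>Both elliptic problems are two-point problems for linear 2x2 systems of ordinary differential
  equations, with unknowns \<open>(u, h\<^sub>b u')\<close> for \<open>R\<^sub>b\<^sup>0\<close> and \<open>(flux, u)\<close> for \<open>R\<^sub>b\<^sup>1\<close>; a monotone product of the two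
  components gives unique solvability, and the solution operators gain one derivative. Hence the
  system has no loss of derivatives: with \<open>1/h\<close> as an additional unknown it is an ordinary
  differential equation with polynomial right-hand side, and Picard iteration yields a solution that is
  smooth in time. Uniqueness is a Gronwall argument in sup norms for \<open>(\<zeta>, q, \<partial>\<^sub>x q, q\<^sub>0, q\<^sub>\<ell>)\<close>, where the
  equation for \<open>\<partial>\<^sub>x q\<close> is the differentiated second equation. By uniqueness, all solutions glue to one
  on the supremum of the existence times.\<close>

text \<open>The reciprocal of the height is what keeps the system from being polynomial in the
  unknowns. Once it is an unknown itself, every nonlinearity is composed of bounded bilinear maps
  and bounded linear solution operators on one Banach space, and Picard iteration asks for no lower
  bound of the height along the flow. That the extra unknown is still the reciprocal follows
  afterwards from a linear equation for its product with the height. The derivative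
  \<open>\<partial>\<^sub>x q\<close> enters the uniqueness argument because
  \<open>\<partial>\<^sub>t \<zeta> = - \<partial>\<^sub>x q\<close>; its own equation is again of
  order zero, since the first-order systems express the x-derivatives of the flux, of
  \<open>R\<^sub>b\<^sup>0 B\<close> and of the two boundary functions without differentiating the
  unknowns. As n is at least 1, the data of the elliptic problems are continuous and their solutions
  classical. Mere square integrability concerns only the highest derivatives, and the flow changes
  these by continuous factors and continuous summands.\<close>

text \<open>The completeness of spaces of bounded continuous functions is available on metric domains only; it
  is needed for bounded sequences.\<close>

instantiation nat :: metric_space
begin

definition dist_nat :: "nat \<Rightarrow> nat \<Rightarrow> real" where
  "dist_nat m n = \<bar>real m - real n\<bar>"

definition uniformity_nat :: "(nat \<times> nat) filter" where
  "uniformity_nat = (INF e\<in>{0<..}. principal {(x, y). dist x y < e})"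

instance
proof
  show "uniformity = (INF e\<in>{0<..}. principal {(x, y::nat). dist x y < e})"
    by (rule uniformity_nat_def)
  show "open U \<longleftrightarrow> (\<forall>x\<in>U. eventually (\<lambda>(x', y). x' = x \<longrightarrow> y \<in> U) uniformity)" for U :: "nat set"
  proof -
    have "m = n" if "dist m n < 1" for m n :: nat
      using that unfolding dist_nat_def by linarith
    then have "eventually (\<lambda>(x', y). x' = x \<longrightarrow> y \<in> U) uniformity" if "x \<in> U" for x
      unfolding uniformity_nat_def
      by (intro eventually_INF1[of 1]) (use that in \<open>auto simp: eventually_principal\<close>)
    then show ?thesis by (simp add: open_discrete)
  qed
qed (auto simp: dist_nat_def)

end

instance bcontfun :: (metric_space, banach) banach ..

section \<open>Curves of class C^k\<close>

text \<open>Derivatives are taken relative to I, hence one-sided at an end point that belongs to I.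
  Finite orders are used because the passage from C^k to C^(k+1) along an equation u' = G t (u t) is
  an induction on k.\<close>

fun Ck_on :: "nat \<Rightarrow> real set \<Rightarrow> (real \<Rightarrow> 'a::real_normed_vector) \<Rightarrow> bool" where
  "Ck_on 0 I u = continuous_on I u"
| "Ck_on (Suc k) I u =
     (\<exists>u'. (\<forall>t\<in>I. (u has_vector_derivative u' t) (at t within I)) \<and> Ck_on k I u')"

lemma Ck_on_SucE:
  assumes "Ck_on (Suc k) I u"
  obtains u' where "\<forall>t\<in>I. (u has_vector_derivative u' t) (at t within I)" and "Ck_on k I u'"
  using assms unfolding Ck_on.simps by blast

lemma Ck_on_SucI:
  assumes "\<And>t. t \<in> I \<Longrightarrow> (u has_vector_derivative u' t) (at t within I)"
    and "Ck_on k I u'"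
  shows "Ck_on (Suc k) I u"
  using assms unfolding Ck_on.simps by blast

declare Ck_on.simps(2) [simp del]

lemma Ck_on_cong:
  assumes "Ck_on k I u" and "\<And>t. t \<in> I \<Longrightarrow> v t = u t"
  shows "Ck_on k I v"
proof (cases k)
  case 0
  then show ?thesis using assms continuous_on_cong[OF refl, of I v u] by simp
next
  case (Suc m)
  with assms(1) obtain u' where
    u': "\<forall>t\<in>I. (u has_vector_derivative u' t) (at t within I)"
    and "Ck_on m I u'" by (auto elim: Ck_on_SucE)
  note C = this(2)
  have "(v has_vector_derivative u' t) (at t within I)" if "t \<in> I" for t
    using has_vector_derivative_transform[OF that assms(2) bspec[OF u' that]] .
  from Ck_on_SucI[OF this C] show ?thesis using Suc by simp
qed

lemma Ck_on_Suc_D: "Ck_on (Suc k) I u \<Longrightarrow> Ck_on k I u"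
proof (induction k arbitrary: u)
  case 0
  then show ?case
    by (auto simp: continuous_on_eq_continuous_within intro: has_vector_derivative_continuous
        elim!: Ck_on_SucE)
next
  case (Suc k)
  from Suc.prems show ?case
    by (rule Ck_on_SucE) (rule Ck_on_SucI, erule bspec, assumption, rule Suc.IH)
qed

lemma Ck_on_continuous: "Ck_on k I u \<Longrightarrow> continuous_on I u"
  by (induction k) (auto dest: Ck_on_Suc_D)

lemma Ck_on_subset: "Ck_on k I u \<Longrightarrow> J \<subseteq> I \<Longrightarrow> Ck_on k J u"
proof (induction k arbitrary: u)
  case 0
  then show ?case by (auto intro: continuous_on_subset)
next
  case (Suc k)
  from Suc.prems(1) obtain u' where
    "\<forall>t\<in>I. (u has_vector_derivative u' t) (at t within I)" "Ck_on k I u'"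
    by (rule Ck_on_SucE)
  note u' = this
  show ?case
    by (rule Ck_on_SucI[OF has_vector_derivative_within_subset[OF bspec[OF u'(1)] Suc.prems(2)]
          Suc.IH[OF u'(2) Suc.prems(2)]]) (use Suc.prems(2) in blast)
qed

lemma Ck_on_const [simp]: "Ck_on k I (\<lambda>t. c)"
proof (induction k arbitrary: c)
  case (Suc k)
  show ?case by (rule Ck_on_SucI[where u' = "\<lambda>t. 0"]) (auto intro: Suc)
qed auto

lemma Ck_on_bounded_linear:
  assumes "bounded_linear L"
  shows "Ck_on k I u \<Longrightarrow> Ck_on k I (\<lambda>t. L (u t))"
proof (induction k arbitrary: u)
  case 0
  then show ?case using bounded_linear.continuous_on[OF assms] by auto
next
  case (Suc k)
  from Suc.prems show ?case
    by (rule Ck_on_SucE)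
       (rule Ck_on_SucI, rule bounded_linear.has_vector_derivative[OF assms], erule bspec, assumption, rule Suc.IH)
qed

lemma Ck_on_add:
  "Ck_on k I u \<Longrightarrow> Ck_on k I v \<Longrightarrow> Ck_on k I (\<lambda>t. u t + v t)"
proof (induction k arbitrary: u v)
  case 0
  then show ?case by (simp add: continuous_on_add)
next
  case (Suc k)
  obtain u' where u': "\<forall>t\<in>I. (u has_vector_derivative u' t) (at t within I)" "Ck_on k I u'"
    using Suc.prems(1) by (rule Ck_on_SucE)
  obtain v' where v': "\<forall>t\<in>I. (v has_vector_derivative v' t) (at t within I)" "Ck_on k I v'"
    using Suc.prems(2) by (rule Ck_on_SucE)
  show ?case
    by (rule Ck_on_SucI[OF has_vector_derivative_add[OF bspec[OF u'(1)] bspec[OF v'(1)]]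
          Suc.IH[OF u'(2) v'(2)]])
qed

lemma Ck_on_bounded_bilinear:
  assumes "bounded_bilinear B"
  shows "Ck_on k I u \<Longrightarrow> Ck_on k I v \<Longrightarrow> Ck_on k I (\<lambda>t. B (u t) (v t))"
proof (induction k arbitrary: u v)
  case 0
  then show ?case using bounded_bilinear.continuous_on[OF assms] by auto
next
  case (Suc k)
  obtain u' where u': "\<forall>t\<in>I. (u has_vector_derivative u' t) (at t within I)" "Ck_on k I u'"
    using Suc.prems(1) by (rule Ck_on_SucE)
  obtain v' where v': "\<forall>t\<in>I. (v has_vector_derivative v' t) (at t within I)" "Ck_on k I v'"
    using Suc.prems(2) by (rule Ck_on_SucE)
  have "Ck_on k I (\<lambda>t. B (u t) (v' t) + B (u' t) (v t))"
    by (intro Ck_on_add Suc.IH u'(2) v'(2) Suc.prems[THEN Ck_on_Suc_D])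
  note C = this
  have "((\<lambda>t. B (u t) (v t)) has_vector_derivative B (u t) (v' t) + B (u' t) (v t))
      (at t within I)" if "t \<in> I" for t
    by (rule bounded_bilinear.has_vector_derivative[OF assms bspec[OF u'(1) that] bspec[OF v'(1) that]])
  from Ck_on_SucI[OF this C] show ?case .
qed

lemmas Ck_on_mult = Ck_on_bounded_bilinear[OF bounded_bilinear_mult]

lemma Ck_on_minus: "Ck_on k I u \<Longrightarrow> Ck_on k I (\<lambda>t. - u t)"
  by (rule Ck_on_bounded_linear[OF bounded_linear_minus[OF bounded_linear_ident]])

lemma Ck_on_diff: "Ck_on k I u \<Longrightarrow> Ck_on k I v \<Longrightarrow> Ck_on k I (\<lambda>t. u t - v t)"
  using Ck_on_add[OF _ Ck_on_minus, of k I u v] by simp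

lemma Ck_on_power: "Ck_on k I u \<Longrightarrow> Ck_on k I (\<lambda>t. u t ^ m)" for u :: "real \<Rightarrow> real"
  by (induction m) (simp_all add: Ck_on_mult)

lemma Ck_on_inverse:
  fixes u :: "real \<Rightarrow> real"
  assumes "\<And>t. t \<in> I \<Longrightarrow> u t \<noteq> 0"
  shows "Ck_on k I u \<Longrightarrow> Ck_on k I (\<lambda>t. inverse (u t))"
proof (induction k)
  case 0
  then show ?case using assms by (simp add: continuous_on_inverse)
next
  case (Suc k)
  obtain u' where u': "\<forall>t\<in>I. (u has_vector_derivative u' t) (at t within I)" "Ck_on k I u'"
    using Suc.prems(1) by (rule Ck_on_SucE)
  have "Ck_on k I (\<lambda>t. inverse (u t))"
    using Suc Ck_on_Suc_D by blast
  then have "Ck_on k I (\<lambda>t. - (inverse (u t) * u' t * inverse (u t)))"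
    by (intro Ck_on_minus Ck_on_mult u'(2))
  note C = this
  have "((\<lambda>t. inverse (u t)) has_vector_derivative - (inverse (u t) * u' t * inverse (u t)))
      (at t within I)" if "t \<in> I" for t
    using bspec[OF u'(1) that] assms[OF that]
    unfolding has_real_derivative_iff_has_vector_derivative[symmetric]
    by (auto intro!: derivative_eq_intros)
  from Ck_on_SucI[OF this C] show ?case .
qed

lemma Ck_on_divide:
  fixes u v :: "real \<Rightarrow> real"
  assumes "Ck_on k I u" "Ck_on k I v" "\<And>t. t \<in> I \<Longrightarrow> v t \<noteq> 0"
  shows "Ck_on k I (\<lambda>t. u t / v t)"
  using Ck_on_mult[OF assms(1) Ck_on_inverse[OF assms(3,2)]] by (simp add: divide_inverse)

lemma Ck_on_Pair:
  assumes "Ck_on k I u" "Ck_on k I v"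
  shows "Ck_on k I (\<lambda>t. (u t, v t))"
proof -
  have 1: "bounded_linear (\<lambda>x::'a. (x, 0::'b))" and 2: "bounded_linear (\<lambda>x::'b. (0::'a, x))"
    by (intro bounded_linear_Pair bounded_linear_ident bounded_linear_zero)+
  from Ck_on_add[OF Ck_on_bounded_linear[OF 1 assms(1)] Ck_on_bounded_linear[OF 2 assms(2)]]
  show ?thesis by simp
qed

lemma has_vector_derivative_unique_within:
  assumes "at t within I \<noteq> bot"
    and "(u has_vector_derivative a) (at t within I)" "(u has_vector_derivative b) (at t within I)"
  shows "a = b"
  using assms vector_derivative_within by metis

text \<open>Each finite order brings its own witness derivatives. At non-isolated points derivatives
  are unique, so the iterates of \<open>vector_derivative\<close> form a single sequence for all
  orders, the form that \<open>smooth_on\<close> and \<open>smooth_curve\<close> ask for.\<close>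

lemma Ck_on_sequence:
  assumes I: "\<And>t. t \<in> I \<Longrightarrow> at t within I \<noteq> bot" and u: "\<And>k. Ck_on k I u"
  obtains D where "D 0 = u"
    and "\<And>k t. t \<in> I \<Longrightarrow> (D k has_vector_derivative D (Suc k) t) (at t within I)"
    and "\<And>k m. Ck_on m I (D k)"
proof
  define d where "d f t = vector_derivative f (at t within I)" for f :: "real \<Rightarrow> 'a" and t
  define D where "D k = (d ^^ k) u" for k
  show "D 0 = u" by (simp add: D_def)
  have d: "(\<forall>t\<in>I. (f has_vector_derivative d f t) (at t within I)) \<and> Ck_on m I (d f)"
    if "Ck_on (Suc m) I f" for f m
  proof -
    obtain f' where f': "\<forall>t\<in>I. (f has_vector_derivative f' t) (at t within I)"
      "Ck_on m I f'" using \<open>Ck_on (Suc m) I f\<close> by (rule Ck_on_SucE)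
    then have "d f t = f' t" if "t \<in> I" for t
      unfolding d_def using I that by (auto intro!: vector_derivative_within)
    with f'(1) Ck_on_cong[OF f'(2), of "d f"] show ?thesis by simp
  qed
  have *: "Ck_on m I (D k)" for k m
  proof (induction k arbitrary: m)
    case (Suc k)
    then have "Ck_on (Suc m) I (D k)" .
    then show ?case using d by (simp add: D_def)
  qed (simp add: D_def u)
  then show "Ck_on m I (D k)" for k m .
  show "(D k has_vector_derivative D (Suc k) t) (at t within I)" if "t \<in> I" for k t
    using d[OF *[of "Suc 0" k]] that by (simp add: D_def)
qed

lemma Ck_on_smooth:
  assumes "\<And>t. t \<in> I \<Longrightarrow> at t within I \<noteq> bot"
  shows "smooth_on I f \<longleftrightarrow> (\<forall>k. Ck_on k I f)"
proof
  assume "smooth_on I f"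
  then obtain D where D: "\<And>x. x \<in> I \<Longrightarrow> D (0::nat) x = f x"
    "\<And>k x. x \<in> I \<Longrightarrow> (D k has_vector_derivative D (Suc k) x) (at x within I)"
    by (auto simp: smooth_on_def has_real_derivative_iff_has_vector_derivative)
  have "Ck_on k I (D m)" for k m
  proof (induction k arbitrary: m)
    case 0
    then show ?case using D(2)
      by (auto simp: continuous_on_eq_continuous_within intro: has_vector_derivative_continuous)
  next
    case (Suc k)
    show ?case by (rule Ck_on_SucI[OF D(2) Suc])
  qed
  then show "\<forall>k. Ck_on k I f" using D(1) Ck_on_cong[of _ I "D 0" f] by simp
next
  assume "\<forall>k. Ck_on k I f"
  with Ck_on_sequence[OF assms, of f] obtain D where "D 0 = f"
    "\<And>k t. t \<in> I \<Longrightarrow> (D k has_vector_derivative D (Suc k) t) (at t within I)" by metis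
  then show "smooth_on I f"
    by (auto simp: smooth_on_def has_real_derivative_iff_has_vector_derivative)
qed

text \<open>Used when solutions are glued. The globally defined \<open>vector_derivative\<close>
  agrees on each neighbourhood V with the local witness, because an open V around t does not change
  the filter \<open>at t within I\<close>.\<close>

lemma Ck_on_local:
  assumes "\<And>t. t \<in> I \<Longrightarrow> at t within I \<noteq> bot"
    and "\<And>t. t \<in> I \<Longrightarrow> \<exists>V. open V \<and> t \<in> V \<and> Ck_on k (I \<inter> V) u"
  shows "Ck_on k I u"
  using assms(2)
proof (induction k arbitrary: u)
  case 0
  show ?case unfolding Ck_on.simps continuous_on_eq_continuous_within
  proof
    fix t assume "t \<in> I"
    with 0 obtain V where V: "open V" "t \<in> V" "continuous_on (I \<inter> V) u" by auto
    then have "continuous (at t within (I \<inter> V)) u"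
      using \<open>t \<in> I\<close> by (auto simp: continuous_on_eq_continuous_within)
    then show "continuous (at t within I) u"
      using V at_within_nhd[of t V I "I \<inter> V"] by simp
  qed
next
  case (Suc k)
  define u' where "u' t = vector_derivative u (at t within I)" for t
  have *: "\<exists>V. open V \<and> t \<in> V \<and> (\<forall>s\<in>I\<inter>V. (u has_vector_derivative u' s) (at s within I))
      \<and> Ck_on k (I \<inter> V) u'" if "t \<in> I" for t
  proof -
    from Suc.prems[OF that] obtain V where V: "open V" "t \<in> V" "Ck_on (Suc k) (I \<inter> V) u"
      by blast
    from V(3) obtain w where
      w: "\<forall>s\<in>I \<inter> V. (u has_vector_derivative w s) (at s within (I \<inter> V))" "Ck_on k (I \<inter> V) w"
      by (rule Ck_on_SucE)
    have w': "(u has_vector_derivative w s) (at s within I)" if "s \<in> I \<inter> V" for s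
      using bspec[OF w(1) that] that V at_within_nhd[of s V I "I \<inter> V"] by auto
    have "u' s = w s" if "s \<in> I \<inter> V" for s
      unfolding u'_def using w'[OF that] that assms(1) by (auto intro: vector_derivative_within)
    with Ck_on_cong[OF w(2), of u'] V w' show ?thesis by (intro exI[of _ V]) simp
  qed
  have "Ck_on k I u'" using Suc.IH[of u'] * by blast
  note C = this
  have "(u has_vector_derivative u' t) (at t within I)" if "t \<in> I" for t
    using *[OF that] that by auto
  from Ck_on_SucI[OF this C] show ?case .
qed


section \<open>Ordinary differential equations\<close>

text \<open>The Lipschitz bound is global in the state, so one contraction covers all of {0..T}. The
  theorem serves linear systems in the space variable and, after truncation, the evolution in
  time.\<close>

theorem ode_global:
  fixes G :: "real \<Rightarrow> 'a::banach \<Rightarrow> 'a"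
  assumes T: "0 \<le> T"
    and cont: "\<And>u. continuous_on {0..T} u \<Longrightarrow> continuous_on {0..T} (\<lambda>t. G t (u t))"
    and lip: "\<And>t u v. t \<in> {0..T} \<Longrightarrow> norm (G t u - G t v) \<le> K * norm (u - v)"
  obtains u where "u 0 = u0"
    and "\<And>t. t \<in> {0..T} \<Longrightarrow> (u has_vector_derivative G t (u t)) (at t within {0..T})"
proof -
  define L where "L = max K 1"
  have L: "L \<ge> 1" "L \<ge> K" by (auto simp: L_def)
  have lip': "norm (G t u - G t v) \<le> L * norm (u - v)" if "t \<in> {0..T}" for t u v
    using lip[OF that, of u v] L(2) mult_right_mono[OF L(2), of "norm (u - v)"] by simp
  \<comment> \<open>With the rate 2 * L, the integral of L * e over {0..t} is (e t - 1) / 2; this is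
    the origin of the contraction factor 1/2.\<close>
  define e where "e t = exp (2 * L * t)" for t
  have e_pos: "e t > 0" for t by (simp add: e_def)
  \<comment> \<open>The unknown is weighted by \<open>1 / e\<close>, which makes the Picard operator a contraction on the whole
    interval.\<close>
  define H where "H (w::real \<Rightarrow>\<^sub>C 'a) t = (1 / e t) *\<^sub>R (u0 + integral {0..t} (\<lambda>s. G s (e s *\<^sub>R w s)))" for w t
  have contG: "continuous_on {0..T} (\<lambda>s. G s (e s *\<^sub>R apply_bcontfun w s))" for w
    by (intro cont continuous_intros) (auto simp: e_def intro!: continuous_intros)
  have intG: "(\<lambda>s. G s (e s *\<^sub>R apply_bcontfun w s)) integrable_on {0..t}" if "t \<in> {0..T}" for w t
    using that by (intro integrable_continuous_real continuous_on_subset[OF contG]) auto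
  have contH: "continuous_on (cbox 0 T) (H w)" for w
    unfolding H_def cbox_interval
    by (intro continuous_intros indefinite_integral_continuous_1 intG)
       (use T in \<open>auto simp: e_def intro!: continuous_intros\<close>)
  \<comment> \<open>\<open>clamp\<close> extends H w by constants outside {0..T}, so that the
    operator acts on the Banach space of bounded continuous functions on the whole line.\<close>
  define N where "N w = (SOME g :: real \<Rightarrow>\<^sub>C 'a. \<forall>x. g x = H w (clamp 0 T x))" for w
  have N: "N w x = H w (clamp 0 T x)" for w x
  proof -
    have "\<exists>g :: real \<Rightarrow>\<^sub>C 'a. \<forall>x. g x = H w (clamp 0 T x)"
      using continuous_on_cbox_bcontfunE[OF contH] by metis
    from someI_ex[OF this] show ?thesis unfolding N_def by blast
  qed
  have est: "norm (H w t - H v t) \<le> 1/2 * norm (w - v)" if t: "t \<in> {0..T}" for w v t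
  proof -
    have "norm (integral {0..t} (\<lambda>s. G s (e s *\<^sub>R w s)) - integral {0..t} (\<lambda>s. G s (e s *\<^sub>R v s)))
      = norm (integral {0..t} (\<lambda>s. G s (e s *\<^sub>R w s) - G s (e s *\<^sub>R v s)))"
      using intG[OF t] by (simp add: integral_diff)
    also have "\<dots> \<le> integral {0..t} (\<lambda>s. L * (e s * norm (w - v)))"
    proof (rule integral_norm_bound_integral)
      show "(\<lambda>s. G s (e s *\<^sub>R w s) - G s (e s *\<^sub>R v s)) integrable_on {0..t}"
        using intG[OF t] by (intro integrable_diff)
      show "(\<lambda>s. L * (e s * norm (w - v))) integrable_on {0..t}"
        by (intro integrable_continuous_real) (auto simp: e_def intro!: continuous_intros)
      fix s assume s: "s \<in> {0..t}"
      have "norm (G s (e s *\<^sub>R w s) - G s (e s *\<^sub>R v s)) \<le> L * norm (e s *\<^sub>R w s - e s *\<^sub>R v s)"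
        using s t by (intro lip') auto
      also have "e s *\<^sub>R w s - e s *\<^sub>R v s = e s *\<^sub>R apply_bcontfun (w - v) s"
        by (simp add: algebra_simps)
      also have "L * norm \<dots> \<le> L * (e s * norm (w - v))"
        using L e_pos[of s] norm_bounded[of "w - v" s] by (auto simp: less_imp_le)
      finally show "norm (G s (e s *\<^sub>R w s) - G s (e s *\<^sub>R v s)) \<le> L * (e s * norm (w - v))" .
    qed
    also have "\<dots> = (e t - 1) / 2 * norm (w - v)"
    proof -
      have "((\<lambda>s. L * (e s * norm (w - v))) has_integral
          (e t / 2 * norm (w - v) - e 0 / 2 * norm (w - v))) {0..t}"
        using t by (intro fundamental_theorem_of_calculus)
         (auto simp: e_def has_real_derivative_iff_has_vector_derivative[symmetric]
           intro!: derivative_eq_intros)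
      from integral_unique[OF this] show ?thesis by (simp add: e_def algebra_simps diff_divide_distrib)
    qed
    finally have "norm (integral {0..t} (\<lambda>s. G s (e s *\<^sub>R w s)) - integral {0..t} (\<lambda>s. G s (e s *\<^sub>R v s)))
      \<le> (e t - 1) / 2 * norm (w - v)" .
    also have "\<dots> \<le> e t / 2 * norm (w - v)"
      by (intro mult_right_mono) auto
    finally have *: "norm (integral {0..t} (\<lambda>s. G s (e s *\<^sub>R w s)) - integral {0..t} (\<lambda>s. G s (e s *\<^sub>R v s)))
      \<le> e t / 2 * norm (w - v)" .
    have "H w t - H v t = (1 / e t) *\<^sub>R (integral {0..t} (\<lambda>s. G s (e s *\<^sub>R w s)) - integral {0..t} (\<lambda>s. G s (e s *\<^sub>R v s)))"
      by (simp add: H_def algebra_simps)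
    then have "norm (H w t - H v t) = 1 / e t *
        norm (integral {0..t} (\<lambda>s. G s (e s *\<^sub>R w s)) - integral {0..t} (\<lambda>s. G s (e s *\<^sub>R v s)))"
      using e_pos[of t] by simp
    also have "\<dots> \<le> 1 / e t * (e t / 2 * norm (w - v))"
      using e_pos[of t] by (intro mult_left_mono *) auto
    finally show ?thesis using e_pos[of t] by simp
  qed
  have cl: "clamp 0 T x \<in> {0..T}" for x
    using clamp_in_interval[of 0 T x] T by (auto simp: cbox_interval)
  have "\<exists>!w. N w = w"
  proof (rule banach_fix_type[of "1/2"])
    show "\<forall>x y. dist (N x) (N y) \<le> 1 / 2 * dist x y"
    proof (intro allI)
      fix x y
      have "norm (N x - N y) \<le> 1 / 2 * norm (x - y)"
        using est[OF cl] by (intro norm_bound) (simp add: N)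
      then show "dist (N x) (N y) \<le> 1 / 2 * dist x y" by (simp add: dist_norm)
    qed
  qed auto
  then obtain w where w: "N w = w" by blast
  define u where "u t = e t *\<^sub>R apply_bcontfun w t" for t
  have clid: "clamp 0 T t = t" if "t \<in> {0..T}" for t
    using that by (simp add: clamp_cancel_cbox cbox_interval)
  have u: "u t = u0 + integral {0..t} (\<lambda>s. G s (u s))" if "t \<in> {0..T}" for t
  proof -
    have "apply_bcontfun w t = H w t" using w N[of w t] clid[OF that] by simp
    then show ?thesis using e_pos[of t] by (simp add: u_def H_def)
  qed
  show thesis
  proof
    show "u 0 = u0" using u[of 0] T by simp
    fix t assume t: "t \<in> {0..T}"
    have "((\<lambda>t. integral {0..t} (\<lambda>s. G s (u s))) has_vector_derivative G t (u t)) (at t within {0..T})"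
      using contG[of w] t by (intro integral_has_vector_derivative) (auto simp: u_def)
    from has_vector_derivative_add[OF has_vector_derivative_const this, of u0]
    have "((\<lambda>t. u0 + integral {0..t} (\<lambda>s. G s (u s))) has_vector_derivative G t (u t)) (at t within {0..T})"
      by (simp only: add_0)
    then show "(u has_vector_derivative G t (u t)) (at t within {0..T})"
      by (rule has_vector_derivative_transform[OF t, rotated]) (rule u)
  qed
qed

section \<open>Truncation, and local solutions of smooth equations in Banach spaces\<close>

definition radial :: "real \<Rightarrow> 'a::real_normed_vector \<Rightarrow> 'a" where
  "radial R u = (if norm u \<le> R then u else (R / norm u) *\<^sub>R u)"

lemma radial_norm: "0 \<le> R \<Longrightarrow> norm (radial R u) \<le> R"
  by (auto simp: radial_def)

text \<open>The constant 2 is available in every normed space. With u the longer vector and m the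
  scaling factor, the difference is m u (u - v) + (m u - m v) v, and each summand is at most the
  norm of u - v.\<close>

lemma radial_lipschitz:
  assumes R: "0 < R"
  shows "norm (radial R u - radial R v) \<le> 2 * norm (u - v)"
proof -
  have *: "norm (radial R u - radial R v) \<le> 2 * norm (u - v)"
    if le: "norm v \<le> norm u" for u v :: 'a
  proof -
    define m where "m x = (if norm x \<le> R then 1 else R / norm x)" for x :: 'a
    have m: "radial R x = m x *\<^sub>R x" "0 \<le> m x" "m x \<le> 1" for x
      using R by (auto simp: radial_def m_def divide_le_eq_1)
    have d: "\<bar>m u - m v\<bar> * norm v \<le> norm u - norm v"
    proof (cases "norm u \<le> R")
      case True
      then show ?thesis using le by (simp add: m_def)
    next
      case u: False
      then have u0: "norm u > 0" using R by linarith
      show ?thesis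
      proof (cases "norm v \<le> R")
        case True
        have "(norm u - R) * norm v \<le> (norm u - norm v) * norm u"
        proof -
          have "(norm u - norm v) * norm u - (norm u - R) * norm v
             \<ge> (norm u - norm v) * norm u - (norm u - norm v) * norm v"
            using True by (auto intro!: mult_right_mono)
          moreover have "(norm u - norm v) * norm u - (norm u - norm v) * norm v \<ge> 0"
            using le by (simp add: left_diff_distrib[symmetric] right_diff_distrib[symmetric])
          ultimately show ?thesis by linarith
        qed
        moreover have "\<bar>m u - m v\<bar> = (norm u - R) / norm u"
          using u True u0 R by (simp add: m_def field_simps abs_if)
        ultimately have "\<bar>m u - m v\<bar> * norm v \<le> (norm u - norm v) * norm u / norm u"
          using u0 divide_right_mono[of "(norm u - R) * norm v" "(norm u - norm v) * norm u" "norm u"]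
          by simp
        then show ?thesis using u0 by simp
      next
        case False
        then have v0: "norm v > 0" using R by linarith
        have "\<bar>m u - m v\<bar> * norm v = R / norm u * (norm u - norm v)"
        proof -
          have "m u \<le> m v" using u False le R u0 v0 by (simp add: m_def frac_le)
          then show ?thesis using u False u0 v0 by (simp add: m_def field_simps)
        qed
        also have "\<dots> \<le> 1 * (norm u - norm v)"
          using u R le u0 by (intro mult_right_mono) auto
        finally show ?thesis by simp
      qed
    qed
    have "radial R u - radial R v = m u *\<^sub>R (u - v) + (m u - m v) *\<^sub>R v"
      by (simp add: m algebra_simps)
    then have "norm (radial R u - radial R v) \<le> m u * norm (u - v) + \<bar>m u - m v\<bar> * norm v"
      using norm_triangle_ineq[of "m u *\<^sub>R (u - v)" "(m u - m v) *\<^sub>R v"] m(2)[of u] by simp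
    also have "\<dots> \<le> 1 * norm (u - v) + norm (u - v)"
      using d m(3)[of u] norm_triangle_ineq2[of u v] by (intro add_mono mult_right_mono) auto
    finally show ?thesis by simp
  qed
  show ?thesis
  proof (cases "norm v \<le> norm u")
    case False
    then show ?thesis using *[of u v] by (simp add: norm_minus_commute)
  qed (rule *)
qed

text \<open>Local Lipschitz continuity gives existence; the second condition gives smoothness in time without
  derivatives of \<open>G\<close>, and both are stable under bounded bilinear operations.\<close>

definition admissible :: "real \<Rightarrow> (real \<Rightarrow> 'a::real_normed_vector \<Rightarrow> 'b::real_normed_vector) \<Rightarrow> bool" where
  "admissible T G \<longleftrightarrow>
     (\<forall>R. \<exists>K. \<forall>t\<in>{0..T}. \<forall>u v. norm u \<le> R \<longrightarrow> norm v \<le> R \<longrightarrow>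
        norm (G t u) \<le> K \<and> norm (G t u - G t v) \<le> K * norm (u - v)) \<and>
     (\<forall>k I u. I \<subseteq> {0..T} \<longrightarrow> Ck_on k I u \<longrightarrow> Ck_on k I (\<lambda>t. G t (u t)))"

lemma admissibleI:
  assumes "\<And>R. \<exists>K. \<forall>t\<in>{0..T}. \<forall>u v. norm u \<le> R \<longrightarrow> norm v \<le> R \<longrightarrow>
        norm (G t u) \<le> K \<and> norm (G t u - G t v) \<le> K * norm (u - v)"
    and "\<And>k I u. I \<subseteq> {0..T} \<Longrightarrow> Ck_on k I u \<Longrightarrow> Ck_on k I (\<lambda>t. G t (u t))"
  shows "admissible T G"
  unfolding admissible_def using assms by (intro conjI allI impI)

lemma admissible_bound:
  assumes "admissible T G"
  obtains K where "\<And>t u v. t \<in> {0..T} \<Longrightarrow> norm u \<le> R \<Longrightarrow> norm v \<le> R \<Longrightarrow>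
        norm (G t u) \<le> K \<and> norm (G t u - G t v) \<le> K * norm (u - v)"
  using assms that unfolding admissible_def by (elim conjE allE[of _ R] exE) blast

lemma admissible_Ck:
  "admissible T G \<Longrightarrow> I \<subseteq> {0..T} \<Longrightarrow> Ck_on k I u \<Longrightarrow> Ck_on k I (\<lambda>t. G t (u t))"
  unfolding admissible_def by (elim conjE allE impE)

lemma admissible_time:
  assumes "\<And>k. Ck_on k {0..T} c"
  shows "admissible T (\<lambda>t (u::'c::real_normed_vector). c t)"
proof -
  have "compact (c ` {0..T})"
    using Ck_on_continuous[OF assms] by (intro compact_continuous_image) auto
  then obtain K where "\<And>t. t \<in> {0..T} \<Longrightarrow> norm (c t) \<le> K"
    by (meson bounded_iff compact_imp_bounded imageI)
  then have "\<exists>K. \<forall>t\<in>{0..T}. \<forall>u v::'c. norm u \<le> R \<longrightarrow> norm v \<le> R \<longrightarrow>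
        norm (c t) \<le> K \<and> norm (c t - c t) \<le> K * norm (u - v)" for R
    by (auto intro!: exI[of _ "max K 0"] simp: le_max_iff_disj)
  then show ?thesis by (intro admissibleI Ck_on_subset[OF assms])
qed

lemma admissible_state: "admissible T (\<lambda>t u. u)"
proof (rule admissibleI)
  fix R
  have "norm (u - v) \<le> max 1 R * norm (u - v)" for u v :: 'a
    using mult_right_mono[of 1 "max 1 R" "norm (u - v)"] by simp
  then show "\<exists>K. \<forall>t\<in>{0..T}. \<forall>u v. norm u \<le> R \<longrightarrow> norm v \<le> R \<longrightarrow>
        norm u \<le> K \<and> norm (u - v) \<le> K * norm (u - v :: 'a)"
    by (intro exI[of _ "max 1 R"]) (auto simp: le_max_iff_disj)
qed

lemma admissible_bounded_linear:
  assumes L: "bounded_linear L" and G: "admissible T G"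
  shows "admissible T (\<lambda>t u. L (G t u))"
proof -
  obtain M where M: "\<And>x. norm (L x) \<le> norm x * M" "M \<ge> 0"
    using bounded_linear.nonneg_bounded[OF L] by blast
  have "\<exists>K. \<forall>t\<in>{0..T}. \<forall>u v. norm u \<le> R \<longrightarrow> norm v \<le> R \<longrightarrow>
        norm (L (G t u)) \<le> K \<and> norm (L (G t u) - L (G t v)) \<le> K * norm (u - v)" for R
  proof -
    obtain K where K: "\<And>t u v. t \<in> {0..T} \<Longrightarrow> norm u \<le> R \<Longrightarrow> norm v \<le> R \<Longrightarrow>
        norm (G t u) \<le> K \<and> norm (G t u - G t v) \<le> K * norm (u - v)"
      using admissible_bound[OF G, of R] by metis
    have "norm (L (G t u)) \<le> K * M \<and> norm (L (G t u) - L (G t v)) \<le> K * M * norm (u - v)"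
      if "t \<in> {0..T}" "norm u \<le> R" "norm v \<le> R" for t u v
    proof
      show "norm (L (G t u)) \<le> K * M"
        using M(1)[of "G t u"] mult_right_mono[OF conjunct1[OF K[OF that]] M(2)] by linarith
      have "norm (L (G t u) - L (G t v)) \<le> norm (G t u - G t v) * M"
        using M(1)[of "G t u - G t v"] by (simp add: bounded_linear.linear[OF L] linear_diff)
      also have "\<dots> \<le> K * norm (u - v) * M"
        using K[OF that] M(2) by (intro mult_right_mono) auto
      finally show "norm (L (G t u) - L (G t v)) \<le> K * M * norm (u - v)" by (simp add: ac_simps)
    qed
    then show ?thesis by blast
  qed
  moreover have "Ck_on k I (\<lambda>t. L (G t (u t)))" if "I \<subseteq> {0..T}" "Ck_on k I u" for k I u
    using that by (intro Ck_on_bounded_linear[OF L] admissible_Ck[OF G])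
  ultimately show ?thesis by (rule admissibleI)
qed

lemma admissible_Pair:
  assumes "admissible T G" "admissible T H"
  shows "admissible T (\<lambda>t u. (G t u, H t u))"
proof -
  have "\<exists>K. \<forall>t\<in>{0..T}. \<forall>u v. norm u \<le> R \<longrightarrow> norm v \<le> R \<longrightarrow>
        norm (G t u, H t u) \<le> K \<and> norm ((G t u, H t u) - (G t v, H t v)) \<le> K * norm (u - v)" for R
  proof -
    obtain K K' where K: "\<And>t u v. t \<in> {0..T} \<Longrightarrow> norm u \<le> R \<Longrightarrow> norm v \<le> R \<Longrightarrow>
        norm (G t u) \<le> K \<and> norm (G t u - G t v) \<le> K * norm (u - v)"
      "\<And>t u v. t \<in> {0..T} \<Longrightarrow> norm u \<le> R \<Longrightarrow> norm v \<le> R \<Longrightarrow>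
        norm (H t u) \<le> K' \<and> norm (H t u - H t v) \<le> K' * norm (u - v)"
      using admissible_bound[OF assms(1), of R] admissible_bound[OF assms(2), of R] by metis
    have pair: "norm (a, b) \<le> norm a + norm b" for a :: 'b and b :: 'c
      by (simp add: norm_Pair sqrt_add_le_add_sqrt norm_prod_def sqrt_sum_squares_le_sum)
    have "norm (G t u, H t u) \<le> K + K' \<and> norm ((G t u, H t u) - (G t v, H t v)) \<le> (K + K') * norm (u - v)"
      if "t \<in> {0..T}" "norm u \<le> R" "norm v \<le> R" for t u v
      using pair[of "G t u" "H t u"] pair[of "G t u - G t v" "H t u - H t v"] K[OF that]
      by (auto simp: distrib_right)
    then show ?thesis by blast
  qed
  moreover have "Ck_on k I (\<lambda>t. (G t (u t), H t (u t)))" if "I \<subseteq> {0..T}" "Ck_on k I u" for k I u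
    using that by (intro Ck_on_Pair admissible_Ck[OF assms(1)] admissible_Ck[OF assms(2)])
  ultimately show ?thesis by (rule admissibleI)
qed

lemma admissible_bounded_bilinear:
  assumes B: "bounded_bilinear B" and G: "admissible T G" and H: "admissible T H"
  shows "admissible T (\<lambda>t u. B (G t u) (H t u))"
proof -
  obtain M where M: "\<And>x y. norm (B x y) \<le> norm x * norm y * M" "M \<ge> 0"
    using bounded_bilinear.nonneg_bounded[OF B] by blast
  have "\<exists>K. \<forall>t\<in>{0..T}. \<forall>u v. norm u \<le> R \<longrightarrow> norm v \<le> R \<longrightarrow>
        norm (B (G t u) (H t u)) \<le> K \<and>
        norm (B (G t u) (H t u) - B (G t v) (H t v)) \<le> K * norm (u - v)" for R
  proof -
    obtain K K' where K: "\<And>t u v. t \<in> {0..T} \<Longrightarrow> norm u \<le> R \<Longrightarrow> norm v \<le> R \<Longrightarrow>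
        norm (G t u) \<le> K \<and> norm (G t u - G t v) \<le> K * norm (u - v)"
      "\<And>t u v. t \<in> {0..T} \<Longrightarrow> norm u \<le> R \<Longrightarrow> norm v \<le> R \<Longrightarrow>
        norm (H t u) \<le> K' \<and> norm (H t u - H t v) \<le> K' * norm (u - v)"
      using admissible_bound[OF G, of R] admissible_bound[OF H, of R] by metis
    have "norm (B (G t u) (H t u)) \<le> 2 * K * K' * M \<and>
        norm (B (G t u) (H t u) - B (G t v) (H t v)) \<le> 2 * K * K' * M * norm (u - v)"
      if t: "t \<in> {0..T}" "norm u \<le> R" "norm v \<le> R" for t u v
    proof
      have K0: "K \<ge> 0" "K' \<ge> 0" using K[OF t] norm_ge_zero order_trans by blast+
      have "norm (B (G t u) (H t u)) \<le> norm (G t u) * norm (H t u) * M" by (rule M)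
      also have "\<dots> \<le> K * K' * M" using K[OF t] K0 M(2) by (intro mult_right_mono mult_mono) auto
      finally show "norm (B (G t u) (H t u)) \<le> 2 * K * K' * M"
        using mult_nonneg_nonneg[OF mult_nonneg_nonneg[OF K0] M(2)] by linarith
      have "B (G t u) (H t u) - B (G t v) (H t v) = B (G t u - G t v) (H t u) + B (G t v) (H t u - H t v)"
        by (simp add: bounded_bilinear.diff_left[OF B] bounded_bilinear.diff_right[OF B])
      then have "norm (B (G t u) (H t u) - B (G t v) (H t v)) \<le>
          norm (B (G t u - G t v) (H t u)) + norm (B (G t v) (H t u - H t v))"
        by (simp only: norm_triangle_ineq)
      also have "\<dots> \<le> norm (G t u - G t v) * norm (H t u) * M + norm (G t v) * norm (H t u - H t v) * M"
        by (intro add_mono M(1))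
      also have "\<dots> \<le> (K * norm (u - v)) * K' * M + K * (K' * norm (u - v)) * M"
        using K[OF t] K[OF t(1,3,2)] K0 M(2)
        by (intro add_mono mult_right_mono mult_mono) auto
      finally show "norm (B (G t u) (H t u) - B (G t v) (H t v)) \<le> 2 * K * K' * M * norm (u - v)"
        by (simp add: algebra_simps)
    qed
    then show ?thesis by blast
  qed
  moreover have "Ck_on k I (\<lambda>t. B (G t (u t)) (H t (u t)))" if "I \<subseteq> {0..T}" "Ck_on k I u" for k I u
    using that by (intro Ck_on_bounded_bilinear[OF B] admissible_Ck[OF G] admissible_Ck[OF H])
  ultimately show ?thesis by (rule admissibleI)
qed

lemma admissible_add:
  assumes "admissible T G" "admissible T H"
  shows "admissible T (\<lambda>t u. G t u + H t u)"
  using admissible_bounded_linear[OF bounded_linear_add[OF bounded_linear_fst bounded_linear_snd]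
      admissible_Pair[OF assms]] by simp

lemma admissible_minus: "admissible T G \<Longrightarrow> admissible T (\<lambda>t u. - G t u)"
  by (rule admissible_bounded_linear[OF bounded_linear_minus[OF bounded_linear_ident]])

lemma admissible_diff:
  "admissible T G \<Longrightarrow> admissible T H \<Longrightarrow> admissible T (\<lambda>t u. G t u - H t u)"
  using admissible_add[OF _ admissible_minus, of T G H] by simp

text \<open>The truncated equation is globally Lipschitz, hence solvable on {0..T}. On a short
  interval the solution stays in the ball where the truncation is the identity. Smoothness is a
  bootstrap: if u is C^k, so is t \<mapsto> G t (u t), and u is C^(k+1); the interval does not
  shrink with k.\<close>

theorem ode_local:
  fixes G :: "real \<Rightarrow> 'a::banach \<Rightarrow> 'a"
  assumes T: "0 < T" and G: "admissible T G"
  obtains T' u where "0 < T'" "T' \<le> T" "u 0 = u0"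
    and "\<And>t. t \<in> {0..T'} \<Longrightarrow> (u has_vector_derivative G t (u t)) (at t within {0..T'})"
    and "\<And>k. Ck_on k {0..T'} u"
proof -
  define R where "R = norm u0 + 1"
  have R: "R > 0" by (simp add: R_def add_nonneg_pos)
  obtain K where K: "\<And>t u v. t \<in> {0..T} \<Longrightarrow> norm u \<le> R \<Longrightarrow> norm v \<le> R \<Longrightarrow>
        norm (G t u) \<le> K \<and> norm (G t u - G t v) \<le> K * norm (u - v)"
    using admissible_bound[OF G, of R] by metis
  have K0: "K \<ge> 0" using K[of 0 0 0] T R order_trans[OF norm_ge_zero] by auto
  define H where "H t u = G t (radial R u)" for t u
  have lipH: "norm (H t u - H t v) \<le> (2 * K) * norm (u - v)" if t: "t \<in> {0..T}" for t u v
  proof -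
    have "norm (H t u - H t v) \<le> K * norm (radial R u - radial R v)"
      unfolding H_def using K[OF t] radial_norm R by (meson less_imp_le)
    also have "\<dots> \<le> K * (2 * norm (u - v))"
      using K0 radial_lipschitz[OF R] by (intro mult_left_mono) auto
    finally show ?thesis by simp
  qed
  have contR: "continuous_on UNIV (radial R :: 'a \<Rightarrow> 'a)"
    by (rule continuous_on_subset[of UNIV], rule lipschitz_on_continuous_on[of 2], rule lipschitz_onI)
       (auto simp: dist_norm radial_lipschitz[OF R])
  have contH: "continuous_on {0..T} (\<lambda>t. H t (u t))" if "continuous_on {0..T} u" for u
  proof -
    have "Ck_on 0 {0..T} (\<lambda>t. radial R (u t))"
      using continuous_on_compose2[OF contR that] by auto
    from admissible_Ck[OF G order_refl this] show ?thesis by (simp add: H_def)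
  qed
  from ode_global[OF less_imp_le[OF T] contH lipH, of u0] obtain u where u: "u 0 = u0"
    "\<And>t. t \<in> {0..T} \<Longrightarrow> (u has_vector_derivative H t (u t)) (at t within {0..T})" by metis
  have contu: "continuous_on {0..T} u"
    using u(2) has_vector_derivative_continuous unfolding continuous_on_eq_continuous_within by blast
  then obtain d where d: "d > 0" "\<And>t. t \<in> {0..T} \<Longrightarrow> dist t 0 < d \<Longrightarrow> dist (u t) (u 0) < 1"
    using T unfolding continuous_on_iff by (metis atLeastAtMost_iff less_eq_real_def zero_less_one)
  define T' where "T' = min T (d/2)"
  have T': "0 < T'" "T' \<le> T" using T d(1) by (auto simp: T'_def)
  have ball: "norm (u t) \<le> R" if "t \<in> {0..T'}" for t
  proof -
    have "dist (u t) u0 < 1" using d(2)[of t] that u(1) d(1) by (auto simp: T'_def dist_real_def)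
    then show ?thesis unfolding R_def dist_norm using norm_triangle_ineq2[of "u t" u0] by linarith
  qed
  have der: "(u has_vector_derivative G t (u t)) (at t within {0..T'})" if "t \<in> {0..T'}" for t
  proof -
    have "H t (u t) = G t (u t)" using ball[OF that] by (simp add: H_def radial_def)
    then show ?thesis
      using has_vector_derivative_within_subset[OF u(2), of t "{0..T'}"] that T' by auto
  qed
  have "Ck_on k {0..T'} u" for k
  proof (induction k)
    case 0
    then show ?case using contu T' by (auto intro: continuous_on_subset)
  next
    case (Suc k)
    then have "Ck_on k {0..T'} (\<lambda>t. G t (u t))"
      using T' by (intro admissible_Ck[OF G]) auto
    from Ck_on_SucI[OF der this] show ?case .
  qed
  with T' u(1) der show thesis using that by blast
qed

text \<open>The supremum over the index need be neither differentiable nor measurable in t, so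
  Gronwall's inequality is replaced by iteration: a common bound M0 improves to M0 (K t)^m / m!
  after m integrations, which tends to 0. For this reason the estimate of the derivatives is assumed
  for every common bound M.\<close>

lemma family_gronwall:
  fixes D D' :: "'i \<Rightarrow> real \<Rightarrow> real"
  assumes der: "\<And>i t. i \<in> J \<Longrightarrow> t \<in> {0..T} \<Longrightarrow> (D i has_real_derivative D' i t) (at t within {0..T})"
    and bdd: "\<And>i t. i \<in> J \<Longrightarrow> t \<in> {0..T} \<Longrightarrow> \<bar>D i t\<bar> \<le> M0"
    and init: "\<And>i. i \<in> J \<Longrightarrow> D i 0 = 0"
    and K: "0 \<le> K"
    and le: "\<And>i t M. i \<in> J \<Longrightarrow> t \<in> {0..T} \<Longrightarrow> (\<And>j. j \<in> J \<Longrightarrow> \<bar>D j t\<bar> \<le> M) \<Longrightarrow> \<bar>D' i t\<bar> \<le> K * M"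
    and i: "i \<in> J" and t: "t \<in> {0..T}"
  shows "D i t = 0"
proof -
  have est: "\<bar>D i t\<bar> \<le> M0 * ((K * t) ^ m / fact m)" if "i \<in> J" "t \<in> {0..T}" for m i t
    using that
  proof (induction m arbitrary: i t)
    case 0
    then show ?case using bdd by auto
  next
    case (Suc m)
    define g where "g s = M0 * ((K * s) ^ Suc m / fact (Suc m))" for s
    have g': "(g has_real_derivative K * (M0 * ((K * s) ^ m / fact m))) (at s within {0..T})" for s
    proof -
      have *: "K * (M0 * ((K * s) ^ m / fact m)) = M0 * (real (Suc m) * (K * s) ^ m * K / fact (Suc m))"
        by (simp add: fact_Suc field_simps del: of_nat_Suc)
      show ?thesis unfolding g_def *
        by (rule derivative_eq_intros refl | simp)+
    qed
    have D'le: "\<bar>D' i s\<bar> \<le> K * (M0 * ((K * s) ^ m / fact m))" if "s \<in> {0..T}" for s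
      using le[OF Suc.prems(1) that Suc.IH[OF _ that]] .
    have "norm (D i t - D i 0) \<le> g t - g 0"
    proof (cases "t = 0")
      case False
      have Dc: "continuous_on {0..T} (D i)"
        using der[OF Suc.prems(1)] DERIV_continuous unfolding continuous_on_eq_continuous_within by blast
      have at: "at s within {0..T} = at s" if "0 < s" "s < t" for s
        using that Suc.prems(2) by (intro at_within_interior) (auto simp: interior_atLeastAtMost_real)
      show ?thesis
      proof (rule differentiable_bound_general[where f' = "D' i" and \<phi>' = "\<lambda>s. K * (M0 * ((K * s) ^ m / fact m))"])
        show "continuous_on {0..t} (D i)" using Suc.prems(2) by (auto intro: continuous_on_subset[OF Dc])
        show "continuous_on {0..t} g" unfolding g_def by (intro continuous_intros) auto
      next
        fix s assume s: "0 < s" "s < t"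
        show "(D i has_vector_derivative D' i s) (at s)"
          using der[OF Suc.prems(1), of s] s Suc.prems(2) at[OF s]
          by (simp add: has_real_derivative_iff_has_vector_derivative)
        show "(g has_vector_derivative K * (M0 * ((K * s) ^ m / fact m))) (at s)"
          using g'[of s] at[OF s] by (simp add: has_real_derivative_iff_has_vector_derivative)
        show "norm (D' i s) \<le> K * (M0 * ((K * s) ^ m / fact m))"
          using D'le[of s] s Suc.prems(2) by simp
      qed (use False Suc.prems in auto)
    qed simp
    then show ?case using init Suc.prems by (simp add: g_def)
  qed
  have "(\<lambda>m. (K * t) ^ m / fact m) \<longlonglongrightarrow> 0"
    using summable_LIMSEQ_zero[OF summable_exp[of "K * t"]]
    by (simp only: divide_inverse mult.commute)
  then have "(\<lambda>m. M0 * ((K * t) ^ m / fact m)) \<longlonglongrightarrow> M0 * 0"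
    by (intro tendsto_mult tendsto_const)
  from LIMSEQ_le_const[OF this, of "\<bar>D i t\<bar>"] est[OF i t] have "\<bar>D i t\<bar> \<le> M0 * 0"
    by simp
  then show ?thesis by simp
qed

section \<open>Sobolev functions on an interval\<close>

text \<open>Bridge between the Lebesgue integrals over the open interval in the definitions and
  gauge integrals over the closed one, where subintervals and primitives are handled.\<close>

lemma lebesgue_on_iff_Icc:
  fixes f :: "real \<Rightarrow> real"
  shows "integrable (lebesgue_on {0<..<l}) f \<longleftrightarrow> f absolutely_integrable_on {0..l}"
  unfolding absolutely_integrable_on_Icc_iff_Ioo
  by (simp add: integrable_restrict_space set_integrable_def)

lemma LINT_eq_Icc:
  fixes f :: "real \<Rightarrow> real"
  assumes "f absolutely_integrable_on {0..l}"
  shows "(LINT x|lebesgue_on {0<..<l}. f x) = integral {0..l} f"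
  using assms lebesgue_on_iff_Icc[of l f]
  by (simp add: lebesgue_integral_eq_integral integral_open_interval_real)

lemma abs_int_sub:
  fixes f :: "real \<Rightarrow> real"
  assumes "f absolutely_integrable_on {0..l}" "{a..b} \<subseteq> {0..l}"
  shows "f integrable_on {a..b}" "(\<lambda>x. \<bar>f x\<bar>) integrable_on {a..b}"
  using absolutely_integrable_on_subinterval[OF assms]
  by (simp_all add: absolutely_integrable_on_def)

lemma abs_int_mult_continuous:
  fixes f g :: "real \<Rightarrow> real"
  assumes f: "f absolutely_integrable_on {0..l}" and g: "continuous_on {0..l} g"
  shows "(\<lambda>x. f x * g x) absolutely_integrable_on {0..l}"
proof -
  have "(\<lambda>x. g x * f x) absolutely_integrable_on {0..l}"
    using g f by (intro absolutely_integrable_bounded_measurable_product_real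
        continuous_imp_measurable_on_sets_lebesgue compact_imp_bounded compact_continuous_image) auto
  then show ?thesis by (simp add: mult.commute)
qed

text \<open>On a bounded interval the inequality |f| <= 1 + f^2 makes a square integrable function
  integrable.\<close>

lemma L2_iff: "L2 l f \<longleftrightarrow> f absolutely_integrable_on {0..l} \<and> (\<lambda>x. (f x)\<^sup>2) absolutely_integrable_on {0..l}"
proof
  assume f: "L2 l f"
  then have sq: "(\<lambda>x. (f x)\<^sup>2) absolutely_integrable_on {0..l}"
    by (simp add: L2_def lebesgue_on_iff_Icc)
  have "f absolutely_integrable_on {0<..<l}"
  proof (rule measurable_bounded_by_integrable_imp_absolutely_integrable)
    show "f \<in> borel_measurable (lebesgue_on {0<..<l})" using f by (simp add: L2_def)
    have "(\<lambda>x. 1 + (f x)\<^sup>2) integrable_on {0..l}"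
      using sq by (intro integrable_add) (auto simp: absolutely_integrable_on_def)
    then show "(\<lambda>x. 1 + (f x)\<^sup>2) integrable_on {0<..<l}" by (simp add: integrable_on_open_interval_real)
    fix x
    have "0 \<le> (\<bar>f x\<bar> - 1)\<^sup>2" by simp
    then have "2 * \<bar>f x\<bar> \<le> 1 + (f x)\<^sup>2" by (simp add: power2_diff)
    then show "norm (f x) \<le> 1 + (f x)\<^sup>2" by simp
  qed simp
  with sq show "f absolutely_integrable_on {0..l} \<and> (\<lambda>x. (f x)\<^sup>2) absolutely_integrable_on {0..l}"
    by (simp add: absolutely_integrable_on_Icc_iff_Ioo)
next
  assume "f absolutely_integrable_on {0..l} \<and> (\<lambda>x. (f x)\<^sup>2) absolutely_integrable_on {0..l}"
  then show "L2 l f"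
    by (auto simp: L2_def lebesgue_on_iff_Icc[symmetric])
qed

lemma L2_abs_int: "L2 l f \<Longrightarrow> f absolutely_integrable_on {0..l}"
  by (simp add: L2_iff)

lemma L2_sq: "L2 l f \<Longrightarrow> (\<lambda>x. (f x)\<^sup>2) absolutely_integrable_on {0..l}"
  by (simp add: L2_iff)

lemma L2_continuous: "continuous_on {0..l} f \<Longrightarrow> L2 l f"
  by (simp add: L2_iff absolutely_integrable_continuous_real continuous_on_power)

lemma L2_mult_continuous:
  assumes "L2 l f" "continuous_on {0..l} g"
  shows "L2 l (\<lambda>x. f x * g x)"
  using assms unfolding L2_iff power_mult_distrib
  by (auto intro!: abs_int_mult_continuous continuous_intros)

lemma L2_add:
  assumes f: "L2 l f" and g: "L2 l g"
  shows "L2 l (\<lambda>x. f x + g x)"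
  unfolding L2_iff
proof
  show 1: "(\<lambda>x. f x + g x) absolutely_integrable_on {0..l}"
    using f g by (intro set_integral_add L2_abs_int)
  have "(\<lambda>x. (f x + g x)\<^sup>2) absolutely_integrable_on {0<..<l}"
  proof (rule measurable_bounded_by_integrable_imp_absolutely_integrable)
    show "(\<lambda>x. (f x + g x)\<^sup>2) \<in> borel_measurable (lebesgue_on {0<..<l})"
      using f g by (auto simp: L2_def)
    have "(\<lambda>x. 2 * (f x)\<^sup>2 + 2 * (g x)\<^sup>2) integrable_on {0..l}"
      using L2_sq[OF f] L2_sq[OF g]
      by (intro integrable_add integrable_on_mult_right) (simp_all add: absolutely_integrable_on_def)
    then show "(\<lambda>x. 2 * (f x)\<^sup>2 + 2 * (g x)\<^sup>2) integrable_on {0<..<l}"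
      by (simp add: integrable_on_open_interval_real)
    fix x
    have "0 \<le> (f x - g x)\<^sup>2" by simp
    then have "(f x + g x)\<^sup>2 \<le> 2 * (f x)\<^sup>2 + 2 * (g x)\<^sup>2" by (simp add: power2_diff power2_sum)
    then show "norm ((f x + g x)\<^sup>2) \<le> 2 * (f x)\<^sup>2 + 2 * (g x)\<^sup>2" by simp
  qed simp
  then show "(\<lambda>x. (f x + g x)\<^sup>2) absolutely_integrable_on {0..l}"
    by (simp add: absolutely_integrable_on_Icc_iff_Ioo)
qed

lemma L2_cong:
  assumes "L2 l f" "\<And>x. x \<in> {0<..<l} \<Longrightarrow> f x = g x"
  shows "L2 l g"
proof -
  have "(\<lambda>x. (g x)\<^sup>2) absolutely_integrable_on {0<..<l} \<longleftrightarrow> (\<lambda>x. (f x)\<^sup>2) absolutely_integrable_on {0<..<l}"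
    "g absolutely_integrable_on {0<..<l} \<longleftrightarrow> f absolutely_integrable_on {0<..<l}"
    by (intro set_integrable_cong refl; simp add: assms(2))+
  then show ?thesis using assms(1) by (simp add: L2_iff absolutely_integrable_on_Icc_iff_Ioo)
qed

text \<open>This takes the place of a differentiation theorem for integrals. Cutting {0..x} into N
  equal pieces shorter than d, the local bounds add up to e times the integral of k over {0..x}, and
  e is arbitrary. It yields the product rule, the rule for reciprocals and the uniqueness of weak
  derivatives, each time with E as the defect of the desired formula on an interval.\<close>

lemma additive_small_zero:
  fixes E :: "real \<Rightarrow> real \<Rightarrow> real" and k :: "real \<Rightarrow> real"
  assumes k: "k integrable_on {0..l}" "\<And>x. x \<in> {0..l} \<Longrightarrow> 0 \<le> k x"
    and add: "\<And>x y z. 0 \<le> x \<Longrightarrow> x \<le> y \<Longrightarrow> y \<le> z \<Longrightarrow> z \<le> l \<Longrightarrow> E x z = E x y + E y z"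
    and small: "\<And>e. e > 0 \<Longrightarrow> \<exists>d>0. \<forall>x y. 0 \<le> x \<longrightarrow> x \<le> y \<longrightarrow> y \<le> l \<longrightarrow> y - x < d \<longrightarrow>
        \<bar>E x y\<bar> \<le> e * integral {x..y} k"
    and x: "x \<in> {0..l}"
  shows "E 0 x = 0"
proof -
  have E0: "E 0 0 = 0" using add[of 0 0 0] x by simp
  have sub: "k integrable_on {a..b}" if "0 \<le> a" "b \<le> l" for a b
    using k(1) by (rule integrable_on_subinterval) (use that in auto)
  have "\<bar>E 0 x\<bar> \<le> e * integral {0..x} k" if e: "e > 0" for e
  proof -
    from small[OF e] obtain d where d: "d > 0"
      "\<And>x y. 0 \<le> x \<Longrightarrow> x \<le> y \<Longrightarrow> y \<le> l \<Longrightarrow> y - x < d \<Longrightarrow> \<bar>E x y\<bar> \<le> e * integral {x..y} k" by blast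
    obtain N :: nat where N: "x / d < real N" using reals_Archimedean2 by blast
    then have N0: "N > 0" using x d(1) by (metis atLeastAtMost_iff divide_nonneg_pos gr0I not_le of_nat_0)
    define s where "s i = real i * (x / real N)" for i
    have s: "0 \<le> s i" "s i \<le> s (Suc i)" "s (Suc i) - s i < d" for i
      using x N N0 d(1) by (auto simp: s_def field_simps)
    have sx: "s i \<le> x" if "i \<le> N" for i
    proof -
      have "real i * x \<le> real N * x" using that x by (intro mult_right_mono) auto
      then show ?thesis using N0 by (simp add: s_def field_simps)
    qed
    have "\<bar>E 0 (s i)\<bar> \<le> e * integral {0..s i} k" if "i \<le> N" for i
      using that
    proof (induction i)
      case 0
      then show ?case by (simp add: s_def E0)
    next
      case (Suc i)
      have le: "s (Suc i) \<le> l" using sx[OF Suc.prems] x by auto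
      have "E 0 (s (Suc i)) = E 0 (s i) + E (s i) (s (Suc i))"
        using s le by (intro add) auto
      moreover have "\<bar>E (s i) (s (Suc i))\<bar> \<le> e * integral {s i..s (Suc i)} k"
        using s le by (intro d(2)) auto
      moreover have "integral {0..s (Suc i)} k = integral {0..s i} k + integral {s i..s (Suc i)} k"
        using s le Henstock_Kurzweil_Integration.integral_combine[of 0 "s i" "s (Suc i)" k]
          sub[of 0 "s (Suc i)"] by simp
      ultimately show ?case using Suc by (simp add: distrib_left)
    qed
    from this[of N] show ?thesis using N0 by (simp add: s_def)
  qed
  note est = this
  define J where "J = integral {0..x} k"
  have J: "J \<ge> 0" unfolding J_def using x k(2) by (intro Henstock_Kurzweil_Integration.integral_nonneg sub) auto
  show ?thesis
  proof (rule ccontr)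
    assume "E 0 x \<noteq> 0"
    \<comment> \<open>With this number as e, the estimate reads |E| <= |E| * J / (J + 1), which is
      impossible for E different from 0.\<close>
    then have "\<bar>E 0 x\<bar> / (J + 1) > 0" using J by simp
    from est[OF this] have "\<bar>E 0 x\<bar> \<le> \<bar>E 0 x\<bar> * (J / (J + 1))" by (simp add: J_def)
    also have "\<dots> < \<bar>E 0 x\<bar> * 1"
      using J \<open>E 0 x \<noteq> 0\<close> by (intro mult_strict_left_mono) auto
    finally show False by simp
  qed
qed

text \<open>\<open>prim l f k\<close>: the function \<open>f\<close> is absolutely continuous on the interval with derivative \<open>k\<close>.\<close>

definition prim :: "real \<Rightarrow> (real \<Rightarrow> real) \<Rightarrow> (real \<Rightarrow> real) \<Rightarrow> bool" where
  "prim l f k \<longleftrightarrow> k absolutely_integrable_on {0..l} \<and> (\<forall>x\<in>{0..l}. f x = f 0 + integral {0..x} k)"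

lemma prim_abs_int: "prim l f k \<Longrightarrow> k absolutely_integrable_on {0..l}"
  by (simp add: prim_def)

lemma prim_eq: "prim l f k \<Longrightarrow> x \<in> {0..l} \<Longrightarrow> f x = f 0 + integral {0..x} k"
  unfolding prim_def by blast

lemma primI:
  assumes "k absolutely_integrable_on {0..l}" "\<And>x. x \<in> {0..l} \<Longrightarrow> f x = f 0 + integral {0..x} k"
  shows "prim l f k"
  using assms unfolding prim_def by blast

lemma prim_increment:
  assumes "prim l f k" "0 \<le> x" "x \<le> y" "y \<le> l"
  shows "f y - f x = integral {x..y} k"
proof -
  have "integral {0..x} k + integral {x..y} k = integral {0..y} k"
    using assms(2-) by (intro Henstock_Kurzweil_Integration.integral_combine
        abs_int_sub(1)[OF prim_abs_int[OF assms(1)]]) auto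
  moreover have "f x = f 0 + integral {0..x} k" "f y = f 0 + integral {0..y} k"
    using assms(2-) by (intro prim_eq[OF assms(1)]; simp)+
  ultimately show ?thesis by simp
qed

lemma prim_continuous:
  assumes "prim l f k"
  shows "continuous_on {0..l} f"
proof -
  have "k integrable_on {0..l}" by (rule abs_int_sub(1)[OF prim_abs_int[OF assms] order_refl])
  then have "continuous_on {0..l} (\<lambda>x. f 0 + integral {0..x} k)"
    by (intro continuous_intros indefinite_integral_continuous_1)
  then show ?thesis by (rule continuous_on_eq) (rule prim_eq[OF assms, symmetric])
qed

lemma uniform_modulus:
  fixes f :: "real \<Rightarrow> real"
  assumes "continuous_on {0..l} f" "e > 0"
  obtains d where "d > 0" "\<And>x y. x \<in> {0..l} \<Longrightarrow> y \<in> {0..l} \<Longrightarrow> \<bar>y - x\<bar> < d \<Longrightarrow> \<bar>f y - f x\<bar> < e"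
proof -
  have "uniformly_continuous_on {0..l} f"
    using assms(1) by (intro compact_uniformly_continuous) auto
  then show thesis using assms(2) that unfolding uniformly_continuous_on_def dist_real_def by meson
qed

text \<open>The increment of f g over {x..y} is exactly (f y - f x) g y + (g y - g x) f x, the
  integral of k and m against frozen values of g and f. By uniform continuity, freezing costs at
  most e (|k| + |m|) on short intervals, so the defect is of the kind excluded by
  \<open>additive_small_zero\<close>.\<close>

lemma prim_mult:
  assumes f: "prim l f k" and g: "prim l g m"
  shows "prim l (\<lambda>x. f x * g x) (\<lambda>x. k x * g x + m x * f x)"
proof -
  note cf = prim_continuous[OF f] and cg = prim_continuous[OF g]
  have ai: "(\<lambda>x. k x * g x + m x * f x) absolutely_integrable_on {0..l}"
    by (intro set_integral_add abs_int_mult_continuous prim_abs_int[OF f] prim_abs_int[OF g] cf cg)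
  have ikg: "(\<lambda>s. k s * g s) integrable_on {x..y}" "(\<lambda>s. m s * f s) integrable_on {x..y}"
    "k integrable_on {x..y}" "m integrable_on {x..y}"
    "(\<lambda>s. \<bar>k s\<bar> + \<bar>m s\<bar>) integrable_on {x..y}"
    if "0 \<le> x" "y \<le> l" for x y
  proof -
    have sub: "{x..y} \<subseteq> {0..l}" using that by auto
    show "(\<lambda>s. k s * g s) integrable_on {x..y}" "(\<lambda>s. m s * f s) integrable_on {x..y}"
      by (intro abs_int_sub(1)[OF _ sub] abs_int_mult_continuous prim_abs_int[OF f] prim_abs_int[OF g] cf cg)+
    show "k integrable_on {x..y}" "m integrable_on {x..y}" "(\<lambda>s. \<bar>k s\<bar> + \<bar>m s\<bar>) integrable_on {x..y}"
      using abs_int_sub[OF prim_abs_int[OF f] sub] abs_int_sub[OF prim_abs_int[OF g] sub]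
      by (auto intro: integrable_add)
  qed
  define E where "E x y = f y * g y - f x * g x - integral {x..y} (\<lambda>s. k s * g s + m s * f s)" for x y
  have "E 0 x = 0" if "x \<in> {0..l}" for x
  proof (rule additive_small_zero[where k = "\<lambda>s. \<bar>k s\<bar> + \<bar>m s\<bar>" and l = l and E = E])
    show "(\<lambda>s. \<bar>k s\<bar> + \<bar>m s\<bar>) integrable_on {0..l}" by (rule ikg) auto
    show "E x z = E x y + E y z" if "0 \<le> x" "x \<le> y" "y \<le> z" "z \<le> l" for x y z
      using that Henstock_Kurzweil_Integration.integral_combine[of x y z "\<lambda>s. k s * g s + m s * f s"]
        integrable_add[OF ikg(1,2)[of x z]] by (simp add: E_def)
    fix e :: real assume e: "e > 0"
    obtain d1 where d1: "d1 > 0" "\<And>x y. x \<in> {0..l} \<Longrightarrow> y \<in> {0..l} \<Longrightarrow> \<bar>y - x\<bar> < d1 \<Longrightarrow> \<bar>f y - f x\<bar> < e"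
      using uniform_modulus[OF cf e] by metis
    obtain d2 where d2: "d2 > 0" "\<And>x y. x \<in> {0..l} \<Longrightarrow> y \<in> {0..l} \<Longrightarrow> \<bar>y - x\<bar> < d2 \<Longrightarrow> \<bar>g y - g x\<bar> < e"
      using uniform_modulus[OF cg e] by metis
    have "\<bar>E x y\<bar> \<le> e * integral {x..y} (\<lambda>s. \<bar>k s\<bar> + \<bar>m s\<bar>)"
      if xy: "0 \<le> x" "x \<le> y" "y \<le> l" "y - x < min d1 d2" for x y
    proof -
      note i = ikg[OF xy(1,3)]
      have fe: "f y - f x = integral {x..y} k" and ge: "g y - g x = integral {x..y} m"
        using prim_increment[OF f xy(1-3)] prim_increment[OF g xy(1-3)] by auto
      have ig: "(\<lambda>s. k s * g y) integrable_on {x..y}" "(\<lambda>s. m s * f x) integrable_on {x..y}"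
        by (intro integrable_on_mult_left i(3,4))+
      have "f y * g y - f x * g x = (f y - f x) * g y + (g y - g x) * f x"
        by (simp add: algebra_simps)
      also have "\<dots> = integral {x..y} (\<lambda>s. k s * g y) + integral {x..y} (\<lambda>s. m s * f x)"
        by (simp add: fe ge)
      finally have "E x y = integral {x..y} (\<lambda>s. (k s * g y + m s * f x) - (k s * g s + m s * f s))"
        unfolding E_def using i ig by (simp add: integral_diff integral_add integrable_add)
      also have "norm \<dots> \<le> integral {x..y} (\<lambda>s. e * (\<bar>k s\<bar> + \<bar>m s\<bar>))"
      proof (rule Henstock_Kurzweil_Integration.integral_norm_bound_integral)
        show "(\<lambda>s. (k s * g y + m s * f x) - (k s * g s + m s * f s)) integrable_on {x..y}"
          using i ig by (intro integrable_diff integrable_add)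
        show "(\<lambda>s. e * (\<bar>k s\<bar> + \<bar>m s\<bar>)) integrable_on {x..y}"
          using i(5) by (rule integrable_on_mult_right)
        fix s assume s: "s \<in> {x..y}"
        have "\<bar>g y - g s\<bar> \<le> e" "\<bar>f x - f s\<bar> \<le> e"
          using d1(2)[of s x] d2(2)[of s y] s xy by auto
        then have "\<bar>k s * (g y - g s)\<bar> \<le> \<bar>k s\<bar> * e" "\<bar>m s * (f x - f s)\<bar> \<le> \<bar>m s\<bar> * e"
          by (auto simp: abs_mult intro: mult_left_mono)
        then show "norm ((k s * g y + m s * f x) - (k s * g s + m s * f s)) \<le> e * (\<bar>k s\<bar> + \<bar>m s\<bar>)"
          using abs_triangle_ineq[of "k s * (g y - g s)" "m s * (f x - f s)"]
          by (simp add: algebra_simps)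
      qed
      finally show ?thesis by simp
    qed
    then show "\<exists>d>0. \<forall>x y. 0 \<le> x \<longrightarrow> x \<le> y \<longrightarrow> y \<le> l \<longrightarrow> y - x < d \<longrightarrow>
        \<bar>E x y\<bar> \<le> e * integral {x..y} (\<lambda>s. \<bar>k s\<bar> + \<bar>m s\<bar>)"
      using d1(1) d2(1) by (intro exI[of _ "min d1 d2"]) auto
  qed (use that in auto)
  then have "f x * g x = f 0 * g 0 + integral {0..x} (\<lambda>x. k x * g x + m x * f x)" if "x \<in> {0..l}" for x
    using that unfolding E_def by fastforce
  then show ?thesis by (intro primI ai)
qed

lemma prim_C1:
  assumes "\<And>x. x \<in> {0..l} \<Longrightarrow> (f has_real_derivative f' x) (at x within {0..l})"
    and "continuous_on {0..l} f'"
  shows "prim l f f'"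
proof (rule primI)
  show "f' absolutely_integrable_on {0..l}" using assms(2) by (rule absolutely_integrable_continuous_real)
  fix x assume x: "x \<in> {0..l}"
  show "f x = f 0 + integral {0..x} f'"
  proof -
    have "(f' has_integral (f x - f 0)) {0..x}"
    proof (rule fundamental_theorem_of_calculus)
      fix y assume "y \<in> {0..x}"
      then show "(f has_vector_derivative f' y) (at y within {0..x})"
        using x has_vector_derivative_within_subset[of f "f' y" y "{0..l}" "{0..x}"] assms(1)[of y]
        by (simp add: has_real_derivative_iff_has_vector_derivative)
    qed (use x in auto)
    then show ?thesis by (simp add: integral_unique)
  qed
qed

lemma prim_derivative:
  assumes f: "prim l f k" and k: "continuous_on {0..l} k" and x: "x \<in> {0..l}"
  shows "(f has_real_derivative k x) (at x within {0..l})"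
proof -
  have "((\<lambda>x. integral {0..x} k) has_real_derivative k x) (at x within {0..l})"
    using integral_has_vector_derivative[OF k x]
    by (simp add: has_real_derivative_iff_has_vector_derivative)
  then have "((\<lambda>x. f 0 + integral {0..x} k) has_real_derivative k x) (at x within {0..l})"
    using DERIV_add[OF DERIV_const, of "\<lambda>x. integral {0..x} k" "k x" x "{0..l}" "f 0"] by simp
  then show ?thesis
    by (rule has_field_derivative_transform_within[OF _ zero_less_one x]) (rule prim_eq[OF f, symmetric])
qed

text \<open>Testing with continuous functions converging to \<open>sgn k\<close>.\<close>

lemma zero_prim_AE:
  fixes k :: "real \<Rightarrow> real"
  assumes k: "k absolutely_integrable_on {0..l}" and z: "\<And>x. x \<in> {0..l} \<Longrightarrow> integral {0..x} k = 0"
  shows "AE x in lebesgue_on {0<..<l}. k x = 0"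
proof (cases "l > 0")
  case l: True
  have "prim l (\<lambda>x. 0) k" using z by (intro primI k) simp
  then have z': "integral {x..y} k = 0" if "0 \<le> x" "x \<le> y" "y \<le> l" for x y
    using prim_increment[OF _ that] by fastforce
  \<comment> \<open>On a short interval g s may be replaced by g x up to e, and the integral of k
    over every subinterval is 0, so again \<open>additive_small_zero\<close> applies.\<close>
  have test: "integral {0..l} (\<lambda>x. k x * g x) = 0" if g: "continuous_on {0..l} g" for g
  proof -
    define E where "E x y = integral {x..y} (\<lambda>s. k s * g s)" for x y
    have i: "(\<lambda>s. k s * g s) integrable_on {x..y}" "k integrable_on {x..y}"
      "(\<lambda>s. \<bar>k s\<bar>) integrable_on {x..y}" if "0 \<le> x" "y \<le> l" for x y
      using that abs_int_sub[OF abs_int_mult_continuous[OF k g], of x y] abs_int_sub[OF k, of x y] by auto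
    have "E 0 l = 0"
    proof (rule additive_small_zero[where k = "\<lambda>s. \<bar>k s\<bar>" and l = l and E = E])
      show "E x z = E x y + E y z" if "0 \<le> x" "x \<le> y" "y \<le> z" "z \<le> l" for x y z
        using that Henstock_Kurzweil_Integration.integral_combine[of x y z "\<lambda>s. k s * g s"]
          i(1)[of x z] by (simp add: E_def)
      fix e :: real assume e: "e > 0"
      obtain d where d: "d > 0" "\<And>x y. x \<in> {0..l} \<Longrightarrow> y \<in> {0..l} \<Longrightarrow> \<bar>y - x\<bar> < d \<Longrightarrow> \<bar>g y - g x\<bar> < e"
        using uniform_modulus[OF g e] by metis
      have "\<bar>E x y\<bar> \<le> e * integral {x..y} (\<lambda>s. \<bar>k s\<bar>)"
        if xy: "0 \<le> x" "x \<le> y" "y \<le> l" "y - x < d" for x y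
      proof -
        have "integral {x..y} (\<lambda>s. k s * g x) = 0" using z'[OF xy(1-3)] by simp
        then have "E x y = integral {x..y} (\<lambda>s. k s * g s) - integral {x..y} (\<lambda>s. k s * g x)"
          by (simp add: E_def)
        also have "\<dots> = integral {x..y} (\<lambda>s. k s * g s - k s * g x)"
          using i[OF xy(1,3)] by (intro integral_diff[symmetric]) (auto intro: integrable_on_mult_left)
        also have "norm \<dots> \<le> integral {x..y} (\<lambda>s. e * \<bar>k s\<bar>)"
        proof (rule Henstock_Kurzweil_Integration.integral_norm_bound_integral)
          show "(\<lambda>s. k s * g s - k s * g x) integrable_on {x..y}"
            using i[OF xy(1,3)] by (intro integrable_diff integrable_on_mult_left)
          show "(\<lambda>s. e * \<bar>k s\<bar>) integrable_on {x..y}"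
            using i(3)[OF xy(1,3)] by (rule integrable_on_mult_right)
          fix s assume s: "s \<in> {x..y}"
          have "\<bar>g s - g x\<bar> \<le> e" using d(2)[of x s] s xy by auto
          then have "\<bar>k s * (g s - g x)\<bar> \<le> \<bar>k s\<bar> * e" by (auto simp: abs_mult intro: mult_left_mono)
          then show "norm (k s * g s - k s * g x) \<le> e * \<bar>k s\<bar>" by (simp add: algebra_simps)
        qed
        finally show ?thesis by simp
      qed
      then show "\<exists>d>0. \<forall>x y. 0 \<le> x \<longrightarrow> x \<le> y \<longrightarrow> y \<le> l \<longrightarrow> y - x < d \<longrightarrow>
          \<bar>E x y\<bar> \<le> e * integral {x..y} (\<lambda>s. \<bar>k s\<bar>)"
        using d(1) by blast
    qed (use l i[of 0 l] in auto)
    then show ?thesis by (simp add: E_def)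
  qed
  define u where "u x = sgn (if x \<in> {0<..<l} then k x else 0)" for x
  have "k \<in> borel_measurable (lebesgue_on {0<..<l})"
    using k by (intro absolutely_integrable_imp_borel_measurable) (auto simp: absolutely_integrable_on_Icc_iff_Ioo)
  then have "(\<lambda>x. if x \<in> {0<..<l} then k x else 0) \<in> borel_measurable lebesgue"
    by (simp add: borel_measurable_if del: greaterThanLessThan_iff)
  then have "u \<in> borel_measurable lebesgue"
    unfolding u_def by (rule measurable_compose) simp
  then have "u measurable_on UNIV"
    by (intro lebesgue_measurable_imp_measurable_on_real) auto
  then obtain N g where N: "negligible N" and g: "\<And>n. continuous_on UNIV (g n)"
    and lim: "\<And>x. x \<notin> N \<Longrightarrow> (\<lambda>n::nat. g n x) \<longlonglongrightarrow> u x"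
    unfolding measurable_on_def by auto
  \<comment> \<open>Clipping to [-1, 1] provides an integrable majorant and does not disturb the
    limit, as the values of \<open>sgn\<close> lie in that interval.\<close>
  define h where "h n x = max (-1) (min 1 (g n x))" for n x
  have hc: "continuous_on A (h n)" for n A
    unfolding h_def by (intro continuous_intros continuous_on_subset[OF g]) auto
  have hb: "\<bar>h n x\<bar> \<le> 1" for n x by (auto simp: h_def)
  have hl: "(\<lambda>n. h n x) \<longlonglongrightarrow> u x" if "x \<notin> N" for x
  proof -
    have "(\<lambda>n. h n x) \<longlonglongrightarrow> max (-1) (min 1 (u x))"
      unfolding h_def using lim[OF that] by (intro tendsto_intros)
    moreover have "max (-1) (min 1 (u x)) = u x" by (simp add: u_def sgn_if)
    ultimately show ?thesis by simp
  qed
  \<comment> \<open>Setting k to 0 on the exceptional null set and at both ends makes the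
    convergence below hold at every point of {0..l}.\<close>
  define k' where "k' x = (if x \<in> N \<or> x = 0 \<or> x = l then 0 else k x)" for x
  have N': "negligible (N \<union> {0, l})" using N by (intro negligible_Un) auto
  have kk: "integral {0..l} (\<lambda>x. k' x * h n x) = 0" for n
  proof -
    have "integral {0..l} (\<lambda>x. k' x * h n x) = integral {0..l} (\<lambda>x. k x * h n x)"
      by (rule integral_spike[OF N']) (auto simp: k'_def)
    then show ?thesis using test[OF hc] by simp
  qed
  have k'_ai: "k' absolutely_integrable_on {0..l}"
    by (rule absolutely_integrable_spike[OF k N']) (auto simp: k'_def)
  have "(\<lambda>n. integral {0..l} (\<lambda>x. k' x * h n x)) \<longlonglongrightarrow> integral {0..l} (\<lambda>x. \<bar>k' x\<bar>)"
  proof (rule dominated_convergence(2))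
    show "(\<lambda>x. k' x * h n x) integrable_on {0..l}" for n
      using abs_int_sub(1)[OF abs_int_mult_continuous[OF k'_ai hc]] by auto
    show "(\<lambda>x. \<bar>k' x\<bar>) integrable_on {0..l}" using abs_int_sub[OF k'_ai] by auto
    show "norm (k' x * h n x) \<le> \<bar>k' x\<bar>" for n x
      using hb[of n x] by (simp add: abs_mult mult_left_le)
    fix x assume x: "x \<in> {0..l}"
    show "(\<lambda>n. k' x * h n x) \<longlonglongrightarrow> \<bar>k' x\<bar>"
    proof (cases "x \<in> N \<or> x = 0 \<or> x = l")
      case True
      then show ?thesis by (simp add: k'_def)
    next
      case False
      then have "(\<lambda>n. k' x * h n x) \<longlonglongrightarrow> k' x * u x" using hl by (intro tendsto_intros) auto
      moreover have "k' x * u x = \<bar>k' x\<bar>" using False x by (auto simp: k'_def u_def abs_sgn)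
      ultimately show ?thesis by simp
    qed
  qed
  then have "integral {0..l} (\<lambda>x. \<bar>k' x\<bar>) = 0" by (simp add: kk LIMSEQ_const_iff)
  moreover have "integral {0..l} (\<lambda>x. \<bar>k' x\<bar>) = integral {0..l} (\<lambda>x. \<bar>k x\<bar>)"
    by (rule integral_spike[OF N']) (auto simp: k'_def)
  moreover have ak: "(\<lambda>x. \<bar>k x\<bar>) absolutely_integrable_on {0..l}"
    using k by (rule set_integrable_abs)
  ultimately have "(LINT x|lebesgue_on {0<..<l}. \<bar>k x\<bar>) = 0" by (simp add: LINT_eq_Icc)
  then have "AE x in lebesgue_on {0<..<l}. \<bar>k x\<bar> = 0"
    using ak by (subst (asm) integral_nonneg_eq_0_iff_AE) (auto simp: lebesgue_on_iff_Icc)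
  then show ?thesis by simp
qed (simp add: AE_restrict_space_iff)

section \<open>Smooth cut-off functions\<close>

definition flat :: "nat \<Rightarrow> real \<Rightarrow> real" where
  "flat m x = (if x > 0 then (1 / x) ^ m * exp (- (1 / x)) else 0)"

lemma flat_nonneg: "0 \<le> flat m x"
  by (simp add: flat_def)

lemma flat_pos: "0 < x \<Longrightarrow> 0 < flat m x"
  by (simp add: flat_def)

lemma flat_zero: "x \<le> 0 \<Longrightarrow> flat m x = 0"
  by (simp add: flat_def)

lemma flat_tendsto_0: "(flat m \<longlongrightarrow> 0) (at 0)"
proof (rule filterlim_split_at)
  have "eventually (\<lambda>x. x < 0) (at_left (0::real))"
    by (simp add: eventually_at_filter)
  then have "eventually (\<lambda>x. flat m x = 0) (at_left 0)"
    by eventually_elim (simp add: flat_def)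
  then show "(flat m \<longlongrightarrow> 0) (at_left 0)" by (rule tendsto_eventually)
  have *: "((\<lambda>x. (inverse x) ^ m / exp (inverse x)) \<longlongrightarrow> (0::real)) (at_right 0)"
    by (rule filterlim_compose[OF tendsto_power_div_exp_0 filterlim_inverse_at_top_right])
  have "eventually (\<lambda>x. x > 0) (at_right (0::real))"
    by (simp add: eventually_at_filter)
  then have "eventually (\<lambda>x. (inverse x) ^ m / exp (inverse x) = flat m x) (at_right 0)"
  proof eventually_elim
    case (elim x)
    then show ?case by (simp add: flat_def exp_minus divide_inverse)
  qed
  with * show "(flat m \<longlongrightarrow> 0) (at_right 0)"
    by (rule Lim_transform_eventually)
qed

text \<open>The functions x^(-m) exp(-1/x) have combinations of themselves as derivatives, which
  gives smoothness of all of them by one induction. At 0 the difference quotient of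
  \<open>flat m\<close> is \<open>flat (m + 1)\<close>, and this tends to 0.\<close>

lemma flat_derivative:
  "(flat m has_real_derivative flat (m + 2) x - real m * flat (m + 1) x) (at x)"
proof (cases x "0::real" rule: linorder_cases)
  case less
  have "((\<lambda>x. 0) has_real_derivative flat (m + 2) x - real m * flat (m + 1) x) (at x)"
    using less by (simp add: flat_zero)
  then show ?thesis
    by (rule has_field_derivative_transform_within_open[where S = "{..<0}"])
       (use less in \<open>auto simp: flat_zero\<close>)
next
  case greater
  have "((\<lambda>x. (1 / x) ^ m * exp (- (1 / x))) has_real_derivative flat (m + 2) x - real m * flat (m + 1) x) (at x)"
  proof -
    have d: "((\<lambda>x. 1 / x) has_real_derivative - (1 / x)\<^sup>2) (at x)"
      using DERIV_inverse[of x UNIV] greater by (simp add: inverse_eq_divide power2_eq_square)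
    have p: "((\<lambda>x. (1 / x) ^ m) has_real_derivative - (real m * (1 / x) ^ (m + 1))) (at x)"
    proof (cases m)
      case (Suc j)
      have "c * (- y\<^sup>2 * y ^ (Suc j - Suc 0)) = - (c * y ^ (Suc j + 1))" for y c :: real
        by (simp add: power2_eq_square)
      then have "real m * (- (1 / x)\<^sup>2 * (1 / x) ^ (m - Suc 0)) = - (real m * (1 / x) ^ (m + 1))"
        unfolding Suc .
      with DERIV_power[OF d, of m] show ?thesis by (simp only:)
    qed simp
    have e: "((\<lambda>x. exp (- (1 / x))) has_real_derivative exp (- (1 / x)) * (1 / x)\<^sup>2) (at x)"
      using DERIV_fun_exp[OF DERIV_minus[OF d]] by simp
    have f: "flat j x = (1 / x) ^ j * exp (- (1 / x))" for j
      using greater by (simp add: flat_def)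
    have "y ^ (m + 2) * E - real m * (y ^ (m + 1) * E) = - (real m * y ^ (m + 1)) * E + E * y\<^sup>2 * y ^ m" for y E :: real
      by (simp add: power_add power2_eq_square)
    from this[of "1 / x" "exp (- (1 / x))"]
    have "flat (m + 2) x - real m * flat (m + 1) x = - (real m * (1 / x) ^ (m + 1)) * exp (- (1 / x))
        + exp (- (1 / x)) * (1 / x)\<^sup>2 * (1 / x) ^ m"
      unfolding f .
    then show ?thesis by (simp only: DERIV_mult[OF p e])
  qed
  then show ?thesis
    by (rule has_field_derivative_transform_within_open[where S = "{0<..}"])
       (use greater in \<open>auto simp: flat_def\<close>)
next
  case equal
  have "((\<lambda>y. (flat m y - flat m 0) / (y - 0)) \<longlongrightarrow> 0) (at 0)"
  proof (rule Lim_transform_eventually[OF flat_tendsto_0[of "m + 1"]])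
    show "eventually (\<lambda>y. flat (m + 1) y = (flat m y - flat m 0) / (y - 0)) (at 0)"
      unfolding eventually_at by (intro exI[of _ 1]) (simp add: flat_def)
  qed
  moreover have "flat (m + 2) 0 - real m * flat (m + 1) 0 = 0" by (simp add: flat_zero)
  ultimately show ?thesis unfolding equal has_field_derivative_iff by (simp only:)
qed

lemma flat_continuous: "continuous_on A (flat m)"
  by (intro continuous_at_imp_continuous_on ballI DERIV_isCont[OF flat_derivative])

lemma flat_Ck: "Ck_on k UNIV (flat m)"
proof (induction k arbitrary: m)
  case 0
  then show ?case by (simp add: flat_continuous)
next
  case (Suc k)
  show ?case
  proof (rule Ck_on_SucI)
    show "(flat m has_vector_derivative flat (m + 2) t - real m * flat (m + 1) t) (at t within UNIV)" for t
      using flat_derivative by (simp add: has_real_derivative_iff_has_vector_derivative)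
    show "Ck_on k UNIV (\<lambda>t. flat (m + 2) t - real m * flat (m + 1) t)"
      by (intro Ck_on_diff Ck_on_mult Suc.IH Ck_on_const)
  qed
qed

lemma Ck_on_affine:
  fixes u :: "real \<Rightarrow> real"
  shows "Ck_on k UNIV u \<Longrightarrow> Ck_on k UNIV (\<lambda>x. u (a * x + c))"
proof (induction k arbitrary: u)
  case 0
  then show ?case by (auto intro!: continuous_on_compose2[of UNIV u] continuous_intros)
next
  case (Suc k)
  obtain u' where u': "\<forall>t\<in>UNIV. (u has_vector_derivative u' t) (at t within UNIV)" "Ck_on k UNIV u'"
    using Suc.prems by (rule Ck_on_SucE)
  show ?case
  proof (rule Ck_on_SucI)
    fix t
    have "(u has_real_derivative u' (a * t + c)) (at (a * t + c))"
      using u'(1) by (simp add: has_real_derivative_iff_has_vector_derivative)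
    moreover have "((\<lambda>x. a * x + c) has_real_derivative a) (at t)"
      by (auto intro!: derivative_eq_intros)
    ultimately have "((\<lambda>x. u (a * x + c)) has_real_derivative u' (a * t + c) * a) (at t)"
      by (rule DERIV_chain2)
    then show "((\<lambda>x. u (a * x + c)) has_vector_derivative u' (a * t + c) * a) (at t within UNIV)"
      by (simp add: has_real_derivative_iff_has_vector_derivative)
    show "Ck_on k UNIV (\<lambda>t. u' (a * t + c) * a)"
      by (rule Ck_on_mult[OF Suc.IH[OF u'(2)] Ck_on_const])
  qed
qed

definition step :: "real \<Rightarrow> real" where
  "step x = flat 0 x / (flat 0 x + flat 0 (1 - x))"

text \<open>The derivative of \<open>step\<close>, in a form that shows its sign and its support.
  Rescaled, it is a nonnegative kernel of mass one on an interval of length e.\<close>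

definition step' :: "real \<Rightarrow> real" where
  "step' x = (flat 2 x * flat 0 (1 - x) + flat 0 x * flat 2 (1 - x)) / (flat 0 x + flat 0 (1 - x))\<^sup>2"

lemma step_denom_pos: "0 < flat 0 x + flat 0 (1 - x)"
  using flat_pos[of x 0] flat_pos[of "1 - x" 0] flat_nonneg[of 0 x] flat_nonneg[of 0 "1 - x"]
  by (cases "x > 0") auto

lemma step_0: "x \<le> 0 \<Longrightarrow> step x = 0"
  by (simp add: step_def flat_zero)

lemma step_1: "x \<ge> 1 \<Longrightarrow> step x = 1"
  using flat_pos[of x 0] by (simp add: step_def flat_zero)

lemma step_bounds: "0 \<le> step x" "step x \<le> 1"
  using step_denom_pos[of x] flat_nonneg[of 0 x] flat_nonneg[of 0 "1 - x"]
  by (auto simp: step_def)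

lemma step'_nonneg: "0 \<le> step' x"
  by (simp add: step'_def flat_nonneg)

lemma step'_0: "x \<le> 0 \<or> x \<ge> 1 \<Longrightarrow> step' x = 0"
  by (auto simp: step'_def flat_zero)

lemma step_derivative: "(step has_real_derivative step' x) (at x)"
proof -
  have f: "(flat 0 has_real_derivative flat 2 x) (at x)"
    using flat_derivative[of 0 x] by (simp add: numeral_2_eq_2)
  have d1: "((\<lambda>x. 1 - x) has_real_derivative - 1) (at x)"
    by (rule derivative_eq_intros refl | simp)+
  have g: "((\<lambda>x. flat 0 (1 - x)) has_real_derivative - flat 2 (1 - x)) (at x)"
    using DERIV_chain2[where f = "flat 0" and g = "\<lambda>x. 1 - x" and x = x and s = UNIV and Db = "-1",
        OF flat_derivative[of 0 "1 - x"] d1]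
    by (simp add: numeral_2_eq_2)
  have "((\<lambda>x. flat 0 x / (flat 0 x + flat 0 (1 - x))) has_real_derivative step' x) (at x)"
    using DERIV_divide[OF f DERIV_add[OF f g]] step_denom_pos[of x]
    by (simp add: step'_def power2_eq_square algebra_simps)
  then show ?thesis unfolding step_def[abs_def] .
qed

lemma step'_continuous: "continuous_on A step'"
proof -
  have c: "continuous_on A (\<lambda>x. flat m (1 - x))" for m
    by (rule continuous_on_compose2[OF flat_continuous[of UNIV]]) (auto intro!: continuous_intros)
  have "(flat 0 x + flat 0 (1 - x))\<^sup>2 \<noteq> 0" for x
    using step_denom_pos[of x] by simp
  then show ?thesis unfolding step'_def[abs_def]
    by (intro continuous_intros flat_continuous c) blast
qed

lemma step_Ck: "Ck_on k UNIV step"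
proof -
  have g: "Ck_on k UNIV (\<lambda>t. flat 0 (1 - t))"
    using Ck_on_affine[OF flat_Ck[of k 0], of "-1" 1] by simp
  have "flat 0 t + flat 0 (1 - t) \<noteq> 0" for t using step_denom_pos[of t] by simp
  from Ck_on_divide[OF flat_Ck[of k 0] Ck_on_add[OF flat_Ck[of k 0] g] this]
  show ?thesis unfolding step_def[abs_def] .
qed

lemma step_scaled_derivative:
  assumes "e > 0"
  shows "((\<lambda>x. step ((x - c) / e)) has_real_derivative step' ((x - c) / e) / e) (at x within A)"
proof -
  have "((\<lambda>x. (x - c) / e) has_real_derivative 1 / e) (at x)"
  proof -
    have "((\<lambda>x. x - c) has_real_derivative 1) (at x)"
      by (rule derivative_eq_intros refl | simp)+
    then show ?thesis by (rule DERIV_cdivide)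
  qed
  from DERIV_chain2[where f = step and g = "\<lambda>x. (x - c) / e" and x = x and s = UNIV,
      OF step_derivative this]
  have "((\<lambda>x. step ((x - c) / e)) has_real_derivative step' ((x - c) / e) / e) (at x)"
    by simp
  then show ?thesis by (rule has_field_derivative_at_within)
qed

text \<open>As e tends to 0, these functions tend to the indicator of {a<..b}, while their
  derivatives are the difference of two averaging kernels, one at a and one at b.\<close>

lemma step_test_fun:
  assumes "0 < a" "a \<le> b" "b + e < l" "e > 0"
  shows "test_fun l (\<lambda>x. step ((x - a) / e) - step ((x - b) / e))"
  unfolding test_fun_def
proof (intro conjI exI)
  have s: "Ck_on k UNIV (\<lambda>x. step ((x - c) / e))" for k c
    using Ck_on_affine[OF step_Ck, of k "1 / e" "- c / e"] by (simp add: diff_divide_distrib)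
  show "smooth_on UNIV (\<lambda>x. step ((x - a) / e) - step ((x - b) / e))"
    by (subst Ck_on_smooth) (simp, intro allI Ck_on_diff[OF s s])
  show "0 < a" "b + e < l" by fact+
  show "\<forall>x. x \<notin> {a..b + e} \<longrightarrow> step ((x - a) / e) - step ((x - b) / e) = 0"
  proof (intro allI impI)
    fix x assume "x \<notin> {a..b + e}"
    then consider "x < a" | "x > b + e" by force
    then show "step ((x - a) / e) - step ((x - b) / e) = 0"
      using assms by cases (simp_all add: step_0 step_1 divide_nonpos_pos field_simps)
  qed
qed

text \<open>The kernel has integral 1 over {0..l} and vanishes outside {c..c + e}, so the error is a
  weighted average of f x - f c over that short interval.\<close>

lemma step_average:
  assumes f: "continuous_on {0..l} f" and c: "0 \<le> c" "c + e \<le> l" and e: "e > 0"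
    and near: "\<And>x. x \<in> {c..c + e} \<Longrightarrow> \<bar>f x - f c\<bar> \<le> \<eta>"
  shows "\<bar>integral {0..l} (\<lambda>x. f x * (step' ((x - c) / e) / e)) - f c\<bar> \<le> \<eta>"
proof -
  define \<psi> where "\<psi> x = step' ((x - c) / e) / e" for x
  have \<psi>c: "continuous_on {0..l} \<psi>"
    unfolding \<psi>_def using e
    by (intro continuous_intros continuous_on_compose2[OF step'_continuous[of UNIV]]) auto
  have "(\<psi> has_integral (step ((l - c) / e) - step ((0 - c) / e))) {0..l}"
    unfolding \<psi>_def using c e step_scaled_derivative[OF e, of c]
    by (intro fundamental_theorem_of_calculus)
       (auto simp: has_real_derivative_iff_has_vector_derivative)
  moreover have "step ((l - c) / e) = 1" "step ((0 - c) / e) = 0"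
    using c e by (auto intro!: step_0 step_1 simp: field_simps)
  ultimately have \<psi>1: "(\<psi> has_integral 1) {0..l}" by simp
  have "norm (integral {0..l} (\<lambda>x. (f x - f c) * \<psi> x)) \<le> integral {0..l} (\<lambda>x. \<eta> * \<psi> x)"
  proof (rule Henstock_Kurzweil_Integration.integral_norm_bound_integral)
    show "(\<lambda>x. (f x - f c) * \<psi> x) integrable_on {0..l}" "(\<lambda>x. \<eta> * \<psi> x) integrable_on {0..l}"
      by (intro integrable_continuous_real continuous_intros f \<psi>c)+
    fix x assume "x \<in> {0..l}"
    show "norm ((f x - f c) * \<psi> x) \<le> \<eta> * \<psi> x"
    proof (cases "x \<in> {c..c + e}")
      case True
      have "\<psi> x \<ge> 0" using step'_nonneg[of "(x - c) / e"] e by (simp add: \<psi>_def)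
      then show ?thesis using mult_right_mono[OF near[OF True], of "\<psi> x"] by (simp add: abs_mult)
    next
      case False
      then have "\<psi> x = 0" using e by (auto simp: \<psi>_def field_simps intro!: step'_0)
      then show ?thesis by simp
    qed
  qed
  also have "integral {0..l} (\<lambda>x. \<eta> * \<psi> x) = \<eta>"
    using \<psi>1 by (simp add: integral_unique)
  also have "integral {0..l} (\<lambda>x. (f x - f c) * \<psi> x) = integral {0..l} (\<lambda>x. f x * \<psi> x) - f c"
  proof -
    have "integral {0..l} (\<lambda>x. (f x - f c) * \<psi> x)
        = integral {0..l} (\<lambda>x. f x * \<psi> x) - integral {0..l} (\<lambda>x. f c * \<psi> x)"
      unfolding left_diff_distrib
      by (intro integral_diff integrable_continuous_real continuous_intros f \<psi>c)
    then show ?thesis using \<psi>1 by (simp add: integral_unique)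
  qed
  finally show ?thesis by (simp add: \<psi>_def)
qed

section \<open>Weak derivatives and absolutely continuous primitives\<close>

lemma test_fun_D:
  assumes "test_fun l \<phi>"
  shows "(\<phi> has_real_derivative deriv \<phi> x) (at x)" "continuous_on A (deriv \<phi>)" "\<phi> 0 = 0" "\<phi> l = 0"
proof -
  obtain D where D: "\<And>x. D (0::nat) x = \<phi> x" "\<And>k x. (D k has_real_derivative D (Suc k) x) (at x)"
    using assms by (auto simp: test_fun_def smooth_on_def)
  have "D 0 = \<phi>" using D(1) by auto
  then have \<phi>: "(\<phi> has_real_derivative D 1 x) (at x)" for x using D(2)[of 0 x] by simp
  then have d: "deriv \<phi> x = D 1 x" for x by (rule DERIV_imp_deriv)
  show "(\<phi> has_real_derivative deriv \<phi> x) (at x)" by (simp only: d \<phi>)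
  have "continuous_on A (D 1)"
    by (intro continuous_at_imp_continuous_on ballI DERIV_isCont[OF D(2)])
  moreover have "deriv \<phi> = D 1" using d by auto
  ultimately show "continuous_on A (deriv \<phi>)" by simp
  show "\<phi> 0 = 0" "\<phi> l = 0" using assms unfolding test_fun_def by fastforce+
qed

lemma test_fun_continuous: "test_fun l \<phi> \<Longrightarrow> continuous_on A \<phi>"
  by (intro continuous_at_imp_continuous_on ballI DERIV_isCont[OF test_fun_D(1)])

text \<open>The weak identity is tested with smoothed indicators of {a<..b}. On one side two
  averages of f tend to f a - f b by continuity; on the other the integrals tend to the integral of
  k over {a..b} by dominated convergence.\<close>

lemma weak_deriv_increment:
  assumes w: "weak_deriv l f k" and f: "continuous_on {0..l} f" and ab: "0 < a" "a < b" "b < l"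
  shows "f b - f a = integral {a..b} k"
proof -
  \<comment> \<open>The widths tend to 0 and never exceed (l - b) / 2, so the supports {a..b + e n}
    stay inside the open interval.\<close>
  define e where "e n = (l - b) / 2 * inverse (real (Suc n))" for n
  have e_lim: "e \<longlonglongrightarrow> 0"
    unfolding e_def[abs_def] by (intro tendsto_mult_right_zero LIMSEQ_inverse_real_of_nat)
  have e_pos: "e n > 0" for n using ab by (simp add: e_def)
  have e_le: "b + e n < l" for n
  proof -
    have "inverse (real (Suc n)) \<le> 1" by (simp add: inverse_le_1_iff)
    then have "e n \<le> (l - b) / 2 * 1" unfolding e_def using ab by (intro mult_left_mono) auto
    then show ?thesis using ab by simp
  qed
  define \<phi> where "\<phi> n x = step ((x - a) / e n) - step ((x - b) / e n)" for n x
  have tf: "test_fun l (\<phi> n)" for n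
    unfolding \<phi>_def[abs_def] using ab e_pos e_le by (intro step_test_fun) auto
  have kai: "k absolutely_integrable_on {0..l}"
    using w by (simp add: weak_deriv_def L2_abs_int)
  define A where "A c n = integral {0..l} (\<lambda>x. f x * (step' ((x - c) / e n) / e n))" for c n
  have A_lim: "A c \<longlonglongrightarrow> f c" if c: "a \<le> c" "c \<le> b" for c
  proof (rule tendstoI)
    fix \<epsilon> :: real assume \<epsilon>: "\<epsilon> > 0"
    obtain d where d: "d > 0" "\<And>x y. x \<in> {0..l} \<Longrightarrow> y \<in> {0..l} \<Longrightarrow> \<bar>y - x\<bar> < d \<Longrightarrow> \<bar>f y - f x\<bar> < \<epsilon> / 2"
      using uniform_modulus[OF f, of "\<epsilon> / 2"] \<epsilon> by auto
    have "eventually (\<lambda>n. e n < d) sequentially" using e_lim d(1) by (rule order_tendstoD)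
    then show "eventually (\<lambda>n. dist (A c n) (f c) < \<epsilon>) sequentially"
    proof eventually_elim
      case (elim n)
      have "\<bar>A c n - f c\<bar> \<le> \<epsilon> / 2"
        unfolding A_def
      proof (rule step_average[OF f])
        show "0 \<le> c" "c + e n \<le> l" "0 < e n" using c ab e_le[of n] e_pos[of n] by auto
        show "\<bar>f x - f c\<bar> \<le> \<epsilon> / 2" if "x \<in> {c..c + e n}" for x
          using d(2)[of c x] that elim c ab e_le[of n] by auto
      qed
      then show ?case using \<epsilon> by (simp add: dist_real_def)
    qed
  qed
  have lhs: "(LINT x|lebesgue_on {0<..<l}. f x * deriv (\<phi> n) x) = A a n - A b n" for n
  proof -
    have d: "deriv (\<phi> n) x = step' ((x - a) / e n) / e n - step' ((x - b) / e n) / e n" for x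
      unfolding \<phi>_def[abs_def]
      by (intro DERIV_imp_deriv DERIV_diff step_scaled_derivative e_pos)
    have "(LINT x|lebesgue_on {0<..<l}. f x * deriv (\<phi> n) x) = integral {0..l} (\<lambda>x. f x * deriv (\<phi> n) x)"
      by (intro LINT_eq_Icc absolutely_integrable_continuous_real continuous_intros f test_fun_D(2)[OF tf])
    also have "\<dots> = A a n - A b n"
      unfolding d right_diff_distrib A_def using e_pos[of n]
      by (intro integral_diff integrable_continuous_real continuous_intros f
          continuous_on_compose2[OF step'_continuous[of UNIV]]) auto
    finally show ?thesis .
  qed
  define g where "g x = (if x \<in> {a<..b} then k x else 0)" for x
  have rhs: "(\<lambda>n. LINT x|lebesgue_on {0<..<l}. k x * \<phi> n x) \<longlonglongrightarrow> integral {a..b} k"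
  proof -
    have "(\<lambda>n. integral {0..l} (\<lambda>x. k x * \<phi> n x)) \<longlonglongrightarrow> integral {0..l} g"
    proof (rule dominated_convergence(2))
      show "(\<lambda>x. k x * \<phi> n x) integrable_on {0..l}" for n
        by (rule abs_int_sub(1)[OF abs_int_mult_continuous[OF kai test_fun_continuous[OF tf]] order_refl])
      show "(\<lambda>x. \<bar>k x\<bar>) integrable_on {0..l}" by (rule abs_int_sub(2)[OF kai order_refl])
      show "norm (k x * \<phi> n x) \<le> \<bar>k x\<bar>" for n x
      proof -
        have "\<bar>\<phi> n x\<bar> \<le> 1"
          using step_bounds[of "(x - a) / e n"] step_bounds[of "(x - b) / e n"] by (auto simp: \<phi>_def)
        then show ?thesis by (simp add: abs_mult mult_left_le)
      qed
      fix x assume "x \<in> {0..l}"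
      consider "x \<le> a" | "a < x" "x \<le> b" | "b < x" by linarith
      then have "eventually (\<lambda>n. k x * \<phi> n x = g x) sequentially"
      proof cases
        case 1
        then show ?thesis using ab e_pos
          by (intro always_eventually) (simp add: \<phi>_def g_def step_0 divide_nonpos_pos)
      next
        case 2
        then have "eventually (\<lambda>n. e n < x - a) sequentially" using order_tendstoD(2)[OF e_lim, of "x - a"] by simp
        then show ?thesis
        proof eventually_elim
          case (elim n)
          then show ?case using 2 e_pos[of n]
            by (simp add: \<phi>_def g_def step_0 step_1 divide_nonpos_pos)
        qed
      next
        case 3
        then have "eventually (\<lambda>n. e n < x - b) sequentially" using order_tendstoD(2)[OF e_lim, of "x - b"] by simp
        then show ?thesis
        proof eventually_elim
          case (elim n)
          then show ?case using 3 ab e_pos[of n] by (simp add: \<phi>_def g_def step_1)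
        qed
      qed
      then show "(\<lambda>n. k x * \<phi> n x) \<longlonglongrightarrow> g x" by (rule tendsto_eventually)
    qed
    moreover have "integral {0..l} (\<lambda>x. k x * \<phi> n x) = (LINT x|lebesgue_on {0<..<l}. k x * \<phi> n x)" for n
      by (rule LINT_eq_Icc[symmetric]) (rule abs_int_mult_continuous[OF kai test_fun_continuous[OF tf]])
    moreover have "integral {0..l} g = integral ({a<..b} \<inter> {0..l}) k"
      unfolding g_def[abs_def] by (rule Henstock_Kurzweil_Integration.integral_restrict_Int)
    moreover have "{a<..b} \<inter> {0..l} = {a<..b}" using ab by auto
    moreover have "integral {a<..b} k = integral {a..b} k"
      by (rule integral_spike_set) (auto intro: negligible_subset[of "{a}"])
    ultimately show ?thesis by simp
  qed
  have "(\<lambda>n. A a n - A b n) \<longlonglongrightarrow> f a - f b"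
    using ab by (intro tendsto_diff A_lim) auto
  moreover have "A a n - A b n = - (LINT x|lebesgue_on {0<..<l}. k x * \<phi> n x)" for n
  proof -
    have "(LINT x|lebesgue_on {0<..<l}. f x * deriv (\<phi> n) x) = - (LINT x|lebesgue_on {0<..<l}. k x * \<phi> n x)"
      using w tf[of n] unfolding weak_deriv_def by blast
    then show ?thesis by (simp only: lhs)
  qed
  ultimately have "(\<lambda>n. - (LINT x|lebesgue_on {0<..<l}. k x * \<phi> n x)) \<longlonglongrightarrow> f a - f b" by simp
  from LIMSEQ_unique[OF this tendsto_minus[OF rhs]] show ?thesis by simp
qed

text \<open>The increment formula is known between interior points only. It makes f minus the
  primitive of k constant on the open interval, and continuity carries this to the end
  points.\<close>

lemma weak_deriv_prim:
  assumes w: "weak_deriv l f k" and f: "continuous_on {0..l} f" and l: "l > 0"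
  shows "prim l f k"
proof -
  have kai: "k absolutely_integrable_on {0..l}"
    using w by (simp add: weak_deriv_def L2_abs_int)
  define G where "G x = f x - integral {0..x} k" for x
  have ki: "k integrable_on {0..x}" if "x \<le> l" for x
    using that by (intro abs_int_sub(1)[OF kai]) auto
  have Gc: "continuous_on {0..l} G"
    unfolding G_def by (intro continuous_intros f indefinite_integral_continuous_1 ki order_refl)
  have Geq: "G x = G y" if "0 < x" "x < y" "y < l" for x y
  proof -
    have "integral {0..x} k + integral {x..y} k = integral {0..y} k"
      using that by (intro Henstock_Kurzweil_Integration.integral_combine ki) auto
    then show ?thesis using weak_deriv_increment[OF w f that] by (simp add: G_def)
  qed
  have mid: "G x = G (l / 2)" if "x \<in> {0<..<l}" for x
  proof (cases x "l / 2" rule: linorder_cases)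
    case less
    then show ?thesis using Geq[of x "l / 2"] that l by simp
  next
    case greater
    then show ?thesis using Geq[of "l / 2" x] that l by simp
  next
    case equal
    then show ?thesis by (simp only:)
  qed
  have const: "G x = G (l / 2)" if "x \<in> {0..l}" for x
  proof -
    have "closure {0<..<l} = {0..l}" using l by simp
    then have "continuous_on (closure {0<..<l}) G" "x \<in> closure {0<..<l}" using Gc that by (simp_all only:)
    from continuous_constant_on_closure[where S = "{0<..<l}" and f = G and a = "G (l / 2)", OF this(1) mid this(2)]
    show ?thesis .
  qed
  show ?thesis
  proof (rule primI[OF kai])
    fix x assume x: "x \<in> {0..l}"
    have "G x = G 0" using const[OF x] const[of 0] l by simp
    then show "f x = f 0 + integral {0..x} k" by (simp add: G_def)
  qed
qed

text \<open>Integration by parts: the product rule for f and the test function, integrated up to l,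
  where the boundary terms vanish.\<close>

lemma prim_weak_deriv:
  assumes f: "prim l f k" and k: "L2 l k" and l: "l \<ge> 0"
  shows "weak_deriv l f k"
  unfolding weak_deriv_def
proof (intro conjI allI impI k)
  note fc = prim_continuous[OF f]
  show "L2 l f" using fc by (rule L2_continuous)
  fix \<phi> assume \<phi>: "test_fun l \<phi>"
  have \<phi>p: "prim l \<phi> (deriv \<phi>)"
    using test_fun_D[OF \<phi>] by (intro prim_C1) (auto intro: has_field_derivative_at_within)
  have ai: "(\<lambda>x. k x * \<phi> x) absolutely_integrable_on {0..l}"
    "(\<lambda>x. deriv \<phi> x * f x) absolutely_integrable_on {0..l}"
    by (intro abs_int_mult_continuous prim_abs_int[OF f] prim_abs_int[OF \<phi>p] fc test_fun_continuous[OF \<phi>])+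
  have "0 = integral {0..l} (\<lambda>x. k x * \<phi> x + deriv \<phi> x * f x)"
    using prim_eq[OF prim_mult[OF f \<phi>p], of l] l test_fun_D(3,4)[OF \<phi>] by simp
  also have "\<dots> = integral {0..l} (\<lambda>x. k x * \<phi> x) + integral {0..l} (\<lambda>x. deriv \<phi> x * f x)"
    by (intro integral_add abs_int_sub(1)[OF ai(1)] abs_int_sub(1)[OF ai(2)] order_refl)
  finally show "(LINT x|lebesgue_on {0<..<l}. f x * deriv \<phi> x) = - (LINT x|lebesgue_on {0<..<l}. k x * \<phi> x)"
    using LINT_eq_Icc[OF ai(1)] LINT_eq_Icc[OF ai(2)] by (simp add: mult.commute)
qed

section \<open>Equality almost everywhere and the chosen weak derivative\<close>

lemma AE_Ioo_iff:
  "(AE x in lebesgue_on {0<..<l::real}. P x) \<longleftrightarrow> negligible {x \<in> {0<..<l}. \<not> P x}"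
proof
  assume "AE x in lebesgue_on {0<..<l}. P x"
  then have "AE x in lebesgue. x \<in> {0<..<l} \<longrightarrow> P x"
    by (subst (asm) AE_restrict_space_iff) auto
  then obtain N where N: "{x \<in> space lebesgue. \<not> (x \<in> {0<..<l} \<longrightarrow> P x)} \<subseteq> N" "N \<in> null_sets lebesgue"
    by (auto elim!: AE_E simp: null_sets_def)
  then have "negligible N" by (simp add: negligible_iff_null_sets)
  then show "negligible {x \<in> {0<..<l}. \<not> P x}"
    by (rule negligible_subset) (use N(1) in auto)
next
  assume "negligible {x \<in> {0<..<l}. \<not> P x}"
  then have "{x \<in> {0<..<l}. \<not> P x} \<in> null_sets lebesgue" by (simp add: negligible_iff_null_sets)
  then have "AE x in lebesgue. x \<in> {0<..<l} \<longrightarrow> P x"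
    by (rule AE_I') auto
  then show "AE x in lebesgue_on {0<..<l}. P x"
    by (subst AE_restrict_space_iff) auto
qed

lemma AE_Ioo_all: "(\<And>x. x \<in> {0<..<l} \<Longrightarrow> P x) \<Longrightarrow> AE x in lebesgue_on {0<..<l::real}. P x"
proof -
  assume "\<And>x. x \<in> {0<..<l} \<Longrightarrow> P x"
  then have "{x \<in> {0<..<l}. \<not> P x} = {}" by blast
  then show ?thesis unfolding AE_Ioo_iff by (simp only: negligible_empty)
qed

lemma AE_abs_int:
  fixes f g :: "real \<Rightarrow> real"
  assumes ae: "AE x in lebesgue_on {0<..<l}. f x = g x" and f: "f absolutely_integrable_on {0..l}"
  shows "g absolutely_integrable_on {0..l}" "integral {0..l} g = integral {0..l} f"
proof -
  define N where "N = {x \<in> {0<..<l}. f x \<noteq> g x} \<union> {0, l}"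
  have N: "negligible N"
    unfolding N_def using ae by (intro negligible_Un) (auto simp: AE_Ioo_iff)
  have eq: "g x = f x" if "x \<in> {0..l} - N" for x
    using that unfolding N_def by force
  show "g absolutely_integrable_on {0..l}"
    using f N eq by (rule absolutely_integrable_spike)
  show "integral {0..l} g = integral {0..l} f"
    by (rule integral_spike[OF N eq, symmetric])
qed

lemma AE_L2:
  assumes "AE x in lebesgue_on {0<..<l}. f x = g x" "L2 l f"
  shows "L2 l g"
proof -
  have "AE x in lebesgue_on {0<..<l}. (f x)\<^sup>2 = (g x)\<^sup>2"
    using assms(1) by eventually_elim simp
  from AE_abs_int(1)[OF this L2_sq[OF assms(2)]] AE_abs_int(1)[OF assms(1) L2_abs_int[OF assms(2)]]
  show ?thesis by (simp add: L2_iff)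
qed

lemma AE_LINT:
  fixes f g :: "real \<Rightarrow> real"
  assumes "AE x in lebesgue_on {0<..<l}. f x = g x"
  shows "(LINT x|lebesgue_on {0<..<l}. f x) = (LINT x|lebesgue_on {0<..<l}. g x)"
proof (cases "f absolutely_integrable_on {0..l}")
  case True
  then show ?thesis using AE_abs_int[OF assms True] by (simp add: LINT_eq_Icc)
next
  case False
  have "AE x in lebesgue_on {0<..<l}. g x = f x" using assms by eventually_elim simp
  from AE_abs_int(1)[OF this] False have "\<not> g absolutely_integrable_on {0..l}" by argo
  then show ?thesis using False by (simp add: lebesgue_on_iff_Icc[symmetric] not_integrable_integral_eq)
qed

lemma weak_deriv_AE_cong:
  assumes "AE x in lebesgue_on {0<..<l}. f x = g x"
  shows "weak_deriv l f k \<longleftrightarrow> weak_deriv l g k"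
proof -
  have *: "weak_deriv l g k" if ae: "AE x in lebesgue_on {0<..<l}. f x = g x" and w: "weak_deriv l f k" for f g
  proof -
    have "(LINT x|lebesgue_on {0<..<l}. f x * deriv \<phi> x) = (LINT x|lebesgue_on {0<..<l}. g x * deriv \<phi> x)" for \<phi>
    proof (rule AE_LINT)
      show "AE x in lebesgue_on {0<..<l}. f x * deriv \<phi> x = g x * deriv \<phi> x"
        using ae by eventually_elim simp
    qed
    then show ?thesis using w AE_L2[OF ae] by (simp add: weak_deriv_def)
  qed
  have ae': "AE x in lebesgue_on {0<..<l}. g x = f x" using assms by eventually_elim simp
  show ?thesis using *[OF assms] *[OF ae'] by (rule iffI)
qed

text \<open>The predicate under the choice operator sees f only up to null sets, so the two chosen
  functions are literally equal. This lets \<open>Dw\<close> be rewritten inside other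
  operators.\<close>

lemma Dw_AE_cong:
  assumes "AE x in lebesgue_on {0<..<l}. f x = g x"
  shows "Dw l f = Dw l g"
  unfolding Dw_def weak_deriv_AE_cong[OF assms] ..

lemma Dw_cong: "(\<And>x. x \<in> {0<..<l} \<Longrightarrow> f x = g x) \<Longrightarrow> Dw l f = Dw l g"
  by (rule Dw_AE_cong) (rule AE_Ioo_all)

lemma Dw_properties:
  assumes "weak_deriv l f k"
  shows "weak_deriv l f (Dw l f)"
    and "weak_deriv l f m \<Longrightarrow> continuous_on {0..l} m \<Longrightarrow> continuous_on {0..l} (Dw l f)"
proof -
  let ?P = "\<lambda>f'. weak_deriv l f f' \<and>
     ((\<exists>k. weak_deriv l f k \<and> continuous_on {0..l} k) \<longrightarrow> continuous_on {0..l} f')"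
  have "\<exists>f'. ?P f'" using assms by blast
  then have "?P (Dw l f)" unfolding Dw_def by (rule someI_ex)
  then show "weak_deriv l f (Dw l f)"
    "weak_deriv l f m \<Longrightarrow> continuous_on {0..l} m \<Longrightarrow> continuous_on {0..l} (Dw l f)" by blast+
qed

text \<open>Both are derivatives of the same primitive, so the integrals of their difference over
  all intervals {0..x} vanish.\<close>

lemma weak_deriv_AE_unique:
  assumes "weak_deriv l f k" "weak_deriv l f m" "continuous_on {0..l} f" "l > 0"
  shows "AE x in lebesgue_on {0<..<l}. k x = m x"
proof -
  have p: "prim l f k" "prim l f m" using assms by (auto intro: weak_deriv_prim)
  have "AE x in lebesgue_on {0<..<l}. k x - m x = 0"
  proof (rule zero_prim_AE)
    show "(\<lambda>x. k x - m x) absolutely_integrable_on {0..l}"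
      by (intro set_integral_diff prim_abs_int[OF p(1)] prim_abs_int[OF p(2)])
    fix x assume x: "x \<in> {0..l}"
    then have s: "{0..x} \<subseteq> {0..l}" by auto
    show "integral {0..x} (\<lambda>x. k x - m x) = 0"
      using prim_eq[OF p(1) x] prim_eq[OF p(2) x]
        integral_diff[OF abs_int_sub(1)[OF prim_abs_int[OF p(1)] s] abs_int_sub(1)[OF prim_abs_int[OF p(2)] s]]
      by simp
  qed
  then show ?thesis by simp
qed

text \<open>The choice in \<open>Dw\<close> takes a continuous representative when there is one. It
  and k are then both classical derivatives of f, one-sided at the ends, and so agree at every point
  of the closed interval.\<close>

lemma Dw_eq:
  assumes f: "continuous_on {0..l} f" and w: "weak_deriv l f k" and k: "continuous_on {0..l} k"
    and l: "l > 0" and x: "x \<in> {0..l}"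
  shows "Dw l f x = k x"
proof -
  note D = Dw_properties(1)[OF w] Dw_properties(2)[OF w w k]
  have "(f has_real_derivative k x) (at x within {0..l})"
    by (rule prim_derivative[OF weak_deriv_prim[OF w f l] k x])
  moreover have "(f has_real_derivative Dw l f x) (at x within {0..l})"
    by (rule prim_derivative[OF weak_deriv_prim[OF D(1) f l] D(2) x])
  moreover have "at x within {0..l} \<noteq> bot"
    using l x by (simp add: trivial_limit_within islimpt_Icc)
  ultimately show ?thesis
    using has_vector_derivative_unique_within by (metis has_real_derivative_iff_has_vector_derivative)
qed

lemma C1_weak_deriv:
  assumes "\<And>x. x \<in> {0..l} \<Longrightarrow> (f has_real_derivative f' x) (at x within {0..l})"
    and "continuous_on {0..l} f'" "l > 0"
  shows "weak_deriv l f f'"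
  using assms by (intro prim_weak_deriv prim_C1 L2_continuous) auto

lemma C1_continuous:
  fixes f :: "real \<Rightarrow> real"
  assumes "\<And>x. x \<in> A \<Longrightarrow> (f has_real_derivative f' x) (at x within A)"
  shows "continuous_on A f"
  using DERIV_continuous[OF assms] unfolding continuous_on_eq_continuous_within by blast

lemma Dw_C1:
  assumes "\<And>x. x \<in> {0..l} \<Longrightarrow> (f has_real_derivative f' x) (at x within {0..l})"
    and "continuous_on {0..l} f'" "l > 0" "x \<in> {0..l}"
  shows "Dw l f x = f' x"
  by (rule Dw_eq[OF C1_continuous[OF assms(1)] C1_weak_deriv[OF assms(1-3)] assms(2-4)])

section \<open>Calculus in the Sobolev spaces\<close>

lemma Hs_L2: "f \<in> Hs l n \<Longrightarrow> L2 l f"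
  by (cases n) (auto simp: weak_deriv_def)

lemma Hs_cong:
  assumes "f \<in> Hs l n" "\<And>x. x \<in> {0..l} \<Longrightarrow> f x = g x"
  shows "g \<in> Hs l n"
proof (cases n)
  case 0
  then show ?thesis using assms L2_cong[of l f g] by auto
next
  case (Suc m)
  then obtain f' where f': "continuous_on {0..l} f" "f' \<in> Hs l m" "weak_deriv l f f'"
    using assms(1) by auto
  have "AE x in lebesgue_on {0<..<l}. f x = g x"
    by (rule AE_Ioo_all) (simp add: assms(2))
  then have "weak_deriv l g f'" using f'(3) weak_deriv_AE_cong by blast
  moreover have "continuous_on {0..l} g" using f'(1) assms(2) by (rule continuous_on_eq)
  ultimately show ?thesis using Suc f'(2) by auto
qed

lemma Hs_Suc_subset: "f \<in> Hs l (Suc n) \<Longrightarrow> f \<in> Hs l n"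
proof (induction n arbitrary: f)
  case 0
  then show ?case using Hs_L2[of f l "Suc 0"] by simp
next
  case (Suc n)
  from Suc.prems obtain f' where f': "continuous_on {0..l} f" "f' \<in> Hs l (Suc n)" "weak_deriv l f f'"
    unfolding Hs.simps(2)[of l "Suc n"] mem_Collect_eq by blast
  with Suc.IH[OF f'(2)] show ?case unfolding Hs.simps(2)[of l n] mem_Collect_eq by blast
qed

lemma Hs_continuous: "f \<in> Hs l (Suc n) \<Longrightarrow> continuous_on {0..l} f"
  by simp

text \<open>For n > 0 the witness in the definition of \<open>Hs\<close> is continuous and coincides
  with \<open>Dw\<close> on {0..l}; for n = 0 square integrability of \<open>Dw\<close> is all that
  is claimed.\<close>

lemma Hs_Dw:
  assumes "f \<in> Hs l (Suc n)" "l > 0"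
  shows "Dw l f \<in> Hs l n" "weak_deriv l f (Dw l f)"
proof -
  from assms obtain f' where f': "continuous_on {0..l} f" "f' \<in> Hs l n" "weak_deriv l f f'" by auto
  show w: "weak_deriv l f (Dw l f)" using f'(3) by (rule Dw_properties)
  show "Dw l f \<in> Hs l n"
  proof (cases n)
    case 0
    then show ?thesis using w by (simp add: weak_deriv_def)
  next
    case (Suc m)
    then have "continuous_on {0..l} f'" using f'(2) by simp
    then have "f' x = Dw l f x" if "x \<in> {0..l}" for x
      using Dw_eq[OF f'(1,3) _ assms(2) that] by simp
    then show ?thesis using Hs_cong[OF f'(2)] by blast
  qed
qed

lemma Hs_prim: "f \<in> Hs l (Suc n) \<Longrightarrow> l > 0 \<Longrightarrow> prim l f (Dw l f)"
  by (rule weak_deriv_prim[OF Hs_Dw(2) Hs_continuous])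

lemma Hs_derivative:
  "f \<in> Hs l (Suc (Suc n)) \<Longrightarrow> l > 0 \<Longrightarrow> x \<in> {0..l} \<Longrightarrow>
    (f has_real_derivative Dw l f x) (at x within {0..l})"
  by (rule prim_derivative[OF Hs_prim Hs_continuous[OF Hs_Dw(1)]])

lemma HsI:
  assumes p: "prim l f k" and k: "k \<in> Hs l n" and l: "l > 0"
  shows "f \<in> Hs l (Suc n)"
proof -
  have "weak_deriv l f k" by (rule prim_weak_deriv[OF p Hs_L2[OF k] less_imp_le[OF l]])
  with k prim_continuous[OF p] show ?thesis unfolding Hs.simps mem_Collect_eq by blast
qed

lemma prim_lin:
  assumes f: "prim l f f'" and g: "prim l g g'"
  shows "prim l (\<lambda>x. a * f x + b * g x) (\<lambda>x. a * f' x + b * g' x)"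
proof (rule primI)
  have ai: "(\<lambda>x. a * f' x) absolutely_integrable_on {0..l}" "(\<lambda>x. b * g' x) absolutely_integrable_on {0..l}"
    using prim_abs_int[OF f] prim_abs_int[OF g] by (intro set_integrable_mult_right; simp)+
  then show "(\<lambda>x. a * f' x + b * g' x) absolutely_integrable_on {0..l}" by (rule set_integral_add)
  fix x assume x: "x \<in> {0..l}"
  then have s: "{0..x} \<subseteq> {0..l}" by auto
  show "a * f x + b * g x = a * f 0 + b * g 0 + integral {0..x} (\<lambda>x. a * f' x + b * g' x)"
    using prim_eq[OF f x] prim_eq[OF g x]
      integral_add[OF abs_int_sub(1)[OF ai(1) s] abs_int_sub(1)[OF ai(2) s]]
    by (simp add: algebra_simps)
qed

lemma L2_lin: "L2 l f \<Longrightarrow> L2 l g \<Longrightarrow> L2 l (\<lambda>x. a * f x + b * g x)"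
  using L2_add[OF L2_mult_continuous[of l f "\<lambda>x. a"] L2_mult_continuous[of l g "\<lambda>x. b"]]
  by (simp add: mult.commute)

lemma Hs_lin:
  assumes l: "l > 0"
  shows "f \<in> Hs l n \<Longrightarrow> g \<in> Hs l n \<Longrightarrow> (\<lambda>x. a * f x + b * g x) \<in> Hs l n"
proof (induction n arbitrary: f g)
  case 0
  then show ?case by (simp add: L2_lin)
next
  case (Suc n)
  show ?case
    by (rule HsI[OF prim_lin[OF Hs_prim[OF Suc.prems(1) l] Hs_prim[OF Suc.prems(2) l]]
          Suc.IH[OF Hs_Dw(1)[OF Suc.prems(1) l] Hs_Dw(1)[OF Suc.prems(2) l]] l])
qed

text \<open>Two orders of regularity make the derivatives classical. With one order the chosen
  representatives would satisfy the identity only almost everywhere.\<close>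

lemma Dw_lin:
  assumes "f \<in> Hs l (Suc (Suc n))" "g \<in> Hs l (Suc (Suc n))" and l: "l > 0" and x: "x \<in> {0..l}"
  shows "Dw l (\<lambda>x. a * f x + b * g x) x = a * Dw l f x + b * Dw l g x"
proof (rule Dw_C1[OF _ _ l x])
  show "((\<lambda>x. a * f x + b * g x) has_real_derivative a * Dw l f x + b * Dw l g x) (at x within {0..l})"
    if "x \<in> {0..l}" for x
    by (intro DERIV_add DERIV_cmult Hs_derivative[OF assms(1) l that] Hs_derivative[OF assms(2) l that])
  show "continuous_on {0..l} (\<lambda>x. a * Dw l f x + b * Dw l g x)"
    by (intro continuous_intros Hs_continuous[OF Hs_Dw(1)[OF assms(1) l]] Hs_continuous[OF Hs_Dw(1)[OF assms(2) l]])
qed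

lemma Hnorm_0: "(Hnorm l 0 f)\<^sup>2 = (LINT x|lebesgue_on {0<..<l}. (f x)\<^sup>2)"
  by (simp add: Hnorm_def)

lemma Hnorm_Suc: "(Hnorm l (Suc n) f)\<^sup>2 = (LINT x|lebesgue_on {0<..<l}. (f x)\<^sup>2) + (Hnorm l n (Dw l f))\<^sup>2"
proof -
  have nn: "0 \<le> (\<Sum>k\<le>n. LINT x|lebesgue_on {0<..<l}. ((Dw l ^^ k) f x)\<^sup>2)" for n f
    by (intro sum_nonneg) simp
  show ?thesis unfolding Hnorm_def
    unfolding real_sqrt_pow2[OF nn] sum.atMost_Suc_shift funpow_Suc_right o_apply
    by (simp add: add_nonneg_nonneg sum_nonneg)
qed

lemma Hnorm_nonneg: "0 \<le> Hnorm l n f"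
  by (simp add: Hnorm_def sum_nonneg)

lemma Hnorm_AE_cong:
  assumes "AE x in lebesgue_on {0<..<l}. f x = g x"
  shows "Hnorm l n f = Hnorm l n g"
proof -
  have "(LINT x|lebesgue_on {0<..<l}. (f x)\<^sup>2) = (LINT x|lebesgue_on {0<..<l}. (g x)\<^sup>2)"
  proof (rule AE_LINT)
    show "AE x in lebesgue_on {0<..<l}. (f x)\<^sup>2 = (g x)\<^sup>2" using assms by eventually_elim simp
  qed
  then have "(Hnorm l n f)\<^sup>2 = (Hnorm l n g)\<^sup>2"
    by (cases n) (simp_all add: Hnorm_0 Hnorm_Suc Dw_AE_cong[OF assms])
  then show ?thesis by (simp add: Hnorm_nonneg power2_eq_iff_nonneg)
qed

lemma Hnorm_Suc_ge: "Hnorm l n (Dw l f) \<le> Hnorm l (Suc n) f"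
proof (rule power2_le_imp_le[OF _ Hnorm_nonneg])
  show "(Hnorm l n (Dw l f))\<^sup>2 \<le> (Hnorm l (Suc n) f)\<^sup>2" by (simp add: Hnorm_Suc)
qed

text \<open>Sobolev embedding. The increment of f^2 is an integral of 2 f f', so f(x)^2 - f(y)^2 is
  at most the integral of f^2 + f'^2, which is bounded by the squared norm N. Integrating over y
  gives l f(x)^2 <= (1 + l) N, hence the constant.\<close>

lemma Hnorm_sup:
  assumes f: "f \<in> Hs l (Suc n)" and l: "l > 0" and x: "x \<in> {0..l}"
  shows "\<bar>f x\<bar> \<le> sqrt (1 / l + 1) * Hnorm l (Suc n) f"
proof -
  define N where "N = (Hnorm l (Suc n) f)\<^sup>2"
  define F where "F = integral {0..l} (\<lambda>x. (f x)\<^sup>2)"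
  define G where "G = integral {0..l} (\<lambda>x. (Dw l f x)\<^sup>2)"
  note p = Hs_prim[OF f l]
  note fc = Hs_continuous[OF f]
  have s1: "(\<lambda>x. (f x)\<^sup>2) absolutely_integrable_on {0..l}" and s2: "(\<lambda>x. (Dw l f x)\<^sup>2) absolutely_integrable_on {0..l}"
    using L2_sq[OF Hs_L2[OF f]] L2_sq[OF Hs_L2[OF Hs_Dw(1)[OF f l]]] by auto
  have "G \<le> (Hnorm l n (Dw l f))\<^sup>2"
  proof (cases n)
    case 0
    then show ?thesis by (simp add: Hnorm_0 G_def LINT_eq_Icc[OF s2])
  next
    case (Suc m)
    then show ?thesis by (simp add: Hnorm_Suc G_def LINT_eq_Icc[OF s2])
  qed
  then have NG: "F + G \<le> N" by (simp add: N_def Hnorm_Suc F_def LINT_eq_Icc[OF s1])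
  note pp = prim_mult[OF p p]
  note ppai = prim_abs_int[OF pp]
  have diff: "(f x)\<^sup>2 - (f y)\<^sup>2 \<le> F + G" if "x \<in> {0..l}" "y \<in> {0..l}" for x y
  proof -
    have *: "\<bar>f v * f v - f u * f u\<bar> \<le> F + G" if "0 \<le> u" "u \<le> v" "v \<le> l" for u v
    proof -
      have sub: "{u..v} \<subseteq> {0..l}" using that by auto
      have i: "(\<lambda>x. (f x)\<^sup>2 + (Dw l f x)\<^sup>2) integrable_on {u..v}" if "{u..v} \<subseteq> {0..l}" for u v
        by (intro integrable_add abs_int_sub(1)[OF s1 that] abs_int_sub(1)[OF s2 that])
      have "norm (f v * f v - f u * f u) \<le> integral {u..v} (\<lambda>x. (f x)\<^sup>2 + (Dw l f x)\<^sup>2)"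
        unfolding prim_increment[OF pp that]
      proof (rule Henstock_Kurzweil_Integration.integral_norm_bound_integral)
        show "(\<lambda>x. Dw l f x * f x + Dw l f x * f x) integrable_on {u..v}" by (rule abs_int_sub(1)[OF ppai sub])
        show "(\<lambda>x. (f x)\<^sup>2 + (Dw l f x)\<^sup>2) integrable_on {u..v}" by (rule i[OF sub])
        fix x
        have "0 \<le> (\<bar>f x\<bar> - \<bar>Dw l f x\<bar>)\<^sup>2" by simp
        then have "2 * (\<bar>f x\<bar> * \<bar>Dw l f x\<bar>) \<le> (f x)\<^sup>2 + (Dw l f x)\<^sup>2" by (simp add: power2_diff)
        then show "norm (Dw l f x * f x + Dw l f x * f x) \<le> (f x)\<^sup>2 + (Dw l f x)\<^sup>2"
          by (simp add: abs_mult[symmetric] mult.commute flip: mult_2)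
      qed
      also have "\<dots> \<le> integral {0..l} (\<lambda>x. (f x)\<^sup>2 + (Dw l f x)\<^sup>2)"
        by (intro integral_subset_le sub i) auto
      also have "\<dots> = F + G"
        unfolding F_def G_def by (intro integral_add abs_int_sub(1)[OF s1] abs_int_sub(1)[OF s2] order_refl)
      finally show ?thesis by simp
    qed
    show ?thesis using *[of x y] *[of y x] that by (cases "x \<le> y") (auto simp: power2_eq_square)
  qed
  have "integral {0..l} (\<lambda>y. (f x)\<^sup>2) \<le> integral {0..l} (\<lambda>y. (f y)\<^sup>2 + N)"
  proof (rule integral_le)
    show "(\<lambda>y. (f x)\<^sup>2) integrable_on {0..l}" by (rule integrable_const_ivl)
    show "(\<lambda>y. (f y)\<^sup>2 + N) integrable_on {0..l}"
      by (intro integrable_add abs_int_sub(1)[OF s1 order_refl] integrable_const_ivl)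
    show "(f x)\<^sup>2 \<le> (f y)\<^sup>2 + N" if "y \<in> {0..l}" for y
      using diff[OF x that] NG by simp
  qed
  also have "integral {0..l} (\<lambda>y. (f y)\<^sup>2 + N) = F + l * N"
    unfolding F_def using l
    by (subst integral_add) (auto intro: abs_int_sub(1)[OF s1 order_refl])
  finally have "l * (f x)\<^sup>2 \<le> F + l * N" using l by simp
  moreover have "G \<ge> 0" unfolding G_def
    by (intro Henstock_Kurzweil_Integration.integral_nonneg abs_int_sub(1)[OF s2 order_refl]) simp
  ultimately have "l * (f x)\<^sup>2 \<le> N + l * N" using NG by linarith
  then have "(f x)\<^sup>2 \<le> (1 / l + 1) * N" using l by (simp add: field_simps)
  then have "sqrt ((f x)\<^sup>2) \<le> sqrt ((1 / l + 1) * N)" by (rule real_sqrt_le_mono)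
  then show ?thesis by (simp add: real_sqrt_mult N_def Hnorm_nonneg)
qed

section \<open>Linear boundary value problems\<close>

text \<open>Both elliptic problems of the system take this form: for the Dirichlet problem
  \<open>y1 = u\<close>, \<open>y2 = h\<^sub>b u'\<close>; for the problem defining \<open>R\<^sub>b\<^sup>1\<close>, \<open>y2 = u\<close> and \<open>y1\<close> is the flux
  \<open>\<surd>3 (h\<^sub>b/\<alpha>\<^sub>b) (h\<^sub>bS)\<^sup>*u\<close>. In both cases \<open>\<rho> y1 y2\<close> is increasing along homogeneous
  solutions, which gives uniqueness.\<close>

locale bvp =
  fixes l :: real and m11 m12 m21 m22 \<rho> :: "real \<Rightarrow> real"
  assumes l: "l > 0"
    and cont: "continuous_on {0..l} m11" "continuous_on {0..l} m12"
      "continuous_on {0..l} m21" "continuous_on {0..l} m22"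
    and pos: "\<And>x. x \<in> {0..l} \<Longrightarrow> 0 < m12 x" "\<And>x. x \<in> {0..l} \<Longrightarrow> 0 < m21 x"
      "\<And>x. x \<in> {0..l} \<Longrightarrow> 0 < \<rho> x"
    and \<rho>_deriv: "\<And>x. x \<in> {0..l} \<Longrightarrow>
      (\<rho> has_real_derivative - (m11 x + m22 x) * \<rho> x) (at x within {0..l})"
begin

definition sol :: "(real \<Rightarrow> real) \<Rightarrow> (real \<Rightarrow> real) \<Rightarrow> (real \<Rightarrow> real) \<Rightarrow> (real \<Rightarrow> real) \<Rightarrow> bool" where
  "sol d1 d2 y1 y2 \<longleftrightarrow> (\<forall>x\<in>{0..l}.
     (y1 has_real_derivative m11 x * y1 x + m12 x * y2 x + d1 x) (at x within {0..l}) \<and>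
     (y2 has_real_derivative m21 x * y1 x + m22 x * y2 x + d2 x) (at x within {0..l}))"

lemma solD:
  assumes "sol d1 d2 y1 y2" "x \<in> {0..l}"
  shows "(y1 has_real_derivative m11 x * y1 x + m12 x * y2 x + d1 x) (at x within {0..l})"
    "(y2 has_real_derivative m21 x * y1 x + m22 x * y2 x + d2 x) (at x within {0..l})"
  using assms unfolding sol_def by blast+

lemma sol_continuous:
  assumes "sol d1 d2 y1 y2"
  shows "continuous_on {0..l} y1" "continuous_on {0..l} y2"
  by (rule C1_continuous, rule solD[OF assms], assumption)+

lemma sol_lin:
  assumes y: "sol d1 d2 y1 y2" and z: "sol e1 e2 z1 z2"
  shows "sol (\<lambda>x. a * d1 x + c * e1 x) (\<lambda>x. a * d2 x + c * e2 x)
    (\<lambda>x. a * y1 x + c * z1 x) (\<lambda>x. a * y2 x + c * z2 x)"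
  unfolding sol_def
proof (intro ballI conjI)
  fix x assume x: "x \<in> {0..l}"
  have "a * (m11 x * y1 x + m12 x * y2 x + d1 x) + c * (m11 x * z1 x + m12 x * z2 x + e1 x)
      = m11 x * (a * y1 x + c * z1 x) + m12 x * (a * y2 x + c * z2 x) + (a * d1 x + c * e1 x)"
    "a * (m21 x * y1 x + m22 x * y2 x + d2 x) + c * (m21 x * z1 x + m22 x * z2 x + e2 x)
      = m21 x * (a * y1 x + c * z1 x) + m22 x * (a * y2 x + c * z2 x) + (a * d2 x + c * e2 x)"
    by (simp_all add: algebra_simps)
  with DERIV_add[OF DERIV_cmult[OF solD(1)[OF y x]] DERIV_cmult[OF solD(1)[OF z x]], of a c]
    DERIV_add[OF DERIV_cmult[OF solD(2)[OF y x]] DERIV_cmult[OF solD(2)[OF z x]], of a c]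
  show "((\<lambda>x. a * y1 x + c * z1 x) has_real_derivative
      m11 x * (a * y1 x + c * z1 x) + m12 x * (a * y2 x + c * z2 x) + (a * d1 x + c * e1 x)) (at x within {0..l})"
    "((\<lambda>x. a * y2 x + c * z2 x) has_real_derivative
      m21 x * (a * y1 x + c * z1 x) + m22 x * (a * y2 x + c * z2 x) + (a * d2 x + c * e2 x)) (at x within {0..l})"
    by (simp_all only:)
qed

lemma sol_cong:
  assumes "sol d1 d2 y1 y2" "\<And>x. x \<in> {0..l} \<Longrightarrow> d1 x = e1 x" "\<And>x. x \<in> {0..l} \<Longrightarrow> d2 x = e2 x"
  shows "sol e1 e2 y1 y2"
  using assms unfolding sol_def by simp

text \<open>The derivative of \<open>\<rho> y1 y2\<close> is
  \<open>\<rho> (m12 y2^2 + m21 y1^2)\<close>, which is continuous and nonnegative with vanishing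
  integral, so both squares vanish pointwise. Stating the boundary condition for the products allows
  either component to vanish at either end.\<close>

lemma homogeneous_zero:
  assumes y: "sol (\<lambda>x. 0) (\<lambda>x. 0) y1 y2" and b: "y1 0 * y2 0 = 0" "y1 l * y2 l = 0"
    and x: "x \<in> {0..l}"
  shows "y1 x = 0" "y2 x = 0"
proof -
  define P' where "P' x = \<rho> x * (m12 x * (y2 x * y2 x) + m21 x * (y1 x * y1 x))" for x
  have \<rho>c: "continuous_on {0..l} \<rho>" by (rule C1_continuous[OF \<rho>_deriv])
  have P: "((\<lambda>x. \<rho> x * (y1 x * y2 x)) has_real_derivative P' x) (at x within {0..l})" if "x \<in> {0..l}" for x
    using DERIV_mult[OF \<rho>_deriv[OF that] DERIV_mult[OF solD[OF y that]]]
    by (simp add: P'_def algebra_simps)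
  have P'c: "continuous_on {0..l} P'"
    unfolding P'_def by (intro continuous_intros \<rho>c cont sol_continuous[OF y])
  have nn: "0 \<le> P' x" if "x \<in> {0..l}" for x
    unfolding P'_def using pos[OF that] by (simp add: less_imp_le)
  have "integral {0..l} P' = 0"
    using prim_eq[OF prim_C1[OF P P'c], of l] l b by simp
  then have "P' x = 0" using integral_eq_0_iff[OF P'c l nn] x by blast
  then have z: "m12 x * (y2 x * y2 x) + m21 x * (y1 x * y1 x) = 0"
    using pos(3)[OF x] by (simp add: P'_def)
  have "0 \<le> m12 x * (y2 x * y2 x)" "0 \<le> m21 x * (y1 x * y1 x)"
    using pos[OF x] by (auto intro: mult_nonneg_nonneg)
  then have "m12 x * (y2 x * y2 x) = 0" "m21 x * (y1 x * y1 x) = 0" using z by linarith+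
  then show "y1 x = 0" "y2 x = 0" using pos[OF x] by auto
qed

lemma sol_unique:
  assumes y: "sol d1 d2 y1 y2" and z: "sol e1 e2 z1 z2"
    and d: "\<And>x. x \<in> {0..l} \<Longrightarrow> d1 x = e1 x" "\<And>x. x \<in> {0..l} \<Longrightarrow> d2 x = e2 x"
    and b: "y1 0 = z1 0" "y1 l = z1 l" and x: "x \<in> {0..l}"
  shows "y1 x = z1 x" "y2 x = z2 x"
proof -
  have "sol (\<lambda>x. 0) (\<lambda>x. 0) (\<lambda>x. 1 * y1 x + (-1) * z1 x) (\<lambda>x. 1 * y2 x + (-1) * z2 x)"
    by (rule sol_cong[OF sol_lin[OF y z, of 1 "-1"]]) (simp_all add: d)
  from homogeneous_zero[OF this _ _ x] show "y1 x = z1 x" "y2 x = z2 x"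
    by (simp_all add: b)
qed

lemma initial_value_problem:
  obtains y1 y2 where "sol (\<lambda>x. 0) (\<lambda>x. 0) y1 y2" "y1 0 = c1" "y2 0 = c2"
proof -
  define G where "G x u = (m11 x * fst u + m12 x * snd u, m21 x * fst u + m22 x * snd u)" for x and u :: "real \<times> real"
  have "\<exists>M. \<forall>x\<in>{0..l}. \<bar>m x\<bar> \<le> M" if "continuous_on {0..l} m" for m :: "real \<Rightarrow> real"
  proof -
    have "compact (m ` {0..l})" using that by (intro compact_continuous_image) auto
    then obtain M where "\<forall>y\<in>m ` {0..l}. norm y \<le> M"
      using compact_imp_bounded bounded_iff by blast
    then show ?thesis by auto
  qed
  from this[OF cont(1)] this[OF cont(2)] this[OF cont(3)] this[OF cont(4)]
  obtain M1 M2 M3 M4 where M: "\<And>x. x \<in> {0..l} \<Longrightarrow> \<bar>m11 x\<bar> \<le> M1" "\<And>x. x \<in> {0..l} \<Longrightarrow> \<bar>m12 x\<bar> \<le> M2"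
    "\<And>x. x \<in> {0..l} \<Longrightarrow> \<bar>m21 x\<bar> \<le> M3" "\<And>x. x \<in> {0..l} \<Longrightarrow> \<bar>m22 x\<bar> \<le> M4" by blast
  have lip: "norm (G x u - G x v) \<le> (M1 + M2 + M3 + M4) * norm (u - v)" if x: "x \<in> {0..l}" for x u v
  proof -
    have n: "norm (a, c) \<le> \<bar>a\<bar> + \<bar>c\<bar>" for a c :: real
      by (simp add: norm_Pair sqrt_sum_squares_le_sum_abs)
    have f: "\<bar>fst u - fst v\<bar> \<le> norm (u - v)" "\<bar>snd u - snd v\<bar> \<le> norm (u - v)"
    proof -
      have uv: "u - v = (fst u - fst v, snd u - snd v)" by (simp add: prod_eq_iff)
      show "\<bar>fst u - fst v\<bar> \<le> norm (u - v)" "\<bar>snd u - snd v\<bar> \<le> norm (u - v)"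
        unfolding uv using norm_fst_le[of "fst u - fst v" "snd u - snd v"]
          norm_snd_le[of "snd u - snd v" "fst u - fst v"] by simp_all
    qed
    have e: "\<bar>m * a\<bar> \<le> M * norm (u - v)" if "\<bar>m\<bar> \<le> M" "\<bar>a\<bar> \<le> norm (u - v)" for m a M :: real
      using mult_mono[OF that] that(1) by (simp add: abs_mult)
    have "G x u - G x v = (m11 x * (fst u - fst v) + m12 x * (snd u - snd v),
        m21 x * (fst u - fst v) + m22 x * (snd u - snd v))"
      by (simp add: G_def algebra_simps)
    then have "norm (G x u - G x v) \<le> \<bar>m11 x * (fst u - fst v) + m12 x * (snd u - snd v)\<bar>
        + \<bar>m21 x * (fst u - fst v) + m22 x * (snd u - snd v)\<bar>"
      using n by simp
    also have "\<dots> \<le> (M1 * norm (u - v) + M2 * norm (u - v)) + (M3 * norm (u - v) + M4 * norm (u - v))"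
      using e[OF M(1)[OF x] f(1)] e[OF M(2)[OF x] f(2)] e[OF M(3)[OF x] f(1)] e[OF M(4)[OF x] f(2)]
      by linarith
    finally show ?thesis by (simp add: algebra_simps)
  qed
  have contG: "continuous_on {0..l} (\<lambda>x. G x (u x))" if "continuous_on {0..l} u" for u
    unfolding G_def using that by (intro continuous_intros cont)
  obtain u where u: "u 0 = (c1, c2)"
    "\<And>x. x \<in> {0..l} \<Longrightarrow> (u has_vector_derivative G x (u x)) (at x within {0..l})"
    using ode_global[of l G "M1 + M2 + M3 + M4" "(c1, c2)", OF less_imp_le[OF l] contG lip] by blast
  have "sol (\<lambda>x. 0) (\<lambda>x. 0) (\<lambda>x. fst (u x)) (\<lambda>x. snd (u x))"
    unfolding sol_def
  proof (intro ballI conjI)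
    fix x assume x: "x \<in> {0..l}"
    from bounded_linear.has_vector_derivative[OF bounded_linear_fst u(2)[OF x]]
      bounded_linear.has_vector_derivative[OF bounded_linear_snd u(2)[OF x]]
    show "((\<lambda>x. fst (u x)) has_real_derivative m11 x * fst (u x) + m12 x * snd (u x) + 0) (at x within {0..l})"
      "((\<lambda>x. snd (u x)) has_real_derivative m21 x * fst (u x) + m22 x * snd (u x) + 0) (at x within {0..l})"
      by (simp_all add: G_def has_real_derivative_iff_has_vector_derivative)
  qed
  then show thesis using that u(1) by simp
qed

definition left_sol where
  "left_sol = (SOME y. sol (\<lambda>x. 0) (\<lambda>x. 0) (fst y) (snd y) \<and> fst y 0 = 1 \<and> fst y l = 0)"
definition right_sol where
  "right_sol = (SOME y. sol (\<lambda>x. 0) (\<lambda>x. 0) (fst y) (snd y) \<and> fst y 0 = 0 \<and> fst y l = 1)"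

text \<open>Shooting from 0. The solution with data (0, 1) has a nonzero first component at l, since
  otherwise \<open>homogeneous_zero\<close> would force its second component to vanish at 0. Scaling
  it, and correcting the solution with data (1, 0) by a multiple of it, gives both.\<close>

lemma boundary_sols:
  shows left_sol: "sol (\<lambda>x. 0) (\<lambda>x. 0) (fst left_sol) (snd left_sol)" "fst left_sol 0 = 1" "fst left_sol l = 0"
    and right_sol: "sol (\<lambda>x. 0) (\<lambda>x. 0) (fst right_sol) (snd right_sol)" "fst right_sol 0 = 0" "fst right_sol l = 1"
proof -
  obtain y1 y2 where y: "sol (\<lambda>x. 0) (\<lambda>x. 0) y1 y2" "y1 0 = 0" "y2 0 = 1"
    by (rule initial_value_problem)
  obtain z1 z2 where z: "sol (\<lambda>x. 0) (\<lambda>x. 0) z1 z2" "z1 0 = 1" "z2 0 = 0"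
    by (rule initial_value_problem)
  have nz: "y1 l \<noteq> 0"
    using homogeneous_zero(2)[OF y(1), of 0] y l by auto
  have "sol (\<lambda>x. 0) (\<lambda>x. 0) (\<lambda>x. 1 / y1 l * y1 x + 0 * z1 x) (\<lambda>x. 1 / y1 l * y2 x + 0 * z2 x)"
    by (rule sol_cong[OF sol_lin[OF y(1) z(1)]]) simp_all
  then have "\<exists>y. sol (\<lambda>x. 0) (\<lambda>x. 0) (fst y) (snd y) \<and> fst y 0 = 0 \<and> fst y l = 1"
    using y(2) nz by (intro exI[of _ "(\<lambda>x. 1 / y1 l * y1 x + 0 * z1 x, \<lambda>x. 1 / y1 l * y2 x + 0 * z2 x)"]) simp
  from someI_ex[OF this, folded right_sol_def]
  show "sol (\<lambda>x. 0) (\<lambda>x. 0) (fst right_sol) (snd right_sol)" "fst right_sol 0 = 0" "fst right_sol l = 1"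
    by blast+
  have "sol (\<lambda>x. 0) (\<lambda>x. 0) (\<lambda>x. - (z1 l / y1 l) * y1 x + 1 * z1 x) (\<lambda>x. - (z1 l / y1 l) * y2 x + 1 * z2 x)"
    by (rule sol_cong[OF sol_lin[OF y(1) z(1)]]) simp_all
  then have "\<exists>y. sol (\<lambda>x. 0) (\<lambda>x. 0) (fst y) (snd y) \<and> fst y 0 = 1 \<and> fst y l = 0"
    using y(2) z(2) nz
    by (intro exI[of _ "(\<lambda>x. - (z1 l / y1 l) * y1 x + 1 * z1 x, \<lambda>x. - (z1 l / y1 l) * y2 x + 1 * z2 x)"]) simp
  from someI_ex[OF this, folded left_sol_def]
  show "sol (\<lambda>x. 0) (\<lambda>x. 0) (fst left_sol) (snd left_sol)" "fst left_sol 0 = 1" "fst left_sol l = 0"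
    by blast+
qed

abbreviation "p1 \<equiv> fst left_sol"
abbreviation "p2 \<equiv> snd left_sol"
abbreviation "r1 \<equiv> fst right_sol"
abbreviation "r2 \<equiv> snd right_sol"

definition wr :: "real \<Rightarrow> real" where
  "wr x = p1 x * r2 x - p2 x * r1 x"

text \<open>\<open>wr\<close> is the Wronskian, and \<open>\<rho> wr\<close> is constant by
  Liouville's formula, as \<open>\<rho>'/\<rho>\<close> is minus the trace. At 0 the Wronskian is r2
  0. If this were 0, subtracting y1 l times r from the solution y with data (0, 1) would give a
  first component vanishing at both ends, against y2 0 = 1.\<close>

lemma wr_nonzero:
  assumes x: "x \<in> {0..l}"
  shows "wr x \<noteq> 0"
proof -
  have d: "((\<lambda>x. \<rho> x * wr x) has_real_derivative 0) (at x within {0..l})" if "x \<in> {0..l}" for x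
    unfolding wr_def
    using DERIV_mult[OF \<rho>_deriv[OF that] DERIV_diff[OF
          DERIV_mult[OF solD(1)[OF left_sol(1) that] solD(2)[OF right_sol(1) that]]
          DERIV_mult[OF solD(2)[OF left_sol(1) that] solD(1)[OF right_sol(1) that]]]]
    by (simp add: algebra_simps)
  have "prim l (\<lambda>x. \<rho> x * wr x) (\<lambda>x. 0)" by (rule prim_C1[OF d continuous_on_const])
  from prim_eq[OF this x] have *: "\<rho> x * wr x = \<rho> 0 * wr 0" by simp
  have "wr 0 \<noteq> 0"
  proof
    assume "wr 0 = 0"
    then have "r2 0 = 0" by (simp add: wr_def left_sol right_sol)
    obtain y1 y2 where y: "sol (\<lambda>x. 0) (\<lambda>x. 0) y1 y2" "y1 0 = 0" "y2 0 = 1"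
      by (rule initial_value_problem)
    have "sol (\<lambda>x. 0) (\<lambda>x. 0) (\<lambda>x. 1 * y1 x + (- y1 l) * r1 x) (\<lambda>x. 1 * y2 x + (- y1 l) * r2 x)"
      by (rule sol_cong[OF sol_lin[OF y(1) right_sol(1)]]) simp_all
    from homogeneous_zero(2)[OF this, of 0] show False
      using y \<open>r2 0 = 0\<close> l by (simp add: right_sol)
  qed
  then show ?thesis using * pos(3)[of 0] l by auto
qed

text \<open>Cramer's rule for the derivatives of the two coefficients in the variation of
  constants.\<close>

definition coef1 :: "(real \<Rightarrow> real) \<Rightarrow> (real \<Rightarrow> real) \<Rightarrow> real \<Rightarrow> real" where
  "coef1 d1 d2 x = (d1 x * r2 x - d2 x * r1 x) / wr x"
definition coef2 :: "(real \<Rightarrow> real) \<Rightarrow> (real \<Rightarrow> real) \<Rightarrow> real \<Rightarrow> real" where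
  "coef2 d1 d2 x = (p1 x * d2 x - p2 x * d1 x) / wr x"

text \<open>Variation of constants; \<open>c\<close>, \<open>d\<close> are the boundary values of the first component.\<close>

definition dir1 :: "(real \<Rightarrow> real) \<Rightarrow> (real \<Rightarrow> real) \<Rightarrow> real \<Rightarrow> real \<Rightarrow> real \<Rightarrow> real" where
  "dir1 d1 d2 c d x = p1 x * (c + integral {0..x} (coef1 d1 d2))
     + r1 x * (d - integral {0..l} (coef2 d1 d2) + integral {0..x} (coef2 d1 d2))"
definition dir2 :: "(real \<Rightarrow> real) \<Rightarrow> (real \<Rightarrow> real) \<Rightarrow> real \<Rightarrow> real \<Rightarrow> real \<Rightarrow> real" where
  "dir2 d1 d2 c d x = p2 x * (c + integral {0..x} (coef1 d1 d2))
     + r2 x * (d - integral {0..l} (coef2 d1 d2) + integral {0..x} (coef2 d1 d2))"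

lemma coef_continuous:
  assumes "continuous_on {0..l} d1" "continuous_on {0..l} d2"
  shows "continuous_on {0..l} (coef1 d1 d2)" "continuous_on {0..l} (coef2 d1 d2)"
proof -
  have "continuous_on {0..l} wr"
    unfolding wr_def by (intro continuous_intros sol_continuous[OF left_sol(1)] sol_continuous[OF right_sol(1)])
  then show "continuous_on {0..l} (coef1 d1 d2)" "continuous_on {0..l} (coef2 d1 d2)"
    unfolding coef1_def coef2_def using wr_nonzero
    by (intro continuous_intros sol_continuous[OF left_sol(1)] sol_continuous[OF right_sol(1)] assms; blast)+
qed

lemma dir_sol:
  assumes d: "continuous_on {0..l} d1" "continuous_on {0..l} d2"
  shows "sol d1 d2 (dir1 d1 d2 c d) (dir2 d1 d2 c d)"
  unfolding sol_def
proof (intro ballI conjI)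
  fix x assume x: "x \<in> {0..l}"
  define A where "A x = c + integral {0..x} (coef1 d1 d2)" for x
  define B where "B x = d - integral {0..l} (coef2 d1 d2) + integral {0..x} (coef2 d1 d2)" for x
  have I: "((\<lambda>x. e + integral {0..x} f) has_real_derivative f x) (at x within {0..l})"
    if "continuous_on {0..l} f" for f e
    using DERIV_add[OF DERIV_const[of e] integral_has_real_derivative[OF that x]] by simp
  have A: "(A has_real_derivative coef1 d1 d2 x) (at x within {0..l})"
    and B: "(B has_real_derivative coef2 d1 d2 x) (at x within {0..l})"
    unfolding A_def[abs_def] B_def[abs_def] by (rule I[OF coef_continuous(1)[OF d]], rule I[OF coef_continuous(2)[OF d]])
  have w: "wr x \<noteq> 0" by (rule wr_nonzero[OF x])
  have e1: "p1 x * coef1 d1 d2 x + r1 x * coef2 d1 d2 x = d1 x"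
  proof -
    have "p1 x * coef1 d1 d2 x + r1 x * coef2 d1 d2 x
        = (p1 x * (d1 x * r2 x - d2 x * r1 x) + r1 x * (p1 x * d2 x - p2 x * d1 x)) / wr x"
      by (simp add: coef1_def coef2_def add_divide_distrib)
    also have "p1 x * (d1 x * r2 x - d2 x * r1 x) + r1 x * (p1 x * d2 x - p2 x * d1 x) = d1 x * wr x"
      by (simp add: wr_def algebra_simps)
    finally show ?thesis using w by simp
  qed
  have e2: "p2 x * coef1 d1 d2 x + r2 x * coef2 d1 d2 x = d2 x"
  proof -
    have "p2 x * coef1 d1 d2 x + r2 x * coef2 d1 d2 x
        = (p2 x * (d1 x * r2 x - d2 x * r1 x) + r2 x * (p1 x * d2 x - p2 x * d1 x)) / wr x"
      by (simp add: coef1_def coef2_def add_divide_distrib)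
    also have "p2 x * (d1 x * r2 x - d2 x * r1 x) + r2 x * (p1 x * d2 x - p2 x * d1 x) = d2 x * wr x"
      by (simp add: wr_def algebra_simps)
    finally show ?thesis using w by simp
  qed
  have D: "dir1 d1 d2 c d = (\<lambda>x. p1 x * A x + r1 x * B x)" "dir2 d1 d2 c d = (\<lambda>x. p2 x * A x + r2 x * B x)"
    by (auto simp: dir1_def dir2_def A_def B_def)
  have "((\<lambda>x. p1 x * A x + r1 x * B x) has_real_derivative
      ((m11 x * p1 x + m12 x * p2 x + 0) * A x + coef1 d1 d2 x * p1 x) +
      ((m11 x * r1 x + m12 x * r2 x + 0) * B x + coef2 d1 d2 x * r1 x)) (at x within {0..l})"
    by (intro DERIV_add DERIV_mult A B solD(1)[OF left_sol(1) x] solD(1)[OF right_sol(1) x])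
  also have "((m11 x * p1 x + m12 x * p2 x + 0) * A x + coef1 d1 d2 x * p1 x) +
      ((m11 x * r1 x + m12 x * r2 x + 0) * B x + coef2 d1 d2 x * r1 x)
      = m11 x * (p1 x * A x + r1 x * B x) + m12 x * (p2 x * A x + r2 x * B x) + (p1 x * coef1 d1 d2 x + r1 x * coef2 d1 d2 x)"
    by (simp add: algebra_simps)
  finally show "(dir1 d1 d2 c d has_real_derivative
      m11 x * dir1 d1 d2 c d x + m12 x * dir2 d1 d2 c d x + d1 x) (at x within {0..l})"
    unfolding D e1 .
  have "((\<lambda>x. p2 x * A x + r2 x * B x) has_real_derivative
      ((m21 x * p1 x + m22 x * p2 x + 0) * A x + coef1 d1 d2 x * p2 x) +
      ((m21 x * r1 x + m22 x * r2 x + 0) * B x + coef2 d1 d2 x * r2 x)) (at x within {0..l})"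
    by (intro DERIV_add DERIV_mult A B solD(2)[OF left_sol(1) x] solD(2)[OF right_sol(1) x])
  also have "((m21 x * p1 x + m22 x * p2 x + 0) * A x + coef1 d1 d2 x * p2 x) +
      ((m21 x * r1 x + m22 x * r2 x + 0) * B x + coef2 d1 d2 x * r2 x)
      = m21 x * (p1 x * A x + r1 x * B x) + m22 x * (p2 x * A x + r2 x * B x) + (p2 x * coef1 d1 d2 x + r2 x * coef2 d1 d2 x)"
    by (simp add: algebra_simps)
  finally show "(dir2 d1 d2 c d has_real_derivative
      m21 x * dir1 d1 d2 c d x + m22 x * dir2 d1 d2 c d x + d2 x) (at x within {0..l})"
    unfolding D e2 .
qed

lemma dir_boundary: "dir1 d1 d2 c d 0 = c" "dir1 d1 d2 c d l = d"
  by (simp_all add: dir1_def left_sol right_sol)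

lemma dir_unique:
  assumes "continuous_on {0..l} d1" "continuous_on {0..l} d2" "sol e1 e2 y1 y2"
    "\<And>x. x \<in> {0..l} \<Longrightarrow> e1 x = d1 x" "\<And>x. x \<in> {0..l} \<Longrightarrow> e2 x = d2 x"
    "y1 0 = c" "y1 l = d" "x \<in> {0..l}"
  shows "y1 x = dir1 d1 d2 c d x" "y2 x = dir2 d1 d2 c d x"
  using sol_unique[OF assms(3) dir_sol[OF assms(1,2)] assms(4,5) _ _ assms(8)] assms(6,7)
  by (simp_all add: dir_boundary)

lemma dir_lin:
  assumes d: "continuous_on {0..l} d1" "continuous_on {0..l} d2"
    and e: "continuous_on {0..l} e1" "continuous_on {0..l} e2"
    and f: "continuous_on {0..l} f1" "continuous_on {0..l} f2"
      "\<And>x. x \<in> {0..l} \<Longrightarrow> f1 x = a * d1 x + b * e1 x" "\<And>x. x \<in> {0..l} \<Longrightarrow> f2 x = a * d2 x + b * e2 x"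
    and x: "x \<in> {0..l}"
  shows "dir1 f1 f2 0 0 x = a * dir1 d1 d2 0 0 x + b * dir1 e1 e2 0 0 x"
    "dir2 f1 f2 0 0 x = a * dir2 d1 d2 0 0 x + b * dir2 e1 e2 0 0 x"
  using dir_unique[OF f(1,2) sol_lin[OF dir_sol[OF d, of 0 0] dir_sol[OF e, of 0 0], of a b] _ _ _ _ x, of 0 0]
  by (simp_all add: f dir_boundary)

text \<open>The constant depends on the coefficients of the system only. It gives the boundedness of
  the solution operators for existence and their Lipschitz estimates for uniqueness.\<close>

lemma dir_bound:
  obtains C where "0 \<le> C" and "\<And>d1 d2 M x. continuous_on {0..l} d1 \<Longrightarrow> continuous_on {0..l} d2 \<Longrightarrow>
      (\<And>x. x \<in> {0..l} \<Longrightarrow> \<bar>d1 x\<bar> \<le> M) \<Longrightarrow> (\<And>x. x \<in> {0..l} \<Longrightarrow> \<bar>d2 x\<bar> \<le> M) \<Longrightarrow> x \<in> {0..l} \<Longrightarrow>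
      \<bar>dir1 d1 d2 0 0 x\<bar> \<le> C * M \<and> \<bar>dir2 d1 d2 0 0 x\<bar> \<le> C * M"
proof -
  have bdd: "\<exists>K\<ge>0. \<forall>x\<in>{0..l}. \<bar>m x\<bar> \<le> K" if "continuous_on {0..l} m" for m :: "real \<Rightarrow> real"
  proof -
    have "compact (m ` {0..l})" using that by (intro compact_continuous_image) auto
    then obtain K where K: "\<forall>y\<in>m ` {0..l}. norm y \<le> K"
      using compact_imp_bounded bounded_iff by blast
    then have "\<forall>x\<in>{0..l}. \<bar>m x\<bar> \<le> max 0 K" by (auto simp: le_max_iff_disj)
    then show ?thesis by (intro exI[of _ "max 0 K"]) simp
  qed
  have wc: "continuous_on {0..l} (\<lambda>x. 1 / wr x)"
    unfolding wr_def using wr_nonzero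
    by (intro continuous_intros sol_continuous[OF left_sol(1)] sol_continuous[OF right_sol(1)]) (simp add: wr_def)
  obtain K1 where K1: "K1 \<ge> 0" "\<forall>x\<in>{0..l}. \<bar>p1 x\<bar> \<le> K1" using bdd[OF sol_continuous(1)[OF left_sol(1)]] by blast
  obtain K2 where K2: "K2 \<ge> 0" "\<forall>x\<in>{0..l}. \<bar>p2 x\<bar> \<le> K2" using bdd[OF sol_continuous(2)[OF left_sol(1)]] by blast
  obtain K3 where K3: "K3 \<ge> 0" "\<forall>x\<in>{0..l}. \<bar>r1 x\<bar> \<le> K3" using bdd[OF sol_continuous(1)[OF right_sol(1)]] by blast
  obtain K4 where K4: "K4 \<ge> 0" "\<forall>x\<in>{0..l}. \<bar>r2 x\<bar> \<le> K4" using bdd[OF sol_continuous(2)[OF right_sol(1)]] by blast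
  obtain K5 where K5: "K5 \<ge> 0" "\<forall>x\<in>{0..l}. \<bar>1 / wr x\<bar> \<le> K5" using bdd[OF wc] by blast
  define K where "K = K1 + K2 + K3 + K4"
  have K: "K \<ge> 0" using K1 K2 K3 K4 by (simp add: K_def)
  have Kb: "\<bar>p1 x\<bar> \<le> K" "\<bar>p2 x\<bar> \<le> K" "\<bar>r1 x\<bar> \<le> K" "\<bar>r2 x\<bar> \<le> K" if "x \<in> {0..l}" for x
    using bspec[OF K1(2) that] bspec[OF K2(2) that] bspec[OF K3(2) that] bspec[OF K4(2) that] K1(1) K2(1) K3(1) K4(1)
    unfolding K_def by linarith+
  have pr: "\<bar>u * v\<bar> \<le> U * V" if "\<bar>u\<bar> \<le> U" "\<bar>v\<bar> \<le> V" for u v U V :: real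
    using mult_mono[OF that] that(1) by (simp add: abs_mult)
  \<comment> \<open>The factor 2 * K * K5 bounds the integrands per unit of data and l accounts for
    the integration. Four products with K remain to be estimated, so 6 is generous.\<close>
  define C where "C = 6 * K * (l * (2 * K * K5))"
  show thesis
  proof (rule that)
    show "0 \<le> C" using K K5(1) l by (simp add: C_def)
    fix d1 d2 :: "real \<Rightarrow> real" and M x :: real
    assume d: "continuous_on {0..l} d1" "continuous_on {0..l} d2"
      and M: "\<And>x. x \<in> {0..l} \<Longrightarrow> \<bar>d1 x\<bar> \<le> M" "\<And>x. x \<in> {0..l} \<Longrightarrow> \<bar>d2 x\<bar> \<le> M" and x: "x \<in> {0..l}"
    have M0: "M \<ge> 0" using M(1)[OF x] by linarith
    have cb: "\<bar>coef1 d1 d2 s\<bar> \<le> 2 * K * K5 * M" "\<bar>coef2 d1 d2 s\<bar> \<le> 2 * K * K5 * M" if s: "s \<in> {0..l}" for s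
    proof -
      have "\<bar>d1 s * r2 s - d2 s * r1 s\<bar> \<le> M * K + M * K" "\<bar>p1 s * d2 s - p2 s * d1 s\<bar> \<le> K * M + K * M"
        using pr[OF M(1)[OF s] Kb(4)[OF s]] pr[OF M(2)[OF s] Kb(3)[OF s]]
          pr[OF Kb(1)[OF s] M(2)[OF s]] pr[OF Kb(2)[OF s] M(1)[OF s]] by linarith+
      from pr[OF this(1) bspec[OF K5(2) s]] pr[OF this(2) bspec[OF K5(2) s]]
      show "\<bar>coef1 d1 d2 s\<bar> \<le> 2 * K * K5 * M" "\<bar>coef2 d1 d2 s\<bar> \<le> 2 * K * K5 * M"
      proof -
        assume a: "\<bar>(d1 s * r2 s - d2 s * r1 s) * (1 / wr s)\<bar> \<le> (M * K + M * K) * K5"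
          "\<bar>(p1 s * d2 s - p2 s * d1 s) * (1 / wr s)\<bar> \<le> (K * M + K * M) * K5"
        have "(M * K + M * K) * K5 = 2 * K * K5 * M" "(K * M + K * M) * K5 = 2 * K * K5 * M"
          by (simp_all add: algebra_simps)
        with a show "\<bar>coef1 d1 d2 s\<bar> \<le> 2 * K * K5 * M" "\<bar>coef2 d1 d2 s\<bar> \<le> 2 * K * K5 * M"
          by (simp_all add: coef1_def coef2_def ac_simps)
      qed
    qed
    define Q where "Q = l * (2 * K * K5 * M)"
    have ib: "\<bar>integral {0..s} f\<bar> \<le> Q"
      if f: "continuous_on {0..l} f" "\<And>s. s \<in> {0..l} \<Longrightarrow> \<bar>f s\<bar> \<le> 2 * K * K5 * M" and s: "s \<in> {0..l}" for f s
    proof -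
      have "norm (integral {0..s} f) \<le> integral {0..s} (\<lambda>x. 2 * K * K5 * M)"
        using f s by (intro Henstock_Kurzweil_Integration.integral_norm_bound_integral integrable_continuous_real)
          (auto intro: continuous_on_subset)
      also have "\<dots> = s * (2 * K * K5 * M)" using s by simp
      also have "\<dots> \<le> Q" unfolding Q_def using s K K5(1) M0 by (intro mult_right_mono) auto
      finally show ?thesis by simp
    qed
    have "\<bar>integral {0..x} (coef1 d1 d2)\<bar> \<le> Q" "\<bar>integral {0..x} (coef2 d1 d2)\<bar> \<le> Q" "\<bar>integral {0..l} (coef2 d1 d2)\<bar> \<le> Q"
      using l x by (intro ib coef_continuous[OF d] cb; simp)+
    then have ab: "\<bar>0 + integral {0..x} (coef1 d1 d2)\<bar> \<le> 2 * Q"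
      "\<bar>0 - integral {0..l} (coef2 d1 d2) + integral {0..x} (coef2 d1 d2)\<bar> \<le> 2 * Q" by linarith+
    have "\<bar>dir1 d1 d2 0 0 x\<bar> \<le> K * (2 * Q) + K * (2 * Q)" "\<bar>dir2 d1 d2 0 0 x\<bar> \<le> K * (2 * Q) + K * (2 * Q)"
      unfolding dir1_def dir2_def
      using pr[OF Kb(1)[OF x] ab(1)] pr[OF Kb(3)[OF x] ab(2)] pr[OF Kb(2)[OF x] ab(1)] pr[OF Kb(4)[OF x] ab(2)]
      by linarith+
    moreover have "K * (2 * Q) + K * (2 * Q) \<le> C * M"
    proof -
      have "0 \<le> K * Q" unfolding Q_def using K K5(1) M0 l by simp
      moreover have "C * M = 6 * (K * Q)" by (simp add: C_def Q_def)
      ultimately show ?thesis by simp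
    qed
    ultimately show "\<bar>dir1 d1 d2 0 0 x\<bar> \<le> C * M \<and> \<bar>dir2 d1 d2 0 0 x\<bar> \<le> C * M" by linarith
  qed
qed

end

lemma weak_deriv_AE_cong_right:
  assumes ae: "AE x in lebesgue_on {0<..<l}. k x = m x" and w: "weak_deriv l f k"
  shows "weak_deriv l f m"
proof -
  have "(LINT x|lebesgue_on {0<..<l}. k x * \<phi> x) = (LINT x|lebesgue_on {0<..<l}. m x * \<phi> x)" for \<phi>
  proof (rule AE_LINT)
    show "AE x in lebesgue_on {0<..<l}. k x * \<phi> x = m x * \<phi> x" using ae by eventually_elim simp
  qed
  then show ?thesis using w AE_L2[OF ae] by (simp add: weak_deriv_def)
qed

lemma Hs_C1:
  assumes "\<And>x. x \<in> {0..l} \<Longrightarrow> (f has_real_derivative f' x) (at x within {0..l})"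
    and "continuous_on {0..l} f'" "l > 0"
  shows "f \<in> Hs l (Suc 0)"
proof (rule HsI[OF prim_C1[OF assms(1,2)] _ assms(3)])
  show "f' \<in> Hs l 0" using L2_continuous[OF assms(2)] by simp
qed

lemma Hs_1_mult:
  assumes f: "f \<in> Hs l (Suc 0)" and g: "g \<in> Hs l (Suc 0)" and l: "l > 0"
  shows "(\<lambda>x. f x * g x) \<in> Hs l (Suc 0)"
proof (rule HsI[OF prim_mult[OF Hs_prim[OF f l] Hs_prim[OF g l]] _ l])
  show "(\<lambda>x. Dw l f x * g x + Dw l g x * f x) \<in> Hs l 0"
    using L2_add[OF L2_mult_continuous[OF Hs_L2[OF Hs_Dw(1)[OF f l]] Hs_continuous[OF g]]
        L2_mult_continuous[OF Hs_L2[OF Hs_Dw(1)[OF g l]] Hs_continuous[OF f]]] by simp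
qed

text \<open>This turns equations that hold almost everywhere into ordinary differential equations: a
  weak derivative that is almost everywhere equal to a continuous function is a classical
  one.\<close>

lemma Hs_classical:
  assumes f: "f \<in> Hs l (Suc 0)" and l: "l > 0" and m: "continuous_on {0..l} m"
    and ae: "AE x in lebesgue_on {0<..<l}. Dw l f x = m x" and x: "x \<in> {0..l}"
  shows "(f has_real_derivative m x) (at x within {0..l})"
  by (rule prim_derivative[OF weak_deriv_prim[OF weak_deriv_AE_cong_right[OF ae Hs_Dw(2)[OF f l]]
          Hs_continuous[OF f] l] m x])

section \<open>The elliptic problems of the Boussinesq--Abbott system\<close>

locale bottom =
  fixes l h0 :: real and b :: "real \<Rightarrow> real"
  assumes l: "l > 0" and b_smooth: "smooth_on {0..l} b"
    and hb_pos: "\<And>x. x \<in> {0..l} \<Longrightarrow> hb h0 b x > 0"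
    and coercive: "\<And>x. x \<in> {0..l} \<Longrightarrow>
      1 + 1/4 * (Dcl {0..l} b x)\<^sup>2 + 1/6 * hb h0 b x * Dcl {0..l} (Dcl {0..l} b) x > 0"
begin

abbreviation "H \<equiv> hb h0 b"
abbreviation "\<alpha> \<equiv> alphab l b"
abbreviation "B1 \<equiv> Dcl {0..l} b"
abbreviation "B2 \<equiv> Dcl {0..l} (Dcl {0..l} b)"

lemma nontrivial: "x \<in> {0..l} \<Longrightarrow> at x within {0..l} \<noteq> bot"
  using l by (simp add: trivial_limit_within islimpt_Icc)

lemma Dcl_eq:
  assumes "(f has_real_derivative f') (at x within {0..l})" "x \<in> {0..l}"
  shows "Dcl {0..l} f x = f'"
  unfolding Dcl_def
  using assms nontrivial by (intro vector_derivative_within) (auto simp: has_real_derivative_iff_has_vector_derivative)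

lemma b_Ck: "Ck_on k {0..l} b"
  using b_smooth Ck_on_smooth[OF nontrivial] by blast

lemma Dcl_Ck:
  assumes "\<And>k. Ck_on k {0..l} f"
  shows "Ck_on k {0..l} (Dcl {0..l} f)"
    "\<And>x. x \<in> {0..l} \<Longrightarrow> (f has_real_derivative Dcl {0..l} f x) (at x within {0..l})"
proof -
  obtain u' where u': "\<forall>t\<in>{0..l}. (f has_vector_derivative u' t) (at t within {0..l})" "Ck_on k {0..l} u'"
    using assms[of "Suc k"] by (rule Ck_on_SucE)
  then have *: "Dcl {0..l} f x = u' x" if "x \<in> {0..l}" for x
    using that by (intro Dcl_eq) (auto simp: has_real_derivative_iff_has_vector_derivative)
  show "Ck_on k {0..l} (Dcl {0..l} f)" by (rule Ck_on_cong[OF u'(2) *])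
  show "(f has_real_derivative Dcl {0..l} f x) (at x within {0..l})" if "x \<in> {0..l}" for x
    using u'(1) that unfolding *[OF that] by (simp add: has_real_derivative_iff_has_vector_derivative)
qed

lemmas B1_Ck = Dcl_Ck(1)[OF b_Ck]
lemmas B2_Ck = Dcl_Ck(1)[OF B1_Ck]

lemma H_Ck: "Ck_on k {0..l} H"
  unfolding hb_def[abs_def] by (rule Ck_on_diff[OF Ck_on_const b_Ck])

lemma \<alpha>_Ck: "Ck_on k {0..l} \<alpha>"
  unfolding alphab_def[abs_def]
  by (rule Ck_on_add[OF Ck_on_const Ck_on_mult[OF Ck_on_const Ck_on_power[OF B1_Ck]]])

lemmas conts = Ck_on_continuous[OF B1_Ck] Ck_on_continuous[OF B2_Ck] Ck_on_continuous[OF H_Ck]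
  Ck_on_continuous[OF \<alpha>_Ck]

lemma B1_deriv: "x \<in> {0..l} \<Longrightarrow> (B1 has_real_derivative B2 x) (at x within {0..l})"
  by (rule Dcl_Ck(2)[OF B1_Ck])

lemma H_deriv: "x \<in> {0..l} \<Longrightarrow> (H has_real_derivative - B1 x) (at x within {0..l})"
  unfolding hb_def[abs_def] using DERIV_diff[OF DERIV_const[of h0] Dcl_Ck(2)[OF b_Ck]] by simp

lemma H_nz: "x \<in> {0..l} \<Longrightarrow> H x \<noteq> 0"
  using hb_pos by fastforce

lemma \<alpha>_pos: "\<alpha> x > 0"
proof -
  have "0 \<le> (B1 x)\<^sup>2" by simp
  then show ?thesis unfolding alphab_def by linarith
qed

text \<open>The coefficient of u in (1 + hb Tb) u = c0 u - 1/3 hb (hb u')', obtained by expanding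
  the operator; the first-order terms cancel because hb' = - b'. It is bounded below by the
  coercivity expression, as 1/3 exceeds 1/4.\<close>

definition c0 :: "real \<Rightarrow> real" where
  "c0 x = 1 + 1/3 * (B1 x)\<^sup>2 + 1/6 * H x * B2 x"

lemma c0_pos: "x \<in> {0..l} \<Longrightarrow> c0 x > 0"
proof -
  assume "x \<in> {0..l}"
  from coercive[OF this] show ?thesis
    unfolding c0_def using zero_le_power2[of "B1 x"] by linarith
qed

sublocale D: bvp l "\<lambda>x. 0" "\<lambda>x. 1 / H x" "\<lambda>x. 3 * c0 x / H x" "\<lambda>x. 0" "\<lambda>x. 1"
proof
  show "continuous_on {0..l} (\<lambda>x. 1 / H x)" "continuous_on {0..l} (\<lambda>x. 3 * c0 x / H x)"
    unfolding c0_def using H_nz by (intro continuous_intros conts; blast)+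
  show "0 < 1 / H x" "0 < 3 * c0 x / H x" if "x \<in> {0..l}" for x
    using hb_pos[OF that] c0_pos[OF that] by simp_all
qed (use l in \<open>auto intro!: derivative_eq_intros\<close>)

text \<open>The weight is H because the trace of the coefficient matrix is B1 / H and H' = -
  B1.\<close>

sublocale F: bvp l "\<lambda>x. B1 x / (2 * H x)" "\<lambda>x. 3" "\<lambda>x. \<alpha> x / (H x)\<^sup>2" "\<lambda>x. B1 x / (2 * H x)" H
proof
  show "continuous_on {0..l} (\<lambda>x. B1 x / (2 * H x))"
    "continuous_on {0..l} (\<lambda>x. \<alpha> x / (H x)\<^sup>2)"
    using H_nz by (intro continuous_intros conts; simp)+
  show "0 < \<alpha> x / (H x)\<^sup>2" "0 < H x" if "x \<in> {0..l}" for x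
    using hb_pos[OF that] \<alpha>_pos[of x] by simp_all
  show "(H has_real_derivative - (B1 x / (2 * H x) + B1 x / (2 * H x)) * H x) (at x within {0..l})"
    if "x \<in> {0..l}" for x
    using H_deriv[OF that] H_nz[OF that] by (simp add: field_simps)
qed (use l in auto)

lemma quotient_deriv:
  assumes u: "(u has_real_derivative u') (at x within {0..l})" and x: "x \<in> {0..l}"
  shows "((\<lambda>z. u z / H z) has_real_derivative (u' * H x + u x * B1 x) / (H x)\<^sup>2) (at x within {0..l})"
  using DERIV_divide[OF u H_deriv[OF x] H_nz[OF x]] by (simp add: power2_eq_square)

text \<open>For a C^1 function the inner expression H^3 (u / H)' is classical and equals H^2 u' + H
  B1 u; only the outer derivative remains weak.\<close>

lemma Tb_C2:
  assumes u: "\<And>x. x \<in> {0..l} \<Longrightarrow> (u has_real_derivative u' x) (at x within {0..l})"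
    and u': "continuous_on {0..l} u'" and x: "x \<in> {0..l}"
  shows "Tb l h0 b u x = - 1 / (3 * H x) * Dw l (\<lambda>y. (H y)\<^sup>2 * u' y + H y * B1 y * u y) x + 1/2 * B2 x * u x"
proof -
  have "Dw l (\<lambda>y. H y ^ 3 * Dw l (\<lambda>z. u z / H z) y) = Dw l (\<lambda>y. (H y)\<^sup>2 * u' y + H y * B1 y * u y)"
  proof (rule Dw_cong)
    fix y assume "y \<in> {0<..<l}"
    then have y: "y \<in> {0..l}" by simp
    have c: "continuous_on {0..l} (\<lambda>x. (u' x * H x + u x * B1 x) / (H x)\<^sup>2)"
      using H_nz by (intro continuous_intros u' conts C1_continuous[OF u]) auto
    have "Dw l (\<lambda>z. u z / H z) y = (u' y * H y + u y * B1 y) / (H y)\<^sup>2"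
      by (rule Dw_C1[OF quotient_deriv[OF u] c l y])
    then show "H y ^ 3 * Dw l (\<lambda>z. u z / H z) y = (H y)\<^sup>2 * u' y + H y * B1 y * u y"
      using H_nz[OF y] by (simp add: field_simps power2_eq_square power3_eq_cube)
  qed
  then show ?thesis by (simp add: Tb_def)
qed

definition dirichlet_cond where
  "dirichlet_cond f c d u \<longleftrightarrow> u \<in> Hs l 2 \<and>
     (AE x in lebesgue_on {0<..<l}. u x + H x * Tb l h0 b u x = f x) \<and> u 0 = c \<and> u l = d"

lemma dirichlet_data_continuous:
  "continuous_on {0..l} f \<Longrightarrow> continuous_on {0..l} (\<lambda>x. - 3 * f x / H x)"
  using H_nz by (intro continuous_intros conts) auto

lemma dirichlet_exists:
  assumes f: "continuous_on {0..l} f"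
  shows "dirichlet_cond f c d (D.dir1 (\<lambda>x. 0) (\<lambda>x. - 3 * f x / H x) c d)"
proof -
  define U where "U = D.dir1 (\<lambda>x. 0) (\<lambda>x. - 3 * f x / H x) c d"
  define V where "V = D.dir2 (\<lambda>x. 0) (\<lambda>x. - 3 * f x / H x) c d"
  have s: "D.sol (\<lambda>x. 0) (\<lambda>x. - 3 * f x / H x) U V"
    unfolding U_def V_def by (rule D.dir_sol[OF continuous_on_const dirichlet_data_continuous[OF f]])
  have U: "(U has_real_derivative V x / H x) (at x within {0..l})" if "x \<in> {0..l}" for x
    using D.solD(1)[OF s that] by simp
  have V: "(V has_real_derivative 3 * c0 x / H x * U x - 3 * f x / H x) (at x within {0..l})" if "x \<in> {0..l}" for x
    using D.solD(2)[OF s that] by simp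
  note Uc = C1_continuous[OF U] and Vc = C1_continuous[OF V]
  have VHc: "continuous_on {0..l} (\<lambda>x. V x / H x)" using H_nz by (intro continuous_intros Vc conts) auto
  have c0c: "continuous_on {0..l} c0" unfolding c0_def[abs_def] by (intro continuous_intros conts)
  have V'c: "continuous_on {0..l} (\<lambda>x. 3 * c0 x / H x * U x - 3 * f x / H x)"
    using H_nz by (intro continuous_intros Uc conts f c0c) auto
  have qc: "continuous_on {0..l} (\<lambda>x. ((3 * c0 x / H x * U x - 3 * f x / H x) * H x + V x * B1 x) / (H x)\<^sup>2)"
    using H_nz by (intro continuous_intros Vc V'c conts) auto
  have U2: "U \<in> Hs l 2"
    unfolding numeral_2_eq_2
    by (rule HsI[OF prim_C1[OF U VHc] Hs_C1[OF quotient_deriv[OF V] qc l] l])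
  have "U x + H x * Tb l h0 b U x = f x" if "x \<in> {0<..<l}" for x
  proof -
    have x: "x \<in> {0..l}" using that by simp
    define K' where "K' x = - B1 x * V x + H x * (3 * c0 x / H x * U x - 3 * f x / H x)
      + (- B1 x * B1 x + H x * B2 x) * U x + H x * B1 x * (V x / H x)" for x
    have K: "((\<lambda>y. H y * V y + H y * B1 y * U y) has_real_derivative K' x) (at x within {0..l})" if "x \<in> {0..l}" for x
      using DERIV_add[OF DERIV_mult[OF H_deriv[OF that] V[OF that]]
        DERIV_mult[OF DERIV_mult[OF H_deriv[OF that] B1_deriv[OF that]] U[OF that]]]
      by (simp add: K'_def algebra_simps)
    have K'c: "continuous_on {0..l} K'"
      unfolding K'_def by (intro continuous_intros conts V'c VHc Uc Vc)
    have "Dw l (\<lambda>y. (H y)\<^sup>2 * (V y / H y) + H y * B1 y * U y) = Dw l (\<lambda>y. H y * V y + H y * B1 y * U y)"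
      by (rule Dw_cong) (simp add: H_nz power2_eq_square)
    then have "Dw l (\<lambda>y. (H y)\<^sup>2 * (V y / H y) + H y * B1 y * U y) x = K' x"
      using Dw_C1[OF K K'c l x] by simp
    then have "Tb l h0 b U x = - 1 / (3 * H x) * K' x + 1/2 * B2 x * U x"
      using Tb_C2[OF U VHc x] by simp
    moreover have "K' x = 3 * c0 x * U x - 3 * f x + (- B1 x * B1 x + H x * B2 x) * U x"
      using H_nz[OF x] by (simp add: K'_def field_simps)
    ultimately have "H x * Tb l h0 b U x = - 1/3 * (3 * c0 x * U x - 3 * f x + (- B1 x * B1 x + H x * B2 x) * U x)
        + 1/2 * H x * B2 x * U x"
      using H_nz[OF x] by (simp add: field_simps)
    then show ?thesis by (simp add: c0_def power2_eq_square algebra_simps)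
  qed
  then have "AE x in lebesgue_on {0<..<l}. U x + H x * Tb l h0 b U x = f x" by (rule AE_Ioo_all)
  then show ?thesis using U2 D.dir_boundary by (simp add: dirichlet_cond_def U_def)
qed

text \<open>A weak solution is a classical solution of the 2x2 system. The equation gives the inner
  flux a continuous weak derivative, so it is C^1; then H u' is the flux divided by H, minus B1 u,
  hence C^1 too, and its derivative is the second line of the system.\<close>

lemma dirichlet_unique:
  assumes f: "continuous_on {0..l} f" and u: "dirichlet_cond f c d u" and x: "x \<in> {0..l}"
  shows "u x = D.dir1 (\<lambda>x. 0) (\<lambda>x. - 3 * f x / H x) c d x"
    "H x * Dw l u x = D.dir2 (\<lambda>x. 0) (\<lambda>x. - 3 * f x / H x) c d x"
proof -
  have u2: "u \<in> Hs l (Suc (Suc 0))" and ae: "AE x in lebesgue_on {0<..<l}. u x + H x * Tb l h0 b u x = f x"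
    and bc: "u 0 = c" "u l = d"
    using u by (auto simp: dirichlet_cond_def numeral_2_eq_2)
  define u' where "u' = Dw l u"
  have u'1: "u' \<in> Hs l (Suc 0)" unfolding u'_def by (rule Hs_Dw(1)[OF u2 l])
  have ud: "(u has_real_derivative u' x) (at x within {0..l})" if "x \<in> {0..l}" for x
    unfolding u'_def by (rule Hs_derivative[OF u2 l that])
  have u1: "u \<in> Hs l (Suc 0)" by (rule Hs_Suc_subset[OF u2])
  note uc = Hs_continuous[OF u2] and u'c = Hs_continuous[OF u'1]
  have H1: "H \<in> Hs l (Suc 0)" by (rule Hs_C1[OF H_deriv _ l], assumption) (intro continuous_intros conts)
  have B11: "B1 \<in> Hs l (Suc 0)" by (rule Hs_C1[OF B1_deriv conts(2) l])
  \<comment> \<open>The inner flux H^3 (u / H)' of \<open>Tb\<close>; the function m below is the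
    value that the equation forces on its derivative.\<close>
  define K where "K y = (H y)\<^sup>2 * u' y + H y * B1 y * u y" for y
  have K1: "K \<in> Hs l (Suc 0)"
    using Hs_lin[OF l Hs_1_mult[OF Hs_1_mult[OF H1 H1 l] u'1 l] Hs_1_mult[OF Hs_1_mult[OF H1 B11 l] u1 l], of 1 1]
    by (simp add: K_def[abs_def] power2_eq_square)
  define m where "m x = 3 * (u x + 1/2 * H x * B2 x * u x - f x)" for x
  have mc: "continuous_on {0..l} m" unfolding m_def by (intro continuous_intros uc conts f)
  have ioo: "AE x in lebesgue_on {0<..<l}. x \<in> {0<..<l}" by (rule AE_Ioo_all)
  have "AE x in lebesgue_on {0<..<l}. Dw l K x = m x"
    using ae ioo
  proof eventually_elim
    case (elim x)
    then have x: "x \<in> {0..l}" by simp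
    have "Tb l h0 b u x = - 1 / (3 * H x) * Dw l K x + 1/2 * B2 x * u x"
      using Tb_C2[OF ud u'c x] by (simp add: K_def[abs_def])
    then have "H x * Tb l h0 b u x = - 1/3 * Dw l K x + 1/2 * H x * B2 x * u x"
      using H_nz[OF x] by (simp add: field_simps)
    then show ?case using elim(1) by (simp add: m_def)
  qed
  then have Kd: "(K has_real_derivative m x) (at x within {0..l})" if "x \<in> {0..l}" for x
    by (rule Hs_classical[OF K1 l mc _ that])
  have V: "((\<lambda>x. H x * u' x) has_real_derivative 3 * c0 x / H x * u x - 3 * f x / H x) (at x within {0..l})"
    if x: "x \<in> {0..l}" for x
  proof -
    have "((\<lambda>x. K x / H x - B1 x * u x) has_real_derivative
        (m x * H x + K x * B1 x) / (H x)\<^sup>2 - (B2 x * u x + u' x * B1 x)) (at x within {0..l})"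
      by (rule DERIV_diff[OF quotient_deriv[OF Kd[OF x] x] DERIV_mult[OF B1_deriv[OF x] ud[OF x]]])
    moreover have "(m x * H x + K x * B1 x) / (H x)\<^sup>2 - (B2 x * u x + u' x * B1 x) = 3 * c0 x / H x * u x - 3 * f x / H x"
      using H_nz[OF x] by (simp add: m_def K_def c0_def field_simps power2_eq_square power3_eq_cube)
    ultimately have "((\<lambda>x. K x / H x - B1 x * u x) has_real_derivative 3 * c0 x / H x * u x - 3 * f x / H x) (at x within {0..l})"
      by simp
    then show ?thesis
      by (rule has_field_derivative_transform_within[OF _ zero_less_one x])
        (simp add: K_def H_nz power2_eq_square field_simps)
  qed
  have "D.sol (\<lambda>x. 0) (\<lambda>x. - 3 * f x / H x) u (\<lambda>x. H x * u' x)"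
    unfolding D.sol_def using ud V H_nz by simp
  from D.dir_unique[OF continuous_on_const dirichlet_data_continuous[OF f] this refl refl bc x]
  show "u x = D.dir1 (\<lambda>x. 0) (\<lambda>x. - 3 * f x / H x) c d x"
    "H x * Dw l u x = D.dir2 (\<lambda>x. 0) (\<lambda>x. - 3 * f x / H x) c d x"
    by (simp_all add: u'_def)
qed

lemma dirichlet_sol_cond:
  assumes "continuous_on {0..l} f"
  shows "dirichlet_cond f c d (dirichlet_sol l h0 b f c d)"
proof -
  have "\<exists>u. dirichlet_cond f c d u" using dirichlet_exists[OF assms] by blast
  from someI_ex[OF this] show ?thesis unfolding dirichlet_sol_def dirichlet_cond_def .
qed

lemmas dirichlet_sol_eq = dirichlet_unique[OF _ dirichlet_sol_cond]

definition flux_cond where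
  "flux_cond f u \<longleftrightarrow> u \<in> Hs l 2 \<and>
     (AE x in lebesgue_on {0<..<l}.
        u x + 1 / H x * hbS l h0 b (\<lambda>y. H y / \<alpha> y * hbS_adj l h0 b u y) x = f x) \<and>
     hbS_adj l h0 b u 0 = 0 \<and> hbS_adj l h0 b u l = 0"

text \<open>The factor sqrt 3 is the one with which the adjoint enters the flux of the evolution
  equation; it clears all roots.\<close>

lemma hbS_adj_C1:
  assumes u: "\<And>x. x \<in> {0..l} \<Longrightarrow> (u has_real_derivative u' x) (at x within {0..l})"
    and u': "continuous_on {0..l} u'" and x: "x \<in> {0..l}"
  shows "sqrt 3 * hbS_adj l h0 b u x = H x * u' x - 1/2 * B1 x * u x"
proof -
  have d: "((\<lambda>y. (H y)\<^sup>2 * u y) has_real_derivative - 2 * H x * B1 x * u x + (H x)\<^sup>2 * u' x) (at x within {0..l})"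
    if "x \<in> {0..l}" for x
    using DERIV_mult[OF DERIV_mult[OF H_deriv[OF that] H_deriv[OF that]] u[OF that]]
    by (simp add: power2_eq_square algebra_simps)
  have c: "continuous_on {0..l} (\<lambda>x. - 2 * H x * B1 x * u x + (H x)\<^sup>2 * u' x)"
    by (intro continuous_intros conts u' C1_continuous[OF u])
  have Dweq: "Dw l (\<lambda>y. (H y)\<^sup>2 * u y) x = - 2 * H x * B1 x * u x + (H x)\<^sup>2 * u' x"
    by (rule Dw_C1[OF d c l x])
  have alg: "s * (1 / s * (1 / h) * A + s / 2 * B * C) = 1 / h * A + s * s / 2 * B * C" if "s \<noteq> 0" for s h A B C :: real
    using that by (simp add: field_simps)
  have "sqrt 3 * hbS_adj l h0 b u x = 1 / H x * (- 2 * H x * B1 x * u x + (H x)\<^sup>2 * u' x)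
      + sqrt 3 * sqrt 3 / 2 * B1 x * u x"
    unfolding hbS_adj_def Dweq by (rule alg) simp
  also have "sqrt 3 * sqrt 3 = (3::real)" by simp
  also have "1 / H x * (- 2 * H x * B1 x * u x + (H x)\<^sup>2 * u' x) + 3 / 2 * B1 x * u x
      = H x * u' x - 1/2 * B1 x * u x"
    using H_nz[OF x] by (simp add: field_simps power2_eq_square)
  finally show ?thesis .
qed

lemma hbS_eq:
  assumes x: "x \<in> {0..l}"
  shows "1 / H x * hbS l h0 b Y x = - 1 / sqrt 3 * H x * Dw l (\<lambda>y. Y y / H y) x + sqrt 3 / 2 * (B1 x / H x) * Y x"
  using H_nz[OF x] by (simp add: hbS_def S_def)

lemma sqrt3: "sqrt 3 * sqrt 3 = (3::real)" "sqrt 3 \<noteq> 0" by simp_all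

text \<open>The second line of the system says that sqrt 3 times the adjoint of V is (\<alpha> / H)
  W. So W is the flux, its zero boundary values are the boundary conditions of R1, and the first
  line is the differential equation.\<close>

lemma flux_exists:
  assumes f: "continuous_on {0..l} f"
  shows "flux_cond f (F.dir2 (\<lambda>x. - 3 * f x) (\<lambda>x. 0) 0 0)"
proof -
  define W where "W = F.dir1 (\<lambda>x. - 3 * f x) (\<lambda>x. 0) 0 0"
  define V where "V = F.dir2 (\<lambda>x. - 3 * f x) (\<lambda>x. 0) 0 0"
  have fc: "continuous_on {0..l} (\<lambda>x. - 3 * f x)" by (intro continuous_intros f)
  have s: "F.sol (\<lambda>x. - 3 * f x) (\<lambda>x. 0) W V"
    unfolding W_def V_def by (rule F.dir_sol[OF fc continuous_on_const])
  define W' where "W' x = B1 x / (2 * H x) * W x + 3 * V x - 3 * f x" for x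
  define V' where "V' x = \<alpha> x / (H x)\<^sup>2 * W x + B1 x / (2 * H x) * V x" for x
  have W: "(W has_real_derivative W' x) (at x within {0..l})" if "x \<in> {0..l}" for x
    using F.solD(1)[OF s that] by (simp add: W'_def)
  have V: "(V has_real_derivative V' x) (at x within {0..l})" if "x \<in> {0..l}" for x
    using F.solD(2)[OF s that] by (simp add: V'_def)
  note Wc = C1_continuous[OF W] and Vc = C1_continuous[OF V]
  have W'c: "continuous_on {0..l} W'"
    unfolding W'_def using H_nz by (intro continuous_intros Wc Vc conts f) auto
  have V'c: "continuous_on {0..l} V'"
    unfolding V'_def using H_nz by (intro continuous_intros Wc Vc conts f) auto
  have W1: "W \<in> Hs l (Suc 0)" by (rule Hs_C1[OF W W'c l])
  have V1: "V \<in> Hs l (Suc 0)" by (rule Hs_C1[OF V V'c l])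
  have coef: "(\<lambda>x. \<alpha> x / (H x)\<^sup>2) \<in> Hs l (Suc 0)" "(\<lambda>x. B1 x / (2 * H x)) \<in> Hs l (Suc 0)"
  proof -
    have "Ck_on 1 {0..l} (\<lambda>x. \<alpha> x / (H x)\<^sup>2)"
      using H_nz by (intro Ck_on_divide[OF \<alpha>_Ck Ck_on_power[OF H_Ck]]) simp
    moreover have "Ck_on 1 {0..l} (\<lambda>x. B1 x / (2 * H x))"
      using H_nz by (intro Ck_on_divide[OF B1_Ck Ck_on_mult[OF Ck_on_const H_Ck]]) simp
    moreover have "u \<in> Hs l (Suc 0)" if u: "Ck_on 1 {0..l} u" for u
    proof -
      obtain u' where u': "\<forall>t\<in>{0..l}. (u has_vector_derivative u' t) (at t within {0..l})" "Ck_on 0 {0..l} u'"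
        using u unfolding One_nat_def by (rule Ck_on_SucE)
      then show ?thesis
        by (intro Hs_C1[where f' = u']) (auto simp: has_real_derivative_iff_has_vector_derivative l)
    qed
    ultimately show "(\<lambda>x. \<alpha> x / (H x)\<^sup>2) \<in> Hs l (Suc 0)" "(\<lambda>x. B1 x / (2 * H x)) \<in> Hs l (Suc 0)" by blast+
  qed
  have V'1: "V' \<in> Hs l (Suc 0)"
    using Hs_lin[OF l Hs_1_mult[OF coef(1) W1 l] Hs_1_mult[OF coef(2) V1 l], of 1 1]
    by (simp add: V'_def[abs_def])
  have V2: "V \<in> Hs l 2" unfolding numeral_2_eq_2 by (rule HsI[OF prim_C1[OF V V'c] V'1 l])
  define Y where "Y y = H y / \<alpha> y * hbS_adj l h0 b V y" for y
  have adj: "sqrt 3 * hbS_adj l h0 b V x = \<alpha> x / H x * W x" if x: "x \<in> {0..l}" for x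
  proof -
    have "sqrt 3 * hbS_adj l h0 b V x = H x * V' x - 1/2 * B1 x * V x"
      by (rule hbS_adj_C1[OF V V'c x])
    also have "\<dots> = \<alpha> x / H x * W x"
      unfolding V'_def using H_nz[OF x] by (simp add: field_simps power2_eq_square)
    finally show ?thesis .
  qed
  have YW: "sqrt 3 * Y x = W x" if x: "x \<in> {0..l}" for x
  proof -
    have "sqrt 3 * Y x = H x / \<alpha> x * (sqrt 3 * hbS_adj l h0 b V x)" by (simp add: Y_def)
    also have "\<dots> = W x" unfolding adj[OF x] using H_nz[OF x] \<alpha>_pos[of x] by simp
    finally show ?thesis .
  qed
  have "V x + 1 / H x * hbS l h0 b Y x = f x" if "x \<in> {0<..<l}" for x
  proof -
    have x: "x \<in> {0..l}" using that by simp
    have Y: "Y y = 1 / sqrt 3 * W y" if "y \<in> {0..l}" for y using YW[OF that] by (simp add: field_simps)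
    have "Dw l (\<lambda>y. Y y / H y) = Dw l (\<lambda>y. 1 / sqrt 3 * (W y / H y))"
      by (rule Dw_cong) (simp add: Y)
    moreover have "Dw l (\<lambda>y. 1 / sqrt 3 * (W y / H y)) x = 1 / sqrt 3 * ((W' x * H x + W x * B1 x) / (H x)\<^sup>2)"
    proof (rule Dw_C1[OF DERIV_cmult[OF quotient_deriv[OF W]] _ l x])
      show "continuous_on {0..l} (\<lambda>x. 1 / sqrt 3 * ((W' x * H x + W x * B1 x) / (H x)\<^sup>2))"
        using H_nz by (intro continuous_intros Wc W'c conts) auto
    qed
    ultimately have "1 / H x * hbS l h0 b Y x =
        - (1 / (sqrt 3 * sqrt 3)) * H x * ((W' x * H x + W x * B1 x) / (H x)\<^sup>2) + (sqrt 3 / sqrt 3) / 2 * (B1 x / H x) * W x"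
      unfolding hbS_eq[OF x] Y[OF x] by simp
    also have "\<dots> = f x - V x"
      unfolding sqrt3 W'_def using H_nz[OF x] by (simp add: field_simps power2_eq_square)
    finally show ?thesis by simp
  qed
  then have ae: "AE x in lebesgue_on {0<..<l}. V x + 1 / H x * hbS l h0 b Y x = f x" by (rule AE_Ioo_all)
  have "W 0 = 0" "W l = 0" unfolding W_def by (rule F.dir_boundary)+
  then have "hbS_adj l h0 b V 0 = 0" "hbS_adj l h0 b V l = 0"
    using adj[of 0] adj[of l] l by simp_all
  then show ?thesis
    unfolding flux_cond_def V_def[symmetric] using V2 ae unfolding Y_def[abs_def] by blast
qed

text \<open>The flux W of a weak solution is first known to lie in H^1 only. The equation determines
  the weak derivative of Y / H as a continuous function, so W is C^1 and (W, v) solves the system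
  with zero boundary values of W.\<close>

lemma flux_unique:
  assumes f: "continuous_on {0..l} f" and v: "flux_cond f v" and x: "x \<in> {0..l}"
  shows "v x = F.dir2 (\<lambda>x. - 3 * f x) (\<lambda>x. 0) 0 0 x"
    "sqrt 3 * (H x / \<alpha> x) * hbS_adj l h0 b v x = F.dir1 (\<lambda>x. - 3 * f x) (\<lambda>x. 0) 0 0 x"
proof -
  define Y where "Y y = H y / \<alpha> y * hbS_adj l h0 b v y" for y
  have v2: "v \<in> Hs l (Suc (Suc 0))" and ae: "AE x in lebesgue_on {0<..<l}. v x + 1 / H x * hbS l h0 b Y x = f x"
    and bc: "hbS_adj l h0 b v 0 = 0" "hbS_adj l h0 b v l = 0"
    using v unfolding flux_cond_def numeral_2_eq_2 Y_def[abs_def] by blast+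
  define v' where "v' = Dw l v"
  have v'1: "v' \<in> Hs l (Suc 0)" unfolding v'_def by (rule Hs_Dw(1)[OF v2 l])
  have vd: "(v has_real_derivative v' x) (at x within {0..l})" if "x \<in> {0..l}" for x
    unfolding v'_def by (rule Hs_derivative[OF v2 l that])
  have v1: "v \<in> Hs l (Suc 0)" by (rule Hs_Suc_subset[OF v2])
  note vc = Hs_continuous[OF v2] and v'c = Hs_continuous[OF v'1]
  define W where "W x = sqrt 3 * Y x" for x
  have W: "W x = H x / \<alpha> x * (H x * v' x - 1/2 * B1 x * v x)" if x: "x \<in> {0..l}" for x
  proof -
    have "W x = H x / \<alpha> x * (sqrt 3 * hbS_adj l h0 b v x)" by (simp add: W_def Y_def)
    then show ?thesis by (simp only: hbS_adj_C1[OF vd v'c x])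
  qed
  define K where "K x = Y x / H x" for x
  have K1: "K \<in> Hs l (Suc 0)"
  proof -
    have "Ck_on 1 {0..l} (\<lambda>x. 1 / (sqrt 3 * \<alpha> x))"
    proof (rule Ck_on_divide[OF Ck_on_const Ck_on_mult[OF Ck_on_const \<alpha>_Ck]])
      show "sqrt 3 * \<alpha> t \<noteq> 0" for t using \<alpha>_pos[of t] by simp
    qed
    then obtain a' where a': "\<forall>t\<in>{0..l}. ((\<lambda>x. 1 / (sqrt 3 * \<alpha> x)) has_vector_derivative a' t) (at t within {0..l})" "Ck_on 0 {0..l} a'"
      unfolding One_nat_def by (rule Ck_on_SucE)
    have a1: "(\<lambda>x. 1 / (sqrt 3 * \<alpha> x)) \<in> Hs l (Suc 0)"
      using a' by (intro Hs_C1[where f' = a']) (auto simp: has_real_derivative_iff_has_vector_derivative l)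
    have H1: "H \<in> Hs l (Suc 0)" by (rule Hs_C1[OF H_deriv _ l], assumption) (intro continuous_intros conts)
    have B11: "B1 \<in> Hs l (Suc 0)" by (rule Hs_C1[OF B1_deriv conts(2) l])
    have e1: "(\<lambda>x. 1 * (H x * v' x) + (- 1/2) * (B1 x * v x)) \<in> Hs l (Suc 0)"
      by (rule Hs_lin[OF l Hs_1_mult[OF H1 v'1 l] Hs_1_mult[OF B11 v1 l]])
    show ?thesis
    proof (rule Hs_cong[OF Hs_1_mult[OF a1 e1 l]])
      fix x assume x: "x \<in> {0..l}"
      have "H x * (sqrt 3 * K x) = H x * (1 / \<alpha> x * (H x * v' x - 1/2 * B1 x * v x))"
        using W[OF x] H_nz[OF x] by (simp add: W_def K_def)
      then have "sqrt 3 * K x = 1 / \<alpha> x * (H x * v' x - 1/2 * B1 x * v x)"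
        using H_nz[OF x] mult_left_cancel by blast
      then have "1 / sqrt 3 * (1 / \<alpha> x * (H x * v' x - 1/2 * B1 x * v x)) = 1 / sqrt 3 * (sqrt 3 * K x)"
        by (simp only:)
      also have "\<dots> = K x" by simp
      finally have "1 / sqrt 3 * (1 / \<alpha> x * (H x * v' x - 1/2 * B1 x * v x)) = K x" .
      then show "1 / (sqrt 3 * \<alpha> x) * (1 * (H x * v' x) + (- 1/2) * (B1 x * v x)) = K x"
        by simp
    qed
  qed
  have YK: "Y x = H x * K x" if "x \<in> {0..l}" for x using H_nz[OF that] by (simp add: K_def)
  \<comment> \<open>The equation v - (1 / sqrt 3) H K' + (sqrt 3 / 2) B1 K = f, solved for
    K'.\<close>
  define m where "m x = sqrt 3 / H x * (v x - f x + sqrt 3 / 2 * B1 x * K x)" for x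
  have mc: "continuous_on {0..l} m"
    unfolding m_def using H_nz by (intro continuous_intros conts vc f Hs_continuous[OF K1]) auto
  have ioo: "AE x in lebesgue_on {0<..<l}. x \<in> {0<..<l}" by (rule AE_Ioo_all)
  have "AE x in lebesgue_on {0<..<l}. Dw l K x = m x"
    using ae ioo
  proof eventually_elim
    case (elim x)
    then have x: "x \<in> {0..l}" by simp
    have "1 / H x * hbS l h0 b Y x = - 1 / sqrt 3 * H x * Dw l K x + sqrt 3 / 2 * B1 x * K x"
      unfolding hbS_eq[OF x] K_def[abs_def] by simp
    with elim(1) have "v x + (- 1 / sqrt 3 * (H x * Dw l K x) + sqrt 3 / 2 * (B1 x * K x)) = f x"
      by (simp only: mult.assoc)
    moreover have "A = s * (v - f + s / 2 * C)" if "s \<noteq> 0" "v + (- 1 / s * A + s / 2 * C) = f" for s v f A C :: real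
      unfolding that(2)[symmetric] using that(1) by (simp add: field_simps)
    ultimately have "H x * Dw l K x = sqrt 3 * (v x - f x + sqrt 3 / 2 * (B1 x * K x))"
      using sqrt3(2) by blast
    then have "H x * Dw l K x = sqrt 3 * (v x - f x + sqrt 3 / 2 * B1 x * K x)"
      by (simp only: mult.assoc)
    then show ?case unfolding m_def using H_nz[OF x] by (simp add: field_simps)
  qed
  then have Kd: "(K has_real_derivative m x) (at x within {0..l})" if "x \<in> {0..l}" for x
    by (rule Hs_classical[OF K1 l mc _ that])
  have Wd: "(W has_real_derivative B1 x / (2 * H x) * W x + 3 * v x - 3 * f x) (at x within {0..l})"
    if x: "x \<in> {0..l}" for x
  proof -
    have "((\<lambda>x. sqrt 3 * (H x * K x)) has_real_derivative sqrt 3 * (- B1 x * K x + m x * H x)) (at x within {0..l})"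
      by (rule DERIV_cmult[OF DERIV_mult[OF H_deriv[OF x] Kd[OF x]]])
    moreover have "sqrt 3 * (- B1 x * K x + m x * H x) = B1 x / (2 * H x) * W x + 3 * v x - 3 * f x"
    proof -
      have mH: "m x * H x = sqrt 3 * (v x - f x + sqrt 3 / 2 * B1 x * K x)"
        unfolding m_def using H_nz[OF x] by simp
      have "sqrt 3 * (- B1 x * K x + m x * H x)
          = - sqrt 3 * B1 x * K x + (sqrt 3 * sqrt 3) * (v x - f x) + (sqrt 3 * sqrt 3) * (sqrt 3 / 2 * B1 x * K x)"
        unfolding mH by (simp add: algebra_simps)
      also have "\<dots> = 3 * (v x - f x) + sqrt 3 / 2 * B1 x * K x"
        unfolding sqrt3 by simp
      also have "sqrt 3 / 2 * B1 x * K x = B1 x / (2 * H x) * W x"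
        unfolding W_def YK[OF x] using H_nz[OF x] by simp
      finally show ?thesis by simp
    qed
    ultimately have "((\<lambda>x. sqrt 3 * (H x * K x)) has_real_derivative B1 x / (2 * H x) * W x + 3 * v x - 3 * f x) (at x within {0..l})"
      by simp
    then show ?thesis
      by (rule has_field_derivative_transform_within[OF _ zero_less_one x]) (simp add: W_def YK)
  qed
  have v'eq: "v' x = \<alpha> x / (H x)\<^sup>2 * W x + B1 x / (2 * H x) * v x" if x: "x \<in> {0..l}" for x
  proof -
    have "\<alpha> x / (H x)\<^sup>2 * W x = 1 / H x * (H x * v' x - 1/2 * B1 x * v x)"
      unfolding W[OF x] using H_nz[OF x] \<alpha>_pos[of x] by (simp add: power2_eq_square)
    then show ?thesis using H_nz[OF x] by (simp add: field_simps)
  qed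
  have s: "F.sol (\<lambda>x. - 3 * f x) (\<lambda>x. 0) W v"
    unfolding F.sol_def
  proof (intro ballI conjI)
    fix x assume x: "x \<in> {0..l}"
    show "(W has_real_derivative B1 x / (2 * H x) * W x + 3 * v x + - 3 * f x) (at x within {0..l})"
      using Wd[OF x] by simp
    show "(v has_real_derivative \<alpha> x / (H x)\<^sup>2 * W x + B1 x / (2 * H x) * v x + 0) (at x within {0..l})"
      using vd[OF x] v'eq[OF x] by simp
  qed
  have W0: "W 0 = 0" "W l = 0" using bc by (simp_all add: W_def Y_def)
  have fc: "continuous_on {0..l} (\<lambda>x. - 3 * f x)" by (intro continuous_intros f)
  from F.dir_unique[OF fc continuous_on_const s refl refl W0 x]
  show "v x = F.dir2 (\<lambda>x. - 3 * f x) (\<lambda>x. 0) 0 0 x"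
    "sqrt 3 * (H x / \<alpha> x) * hbS_adj l h0 b v x = F.dir1 (\<lambda>x. - 3 * f x) (\<lambda>x. 0) 0 0 x"
    by (simp_all add: W_def Y_def)
qed

lemma R1_cond:
  assumes "continuous_on {0..l} f"
  shows "flux_cond f (R1 l h0 b f)"
proof -
  have "\<exists>u. flux_cond f u" using flux_exists[OF assms] by blast
  from someI_ex[OF this] show ?thesis unfolding R1_def flux_cond_def .
qed

lemmas R1_eq = flux_unique[OF _ R1_cond]

end

section \<open>Continuous extension to bounded continuous functions\<close>

type_synonym cfun = "real \<Rightarrow>\<^sub>C real"

text \<open>For f continuous on {0..l} this carries the sup norm of the interval into a complete
  normed space; outside the interval f is continued by its end values.\<close>

definition toC :: "real \<Rightarrow> (real \<Rightarrow> real) \<Rightarrow> cfun" where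
  "toC l f = Bcontfun (\<lambda>x. f (clamp 0 l x))"

lemma toC_apply_clamp:
  assumes "continuous_on {0..l} f"
  shows "apply_bcontfun (toC l f) x = f (clamp 0 l x)"
proof -
  have "continuous_on (cbox 0 l) f" using assms by (simp add: cbox_interval)
  then obtain g :: cfun where g: "\<And>x. g x = f (clamp 0 l x)"
    by (rule continuous_on_cbox_bcontfunE) blast
  then have "(\<lambda>x. f (clamp 0 l x)) = apply_bcontfun g" by auto
  then show ?thesis using g by (simp add: toC_def apply_bcontfun_inverse)
qed

lemma clamp_mem: "0 \<le> l \<Longrightarrow> clamp 0 l x \<in> {0..l::real}"
  using clamp_in_interval[of 0 l x] by (auto simp: cbox_interval)

lemma clamp_id: "x \<in> {0..l} \<Longrightarrow> clamp 0 l x = (x::real)"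
  by (simp add: clamp_cancel_cbox cbox_interval)

lemma toC_apply: "continuous_on {0..l} f \<Longrightarrow> x \<in> {0..l} \<Longrightarrow> apply_bcontfun (toC l f) x = f x"
  by (simp add: toC_apply_clamp clamp_id)

lemma toC_norm:
  assumes "continuous_on {0..l} f" "\<And>x. x \<in> {0..l} \<Longrightarrow> \<bar>f x\<bar> \<le> M" "0 \<le> l"
  shows "norm (toC l f) \<le> M"
  using assms(2)[OF clamp_mem[OF assms(3)]] by (intro norm_bound) (simp add: toC_apply_clamp[OF assms(1)])

lemma toC_lin:
  assumes "continuous_on {0..l} f" "continuous_on {0..l} g" "0 \<le> l" "continuous_on {0..l} h"
    and "\<And>x. x \<in> {0..l} \<Longrightarrow> h x = a * f x + b * g x"
  shows "toC l h = a *\<^sub>R toC l f + b *\<^sub>R toC l g"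
  using assms(5)[OF clamp_mem[OF assms(3)]]
  by (intro bcontfun_eqI) (simp add: toC_apply_clamp assms(1,2,4))

lemma bounded_linear_toC:
  assumes l: "0 \<le> l" and c: "\<And>e. continuous_on {0..l} (\<phi> e)"
    and lin: "\<And>e f a b x. x \<in> {0..l} \<Longrightarrow> \<phi> (a *\<^sub>R e + b *\<^sub>R f) x = a * \<phi> e x + b * \<phi> f x"
    and bound: "\<And>e x. x \<in> {0..l} \<Longrightarrow> \<bar>\<phi> e x\<bar> \<le> C * norm e"
  shows "bounded_linear (\<lambda>e. toC l (\<phi> e))"
proof (rule bounded_linear_intro[where K = C])
  fix e f :: 'a and r :: real
  show "toC l (\<phi> (e + f)) = toC l (\<phi> e) + toC l (\<phi> f)"
    using toC_lin[OF c[of e] c[of f] l c[of "e + f"], of 1 1] lin[of _ 1 e 1 f] by simp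
  show "toC l (\<phi> (r *\<^sub>R e)) = r *\<^sub>R toC l (\<phi> e)"
    using toC_lin[OF c[of e] c[of e] l c[of "r *\<^sub>R e"], of r 0] lin[of _ r e 0 e] by simp
  show "norm (toC l (\<phi> e)) \<le> norm e * C"
    using toC_norm[OF c bound l, of e] by (simp add: mult.commute)
qed

lemma bounded_linear_apply_bcontfun:
  "bounded_linear (\<lambda>f :: 'a::topological_space \<Rightarrow>\<^sub>C 'b::real_normed_vector. apply_bcontfun f x)"
  by (rule bounded_linear_intro[where K = 1]) (simp_all add: norm_bounded)

lemma bounded_bilinear_compose:
  assumes L: "bounded_linear L" and B: "bounded_bilinear B"
  shows "bounded_bilinear (\<lambda>x y. L (B x y))"
proof -
  obtain K where K: "0 \<le> K" "\<And>x. norm (L x) \<le> norm x * K"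
    using bounded_linear.nonneg_bounded[OF L] by blast
  obtain M where M: "\<And>x y. norm (B x y) \<le> norm x * norm y * M"
    using bounded_bilinear.bounded[OF B] by blast
  note LL = linear_add[OF bounded_linear.linear[OF L]] linear_scale[OF bounded_linear.linear[OF L]]
  note BB = bounded_bilinear.add_left[OF B] bounded_bilinear.add_right[OF B]
    bounded_bilinear.scaleR_left[OF B] bounded_bilinear.scaleR_right[OF B]
  show ?thesis
  proof
    show "\<exists>K. \<forall>a b. norm (L (B a b)) \<le> norm a * norm b * K"
    proof (intro exI allI)
      fix a b
      have "norm (L (B a b)) \<le> norm (B a b) * K" by (rule K)
      also have "\<dots> \<le> norm a * norm b * M * K" using M K(1) by (intro mult_right_mono)
      finally show "norm (L (B a b)) \<le> norm a * norm b * (M * K)" by (simp add: ac_simps)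
    qed
  qed (simp_all add: LL BB)
qed

lemma bounded_bilinear_Pair:
  assumes A: "bounded_bilinear A" and B: "bounded_bilinear B"
  shows "bounded_bilinear (\<lambda>x y. (A x y, B x y))"
proof -
  obtain K where K: "\<And>x y. norm (A x y) \<le> norm x * norm y * K"
    using bounded_bilinear.bounded[OF A] by blast
  obtain M where M: "\<And>x y. norm (B x y) \<le> norm x * norm y * M"
    using bounded_bilinear.bounded[OF B] by blast
  note AA = bounded_bilinear.add_left[OF A] bounded_bilinear.add_right[OF A]
    bounded_bilinear.scaleR_left[OF A] bounded_bilinear.scaleR_right[OF A]
  note BB = bounded_bilinear.add_left[OF B] bounded_bilinear.add_right[OF B]
    bounded_bilinear.scaleR_left[OF B] bounded_bilinear.scaleR_right[OF B]
  show ?thesis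
  proof
    show "\<exists>K. \<forall>a b. norm (A a b, B a b) \<le> norm a * norm b * K"
    proof (intro exI allI)
      fix a b
      have "norm (A a b, B a b) \<le> norm (A a b) + norm (B a b)"
        by (simp add: norm_Pair sqrt_sum_squares_le_sum)
      also have "\<dots> \<le> norm a * norm b * K + norm a * norm b * M" by (intro add_mono K M)
      finally show "norm (A a b, B a b) \<le> norm a * norm b * (K + M)" by (simp add: distrib_left)
    qed
  qed (simp_all add: AA BB)
qed

lemma bounded_bilinear_add:
  assumes "bounded_bilinear A" "bounded_bilinear B"
  shows "bounded_bilinear (\<lambda>x y. A x y + B x y)"
  using bounded_bilinear_compose[OF bounded_linear_add[OF bounded_linear_fst bounded_linear_snd]
      bounded_bilinear_Pair[OF assms]] by simp

definition mulC :: "cfun \<Rightarrow> cfun \<Rightarrow> cfun" where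
  "mulC f g = Bcontfun (\<lambda>x. f x * g x)"

lemma mulC_apply: "apply_bcontfun (mulC f g) x = f x * g x"
proof -
  have "(\<lambda>x. f x * g x) \<in> bcontfun"
  proof (rule bcontfun_normI)
    show "continuous_on UNIV (\<lambda>x. f x * g x)"
      by (intro continuous_on_mult continuous_on_apply_bcontfun)
    show "norm (f x * g x) \<le> norm f * norm g" for x
      using norm_bounded[of f x] norm_bounded[of g x] by (simp add: abs_mult mult_mono)
  qed
  then show ?thesis by (simp add: mulC_def Bcontfun_inverse)
qed

lemma bounded_bilinear_mulC: "bounded_bilinear mulC"
proof
  show "\<exists>K. \<forall>a b. norm (mulC a b) \<le> norm a * norm b * K"
  proof (intro exI allI)
    fix a b :: cfun
    show "norm (mulC a b) \<le> norm a * norm b * 1"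
    proof (rule norm_bound)
      fix x show "norm (mulC a b x) \<le> norm a * norm b * 1"
        using norm_bounded[of a x] norm_bounded[of b x] by (simp add: mulC_apply abs_mult mult_mono)
    qed
  qed
qed (rule bcontfun_eqI, simp add: mulC_apply algebra_simps)+

section \<open>A Banach space containing the Sobolev data\<close>

text \<open>An element \<open>(s, (\<alpha>, \<beta>, \<gamma>))\<close> represents at level \<open>k\<close> the function with derivatives
  \<open>s 0, s 1, \<dots>\<close> at \<open>0\<close> up to order \<open>k - 1\<close>, and with \<open>k\<close>-th derivative \<open>\<alpha> p + \<beta> r + \<gamma>\<close>, where
  \<open>\<alpha>, \<beta>, \<gamma>\<close> are continuous and \<open>p\<close>, \<open>r\<close> are fixed square integrable functions, later the highest
  derivatives of the initial data. The nonlinear system preserves this form; in this way no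
  completeness of spaces of square integrable functions is needed.\<close>

type_synonym jet = "(nat \<Rightarrow>\<^sub>C real) \<times> (cfun \<times> cfun \<times> cfun)"

text \<open>In terms of the represented function of positive level, \<open>hdJ\<close> is the value
  at 0, \<open>tlJ\<close> the jet of the derivative, and \<open>consJ\<close> integrates: it
  prescribes the value at 0 and the derivative.\<close>

definition hdJ :: "jet \<Rightarrow> real" where
  "hdJ e = apply_bcontfun (fst e) 0"
definition tlJ :: "jet \<Rightarrow> jet" where
  "tlJ e = (Bcontfun (\<lambda>i. fst e (Suc i)), snd e)"
definition consJ :: "real \<Rightarrow> jet \<Rightarrow> jet" where
  "consJ a e = (Bcontfun (case_nat a (apply_bcontfun (fst e))), snd e)"

lemma seq_bcontfun: "(\<And>i. \<bar>f i\<bar> \<le> M) \<Longrightarrow> (f :: nat \<Rightarrow> real) \<in> bcontfun"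
  by (rule bcontfun_normI) (simp_all add: continuous_on_discrete)

lemma tlJ_apply: "apply_bcontfun (fst (tlJ e)) i = fst e (Suc i)" "snd (tlJ e) = snd e"
proof -
  have "(\<lambda>i. fst e (Suc i)) \<in> bcontfun"
    using norm_bounded[of "fst e"] by (intro seq_bcontfun[where M = "norm (fst e)"]) simp
  then show "apply_bcontfun (fst (tlJ e)) i = fst e (Suc i)" by (simp add: tlJ_def Bcontfun_inverse)
qed (simp add: tlJ_def)

lemma consJ_apply: "apply_bcontfun (fst (consJ a e)) i = case_nat a (apply_bcontfun (fst e)) i" "snd (consJ a e) = snd e"
proof -
  have "case_nat a (apply_bcontfun (fst e)) \<in> bcontfun"
  proof (rule seq_bcontfun[where M = "max \<bar>a\<bar> (norm (fst e))"])
    show "\<bar>case i of 0 \<Rightarrow> a | Suc i \<Rightarrow> fst e i\<bar> \<le> max \<bar>a\<bar> (norm (fst e))" for i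
      using norm_bounded[of "fst e"] by (cases i) (simp_all add: le_max_iff_disj)
  qed
  then show "apply_bcontfun (fst (consJ a e)) i = case_nat a (apply_bcontfun (fst e)) i"
    by (simp add: consJ_def Bcontfun_inverse)
qed (simp add: consJ_def)

lemma hdJ_consJ [simp]: "hdJ (consJ a e) = a"
  by (simp add: hdJ_def consJ_apply)

lemma tlJ_consJ [simp]: "tlJ (consJ a e) = e"
  by (rule prod_eqI) (auto intro!: bcontfun_eqI simp: tlJ_apply consJ_apply)

lemma bounded_linear_hdJ: "bounded_linear hdJ"
  unfolding hdJ_def[abs_def]
  by (rule bounded_linear_compose[OF bounded_linear_apply_bcontfun bounded_linear_fst])

lemma bounded_linear_tlJ: "bounded_linear tlJ"
proof -
  have "bounded_linear (\<lambda>e. fst (tlJ e))"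
  proof (rule bounded_linear_intro[where K = 1])
    show "norm (fst (tlJ e)) \<le> norm e * 1" for e
    proof (rule norm_bound)
      fix i
      have "norm (fst (tlJ e) i) \<le> norm (fst e)" using norm_bounded[of "fst e" "Suc i"] by (simp add: tlJ_apply)
      also have "\<dots> \<le> norm e" using norm_fst_le[of "fst e" "snd e"] by simp
      finally show "norm (fst (tlJ e) i) \<le> norm e * 1" by simp
    qed
  qed (rule bcontfun_eqI, simp add: tlJ_apply)+
  from bounded_linear_Pair[OF this bounded_linear_snd]
  have "bounded_linear (\<lambda>e. (fst (tlJ e), snd e))" .
  moreover have "(\<lambda>e. (fst (tlJ e), snd e)) = tlJ" by (auto simp: tlJ_def)
  ultimately show ?thesis by simp
qed

lemma bounded_linear_consJ: "bounded_linear (\<lambda>p. consJ (fst p) (snd p))"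
proof -
  have "bounded_linear (\<lambda>p. fst (consJ (fst p) (snd p)))"
  proof (rule bounded_linear_intro[where K = 1])
    show "norm (fst (consJ (fst p) (snd p))) \<le> norm p * 1" for p
    proof (rule norm_bound)
      fix i
      have "\<bar>fst p\<bar> \<le> norm p" "norm (fst (snd p)) \<le> norm p"
        using norm_fst_le[of "fst p" "snd p"] norm_snd_le[of "snd p" "fst p"]
          norm_fst_le[of "fst (snd p)" "snd (snd p)"] by simp_all
      then show "norm (fst (consJ (fst p) (snd p)) i) \<le> norm p * 1"
        using norm_bounded[of "fst (snd p)"] order_trans by (cases i) (auto simp: consJ_apply)
    qed
    show "fst (consJ (fst (p + q)) (snd (p + q))) = fst (consJ (fst p) (snd p)) + fst (consJ (fst q) (snd q))" for p q
    proof (rule bcontfun_eqI)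
      fix i
      show "apply_bcontfun (fst (consJ (fst (p + q)) (snd (p + q)))) i
        = apply_bcontfun (fst (consJ (fst p) (snd p)) + fst (consJ (fst q) (snd q))) i"
        by (cases i) (simp_all add: consJ_apply)
    qed
    show "fst (consJ (fst (a *\<^sub>R p)) (snd (a *\<^sub>R p))) = a *\<^sub>R fst (consJ (fst p) (snd p))" for a p
    proof (rule bcontfun_eqI)
      fix i
      show "apply_bcontfun (fst (consJ (fst (a *\<^sub>R p)) (snd (a *\<^sub>R p)))) i
        = apply_bcontfun (a *\<^sub>R fst (consJ (fst p) (snd p))) i"
        by (cases i) (simp_all add: consJ_apply)
    qed
  qed
  from bounded_linear_Pair[OF this bounded_linear_compose[OF bounded_linear_snd bounded_linear_snd]]
  have "bounded_linear (\<lambda>p. (fst (consJ (fst p) (snd p)), snd (snd p)))" .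
  moreover have "(\<lambda>p. (fst (consJ (fst p) (snd p)), snd (snd p))) = (\<lambda>p. consJ (fst p) (snd p))"
    by (auto simp: consJ_def)
  ultimately show ?thesis by simp
qed

lemma bounded_linear_consJ_comp:
  "bounded_linear f \<Longrightarrow> bounded_linear g \<Longrightarrow> bounded_linear (\<lambda>x. consJ (f x) (g x))"
  using bounded_linear_compose[OF bounded_linear_consJ bounded_linear_Pair] by simp

lemma bounded_bilinear_consJ_comp:
  "bounded_bilinear f \<Longrightarrow> bounded_bilinear g \<Longrightarrow> bounded_bilinear (\<lambda>x y. consJ (f x y) (g x y))"
  using bounded_bilinear_compose[OF bounded_linear_consJ bounded_bilinear_Pair] by simp

text \<open>Integration from 0, k times. Level k reads only the first k entries of the sequence;
  infinite sequences allow all levels to share one Banach space.\<close>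

fun jval :: "(real \<Rightarrow> real) \<Rightarrow> (real \<Rightarrow> real) \<Rightarrow> nat \<Rightarrow> jet \<Rightarrow> real \<Rightarrow> real" where
  "jval p r 0 e x = fst (snd e) x * p x + fst (snd (snd e)) x * r x + snd (snd (snd e)) x"
| "jval p r (Suc k) e x = hdJ e + integral {0..x} (jval p r k (tlJ e))"

lemmas jval_0 = jval.simps(1)
declare jval_0 [simp del]

text \<open>The derivatives s at 0 are fixed before p, r and the coefficients t. Hence the same
  statement serves both initial functions, one with its highest derivative as p, the other with its
  highest derivative as r.\<close>

lemma Hs_jval:
  assumes "f \<in> Hs l n" "l > 0"
  shows "\<exists>g s. L2 l g \<and> (\<forall>p r t. jval p r 0 (0, t) = g \<longrightarrow> (\<forall>x\<in>{0..l}. f x = jval p r n (s, t) x))"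
  using assms(1)
proof (induction n arbitrary: f)
  case 0
  have "jval p r 0 (s, t) = jval p r 0 (0, t)" for p r s t by (rule ext) (simp add: jval_0)
  then have "\<forall>p r t. jval p r 0 (0, t) = f \<longrightarrow> (\<forall>x\<in>{0..l}. f x = jval p r 0 (0, t) x)" by simp
  then show ?case using Hs_L2[OF 0] by blast
next
  case (Suc n)
  from Suc.IH[OF Hs_Dw(1)[OF Suc.prems assms(2)]] obtain g s where g: "L2 l g"
    and s: "\<And>p r t x. jval p r 0 (0, t) = g \<Longrightarrow> x \<in> {0..l} \<Longrightarrow> Dw l f x = jval p r n (s, t) x" by blast
  define s' where "s' = fst (consJ (f 0) (s, (0, 0, 0)))"
  have t: "hdJ (s', t) = f 0" "tlJ (s', t) = (s, t)" for t
  proof -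
    have "(s', t) = consJ (f 0) (s, t)" by (simp add: s'_def consJ_def)
    then show "hdJ (s', t) = f 0" "tlJ (s', t) = (s, t)" by (simp_all only: hdJ_consJ tlJ_consJ)
  qed
  have "f x = jval p r (Suc n) (s', t) x" if j: "jval p r 0 (0, t) = g" and x: "x \<in> {0..l}" for p r t x
  proof -
    have "integral {0..x} (Dw l f) = integral {0..x} (jval p r n (s, t))"
      using x by (intro Henstock_Kurzweil_Integration.integral_cong s[OF j]) auto
    then show ?thesis using prim_eq[OF Hs_prim[OF Suc.prems assms(2)] x] by (simp add: t)
  qed
  then show ?case using g by blast
qed

locale jets =
  fixes l :: real and p r :: "real \<Rightarrow> real"
  assumes l: "l > 0" and p: "L2 l p" and r: "L2 l r"
begin

abbreviation "J \<equiv> jval p r"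

lemma cfun_continuous: "continuous_on A (apply_bcontfun (f :: cfun))"
  by (rule continuous_on_apply_bcontfun)

lemma J_L2_0: "L2 l (J 0 e)"
  unfolding jval_0[abs_def]
  by (intro L2_add L2_continuous[OF cfun_continuous])
     (simp_all only: mult.commute[of "apply_bcontfun _ _"] L2_mult_continuous[OF p cfun_continuous]
       L2_mult_continuous[OF r cfun_continuous])

lemma J_Suc_prim: "L2 l (J k (tlJ e)) \<Longrightarrow> prim l (J (Suc k) e) (J k (tlJ e))"
  by (intro primI L2_abs_int) simp_all

lemma J_L2: "L2 l (J k e)"
proof (induction k arbitrary: e)
  case (Suc k)
  show ?case by (rule L2_continuous[OF prim_continuous[OF J_Suc_prim[OF Suc]]])
qed (rule J_L2_0)

lemma J_prim: "prim l (J (Suc k) e) (J k (tlJ e))"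
  by (rule J_Suc_prim[OF J_L2])

lemma J_continuous: "continuous_on {0..l} (J (Suc k) e)"
  by (rule prim_continuous[OF J_prim])

lemma J_at_0: "J (Suc k) e 0 = hdJ e"
  by simp

lemma J_int: "x \<in> {0..l} \<Longrightarrow> J k e integrable_on {0..x}"
  by (rule abs_int_sub(1)[OF L2_abs_int[OF J_L2]]) auto

lemma J_lin: "x \<in> {0..l} \<Longrightarrow> J k (a *\<^sub>R e + b *\<^sub>R f) x = a * J k e x + b * J k f x"
proof (induction k arbitrary: e f x)
  case 0
  then show ?case by (simp add: jval_0 algebra_simps)
next
  case (Suc k)
  have "tlJ (a *\<^sub>R e + b *\<^sub>R f) = a *\<^sub>R tlJ e + b *\<^sub>R tlJ f" "hdJ (a *\<^sub>R e + b *\<^sub>R f) = a * hdJ e + b * hdJ f"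
    using bounded_linear.linear[OF bounded_linear_tlJ] bounded_linear.linear[OF bounded_linear_hdJ]
    by (simp_all add: linear_add linear_scale)
  moreover have "integral {0..x} (J k (a *\<^sub>R tlJ e + b *\<^sub>R tlJ f))
      = integral {0..x} (\<lambda>y. a * J k (tlJ e) y + b * J k (tlJ f) y)"
    using Suc.prems by (intro Henstock_Kurzweil_Integration.integral_cong Suc.IH) auto
  moreover have "\<dots> = a * integral {0..x} (J k (tlJ e)) + b * integral {0..x} (J k (tlJ f))"
  proof -
    have "(\<lambda>y. a * J k (tlJ e) y) integrable_on {0..x}" "(\<lambda>y. b * J k (tlJ f) y) integrable_on {0..x}"
      by (rule integrable_on_mult_right[OF J_int[OF Suc.prems]])+
    from integral_add[OF this] show ?thesis by simp
  qed
  ultimately show ?case by (simp add: algebra_simps)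
qed

lemma J_Hs: "J k e \<in> Hs l k"
proof (induction k arbitrary: e)
  case (Suc k)
  show ?case by (rule HsI[OF J_prim Suc l])
qed (simp add: J_L2_0)

lemma norm_parts:
  "\<bar>hdJ e\<bar> \<le> norm e" "norm (tlJ e) \<le> norm e" "\<bar>fst (snd e) x\<bar> \<le> norm e"
  "\<bar>fst (snd (snd e)) x\<bar> \<le> norm e" "\<bar>snd (snd (snd e)) x\<bar> \<le> norm e"
proof -
  have 1: "norm (fst e) \<le> norm e" "norm (snd e) \<le> norm e"
    using norm_fst_le[of "fst e" "snd e"] norm_snd_le[of "snd e" "fst e"] by simp_all
  have 2: "norm (fst (snd e)) \<le> norm (snd e)" "norm (snd (snd e)) \<le> norm (snd e)"
    using norm_fst_le[of "fst (snd e)" "snd (snd e)"] norm_snd_le[of "snd (snd e)" "fst (snd e)"] by simp_all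
  have 3: "norm (fst (snd (snd e))) \<le> norm (snd (snd e))" "norm (snd (snd (snd e))) \<le> norm (snd (snd e))"
    using norm_fst_le[of "fst (snd (snd e))" "snd (snd (snd e))"]
      norm_snd_le[of "snd (snd (snd e))" "fst (snd (snd e))"] by simp_all
  show "\<bar>hdJ e\<bar> \<le> norm e" using norm_bounded[of "fst e" 0] 1 by (simp add: hdJ_def)
  show "\<bar>fst (snd e) x\<bar> \<le> norm e" using norm_bounded[of "fst (snd e)" x] 1 2 by simp
  show "\<bar>fst (snd (snd e)) x\<bar> \<le> norm e" using norm_bounded[of "fst (snd (snd e))" x] 1 2 3 by simp
  show "\<bar>snd (snd (snd e)) x\<bar> \<le> norm e" using norm_bounded[of "snd (snd (snd e))" x] 1 2 3 by simp
  have "norm (fst (tlJ e)) \<le> norm (fst e)"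
    using norm_bounded[of "fst e"] by (intro norm_bound) (simp add: tlJ_apply)
  then show "norm (tlJ e) \<le> norm e"
    unfolding norm_prod_def tlJ_apply by (intro real_sqrt_le_mono add_mono power_mono) auto
qed

text \<open>At level 0 only an integral norm is available, because p and r may be unbounded. One
  integration turns it into a sup bound, which in turn bounds the integral norm of the next
  level.\<close>

lemma J_L1_bound: "\<exists>C\<ge>0. \<forall>e. integral {0..l} (\<lambda>x. \<bar>J k e x\<bar>) \<le> C * norm e"
  and J_sup_bound: "\<exists>C\<ge>0. \<forall>e. \<forall>x\<in>{0..l}. \<bar>J (Suc k) e x\<bar> \<le> C * norm e"
proof -
  have step: "\<exists>C\<ge>0. \<forall>e. \<forall>x\<in>{0..l}. \<bar>J (Suc k) e x\<bar> \<le> C * norm e"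
    if C: "C \<ge> 0" "\<And>e. integral {0..l} (\<lambda>x. \<bar>J k e x\<bar>) \<le> C * norm e" for C k
  proof (intro exI[of _ "1 + C"] conjI allI ballI)
    fix e x assume x: "x \<in> {0..l}"
    note ai = L2_abs_int[OF J_L2[of k "tlJ e"]]
    have sub: "{0..x} \<subseteq> {0..l}" using x by auto
    have "\<bar>integral {0..x} (J k (tlJ e))\<bar> \<le> integral {0..x} (\<lambda>y. \<bar>J k (tlJ e) y\<bar>)"
      using Henstock_Kurzweil_Integration.integral_norm_bound_integral[OF abs_int_sub(1)[OF ai sub] abs_int_sub(2)[OF ai sub]]
      by simp
    also have "\<dots> \<le> integral {0..l} (\<lambda>y. \<bar>J k (tlJ e) y\<bar>)"
      by (rule integral_subset_le[OF sub abs_int_sub(2)[OF ai sub] abs_int_sub(2)[OF ai order_refl]]) simp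
    also have "\<dots> \<le> C * norm (tlJ e)" by (rule C)
    also have "\<dots> \<le> C * norm e" using C(1) norm_parts(2) by (intro mult_left_mono)
    finally show "\<bar>J (Suc k) e x\<bar> \<le> (1 + C) * norm e"
      using norm_parts(1)[of e] by (simp add: distrib_right)
  qed (use C in simp)
  have L1: "\<exists>C\<ge>0. \<forall>e. integral {0..l} (\<lambda>x. \<bar>J k e x\<bar>) \<le> C * norm e" for k
  proof (induction k)
    case 0
    note ip = abs_int_sub(2)[OF L2_abs_int[OF p] order_refl] and ir = abs_int_sub(2)[OF L2_abs_int[OF r] order_refl]
    have ipr: "(\<lambda>x. \<bar>p x\<bar> + \<bar>r x\<bar> + 1) integrable_on {0..l}"
      by (intro integrable_add ip ir integrable_const_ivl)
    show ?case
    proof (intro exI[of _ "integral {0..l} (\<lambda>x. \<bar>p x\<bar> + \<bar>r x\<bar> + 1)"] conjI allI)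
      show "0 \<le> integral {0..l} (\<lambda>x. \<bar>p x\<bar> + \<bar>r x\<bar> + 1)"
        by (rule Henstock_Kurzweil_Integration.integral_nonneg[OF ipr]) simp
      fix e
      have "integral {0..l} (\<lambda>x. \<bar>J 0 e x\<bar>) \<le> integral {0..l} (\<lambda>x. (\<bar>p x\<bar> + \<bar>r x\<bar> + 1) * norm e)"
      proof (rule integral_le)
        show "(\<lambda>x. \<bar>J 0 e x\<bar>) integrable_on {0..l}" by (rule abs_int_sub(2)[OF L2_abs_int[OF J_L2] order_refl])
        show "(\<lambda>x. (\<bar>p x\<bar> + \<bar>r x\<bar> + 1) * norm e) integrable_on {0..l}" by (rule integrable_on_mult_left[OF ipr])
        fix x
        have m: "\<bar>a * b\<bar> \<le> \<bar>b\<bar> * norm e" if "\<bar>a\<bar> \<le> norm e" for a b :: real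
          using mult_left_mono[OF that, of "\<bar>b\<bar>"] by (simp add: abs_mult mult.commute)
        from m[OF norm_parts(3)[of e x], of "p x"] m[OF norm_parts(4)[of e x], of "r x"] norm_parts(5)[of e x]
        show "\<bar>J 0 e x\<bar> \<le> (\<bar>p x\<bar> + \<bar>r x\<bar> + 1) * norm e"
          unfolding jval_0 by (simp add: distrib_right)
      qed
      then show "integral {0..l} (\<lambda>x. \<bar>J 0 e x\<bar>) \<le> integral {0..l} (\<lambda>x. \<bar>p x\<bar> + \<bar>r x\<bar> + 1) * norm e"
        by simp
    qed
  next
    case (Suc k)
    then obtain C0 where "C0 \<ge> 0" "\<And>e. integral {0..l} (\<lambda>x. \<bar>J k e x\<bar>) \<le> C0 * norm e" by blast
    from step[OF this] obtain C where C: "C \<ge> 0" "\<And>e x. x \<in> {0..l} \<Longrightarrow> \<bar>J (Suc k) e x\<bar> \<le> C * norm e" by blast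
    show ?case
    proof (intro exI[of _ "l * C"] conjI allI)
      fix e
      have "integral {0..l} (\<lambda>x. \<bar>J (Suc k) e x\<bar>) \<le> integral {0..l} (\<lambda>x. C * norm e)"
        by (rule integral_le[OF abs_int_sub(2)[OF L2_abs_int[OF J_L2] order_refl] integrable_const_ivl C(2)])
      then show "integral {0..l} (\<lambda>x. \<bar>J (Suc k) e x\<bar>) \<le> l * C * norm e" using l by (simp add: mult_ac)
    qed (use C l in simp)
  qed
  then show "\<exists>C\<ge>0. \<forall>e. integral {0..l} (\<lambda>x. \<bar>J k e x\<bar>) \<le> C * norm e" .
  from L1[of k] step show "\<exists>C\<ge>0. \<forall>e. \<forall>x\<in>{0..l}. \<bar>J (Suc k) e x\<bar> \<le> C * norm e" by blast
qed

text \<open>By this bound a curve that is differentiable in the space of jets is differentiable in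
  the Sobolev norm.\<close>

lemma J_Hnorm_bound: "\<exists>C\<ge>0. \<forall>e. (Hnorm l k (J k e))\<^sup>2 \<le> C * (norm e)\<^sup>2"
proof (induction k)
  case 0
  note ip = abs_int_sub(1)[OF L2_sq[OF p] order_refl] and ir = abs_int_sub(1)[OF L2_sq[OF r] order_refl]
  have ipr: "(\<lambda>x. 3 * ((p x)\<^sup>2 + (r x)\<^sup>2 + 1)) integrable_on {0..l}"
    by (intro integrable_add ip ir integrable_const_ivl integrable_on_mult_right)
  show ?case
  proof (intro exI[of _ "integral {0..l} (\<lambda>x. 3 * ((p x)\<^sup>2 + (r x)\<^sup>2 + 1))"] conjI allI)
    show "0 \<le> integral {0..l} (\<lambda>x. 3 * ((p x)\<^sup>2 + (r x)\<^sup>2 + 1))"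
      by (rule Henstock_Kurzweil_Integration.integral_nonneg[OF ipr]) simp
    fix e
    have "(Hnorm l 0 (J 0 e))\<^sup>2 = integral {0..l} (\<lambda>x. (J 0 e x)\<^sup>2)"
      unfolding Hnorm_0 by (rule LINT_eq_Icc[OF L2_sq[OF J_L2]])
    also have "\<dots> \<le> integral {0..l} (\<lambda>x. 3 * ((p x)\<^sup>2 + (r x)\<^sup>2 + 1) * (norm e)\<^sup>2)"
    proof (rule integral_le)
      show "(\<lambda>x. (J 0 e x)\<^sup>2) integrable_on {0..l}" by (rule abs_int_sub(1)[OF L2_sq[OF J_L2] order_refl])
      show "(\<lambda>x. 3 * ((p x)\<^sup>2 + (r x)\<^sup>2 + 1) * (norm e)\<^sup>2) integrable_on {0..l}" by (rule integrable_on_mult_left[OF ipr])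
      fix x
      have m: "(a * b)\<^sup>2 \<le> b\<^sup>2 * (norm e)\<^sup>2" if "\<bar>a\<bar> \<le> norm e" for a b :: real
        unfolding power_mult_distrib mult.commute[of "a\<^sup>2"]
        using abs_le_square_iff[of a "norm e"] that by (intro mult_left_mono) auto
      have q: "(a + b + c)\<^sup>2 \<le> 3 * (a\<^sup>2 + b\<^sup>2 + c\<^sup>2)" for a b c :: real
        using zero_le_power2[of "a - b"] zero_le_power2[of "b - c"] zero_le_power2[of "a - c"]
        by (simp add: power2_eq_square algebra_simps)
      have "(J 0 e x)\<^sup>2 \<le> 3 * ((fst (snd e) x * p x)\<^sup>2 + (fst (snd (snd e)) x * r x)\<^sup>2 + (snd (snd (snd e)) x * 1)\<^sup>2)"
        unfolding jval_0 using q by simp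
      also have "\<dots> \<le> 3 * ((p x)\<^sup>2 * (norm e)\<^sup>2 + (r x)\<^sup>2 * (norm e)\<^sup>2 + 1\<^sup>2 * (norm e)\<^sup>2)"
        by (intro mult_left_mono add_mono m norm_parts) simp
      finally show "(J 0 e x)\<^sup>2 \<le> 3 * ((p x)\<^sup>2 + (r x)\<^sup>2 + 1) * (norm e)\<^sup>2" by (simp add: algebra_simps)
    qed
    finally show "(Hnorm l 0 (J 0 e))\<^sup>2 \<le> integral {0..l} (\<lambda>x. 3 * ((p x)\<^sup>2 + (r x)\<^sup>2 + 1)) * (norm e)\<^sup>2"
      by simp
  qed
next
  case (Suc k)
  then obtain C where C: "C \<ge> 0" "\<And>e. (Hnorm l k (J k e))\<^sup>2 \<le> C * (norm e)\<^sup>2" by blast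
  from J_sup_bound[of k] obtain S where S: "S \<ge> 0" "\<And>e x. x \<in> {0..l} \<Longrightarrow> \<bar>J (Suc k) e x\<bar> \<le> S * norm e" by blast
  show ?case
  proof (intro exI[of _ "l * S\<^sup>2 + C"] conjI allI)
    fix e
    have w: "weak_deriv l (J (Suc k) e) (J k (tlJ e))"
      by (rule prim_weak_deriv[OF J_prim J_L2 less_imp_le[OF l]])
    have "AE x in lebesgue_on {0<..<l}. Dw l (J (Suc k) e) x = J k (tlJ e) x"
      by (rule weak_deriv_AE_unique[OF Dw_properties(1)[OF w] w J_continuous l])
    then have "Hnorm l k (Dw l (J (Suc k) e)) = Hnorm l k (J k (tlJ e))" by (rule Hnorm_AE_cong)
    then have "(Hnorm l k (Dw l (J (Suc k) e)))\<^sup>2 \<le> C * (norm (tlJ e))\<^sup>2" using C(2) by simp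
    also have "\<dots> \<le> C * (norm e)\<^sup>2" using norm_parts(2)[of e] C(1) by (intro mult_left_mono power_mono) auto
    finally have 1: "(Hnorm l k (Dw l (J (Suc k) e)))\<^sup>2 \<le> C * (norm e)\<^sup>2" .
    have "(LINT x|lebesgue_on {0<..<l}. (J (Suc k) e x)\<^sup>2) = integral {0..l} (\<lambda>x. (J (Suc k) e x)\<^sup>2)"
      by (rule LINT_eq_Icc[OF L2_sq[OF J_L2]])
    also have "\<dots> \<le> integral {0..l} (\<lambda>x. (S * norm e)\<^sup>2)"
    proof (rule integral_le[OF abs_int_sub(1)[OF L2_sq[OF J_L2] order_refl] integrable_const_ivl])
      fix x assume "x \<in> {0..l}"
      from S(2)[OF this, of e] show "(J (Suc k) e x)\<^sup>2 \<le> (S * norm e)\<^sup>2"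
        using abs_le_square_iff[of "J (Suc k) e x" "S * norm e"] by auto
    qed
    finally have "(LINT x|lebesgue_on {0<..<l}. (J (Suc k) e x)\<^sup>2) \<le> l * S\<^sup>2 * (norm e)\<^sup>2"
      using l by (simp add: power_mult_distrib mult_ac)
    with 1 show "(Hnorm l (Suc k) (J (Suc k) e))\<^sup>2 \<le> (l * S\<^sup>2 + C) * (norm e)\<^sup>2"
      unfolding Hnorm_Suc by (simp add: distrib_right)
  qed (use C l in simp)
qed

end

text \<open>As for products: the increment of q = 1 / h over {x..y} is exactly - (h y - h x) q x q
  y, and on short intervals q x q y differs little from the square of q s.\<close>

lemma prim_inverse:
  assumes h: "prim l h k" and pos: "\<And>x. x \<in> {0..l} \<Longrightarrow> 0 < h x"
  shows "prim l (\<lambda>x. 1 / h x) (\<lambda>x. - (k x * (1 / h x * (1 / h x))))"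
proof -
  note hc = prim_continuous[OF h] and kai = prim_abs_int[OF h]
  define q where "q x = 1 / h x" for x
  have qc: "continuous_on {0..l} q"
    unfolding q_def using pos by (intro continuous_intros hc) fastforce
  have ai: "(\<lambda>x. - (k x * (q x * q x))) absolutely_integrable_on {0..l}"
    using abs_int_mult_continuous[OF kai, of "\<lambda>x. - (q x * q x)"] by (simp add: continuous_intros qc)
  have ai': "(\<lambda>x. k x * (q x * q x)) absolutely_integrable_on {0..l}"
    by (intro abs_int_mult_continuous[OF kai] continuous_on_mult qc)
  have ik: "(\<lambda>s. k s * (q s * q s)) integrable_on {x..y}" "k integrable_on {x..y}" "(\<lambda>s. \<bar>k s\<bar>) integrable_on {x..y}"
    if "0 \<le> x" "y \<le> l" for x y
    using that abs_int_sub[OF ai', of x y] abs_int_sub[OF kai, of x y] by auto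
  define E where "E x y = q y - q x - integral {x..y} (\<lambda>s. - (k s * (q s * q s)))" for x y
  have "E 0 x = 0" if "x \<in> {0..l}" for x
  proof (rule additive_small_zero[where k = "\<lambda>s. \<bar>k s\<bar>" and l = l and E = E])
    show "(\<lambda>s. \<bar>k s\<bar>) integrable_on {0..l}" by (rule ik) auto
    show "E x z = E x y + E y z" if "0 \<le> x" "x \<le> y" "y \<le> z" "z \<le> l" for x y z
      using that Henstock_Kurzweil_Integration.integral_combine[of x y z "\<lambda>s. k s * (q s * q s)"]
        ik(1)[of x z] by (simp add: E_def)
    fix e :: real assume e: "e > 0"
    have "compact (q ` {0..l})" using qc by (intro compact_continuous_image) auto
    then obtain Q0 where Q0: "\<forall>y\<in>q ` {0..l}. norm y \<le> Q0"
      using compact_imp_bounded bounded_iff by blast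
    define Q where "Q = max Q0 1"
    have Q: "Q > 0" "\<And>x. x \<in> {0..l} \<Longrightarrow> \<bar>q x\<bar> \<le> Q" using Q0 by (auto simp: Q_def le_max_iff_disj)
    \<comment> \<open>Two replacements of q s by an end value occur, each multiplied by a value of
      q, which Q bounds.\<close>
    have "e / (2 * Q) > 0" using e Q by simp
    then obtain d where d: "d > 0" "\<And>x y. x \<in> {0..l} \<Longrightarrow> y \<in> {0..l} \<Longrightarrow> \<bar>y - x\<bar> < d \<Longrightarrow> \<bar>q y - q x\<bar> < e / (2 * Q)"
      using uniform_modulus[OF qc] by metis
    have "\<bar>E x y\<bar> \<le> e * integral {x..y} (\<lambda>s. \<bar>k s\<bar>)"
      if xy: "0 \<le> x" "x \<le> y" "y \<le> l" "y - x < d" for x y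
    proof -
      have nz: "h x > 0" "h y > 0" using pos xy by auto
      have "q y - q x = - ((h y - h x) * (q x * q y))"
        using nz by (simp add: q_def field_simps)
      also have "h y - h x = integral {x..y} k" by (rule prim_increment[OF h xy(1-3)])
      finally have "E x y = - (integral {x..y} k * (q x * q y)) - integral {x..y} (\<lambda>s. - (k s * (q s * q s)))"
        by (simp add: E_def)
      also have "\<dots> = integral {x..y} (\<lambda>s. - (k s * (q x * q y))) - integral {x..y} (\<lambda>s. - (k s * (q s * q s)))"
        by simp
      also have "\<dots> = integral {x..y} (\<lambda>s. - (k s * (q x * q y)) - - (k s * (q s * q s)))"
        using ik[OF xy(1,3)] by (intro integral_diff[symmetric] integrable_neg integrable_on_mult_left)
      also have "norm \<dots> \<le> integral {x..y} (\<lambda>s. e * \<bar>k s\<bar>)"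
      proof (rule Henstock_Kurzweil_Integration.integral_norm_bound_integral)
        show "(\<lambda>s. - (k s * (q x * q y)) - - (k s * (q s * q s))) integrable_on {x..y}"
          using ik[OF xy(1,3)] by (intro integrable_diff integrable_neg integrable_on_mult_left)
        show "(\<lambda>s. e * \<bar>k s\<bar>) integrable_on {x..y}"
          using ik(3)[OF xy(1,3)] by (rule integrable_on_mult_right)
        fix s assume s: "s \<in> {x..y}"
        have m: "x \<in> {0..l}" "y \<in> {0..l}" "s \<in> {0..l}" using s xy by auto
        have A: "\<bar>q s - q x\<bar> \<le> e / (2 * Q)" "\<bar>q s - q y\<bar> \<le> e / (2 * Q)"
          using d(2)[OF m(1,3)] d(2)[OF m(2,3)] s xy by auto
        have "\<bar>q s * (q s - q x)\<bar> \<le> Q * (e / (2 * Q))" "\<bar>q x * (q s - q y)\<bar> \<le> Q * (e / (2 * Q))"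
          unfolding abs_mult
          by (rule mult_mono[OF Q(2)[OF m(3)] A(1)] mult_mono[OF Q(2)[OF m(1)] A(2)];
              simp add: less_imp_le[OF Q(1)])+
        moreover have "Q * (e / (2 * Q)) = e / 2" using Q(1) by simp
        ultimately have "\<bar>q s * (q s - q x) + q x * (q s - q y)\<bar> \<le> e" by linarith
        then have "\<bar>q s * q s - q x * q y\<bar> \<le> e" by (simp add: algebra_simps)
        then have "\<bar>k s\<bar> * \<bar>q s * q s - q x * q y\<bar> \<le> \<bar>k s\<bar> * e" by (rule mult_left_mono) simp
        then show "norm (- (k s * (q x * q y)) - - (k s * (q s * q s))) \<le> e * \<bar>k s\<bar>"
          unfolding abs_mult[symmetric] by (simp add: algebra_simps)
      qed
      finally show ?thesis by simp
    qed
    then show "\<exists>d>0. \<forall>x y. 0 \<le> x \<longrightarrow> x \<le> y \<longrightarrow> y \<le> l \<longrightarrow> y - x < d \<longrightarrow>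
        \<bar>E x y\<bar> \<le> e * integral {x..y} (\<lambda>s. \<bar>k s\<bar>)"
      using d(1) by blast
  qed (use that in auto)
  then have "q x = q 0 + integral {0..x} (\<lambda>s. - (k s * (q s * q s)))" if "x \<in> {0..l}" for x
    using that unfolding E_def by fastforce
  with ai have "prim l q (\<lambda>s. - (k s * (q s * q s)))" by (rule primI)
  then show ?thesis by (simp only: q_def[abs_def])
qed

section \<open>Products, inverses and linear operators for jets\<close>

context jets
begin

lemma J_add: "x \<in> {0..l} \<Longrightarrow> J k (e + f) x = J k e x + J k f x"
  using J_lin[of x k 1 e 1 f] by simp

lemma J_scale: "x \<in> {0..l} \<Longrightarrow> J k (a *\<^sub>R e) x = a * J k e x"
  using J_lin[of x k a e 0 e] by simp

lemma bounded_linear_J_toC: "bounded_linear (\<lambda>e. toC l (J (Suc k) e))"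
proof -
  from J_sup_bound[of k] obtain C where C: "\<And>e x. x \<in> {0..l} \<Longrightarrow> \<bar>J (Suc k) e x\<bar> \<le> C * norm e" by blast
  show ?thesis by (rule bounded_linear_toC[OF less_imp_le[OF l] J_continuous J_lin C])
qed

lemma J_toC: "x \<in> {0..l} \<Longrightarrow> apply_bcontfun (toC l (J (Suc k) e)) x = J (Suc k) e x"
  by (rule toC_apply[OF J_continuous])

definition cJ :: "cfun \<Rightarrow> jet" where
  "cJ f = (0, (0, 0, f))"

lemma J_0_cJ: "J 0 (cJ f) x = f x"
  by (simp add: jval_0 cJ_def)

lemma bounded_linear_cJ: "bounded_linear cJ"
  unfolding cJ_def[abs_def] by (intro bounded_linear_Pair bounded_linear_zero bounded_linear_ident)

text \<open>The lifting step of the constructions below: they are made for the derivative one level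
  lower and then integrated.\<close>

lemma J_cons:
  assumes e: "prim l f f'" "f 0 = a" and j: "\<And>x. x \<in> {0..l} \<Longrightarrow> J k e x = f' x" and x: "x \<in> {0..l}"
  shows "J (Suc k) (consJ a e) x = f x"
proof -
  have "integral {0..x} (J k e) = integral {0..x} f'"
    using x j by (intro Henstock_Kurzweil_Integration.integral_cong) auto
  then show ?thesis using prim_eq[OF e(1) x] e(2) by simp
qed

text \<open>At the bottom, a function of level 1 is continuous and is stored entirely in the third
  coefficient; higher levels follow by acting on the derivative.\<close>

lemma inclusion:
  "\<exists>I. bounded_linear I \<and> (\<forall>e. \<forall>x\<in>{0..l}. J k (I e) x = J (Suc k) e x)"
proof (induction k)
  case 0
  show ?case
  proof (intro exI conjI allI ballI)
    show "bounded_linear (\<lambda>e. cJ (toC l (J (Suc 0) e)))"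
      by (rule bounded_linear_compose[OF bounded_linear_cJ bounded_linear_J_toC])
    show "J 0 (cJ (toC l (J (Suc 0) e))) x = J (Suc 0) e x" if "x \<in> {0..l}" for e x
      unfolding J_0_cJ by (rule J_toC[OF that])
  qed
next
  case (Suc k)
  then obtain I where I: "bounded_linear I" "\<And>e x. x \<in> {0..l} \<Longrightarrow> J k (I e) x = J (Suc k) e x" by blast
  show ?case
  proof (intro exI conjI allI ballI)
    show "bounded_linear (\<lambda>e. consJ (hdJ e) (I (tlJ e)))"
      by (intro bounded_linear_consJ_comp bounded_linear_hdJ bounded_linear_compose[OF I(1) bounded_linear_tlJ])
    show "J (Suc k) (consJ (hdJ e) (I (tlJ e))) x = J (Suc (Suc k)) e x" if "x \<in> {0..l}" for e x
      by (rule J_cons[OF J_prim J_at_0 I(2) that])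
  qed
qed

text \<open>Products of p and r with each other leave the space, so at level 0 one factor must be
  continuous; this is why the first statement has unequal levels. The product rule for two factors
  of level k + 1 involves only such unequal products at level k, and integrating them gives the
  second statement.\<close>

lemma product_1: "\<exists>M. bounded_bilinear M \<and> (\<forall>e f. \<forall>x\<in>{0..l}. J k (M e f) x = J (Suc k) e x * J k f x)"
  and product: "\<exists>M. bounded_bilinear M \<and> (\<forall>e f. \<forall>x\<in>{0..l}. J (Suc k) (M e f) x = J (Suc k) e x * J (Suc k) f x)"
proof -
  have step: "\<exists>M. bounded_bilinear M \<and> (\<forall>e f. \<forall>x\<in>{0..l}. J (Suc k) (M e f) x = J (Suc k) e x * J (Suc k) f x)"
    if M: "bounded_bilinear M" "\<And>e f x. x \<in> {0..l} \<Longrightarrow> J k (M e f) x = J (Suc k) e x * J k f x" for k M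
  proof (intro exI conjI allI ballI)
    show "bounded_bilinear (\<lambda>e f. consJ (hdJ e * hdJ f) (M f (tlJ e) + M e (tlJ f)))"
      by (intro bounded_bilinear_consJ_comp bounded_bilinear_add
          bounded_bilinear.comp[OF bounded_bilinear_mult bounded_linear_hdJ bounded_linear_hdJ]
          bounded_bilinear.comp[OF bounded_bilinear.flip[OF M(1)] bounded_linear_tlJ bounded_linear_ident]
          bounded_bilinear.comp[OF M(1) bounded_linear_ident bounded_linear_tlJ])
    fix e f x assume x: "x \<in> {0..l}"
    show "J (Suc k) (consJ (hdJ e * hdJ f) (M f (tlJ e) + M e (tlJ f))) x = J (Suc k) e x * J (Suc k) f x"
    proof (rule J_cons[OF prim_mult[OF J_prim J_prim] _ _ x])
      show "J (Suc k) e 0 * J (Suc k) f 0 = hdJ e * hdJ f" by (simp only: J_at_0)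
      show "J k (M f (tlJ e) + M e (tlJ f)) y = J k (tlJ e) y * J (Suc k) f y + J k (tlJ f) y * J (Suc k) e y"
        if "y \<in> {0..l}" for y
        unfolding J_add[OF that] M(2)[OF that] by (simp only: mult.commute)
    qed
  qed
  have p1: "\<exists>M. bounded_bilinear M \<and> (\<forall>e f. \<forall>x\<in>{0..l}. J k (M e f) x = J (Suc k) e x * J k f x)" for k
  proof (induction k)
    case 0
    define a where "a e = toC l (J (Suc 0) e)" for e
    have al: "bounded_linear a" unfolding a_def[abs_def] by (rule bounded_linear_J_toC)
    have bl: "bounded_linear (\<lambda>f::jet. fst (snd f))" "bounded_linear (\<lambda>f::jet. fst (snd (snd f)))"
      "bounded_linear (\<lambda>f::jet. snd (snd (snd f)))"
      by (intro bounded_linear_compose[OF bounded_linear_fst] bounded_linear_compose[OF bounded_linear_snd]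
          bounded_linear_snd)+
    note B = bounded_bilinear.comp[OF bounded_bilinear_mulC al]
    show ?case
    proof (intro exI conjI allI ballI)
      show "bounded_bilinear (\<lambda>e (f::jet). (0 :: nat \<Rightarrow>\<^sub>C real,
          (mulC (a e) (fst (snd f)), mulC (a e) (fst (snd (snd f))), mulC (a e) (snd (snd (snd f))))))"
        by (intro bounded_bilinear_Pair B[OF bl(1)] B[OF bl(2)] B[OF bl(3)]
            bounded_bilinear_compose[OF bounded_linear_zero B[OF bl(1)]])
      show "J 0 (0, (mulC (a e) (fst (snd f)), mulC (a e) (fst (snd (snd f))), mulC (a e) (snd (snd (snd f))))) x
          = J (Suc 0) e x * J 0 f x" if "x \<in> {0..l}" for e f x
        using J_toC[OF that, of 0 e] by (simp add: jval_0 mulC_apply a_def algebra_simps del: jval.simps(2))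
    qed
  next
    case (Suc k)
    then obtain M where M: "bounded_bilinear M" "\<And>e f x. x \<in> {0..l} \<Longrightarrow> J k (M e f) x = J (Suc k) e x * J k f x" by blast
    from step[OF this] obtain N where N: "bounded_bilinear N"
      "\<And>e f x. x \<in> {0..l} \<Longrightarrow> J (Suc k) (N e f) x = J (Suc k) e x * J (Suc k) f x" by blast
    from inclusion[of "Suc k"] obtain I where I: "bounded_linear I"
      "\<And>e x. x \<in> {0..l} \<Longrightarrow> J (Suc k) (I e) x = J (Suc (Suc k)) e x" by blast
    show ?case
    proof (intro exI conjI allI ballI)
      show "bounded_bilinear (\<lambda>e f. N (I e) f)"
        by (rule bounded_bilinear.comp[OF N(1) I(1) bounded_linear_ident])
      show "J (Suc k) (N (I e) f) x = J (Suc (Suc k)) e x * J (Suc k) f x" if "x \<in> {0..l}" for e f x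
        unfolding N(2)[OF that] I(2)[OF that] ..
    qed
  qed
  then show "\<exists>M. bounded_bilinear M \<and> (\<forall>e f. \<forall>x\<in>{0..l}. J k (M e f) x = J (Suc k) e x * J k f x)" .
  from p1[of k] obtain M where "bounded_bilinear M" "\<And>e f x. x \<in> {0..l} \<Longrightarrow> J k (M e f) x = J (Suc k) e x * J k f x" by blast
  from step[OF this]
  show "\<exists>M. bounded_bilinear M \<and> (\<forall>e f. \<forall>x\<in>{0..l}. J (Suc k) (M e f) x = J (Suc k) e x * J (Suc k) f x)" .
qed

lemma smooth_jet:
  assumes "\<And>k. Ck_on k {0..l} m"
  shows "\<exists>e. \<forall>x\<in>{0..l}. J k e x = m x"
  using assms
proof (induction k arbitrary: m)
  case 0
  have "continuous_on {0..l} m" by (rule Ck_on_continuous[OF 0])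
  then have "\<forall>x\<in>{0..l}. J 0 (cJ (toC l m)) x = m x" unfolding J_0_cJ using toC_apply by blast
  then show ?case by blast
next
  case (Suc k)
  have nt: "at t within {0..l} \<noteq> bot" if "t \<in> {0..l}" for t
    using l that by (simp add: trivial_limit_within islimpt_Icc)
  obtain D where D: "D 0 = m" "\<And>k t. t \<in> {0..l} \<Longrightarrow> (D k has_vector_derivative D (Suc k) t) (at t within {0..l})"
    "\<And>k j. Ck_on j {0..l} (D k)"
    using Ck_on_sequence[OF nt Suc.prems] by metis
  from Suc.IH[OF D(3)[of _ 1]] obtain e where e: "\<And>x. x \<in> {0..l} \<Longrightarrow> J k e x = D 1 x" by blast
  have "prim l m (D 1)"
    using D(2)[of _ 0] by (intro prim_C1 Ck_on_continuous[OF D(3)])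
      (simp add: D(1) has_real_derivative_iff_has_vector_derivative)
  from J_cons[OF this refl e] show ?case by blast
qed

text \<open>Provides the initial value of the reciprocal height. The derivative - f' / f^2 is the
  jet of f' multiplied by a continuous function when k = 0, and for higher k by the square of the
  reciprocal already found one level lower.\<close>

lemma inverse_jet:
  assumes "\<And>x. x \<in> {0..l} \<Longrightarrow> 0 < J (Suc k) e x"
  shows "\<exists>f. \<forall>x\<in>{0..l}. J (Suc k) f x = 1 / J (Suc k) e x"
  using assms
proof (induction k arbitrary: e)
  case 0
  define q where "q = toC l (\<lambda>x. - (1 / J (Suc 0) e x * (1 / J (Suc 0) e x)))"
  have nz: "\<forall>x\<in>{0..l}. J (Suc 0) e x \<noteq> 0" using 0 by fastforce
  have qc: "continuous_on {0..l} (\<lambda>x. - (1 / J (Suc 0) e x * (1 / J (Suc 0) e x)))"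
    by (intro continuous_on_minus continuous_on_mult continuous_on_divide continuous_on_const J_continuous nz)
  define f where "f = (0 :: nat \<Rightarrow>\<^sub>C real, (mulC q (fst (snd (tlJ e))), mulC q (fst (snd (snd (tlJ e)))), mulC q (snd (snd (snd (tlJ e))))))"
  have "J 0 f x = - (J 0 (tlJ e) x * (1 / J (Suc 0) e x * (1 / J (Suc 0) e x)))" if x: "x \<in> {0..l}" for x
  proof -
    have "J 0 f x = apply_bcontfun q x * J 0 (tlJ e) x"
      by (simp add: f_def jval_0 mulC_apply algebra_simps)
    also have "apply_bcontfun q x = - (1 / J (Suc 0) e x * (1 / J (Suc 0) e x))"
      unfolding q_def by (rule toC_apply[OF qc x])
    finally show ?thesis by (simp only: minus_mult_left mult.commute)
  qed
  from J_cons[OF prim_inverse[OF J_prim 0] refl this] show ?case by blast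
next
  case (Suc k)
  from inclusion[of "Suc k"] obtain I where I: "\<And>e x. x \<in> {0..l} \<Longrightarrow> J (Suc k) (I e) x = J (Suc (Suc k)) e x" by blast
  have "0 < J (Suc k) (I e) x" if "x \<in> {0..l}" for x using I[OF that, of e] Suc.prems[OF that] by simp
  from Suc.IH[OF this] obtain g where g: "\<And>x. x \<in> {0..l} \<Longrightarrow> J (Suc k) g x = 1 / J (Suc k) (I e) x" by blast
  from product[of k] obtain N where N: "\<And>e f x. x \<in> {0..l} \<Longrightarrow> J (Suc k) (N e f) x = J (Suc k) e x * J (Suc k) f x" by blast
  define f where "f = (-1) *\<^sub>R N (tlJ e) (N g g)"
  have "J (Suc k) f x = - (J (Suc k) (tlJ e) x * (1 / J (Suc (Suc k)) e x * (1 / J (Suc (Suc k)) e x)))" if x: "x \<in> {0..l}" for x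
    unfolding f_def J_scale[OF x] N[OF x] g[OF x] I[OF x] by (simp del: jval.simps)
  from J_cons[OF prim_inverse[OF J_prim Suc.prems] refl this] show ?case by blast
qed

text \<open>Expresses that a family of functions depends on its parameter through a bounded linear
  map into jets. Solution operators given by formulas on functions become operators on the state
  space in this way, and only values on {0..l} have to match.\<close>

definition lin :: "nat \<Rightarrow> ('e::real_normed_vector \<Rightarrow> real \<Rightarrow> real) \<Rightarrow> bool" where
  "lin k \<phi> \<longleftrightarrow> (\<exists>Y. bounded_linear Y \<and> (\<forall>e. \<forall>x\<in>{0..l}. \<phi> e x = J k (Y e) x))"

lemma linI: "bounded_linear Y \<Longrightarrow> (\<And>e x. x \<in> {0..l} \<Longrightarrow> \<phi> e x = J k (Y e) x) \<Longrightarrow> lin k \<phi>"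
  unfolding lin_def by blast

lemma lin_Suc: assumes "lin (Suc k) \<phi>" shows "lin k \<phi>"
proof -
  obtain Y where Y: "bounded_linear Y" "\<And>e x. x \<in> {0..l} \<Longrightarrow> \<phi> e x = J (Suc k) (Y e) x"
    using assms unfolding lin_def by blast
  from inclusion[of k] obtain I where I: "bounded_linear I"
    "\<And>e x. x \<in> {0..l} \<Longrightarrow> J k (I e) x = J (Suc k) e x" by blast
  show ?thesis
    by (rule linI[OF bounded_linear_compose[OF I(1) Y(1)]]) (simp only: Y(2) I(2))
qed

lemma lin_le: "j \<le> k \<Longrightarrow> lin k \<phi> \<Longrightarrow> lin j \<phi>"
  by (induction rule: inc_induct) (auto intro: lin_Suc)

lemma lin_add:
  assumes "lin k \<phi>" "lin k \<psi>"
  shows "lin k (\<lambda>e x. \<phi> e x + \<psi> e x)"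
proof -
  obtain Y where Y: "bounded_linear Y" "\<And>e x. x \<in> {0..l} \<Longrightarrow> \<phi> e x = J k (Y e) x"
    using assms(1) unfolding lin_def by blast
  obtain Z where Z: "bounded_linear Z" "\<And>e x. x \<in> {0..l} \<Longrightarrow> \<psi> e x = J k (Z e) x"
    using assms(2) unfolding lin_def by blast
  show ?thesis
    by (rule linI[OF bounded_linear_add[OF Y(1) Z(1)]]) (simp only: Y(2) Z(2) J_add)
qed

lemma lin_smooth_mult:
  assumes "lin k \<phi>" and m: "\<And>k. Ck_on k {0..l} m"
  shows "lin k (\<lambda>e x. m x * \<phi> e x)"
proof -
  obtain Y where Y: "bounded_linear Y" "\<And>e x. x \<in> {0..l} \<Longrightarrow> \<phi> e x = J k (Y e) x"
    using assms(1) unfolding lin_def by blast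
  from smooth_jet[OF m, of "Suc k"] obtain c where c: "\<And>x. x \<in> {0..l} \<Longrightarrow> J (Suc k) c x = m x" by blast
  from product_1[of k] obtain M where M: "bounded_bilinear M"
    "\<And>e f x. x \<in> {0..l} \<Longrightarrow> J k (M e f) x = J (Suc k) e x * J k f x" by blast
  show ?thesis
    by (rule linI[OF bounded_linear_compose[OF bounded_bilinear.bounded_linear_right[OF M(1), of c] Y(1)]])
       (simp only: Y(2) M(2) c)
qed

lemma lin_prim:
  assumes "lin k \<phi>'" "\<And>e. prim l (\<phi> e) (\<phi>' e)" "bounded_linear (\<lambda>e. \<phi> e 0)"
  shows "lin (Suc k) \<phi>"
proof -
  obtain Y where Y: "bounded_linear Y" "\<And>e x. x \<in> {0..l} \<Longrightarrow> \<phi>' e x = J k (Y e) x"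
    using assms(1) unfolding lin_def by blast
  show ?thesis
    by (rule linI[OF bounded_linear_consJ_comp[OF assms(3) Y(1)]])
       (rule J_cons[OF assms(2) refl Y(2)[symmetric], symmetric])
qed

lemma lin_toC:
  assumes "bounded_linear (\<lambda>e. toC l (\<phi> e))" "\<And>e. continuous_on {0..l} (\<phi> e)"
  shows "lin 0 \<phi>"
  by (rule linI[OF bounded_linear_compose[OF bounded_linear_cJ assms(1)]])
     (simp only: J_0_cJ toC_apply[OF assms(2)])

lemma lin_Suc_properties:
  assumes "lin (Suc k) \<phi>"
  shows "continuous_on {0..l} (\<phi> e)"
    and "x \<in> {0..l} \<Longrightarrow> \<phi> (a *\<^sub>R e + b *\<^sub>R f) x = a * \<phi> e x + b * \<phi> f x"
    and "\<exists>C\<ge>0. \<forall>e. \<forall>x\<in>{0..l}. \<bar>\<phi> e x\<bar> \<le> C * norm e"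
proof -
  obtain Y where Y: "bounded_linear Y" "\<And>e x. x \<in> {0..l} \<Longrightarrow> \<phi> e x = J (Suc k) (Y e) x"
    using assms unfolding lin_def by blast
  show "continuous_on {0..l} (\<phi> e)"
    by (rule continuous_on_eq[OF J_continuous Y(2)[symmetric]])
  show "x \<in> {0..l} \<Longrightarrow> \<phi> (a *\<^sub>R e + b *\<^sub>R f) x = a * \<phi> e x + b * \<phi> f x"
    using bounded_linear.linear[OF Y(1)] by (simp only: Y(2) linear_add linear_scale J_lin)
  from J_sup_bound[of k] obtain S where S: "S \<ge> 0" "\<And>e x. x \<in> {0..l} \<Longrightarrow> \<bar>J (Suc k) e x\<bar> \<le> S * norm e" by blast
  obtain K where K: "K \<ge> 0" "\<And>e. norm (Y e) \<le> norm e * K"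
    using bounded_linear.nonneg_bounded[OF Y(1)] by blast
  show "\<exists>C\<ge>0. \<forall>e. \<forall>x\<in>{0..l}. \<bar>\<phi> e x\<bar> \<le> C * norm e"
  proof (intro exI[of _ "S * K"] conjI allI ballI)
    fix e x assume x: "x \<in> {0..l}"
    have "\<bar>\<phi> e x\<bar> \<le> S * norm (Y e)" unfolding Y(2)[OF x] by (rule S(2)[OF x])
    also have "\<dots> \<le> S * (norm e * K)" by (rule mult_left_mono[OF K(2) S(1)])
    finally show "\<bar>\<phi> e x\<bar> \<le> S * K * norm e" by (simp add: ac_simps)
  qed (use S K in simp)
qed

end

locale jets_bvp = jets l p r + bvp l m11 m12 m21 m22 \<rho>
  for l :: real and p r m11 m12 m21 m22 \<rho> :: "real \<Rightarrow> real" +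
  assumes smooth: "\<And>k. Ck_on k {0..l} m11" "\<And>k. Ck_on k {0..l} m12"
    "\<And>k. Ck_on k {0..l} m21" "\<And>k. Ck_on k {0..l} m22"
begin

text \<open>The sup bound of \<open>dir_bound\<close> places the solution operator at level 0. The
  differential equations express the derivatives of the solution by smooth multiples of it and the
  data, so each integration raises the level by one, until the data stop this at one level above
  their own.\<close>

lemma lin_dir:
  assumes d: "lin (Suc k) d1" "lin (Suc k) d2"
  shows "lin (Suc (Suc k)) (\<lambda>e. dir1 (d1 e) (d2 e) 0 0)" "lin (Suc (Suc k)) (\<lambda>e. dir2 (d1 e) (d2 e) 0 0)"
proof -
  define y1 where "y1 e = dir1 (d1 e) (d2 e) 0 0" for e
  define y2 where "y2 e = dir2 (d1 e) (d2 e) 0 0" for e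
  note dc = lin_Suc_properties(1)[OF d(1)] lin_Suc_properties(1)[OF d(2)]
  have s: "sol (d1 e) (d2 e) (y1 e) (y2 e)" for e
    unfolding y1_def y2_def by (rule dir_sol[OF dc])
  note yc = sol_continuous[OF s]
  have lin: "y1 (a *\<^sub>R e + b *\<^sub>R f) x = a * y1 e x + b * y1 f x"
    "y2 (a *\<^sub>R e + b *\<^sub>R f) x = a * y2 e x + b * y2 f x" if x: "x \<in> {0..l}" for a b e f x
    unfolding y1_def y2_def
    by (rule dir_lin[OF dc dc dc lin_Suc_properties(2)[OF d(1)] lin_Suc_properties(2)[OF d(2)] x]; assumption)+
  from lin_Suc_properties(3)[OF d(1)] obtain C1 where C1: "C1 \<ge> 0" "\<And>e x. x \<in> {0..l} \<Longrightarrow> \<bar>d1 e x\<bar> \<le> C1 * norm e" by blast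
  from lin_Suc_properties(3)[OF d(2)] obtain C2 where C2: "C2 \<ge> 0" "\<And>e x. x \<in> {0..l} \<Longrightarrow> \<bar>d2 e x\<bar> \<le> C2 * norm e" by blast
  have "\<exists>C\<ge>0. \<forall>d1 d2 M x. continuous_on {0..l} d1 \<longrightarrow> continuous_on {0..l} d2 \<longrightarrow>
      (\<forall>x\<in>{0..l}. \<bar>d1 x\<bar> \<le> M) \<longrightarrow> (\<forall>x\<in>{0..l}. \<bar>d2 x\<bar> \<le> M) \<longrightarrow> x \<in> {0..l} \<longrightarrow>
      \<bar>dir1 d1 d2 0 0 x\<bar> \<le> C * M \<and> \<bar>dir2 d1 d2 0 0 x\<bar> \<le> C * M"
  proof (rule dir_bound)
    fix C :: real
    assume C0: "0 \<le> C" and C: "\<And>d1 d2 M x. continuous_on {0..l} d1 \<Longrightarrow> continuous_on {0..l} d2 \<Longrightarrow>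
      (\<And>x. x \<in> {0..l} \<Longrightarrow> \<bar>d1 x\<bar> \<le> M) \<Longrightarrow> (\<And>x. x \<in> {0..l} \<Longrightarrow> \<bar>d2 x\<bar> \<le> M) \<Longrightarrow> x \<in> {0..l} \<Longrightarrow>
      \<bar>dir1 d1 d2 0 0 x\<bar> \<le> C * M \<and> \<bar>dir2 d1 d2 0 0 x\<bar> \<le> C * M"
    show ?thesis
    proof (rule exI[of _ C], rule conjI[OF C0], intro allI impI)
      fix d1 d2 :: "real \<Rightarrow> real" and M x :: real
      assume d: "continuous_on {0..l} d1" "continuous_on {0..l} d2"
        "\<forall>x\<in>{0..l}. \<bar>d1 x\<bar> \<le> M" "\<forall>x\<in>{0..l}. \<bar>d2 x\<bar> \<le> M" "x \<in> {0..l}"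
      show "\<bar>dir1 d1 d2 0 0 x\<bar> \<le> C * M \<and> \<bar>dir2 d1 d2 0 0 x\<bar> \<le> C * M"
        by (rule C[OF d(1,2) bspec[OF d(3)] bspec[OF d(4)] d(5)])
    qed
  qed
  then obtain C where C: "\<forall>d1 d2 M x. continuous_on {0..l} d1 \<longrightarrow> continuous_on {0..l} d2 \<longrightarrow>
      (\<forall>x\<in>{0..l}. \<bar>d1 x\<bar> \<le> M) \<longrightarrow> (\<forall>x\<in>{0..l}. \<bar>d2 x\<bar> \<le> M) \<longrightarrow> x \<in> {0..l} \<longrightarrow>
      \<bar>dir1 d1 d2 0 0 x\<bar> \<le> C * M \<and> \<bar>dir2 d1 d2 0 0 x\<bar> \<le> C * M" by (elim exE conjE) (rule that)
  have m: "C1 * norm e \<le> (C1 + C2) * norm e" "C2 * norm e \<le> (C1 + C2) * norm e" for e :: 'a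
    using C1(1) C2(1) by (auto intro!: mult_right_mono)
  have b: "\<bar>y1 e x\<bar> \<le> C * (C1 + C2) * norm e \<and> \<bar>y2 e x\<bar> \<le> C * (C1 + C2) * norm e" if "x \<in> {0..l}" for e x
    unfolding y1_def y2_def mult.assoc
    by (rule C[rule_format, OF dc order_trans[OF C1(2) m(1)] order_trans[OF C2(2) m(2)] that])
  have bl: "bounded_linear (\<lambda>e. toC l (y1 e))" "bounded_linear (\<lambda>e. toC l (y2 e))"
    by (rule bounded_linear_toC[OF less_imp_le[OF l] yc(1) lin(1) conjunct1[OF b]], assumption+)
       (rule bounded_linear_toC[OF less_imp_le[OF l] yc(2) lin(2) conjunct2[OF b]], assumption+)
  have z: "bounded_linear (\<lambda>e. y1 e 0)" "bounded_linear (\<lambda>e. y2 e 0)"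
    using bounded_linear_compose[OF bounded_linear_apply_bcontfun[of 0] bl(1)]
      bounded_linear_compose[OF bounded_linear_apply_bcontfun[of 0] bl(2)] l
    by (simp_all add: toC_apply yc)
  have "lin j y1 \<and> lin j y2" if "j \<le> Suc (Suc k)" for j
    using that
  proof (induction j)
    case 0
    show ?case using lin_toC[OF bl(1) yc(1)] lin_toC[OF bl(2) yc(2)] by blast
  next
    case (Suc j)
    then have y: "lin j y1" "lin j y2" and dj: "lin j d1" "lin j d2" using lin_le[OF _ d(1)] lin_le[OF _ d(2)] by auto
    have L: "lin j (\<lambda>e x. m11 x * y1 e x + m12 x * y2 e x + d1 e x)" "lin j (\<lambda>e x. m21 x * y1 e x + m22 x * y2 e x + d2 e x)"
      by (rule lin_add[OF lin_add[OF lin_smooth_mult[OF y(1) smooth(1)] lin_smooth_mult[OF y(2) smooth(2)]] dj(1)])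
         (rule lin_add[OF lin_add[OF lin_smooth_mult[OF y(1) smooth(3)] lin_smooth_mult[OF y(2) smooth(4)]] dj(2)])
    have P: "prim l (y1 e) (\<lambda>x. m11 x * y1 e x + m12 x * y2 e x + d1 e x)"
      "prim l (y2 e) (\<lambda>x. m21 x * y1 e x + m22 x * y2 e x + d2 e x)" for e
      by (rule prim_C1[OF solD(1)[OF s]], assumption, intro continuous_intros cont yc dc)
         (rule prim_C1[OF solD(2)[OF s]], assumption, intro continuous_intros cont yc dc)
    show ?case
      using lin_prim[where \<phi> = y1, OF L(1) P(1) z(1)] lin_prim[where \<phi> = y2, OF L(2) P(2) z(2)] by (rule conjI)
  qed
  then show "lin (Suc (Suc k)) (\<lambda>e. dir1 (d1 e) (d2 e) 0 0)" "lin (Suc (Suc k)) (\<lambda>e. dir2 (d1 e) (d2 e) 0 0)"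
    unfolding y1_def[abs_def] y2_def[abs_def] by blast+
qed

end

section \<open>Local existence\<close>

lemma at_within_time_nontrivial:
  assumes "t \<in> {0..<T::real}"
  shows "at t within {0..<T} \<noteq> bot"
proof -
  have "at t within {t..<T} \<noteq> bot"
    using assms by (simp add: trivial_limit_within islimpt_Ico)
  moreover have "at t within {t..<T} \<le> at t within {0..<T}"
    using assms by (intro at_le) auto
  ultimately show ?thesis by (auto simp: bot_unique)
qed

lemma at_within_Ici_nontrivial: "0 \<le> t \<Longrightarrow> at t within {0..} \<noteq> (bot :: real filter)"
proof -
  assume t: "0 \<le> t"
  have "at t within {0..<t + 1} \<le> at t within {0..}" by (rule at_le) auto
  then show "at t within {0..} \<noteq> bot"
    using at_within_time_nontrivial[of t "t + 1"] t by (auto simp: bot_unique)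
qed

lemma at_within_Icc_nontrivial: "t \<in> {0..T} \<Longrightarrow> 0 < T \<Longrightarrow> at t within {0..T} \<noteq> (bot :: real filter)"
  by (simp add: trivial_limit_within islimpt_Icc)

lemma Dcl_unique:
  assumes "at t within I \<noteq> bot" "(f has_real_derivative f') (at t within I)"
  shows "Dcl I f t = f'"
  unfolding Dcl_def using assms
  by (intro vector_derivative_within) (simp_all add: has_real_derivative_iff_has_vector_derivative)

lemma Dcl_smooth:
  assumes nt: "\<And>t. t \<in> I \<Longrightarrow> at t within I \<noteq> bot" and f: "smooth_on I f"
  shows "smooth_on I (Dcl I f)" "t \<in> I \<Longrightarrow> (f has_real_derivative Dcl I f t) (at t within I)"
proof -
  obtain D where D: "\<And>x. x \<in> I \<Longrightarrow> D (0::nat) x = f x"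
    "\<And>k x. x \<in> I \<Longrightarrow> (D k has_real_derivative D (Suc k) x) (at x within I)"
    using f unfolding smooth_on_def by blast
  have f1: "(f has_real_derivative D 1 t) (at t within I)" if "t \<in> I" for t
    using has_field_derivative_transform_within[OF D(2)[OF that, of 0] zero_less_one that D(1)] by simp
  have e: "Dcl I f t = D 1 t" if "t \<in> I" for t
    by (rule Dcl_unique[OF nt[OF that] f1[OF that]])
  then show "t \<in> I \<Longrightarrow> (f has_real_derivative Dcl I f t) (at t within I)" using f1 by simp
  show "smooth_on I (Dcl I f)"
    unfolding smooth_on_def using e D(2) by (intro exI[of _ "\<lambda>k. D (Suc k)"]) simp
qed

context bvp
begin

lemma dir_cong:
  assumes "continuous_on {0..l} d1" "continuous_on {0..l} d2" "continuous_on {0..l} e1" "continuous_on {0..l} e2"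
    "\<And>x. x \<in> {0..l} \<Longrightarrow> d1 x = e1 x" "\<And>x. x \<in> {0..l} \<Longrightarrow> d2 x = e2 x" "x \<in> {0..l}"
  shows "dir1 d1 d2 0 0 x = dir1 e1 e2 0 0 x" "dir2 d1 d2 0 0 x = dir2 e1 e2 0 0 x"
  using dir_lin[OF assms(3,4) assms(3,4) assms(1,2) _ _ assms(7), of 1 0] assms(5,6) by simp_all

lemma sol_Ck:
  assumes m: "\<And>k. Ck_on k {0..l} m11" "\<And>k. Ck_on k {0..l} m12" "\<And>k. Ck_on k {0..l} m21" "\<And>k. Ck_on k {0..l} m22"
    and y: "sol (\<lambda>x. 0) (\<lambda>x. 0) y1 y2"
  shows "Ck_on k {0..l} y1 \<and> Ck_on k {0..l} y2"
proof (induction k)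
  case 0
  show ?case using sol_continuous[OF y] by simp
next
  case (Suc k)
  note I = conjunct1[OF Suc] conjunct2[OF Suc]
  have "(y1 has_vector_derivative m11 x * y1 x + m12 x * y2 x) (at x within {0..l})"
    "(y2 has_vector_derivative m21 x * y1 x + m22 x * y2 x) (at x within {0..l})" if "x \<in> {0..l}" for x
    using solD[OF y that] by (simp_all add: has_real_derivative_iff_has_vector_derivative)
  from Ck_on_SucI[OF this(1) Ck_on_add[OF Ck_on_mult[OF m(1) I(1)] Ck_on_mult[OF m(2) I(2)]]]
    Ck_on_SucI[OF this(2) Ck_on_add[OF Ck_on_mult[OF m(3) I(1)] Ck_on_mult[OF m(4) I(2)]]]
  show ?case by (rule conjI)
qed

end

text \<open>The same form of differentiability as in \<open>smooth_curve\<close>; the undefined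
  quotient at s = t is excluded by the filter.\<close>

lemma has_vector_derivative_iff_quotient:
  "(f has_vector_derivative f') (at t within I) \<longleftrightarrow>
    ((\<lambda>s. norm ((1 / (s - t)) *\<^sub>R (f s - f t) - f')) \<longlongrightarrow> 0) (at t within I)"
proof -
  have "norm ((1 / (s - t)) *\<^sub>R (f s - f t) - f') = norm (f s - f t - (s - t) *\<^sub>R f') / norm (s - t)"
    if "s \<noteq> t" for s
  proof -
    have "(1 / (s - t)) *\<^sub>R (f s - f t) - f' = (1 / (s - t)) *\<^sub>R (f s - f t - (s - t) *\<^sub>R f')"
      using that by (simp add: scaleR_diff_right)
    then show ?thesis by (simp add: divide_inverse)
  qed
  then have "((\<lambda>s. norm ((1 / (s - t)) *\<^sub>R (f s - f t) - f')) \<longlongrightarrow> 0) (at t within I) \<longleftrightarrow>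
      ((\<lambda>s. norm (f s - f t - (s - t) *\<^sub>R f') / norm (s - t)) \<longlongrightarrow> 0) (at t within I)"
    by (intro Lim_cong_within refl) auto
  then show ?thesis
    unfolding has_vector_derivative_def has_derivative_iff_norm
    by (simp add: bounded_linear_scaleR_left)
qed

context jets
begin

lemma bounded_linear_J_eval:
  assumes "x \<in> {0..l}"
  shows "bounded_linear (\<lambda>e. J (Suc k) e x)"
proof -
  have "bounded_linear (\<lambda>e. apply_bcontfun (toC l (J (Suc k) e)) x)"
    by (rule bounded_linear_compose[OF bounded_linear_apply_bcontfun bounded_linear_J_toC])
  then show ?thesis by (simp only: J_toC[OF assms])
qed

text \<open>Evaluation at level k is linear, so difference quotients of the functions are the
  functions of the difference quotients, and \<open>J_Hnorm_bound\<close> carries the limits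
  over.\<close>

lemma jet_smooth_curve:
  assumes nt: "\<And>t. t \<in> I \<Longrightarrow> at t within I \<noteq> bot" and u: "\<And>k. Ck_on k I u"
  shows "smooth_curve l k I (\<lambda>t. J k (u t))"
proof -
  obtain D where D: "D 0 = u" "\<And>j t. t \<in> I \<Longrightarrow> (D j has_vector_derivative D (Suc j) t) (at t within I)"
    using Ck_on_sequence[OF nt u] by metis
  from J_Hnorm_bound[of k] obtain C where C: "C \<ge> 0" "\<And>e. (Hnorm l k (J k e))\<^sup>2 \<le> C * (norm e)\<^sup>2" by blast
  have C': "Hnorm l k (J k e) \<le> sqrt C * norm e" for e
  proof -
    have "(Hnorm l k (J k e))\<^sup>2 \<le> (sqrt C * norm e)\<^sup>2" using C by (simp add: power_mult_distrib)
    then show ?thesis by (rule power2_le_imp_le) (simp add: C(1))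
  qed
  have lim: "((\<lambda>s. Hnorm l k (\<lambda>x. (J k (D j s) x - J k (D j t) x) / (s - t) - J k (D (Suc j) t) x)) \<longlongrightarrow> 0) (at t within I)"
    if t: "t \<in> I" for j t
  proof -
    define R where "R s = (1 / (s - t)) *\<^sub>R (D j s - D j t) - D (Suc j) t" for s
    have "((\<lambda>s. norm (R s)) \<longlongrightarrow> 0) (at t within I)"
      using D(2)[OF t, of j] unfolding has_vector_derivative_iff_quotient R_def .
    then have R0: "((\<lambda>s. sqrt C * norm (R s)) \<longlongrightarrow> sqrt C * 0) (at t within I)"
      by (intro tendsto_mult tendsto_const)
    have eq: "Hnorm l k (\<lambda>x. (J k (D j s) x - J k (D j t) x) / (s - t) - J k (D (Suc j) t) x) = Hnorm l k (J k (R s))" for s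
    proof (rule Hnorm_AE_cong, rule AE_Ioo_all)
      fix x assume "x \<in> {0<..<l}"
      then have x: "x \<in> {0..l}" by simp
      have "J k (R s) x = J k ((1 / (s - t)) *\<^sub>R (1 *\<^sub>R D j s + (-1) *\<^sub>R D j t)) x + J k ((-1) *\<^sub>R D (Suc j) t) x"
        unfolding J_add[OF x, symmetric] by (simp add: R_def)
      also have "\<dots> = (1 / (s - t)) * (1 * J k (D j s) x + (-1) * J k (D j t) x) + (-1) * J k (D (Suc j) t) x"
        unfolding J_scale[OF x] J_lin[OF x] ..
      finally show "(J k (D j s) x - J k (D j t) x) / (s - t) - J k (D (Suc j) t) x = J k (R s) x"
        by simp
    qed
    show ?thesis unfolding eq
    proof (rule tendsto_sandwich[OF _ _ tendsto_const R0[unfolded mult_zero_right]])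
      show "eventually (\<lambda>s. 0 \<le> Hnorm l k (J k (R s))) (at t within I)" by (simp add: Hnorm_nonneg)
      show "eventually (\<lambda>s. Hnorm l k (J k (R s)) \<le> sqrt C * norm (R s)) (at t within I)" by (simp add: C')
    qed
  qed
  show ?thesis
    unfolding smooth_curve_def
    by (intro exI[of _ "\<lambda>j t. J k (D j t)"] conjI ballI allI) (simp_all only: D(1) J_Hs lim)
qed

end

section \<open>The linear system for the boundary discharges\<close>

context bottom
begin

text \<open>The data - 3 * f / H with f = 0 are left unsimplified so that these functions match the
  conclusion of \<open>dirichlet_unique\<close> syntactically.\<close>

abbreviation "sL1 \<equiv> D.dir1 (\<lambda>x. 0) (\<lambda>x. - 3 * 0 / H x) 1 0"
abbreviation "sL2 \<equiv> D.dir2 (\<lambda>x. 0) (\<lambda>x. - 3 * 0 / H x) 1 0"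
abbreviation "sR1 \<equiv> D.dir1 (\<lambda>x. 0) (\<lambda>x. - 3 * 0 / H x) 0 1"
abbreviation "sR2 \<equiv> D.dir2 (\<lambda>x. 0) (\<lambda>x. - 3 * 0 / H x) 0 1"

lemma s_sol:
  "D.sol (\<lambda>x. 0) (\<lambda>x. 0) sL1 sL2" "D.sol (\<lambda>x. 0) (\<lambda>x. 0) sR1 sR2"
  using D.dir_sol[of "\<lambda>x. 0" "\<lambda>x. - 3 * 0 / H x"] by (simp_all add: continuous_on_const)

lemma s_eq:
  assumes x: "x \<in> {0..l}"
  shows "s_left l h0 b x = sL1 x" "H x * Dw l (s_left l h0 b) x = sL2 x"
    "s_right l h0 b x = sR1 x" "H x * Dw l (s_right l h0 b) x = sR2 x"
  unfolding s_left_def s_right_def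
  by (rule dirichlet_sol_eq[OF continuous_on_const continuous_on_const x])+

definition "s11 = Dw l (s_left l h0 b) 0"
definition "s12 = Dw l (s_right l h0 b) 0"
definition "s21 = Dw l (s_left l h0 b) l"
definition "s22 = Dw l (s_right l h0 b) l"
definition "sdet = s11 * s22 - s12 * s21"

lemma ends: "0 \<in> {0..l}" "l \<in> {0..l}"
  using l by simp_all

text \<open>A kernel vector (x, y) makes the derivative of x s_left + y s_right vanish at both ends.
  By \<open>homogeneous_zero\<close> this combination vanishes, and its boundary values are x and
  y.\<close>

lemma Sb'_kernel:
  assumes "s11 * x + s12 * y = 0" "s21 * x + s22 * y = 0"
  shows "x = 0" "y = 0"
proof -
  have s: "D.sol (\<lambda>x. 0) (\<lambda>x. 0) (\<lambda>z. x * sL1 z + y * sR1 z) (\<lambda>z. x * sL2 z + y * sR2 z)"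
    by (rule D.sol_cong[OF D.sol_lin[OF s_sol]]) simp_all
  have "x * sL2 0 + y * sR2 0 = H 0 * (s11 * x + s12 * y)" "x * sL2 l + y * sR2 l = H l * (s21 * x + s22 * y)"
    unfolding s11_def s12_def s21_def s22_def
    using s_eq(2,4)[OF ends(1)] s_eq(2,4)[OF ends(2)] by (simp_all add: algebra_simps)
  then have z: "x * sL2 0 + y * sR2 0 = 0" "x * sL2 l + y * sR2 l = 0" using assms by simp_all
  have e: "(x * sL1 0 + y * sR1 0) * (x * sL2 0 + y * sR2 0) = 0" "(x * sL1 l + y * sR1 l) * (x * sL2 l + y * sR2 l) = 0"
    unfolding z by (rule mult_zero_right)+
  have "x * sL1 0 + y * sR1 0 = 0" "x * sL1 l + y * sR1 l = 0"
    by (rule D.homogeneous_zero(1)[OF s e ends(1)], rule D.homogeneous_zero(1)[OF s e ends(2)])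
  then show "x = 0" "y = 0" by (simp_all add: D.dir_boundary)
qed

lemma sdet_nz: "sdet \<noteq> 0"
proof
  assume d: "sdet = 0"
  \<comment> \<open>If the determinant vanishes, (s22, - s21) lies in the kernel, and below also
    (s12, - s11). Then all entries are 0 and (1, 0) lies in the kernel.\<close>
  have "s21 = 0 \<and> s22 = 0" using Sb'_kernel[of s22 "- s21"] d by (auto simp: sdet_def algebra_simps)
  moreover have "s11 = 0 \<and> s12 = 0" using Sb'_kernel[of s12 "- s11"] d by (auto simp: sdet_def algebra_simps)
  ultimately show False using Sb'_kernel[of 1 0] by simp
qed

lemma Sb'_solve:
  "Sb' l h0 b *v vector [x, y] = vector [r1, r2] \<longleftrightarrow>
    x = (s22 * r1 - s12 * r2) / sdet \<and> y = (s11 * r2 - s21 * r1) / sdet"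
proof -
  have "Sb' l h0 b *v vector [x, y] = vector [r1, r2] \<longleftrightarrow> s11 * x + s12 * y = r1 \<and> s21 * x + s22 * y = r2"
    by (simp add: Sb'_def vec_eq_iff forall_2 matrix_vector_mult_def sum_2 s11_def s12_def s21_def s22_def)
  also have "\<dots> \<longleftrightarrow> x = (s22 * r1 - s12 * r2) / sdet \<and> y = (s11 * r2 - s21 * r1) / sdet"
  proof
    assume "s11 * x + s12 * y = r1 \<and> s21 * x + s22 * y = r2"
    then have "sdet * x = s22 * r1 - s12 * r2" "sdet * y = s11 * r2 - s21 * r1"
      by (auto simp: sdet_def algebra_simps)
    then show "x = (s22 * r1 - s12 * r2) / sdet \<and> y = (s11 * r2 - s21 * r1) / sdet"
      using sdet_nz by (simp add: field_simps)
  next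
    assume "x = (s22 * r1 - s12 * r2) / sdet \<and> y = (s11 * r2 - s21 * r1) / sdet"
    then have xy: "sdet * x = s22 * r1 - s12 * r2" "sdet * y = s11 * r2 - s21 * r1"
      using sdet_nz by simp_all
    have "sdet * (s11 * x + s12 * y) = s11 * (sdet * x) + s12 * (sdet * y)"
      "sdet * (s21 * x + s22 * y) = s21 * (sdet * x) + s22 * (sdet * y)" by (simp_all add: algebra_simps)
    then have "sdet * (s11 * x + s12 * y) = sdet * r1" "sdet * (s21 * x + s22 * y) = sdet * r2"
      unfolding xy by (simp_all add: sdet_def algebra_simps)
    then show "s11 * x + s12 * y = r1 \<and> s21 * x + s22 * y = r2" using sdet_nz by simp
  qed
  finally show ?thesis .
qed

text \<open>One row of the boundary equations with \<open>Vbdry\<close> moved to the right: v stands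
  for the boundary value of R1 and dB for that of the derivative of R0 B. The height in it is that
  of the prescribed elevation g.\<close>

definition rhs_bdry :: "real \<Rightarrow> (real \<Rightarrow> real) \<Rightarrow> real \<Rightarrow> real \<Rightarrow> real \<Rightarrow> real \<Rightarrow> real \<Rightarrow> real" where
  "rhs_bdry gr g x t v dB a = 3 * v - dB - Dcl {0..} (Dcl {0..} g) t
     - 3 / (H x)\<^sup>2 * (1/2 * gr * ((h0 + g t - b x)\<^sup>2 - h0\<^sup>2) + 1 / (h0 + g t - b x) * (a * a))"

lemma boundary_law_iff:
  assumes v: "v0 = Rf l h0 gr b z p 0" "vl = Rf l h0 gr b z p l"
    and d: "d0 = Dw l (R0 l h0 b (Bsrc l h0 gr b z p)) 0" "dl = Dw l (R0 l h0 b (Bsrc l h0 gr b z p)) l"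
  shows "Sb' l h0 b *v vector [x, y] + Vbdry l h0 gr b (g0 t) a0 (gl t) al
      = Vint l h0 gr b z p - vector [Dcl {0..} (Dcl {0..} g0) t, Dcl {0..} (Dcl {0..} gl) t] \<longleftrightarrow>
    x = (s22 * rhs_bdry gr g0 0 t v0 d0 a0 - s12 * rhs_bdry gr gl l t vl dl al) / sdet \<and>
    y = (s11 * rhs_bdry gr gl l t vl dl al - s21 * rhs_bdry gr g0 0 t v0 d0 a0) / sdet"
proof -
  have "Vint l h0 gr b z p - vector [Dcl {0..} (Dcl {0..} g0) t, Dcl {0..} (Dcl {0..} gl) t]
      - Vbdry l h0 gr b (g0 t) a0 (gl t) al
      = (vector [rhs_bdry gr g0 0 t v0 d0 a0, rhs_bdry gr gl l t vl dl al] :: real^2)"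
    by (simp add: vec_eq_iff forall_2 Vint_def Vbdry_def rhs_bdry_def fNSW_def Let_def v d power2_eq_square)
  then show ?thesis unfolding Sb'_solve[symmetric] by (metis add_diff_cancel_right' diff_add_cancel)
qed

text \<open>The reciprocal of the boundary height depends on time alone, so it is a smooth
  coefficient c2 and the row is quadratic in a.\<close>

lemma rhs_bdry_admissible:
  fixes v d a :: "real \<Rightarrow> 'u::real_normed_vector \<Rightarrow> real"
  assumes g: "smooth_on {0..} g" and nz: "\<And>t. t \<in> {0..T} \<Longrightarrow> h0 + g t - b x \<noteq> 0"
    and v: "admissible T v" and d: "admissible T d" and a: "admissible T a"
  shows "admissible T (\<lambda>t u. rhs_bdry gr g x t (v t u) (d t u) (a t u))"
proof -
  have nt: "t \<in> {0..} \<Longrightarrow> at t within {0..} \<noteq> (bot :: real filter)" for t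
    using at_within_Ici_nontrivial by simp
  have Ck: "Ck_on k {0..T} f" if "smooth_on {0..} f" for f k
    by (rule Ck_on_subset[of _ "{0..}"]) (use that Ck_on_smooth[OF nt] in auto)
  note gC = Ck[OF g] and gddC = Ck[OF Dcl_smooth(1)[OF nt Dcl_smooth(1)[OF nt g]]]
  have hC: "Ck_on k {0..T} (\<lambda>t. h0 + g t - b x)" for k
    by (rule Ck_on_diff[OF Ck_on_add[OF Ck_on_const gC] Ck_on_const])
  define c1 where "c1 t = Dcl {0..} (Dcl {0..} g) t + 3 / (H x)\<^sup>2 * (1/2 * gr * ((h0 + g t - b x)\<^sup>2 - h0\<^sup>2))" for t
  define c2 where "c2 t = 3 / (H x)\<^sup>2 * (1 / (h0 + g t - b x))" for t
  have "Ck_on k {0..T} c1" for k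
    unfolding c1_def
    by (rule Ck_on_add[OF gddC Ck_on_mult[OF Ck_on_const Ck_on_mult[OF Ck_on_const Ck_on_diff[OF Ck_on_power[OF hC] Ck_on_const]]]])
  note c1 = admissible_time[OF this]
  have "Ck_on k {0..T} c2" for k
    unfolding c2_def by (rule Ck_on_mult[OF Ck_on_const Ck_on_divide[OF Ck_on_const hC nz]])
  note c2 = admissible_time[OF this]
  have "rhs_bdry gr g x t (v t u) (d t u) (a t u) = 3 *\<^sub>R v t u - d t u - (c1 t + c2 t * (a t u * a t u))" for t u
    by (simp add: rhs_bdry_def c1_def c2_def algebra_simps)
  moreover have "admissible T (\<lambda>t u. 3 *\<^sub>R v t u - d t u - (c1 t + c2 t * (a t u * a t u)))"
    by (rule admissible_diff[OF admissible_diff[OF admissible_bounded_linear[OF bounded_linear_scaleR_right v] d]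
        admissible_add[OF c1 admissible_bounded_bilinear[OF bounded_bilinear_mult c2
          admissible_bounded_bilinear[OF bounded_bilinear_mult a a]]]])
  ultimately show ?thesis by simp
qed

end

lemma continuous_bounded_Icc:
  fixes f :: "real \<Rightarrow> real"
  assumes "continuous_on {a..c} f"
  shows "\<exists>M. \<forall>t\<in>{a..c}. \<bar>f t\<bar> \<le> M"
  using compact_imp_bounded[OF compact_continuous_image[OF assms compact_Icc]]
  by (auto simp: bounded_iff)

lemma positive_on_initial_interval:
  fixes f :: "real \<Rightarrow> real"
  assumes "continuous_on {0..} f" "0 < f 0"
  obtains T where "0 < T" "\<And>t. t \<in> {0..T} \<Longrightarrow> 0 < f t"
proof -
  have "(f \<longlongrightarrow> f 0) (at 0 within {0..})" using assms(1) by (simp add: continuous_on_def)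
  then have "eventually (\<lambda>t. 0 < f t) (at 0 within {0..})" by (rule order_tendstoD(1)[OF _ assms(2)])
  then obtain d where d: "0 < d" "\<And>t. t \<in> {0..} \<Longrightarrow> t \<noteq> 0 \<Longrightarrow> dist t 0 < d \<Longrightarrow> 0 < f t"
    unfolding eventually_at by blast
  show thesis
  proof
    show "0 < d / 2" using d by simp
    show "0 < f t" if "t \<in> {0..d / 2}" for t
      using d(1) d(2)[of t] that assms(2) by (cases "t = 0") auto
  qed
qed

section \<open>The evolution equation in the space of jets\<close>

locale wave_jets = bottom l h0 b + jets l p r for l h0 b p r
begin

sublocale DJ: jets_bvp l p r "\<lambda>x. 0" "\<lambda>x. 1 / H x" "\<lambda>x. 3 * c0 x / H x" "\<lambda>x. 0" "\<lambda>x. 1"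
proof unfold_locales
  have c0: "Ck_on k {0..l} c0" for k
    unfolding c0_def[abs_def]
    by (rule Ck_on_add[OF Ck_on_add[OF Ck_on_const Ck_on_mult[OF Ck_on_const Ck_on_power[OF B1_Ck]]]
        Ck_on_mult[OF Ck_on_mult[OF Ck_on_const H_Ck] B2_Ck]])
  show "Ck_on k {0..l} (\<lambda>x. 3 * c0 x / H x)" for k
    by (rule Ck_on_divide[OF Ck_on_mult[OF Ck_on_const c0] H_Ck H_nz])
  show "Ck_on k {0..l} (\<lambda>x. 1 / H x)" for k by (rule Ck_on_divide[OF Ck_on_const H_Ck H_nz])
qed simp_all

sublocale FJ: jets_bvp l p r "\<lambda>x. B1 x / (2 * H x)" "\<lambda>x. 3" "\<lambda>x. \<alpha> x / (H x)\<^sup>2" "\<lambda>x. B1 x / (2 * H x)" H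
proof unfold_locales
  show "Ck_on k {0..l} (\<lambda>x. B1 x / (2 * H x))" for k
    by (rule Ck_on_divide[OF B1_Ck Ck_on_mult[OF Ck_on_const H_Ck]]) (simp add: H_nz)
  show "Ck_on k {0..l} (\<lambda>x. \<alpha> x / (H x)\<^sup>2)" for k
    by (rule Ck_on_divide[OF \<alpha>_Ck Ck_on_power[OF H_Ck]]) (simp add: H_nz)
qed simp_all

lemma lin_J: "lin k (J k)"
  by (rule linI[OF bounded_linear_ident]) simp

lemma lin_zero: "lin k (\<lambda>(e::jet) x. 0)"
  by (rule linI[OF bounded_linear_zero]) (use J_scale[of _ k 0 0] in simp)

text \<open>Both components of both elliptic problems gain one level over their data. The flux and
  R0 B thus reach the level of the discharge although their data have only that of the
  elevation.\<close>

lemma operator_jets: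
  "\<exists>Yw Yv. bounded_linear Yw \<and> bounded_linear Yv \<and> (\<forall>e. \<forall>x\<in>{0..l}.
     F.dir1 (\<lambda>x. - 3 * J (Suc k) e x) (\<lambda>x. 0) 0 0 x = J (Suc (Suc k)) (Yw e) x \<and>
     F.dir2 (\<lambda>x. - 3 * J (Suc k) e x) (\<lambda>x. 0) 0 0 x = J (Suc (Suc k)) (Yv e) x)"
  "\<exists>Yr Ys. bounded_linear Yr \<and> bounded_linear Ys \<and> (\<forall>e. \<forall>x\<in>{0..l}.
     D.dir1 (\<lambda>x. 0) (\<lambda>x. - 3 * J (Suc k) e x / H x) 0 0 x = J (Suc (Suc k)) (Yr e) x \<and>
     D.dir2 (\<lambda>x. 0) (\<lambda>x. - 3 * J (Suc k) e x / H x) 0 0 x = J (Suc (Suc k)) (Ys e) x)"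
proof -
  have 1: "lin (Suc k) (\<lambda>e x. - 3 * J (Suc k) e x)"
    by (rule lin_smooth_mult[OF lin_J Ck_on_const])
  have "Ck_on k {0..l} (\<lambda>x. - 3 / H x)" for k by (rule Ck_on_divide[OF Ck_on_const H_Ck H_nz])
  from lin_smooth_mult[OF lin_J this, of "Suc k"]
  have 2: "lin (Suc k) (\<lambda>e x. - 3 * J (Suc k) e x / H x)" unfolding times_divide_eq_left .
  show "\<exists>Yw Yv. bounded_linear Yw \<and> bounded_linear Yv \<and> (\<forall>e. \<forall>x\<in>{0..l}.
     F.dir1 (\<lambda>x. - 3 * J (Suc k) e x) (\<lambda>x. 0) 0 0 x = J (Suc (Suc k)) (Yw e) x \<and>
     F.dir2 (\<lambda>x. - 3 * J (Suc k) e x) (\<lambda>x. 0) 0 0 x = J (Suc (Suc k)) (Yv e) x)"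
    using FJ.lin_dir[OF 1 lin_zero] unfolding lin_def by blast
  show "\<exists>Yr Ys. bounded_linear Yr \<and> bounded_linear Ys \<and> (\<forall>e. \<forall>x\<in>{0..l}.
     D.dir1 (\<lambda>x. 0) (\<lambda>x. - 3 * J (Suc k) e x / H x) 0 0 x = J (Suc (Suc k)) (Yr e) x \<and>
     D.dir2 (\<lambda>x. 0) (\<lambda>x. - 3 * J (Suc k) e x / H x) 0 0 x = J (Suc (Suc k)) (Ys e) x)"
    using DJ.lin_dir[OF lin_zero 2] unfolding lin_def by blast
qed

lemma J_minus: "x \<in> {0..l} \<Longrightarrow> J k (- e) x = - J k e x"
  using J_scale[of x k "-1" e] by (simp del: jval.simps)

lemma J_diff: "x \<in> {0..l} \<Longrightarrow> J k (e - f) x = J k e x - J k f x"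
  using J_add[of x k e "- f"] J_minus[of x k f] by (simp del: jval.simps)

lemma Dw_J:
  assumes x: "x \<in> {0..l}"
  shows "Dw l (J (Suc (Suc k)) e) x = J (Suc k) (tlJ e) x"
  by (rule Dw_C1[OF prim_derivative[OF J_prim J_continuous] J_continuous l x])

text \<open>The state consists of the elevation and the reciprocal height, read at level Suc m, the
  discharge, read one level higher, and the two boundary discharges. The right-hand side respects
  these levels, because the derivative of the discharge is one level lower and the elliptic
  operators raise the level by one.\<close>

theorem jet_solution:
  assumes g0: "smooth_on {0..} g0" and gl: "smooth_on {0..} gl"
    and pos: "\<And>x. x \<in> {0..l} \<Longrightarrow> 0 < h0 + J (Suc m) z0 x - b x"
    and g0_0: "g0 0 = J (Suc m) z0 0" and gl_0: "gl 0 = J (Suc m) z0 l"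
  shows "\<exists>T>0. \<exists>\<zeta> q q0 ql. is_solution l h0 gr b g0 gl (Suc m) (J (Suc m) z0) (J (Suc (Suc m)) w0) (ereal T) \<zeta> q q0 ql"
proof -
  let ?n = "Suc m"
  from product[of m] obtain N where N: "bounded_bilinear N"
    "\<And>e f x. x \<in> {0..l} \<Longrightarrow> J ?n (N e f) x = J ?n e x * J ?n f x" by blast
  from inclusion[of ?n] obtain I where I: "bounded_linear I"
    "\<And>e x. x \<in> {0..l} \<Longrightarrow> J ?n (I e) x = J (Suc ?n) e x" by blast
  from operator_jets(1)[of m] obtain Yw Yv where Yw: "bounded_linear Yw" and Yv: "bounded_linear Yv" and
    Yw_eq: "\<And>e x. x \<in> {0..l} \<Longrightarrow> F.dir1 (\<lambda>x. - 3 * J ?n e x) (\<lambda>x. 0) 0 0 x = J (Suc ?n) (Yw e) x" and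
    Yv_eq: "\<And>e x. x \<in> {0..l} \<Longrightarrow> F.dir2 (\<lambda>x. - 3 * J ?n e x) (\<lambda>x. 0) 0 0 x = J (Suc ?n) (Yv e) x" by blast
  from operator_jets(2)[of m] obtain Yr Ys where Yr: "bounded_linear Yr" and Ys: "bounded_linear Ys" and
    Yr_eq: "\<And>e x. x \<in> {0..l} \<Longrightarrow> D.dir1 (\<lambda>x. 0) (\<lambda>x. - 3 * J ?n e x / H x) 0 0 x = J (Suc ?n) (Yr e) x" and
    Ys_eq: "\<And>e x. x \<in> {0..l} \<Longrightarrow> D.dir2 (\<lambda>x. 0) (\<lambda>x. - 3 * J ?n e x / H x) 0 0 x = J (Suc ?n) (Ys e) x" by blast
  have cst: "\<exists>e. \<forall>x\<in>{0..l}. J k e x = f x" if "\<And>k. Ck_on k {0..l} f" for f k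
    by (rule smooth_jet[OF that])
  have "Ck_on k {0..l} (\<lambda>x. h0 - b x)" for k by (rule Ck_on_diff[OF Ck_on_const b_Ck])
  from cst[OF this, of ?n] obtain ch where ch: "\<And>x. x \<in> {0..l} \<Longrightarrow> J ?n ch x = h0 - b x" by blast
  have "Ck_on k {0..l} (\<lambda>x. 1 / (H x)\<^sup>2)" for k
    by (rule Ck_on_divide[OF Ck_on_const Ck_on_power[OF H_Ck]]) (simp add: H_nz)
  from cst[OF this, of ?n] obtain cH where cH: "\<And>x. x \<in> {0..l} \<Longrightarrow> J ?n cH x = 1 / (H x)\<^sup>2" by blast
  from cst[OF B1_Ck, of ?n] obtain cB where cB: "\<And>x. x \<in> {0..l} \<Longrightarrow> J ?n cB x = B1 x" by blast
  from cst[OF Ck_on_mult[OF B1_Ck H_Ck], of ?n] obtain cBH where cBH: "\<And>x. x \<in> {0..l} \<Longrightarrow> J ?n cBH x = B1 x * H x" by blast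
  from cst[OF Ck_on_const, of ?n "h0\<^sup>2"] obtain c2 where c2: "\<And>x. x \<in> {0..l} \<Longrightarrow> J ?n c2 x = h0\<^sup>2" by blast
  from cst[OF conjunct1[OF D.sol_Ck[OF DJ.smooth s_sol(1)]], of "Suc ?n"]
  obtain cL where cL: "\<And>x. x \<in> {0..l} \<Longrightarrow> J (Suc ?n) cL x = sL1 x" by blast
  from cst[OF conjunct1[OF D.sol_Ck[OF DJ.smooth s_sol(2)]], of "Suc ?n"]
  obtain cR where cR: "\<And>x. x \<in> {0..l} \<Longrightarrow> J (Suc ?n) cR x = sR1 x" by blast
  have ch_z0: "J ?n (ch + z0) x = h0 + J ?n z0 x - b x" if "x \<in> {0..l}" for x
    unfolding J_add[OF that] ch[OF that] by simp
  have "0 < J ?n (ch + z0) x" if "x \<in> {0..l}" for x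
    unfolding ch_z0[OF that] by (rule pos[OF that])
  from inverse_jet[OF this] obtain k0 where k0: "\<And>x. x \<in> {0..l} \<Longrightarrow> J ?n k0 x = 1 / J ?n (ch + z0) x" by blast

  \<comment> \<open>Components of the state: elevation, reciprocal height, discharge, and the
    boundary discharges at 0 and at l.\<close>
  define Z where "Z u = fst u" for u :: "jet \<times> jet \<times> jet \<times> real \<times> real"
  define K where "K u = fst (snd u)" for u :: "jet \<times> jet \<times> jet \<times> real \<times> real"
  define Q where "Q u = fst (snd (snd u))" for u :: "jet \<times> jet \<times> jet \<times> real \<times> real"
  define A where "A u = fst (snd (snd (snd u)))" for u :: "jet \<times> jet \<times> jet \<times> real \<times> real"
  define C where "C u = snd (snd (snd (snd u)))" for u :: "jet \<times> jet \<times> jet \<times> real \<times> real"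
  have bl: "bounded_linear Z" "bounded_linear K" "bounded_linear Q" "bounded_linear A" "bounded_linear C"
    unfolding Z_def[abs_def] K_def[abs_def] Q_def[abs_def] A_def[abs_def] C_def[abs_def]
    by (intro bounded_linear_fst bounded_linear_snd bounded_linear_ident
        bounded_linear_fst_comp bounded_linear_snd_comp)+
  define Ht where "Ht u = ch + Z u" for u
  define FE where "FE u = N cH ((gr / 2) *\<^sub>R (N (Ht u) (Ht u) - c2) + N (K u) (N (I (Q u)) (I (Q u))))" for u
  \<comment> \<open>\<open>FE\<close> already carries the factor 1 / H^2, so the coefficient B1 * H
    turns it into B1 / H times the flux function.\<close>
  define BE where "BE u = (- gr) *\<^sub>R N cB (Ht u) + (3 / 2) *\<^sub>R N cBH (FE u)" for u
  \<comment> \<open>\<open>Ys\<close> represents H y' for the Dirichlet solution y, so dividing by H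
    at the end gives the derivative that the boundary equation contains.\<close>
  define Rl where "Rl t u = rhs_bdry gr g0 0 t (J (Suc ?n) (Yv (FE u)) 0) (inverse (H 0) *\<^sub>R J (Suc ?n) (Ys (BE u)) 0) (A u)" for t u
  define Rr where "Rr t u = rhs_bdry gr gl l t (J (Suc ?n) (Yv (FE u)) l) (inverse (H l) *\<^sub>R J (Suc ?n) (Ys (BE u)) l) (C u)" for t u
  define P where "P t u = (s22 / sdet) *\<^sub>R Rl t u - (s12 / sdet) *\<^sub>R Rr t u" for t u
  define P' where "P' t u = (s11 / sdet) *\<^sub>R Rr t u - (s21 / sdet) *\<^sub>R Rl t u" for t u
  \<comment> \<open>The second component is the time derivative of 1 / h, namely q_x / h^2, with the
    unknown K written for 1 / h.\<close>
  define G where "G t u = (- tlJ (Q u), N (K u) (N (K u) (tlJ (Q u))),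
      - Yw (FE u) + Yr (BE u) + P t u *\<^sub>R cL + P' t u *\<^sub>R cR, P t u, P' t u)" for t u

  have c0: "continuous_on {0..} (\<lambda>t. h0 + g t - b x)" if "smooth_on {0..} g" for g x
  proof -
    have "Ck_on 0 {0..} g"
      by (rule Ck_on_smooth[THEN iffD1, rule_format, OF _ that]) (simp add: at_within_Ici_nontrivial)
    then show ?thesis by (auto intro!: continuous_intros)
  qed
  \<comment> \<open>The boundary heights are given functions of time, positive at 0 by
    compatibility; up to T0 they stay positive, so that their reciprocals are smooth.\<close>
  obtain T1 where T1: "0 < T1" "\<And>t. t \<in> {0..T1} \<Longrightarrow> 0 < h0 + g0 t - b 0"
    using positive_on_initial_interval[OF c0[OF g0, of 0]] pos[OF ends(1)] g0_0 by metis
  obtain T2 where T2: "0 < T2" "\<And>t. t \<in> {0..T2} \<Longrightarrow> 0 < h0 + gl t - b l"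
    using positive_on_initial_interval[OF c0[OF gl, of l]] pos[OF ends(2)] gl_0 by metis
  define T0 where "T0 = min T1 T2"
  have T0: "0 < T0" "h0 + g0 t - b 0 \<noteq> 0" "h0 + gl t - b l \<noteq> 0" if "t \<in> {0..T0}" for t
    using T1(1) T2(1) T1(2)[of t] T2(2)[of t] that by (auto simp: T0_def)
  have T0_pos: "0 < T0" using T1(1) T2(1) by (simp add: T0_def)

  have aL: "admissible T0 (\<lambda>t u. L u)" if "bounded_linear L" for L :: "(jet \<times> jet \<times> jet \<times> real \<times> real) \<Rightarrow> 'x::real_normed_vector"
    by (rule admissible_bounded_linear[OF that admissible_state])
  have aC: "admissible T0 (\<lambda>t (u :: jet \<times> jet \<times> jet \<times> real \<times> real). c)" for c :: "'x::real_normed_vector"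
    by (rule admissible_time[OF Ck_on_const])
  note aN = admissible_bounded_bilinear[OF N(1)]
  note aS = admissible_bounded_linear[OF bounded_linear_scaleR_right]
  have aH: "admissible T0 (\<lambda>t u. Ht u)" unfolding Ht_def by (rule admissible_add[OF aC aL[OF bl(1)]])
  have aI: "admissible T0 (\<lambda>t u. I (Q u))" by (rule admissible_bounded_linear[OF I(1) aL[OF bl(3)]])
  have aF: "admissible T0 (\<lambda>t u. FE u)" unfolding FE_def
    by (rule aN[OF aC admissible_add[OF aS[OF admissible_diff[OF aN[OF aH aH] aC]] aN[OF aL[OF bl(2)] aN[OF aI aI]]]])
  have aB: "admissible T0 (\<lambda>t u. BE u)" unfolding BE_def
    by (rule admissible_add[OF aS[OF aN[OF aC aH]] aS[OF aN[OF aC aF]]])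
  have ev: "admissible T0 (\<lambda>t u. J (Suc ?n) (E t u) x)" if "x \<in> {0..l}" "admissible T0 E"
    for x and E :: "real \<Rightarrow> (jet \<times> jet \<times> jet \<times> real \<times> real) \<Rightarrow> jet"
    by (rule admissible_bounded_linear[OF bounded_linear_J_eval[OF that(1)] that(2)])
  have aRl: "admissible T0 Rl" unfolding Rl_def[abs_def]
    by (rule rhs_bdry_admissible[OF g0 T0(2) ev[OF ends(1) admissible_bounded_linear[OF Yv aF]]
        aS[OF ev[OF ends(1) admissible_bounded_linear[OF Ys aB]]] aL[OF bl(4)]])
  have aRr: "admissible T0 Rr" unfolding Rr_def[abs_def]
    by (rule rhs_bdry_admissible[OF gl T0(3) ev[OF ends(2) admissible_bounded_linear[OF Yv aF]]
        aS[OF ev[OF ends(2) admissible_bounded_linear[OF Ys aB]]] aL[OF bl(5)]])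
  have aP: "admissible T0 P" unfolding P_def[abs_def] by (rule admissible_diff[OF aS[OF aRl] aS[OF aRr]])
  have aP': "admissible T0 P'" unfolding P'_def[abs_def] by (rule admissible_diff[OF aS[OF aRr] aS[OF aRl]])
  have aT: "admissible T0 (\<lambda>t u. tlJ (Q u))"
    by (rule admissible_bounded_linear[OF bounded_linear_tlJ aL[OF bl(3)]])
  note aM = admissible_bounded_bilinear[OF bounded_bilinear_scaleR]
  have aG: "admissible T0 G" unfolding G_def[abs_def]
    by (rule admissible_Pair[OF admissible_minus[OF aT] admissible_Pair[OF aN[OF aL[OF bl(2)] aN[OF aL[OF bl(2)] aT]]
          admissible_Pair[OF admissible_add[OF admissible_add[OF admissible_add[OF
            admissible_minus[OF admissible_bounded_linear[OF Yw aF]] admissible_bounded_linear[OF Yr aB]]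
            aM[OF aP aC]] aM[OF aP' aC]] admissible_Pair[OF aP aP']]]])
  obtain T u where T: "0 < T" "T \<le> T0" and u0: "u 0 = (z0, k0, w0, J (Suc ?n) w0 0, J (Suc ?n) w0 l)"
    and u': "\<And>t. t \<in> {0..T} \<Longrightarrow> (u has_vector_derivative G t (u t)) (at t within {0..T})"
    and uC: "\<And>k. Ck_on k {0..T} u"
    using ode_local[OF T0_pos aG, of "(z0, k0, w0, J (Suc ?n) w0 0, J (Suc ?n) w0 l)"] by metis
  have TT: "t \<in> {0..T0}" if "t \<in> {0..T}" for t using that T(2) by simp
  have der: "((\<lambda>s. L (u s)) has_vector_derivative L (G t (u t))) (at t within {0..T})"
    if "bounded_linear L" "t \<in> {0..T}" for L :: "(jet \<times> jet \<times> jet \<times> real \<times> real) \<Rightarrow> 'x::real_normed_vector" and t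
    by (rule bounded_linear.has_vector_derivative[OF that(1) u'[OF that(2)]])
  have derJ: "((\<lambda>s. J (Suc k) (L (u s)) x) has_real_derivative J (Suc k) (L (G t (u t))) x) (at t within {0..T})"
    if "bounded_linear L" "t \<in> {0..T}" "x \<in> {0..l}" for L t x k
    unfolding has_real_derivative_iff_has_vector_derivative
    by (rule der[OF bounded_linear_compose[OF bounded_linear_J_eval[OF that(3)] that(1)] that(2)])
  have G_parts: "Z (G t w) = - tlJ (Q w)" "K (G t w) = N (K w) (N (K w) (tlJ (Q w)))"
    "Q (G t w) = - Yw (FE w) + Yr (BE w) + P t w *\<^sub>R cL + P' t w *\<^sub>R cR" "A (G t w) = P t w" "C (G t w) = P' t w" for t w
    by (simp_all add: Z_def K_def Q_def A_def C_def G_def)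
  have u0_parts: "Z (u 0) = z0" "K (u 0) = k0" "Q (u 0) = w0" "A (u 0) = J (Suc ?n) w0 0" "C (u 0) = J (Suc ?n) w0 l"
    by (simp_all add: Z_def K_def Q_def A_def C_def u0)
  define \<zeta> where "\<zeta> t = J ?n (Z (u t))" for t
  define q where "q t = J (Suc ?n) (Q (u t))" for t
  have Ht_eq: "J ?n (Ht (u t)) x = h0 + \<zeta> t x - b x" if "x \<in> {0..l}" for t x
    unfolding Ht_def J_add[OF that] ch[OF that] \<zeta>_def by simp
  have d\<zeta>: "((\<lambda>s. \<zeta> s x) has_real_derivative - J ?n (tlJ (Q (u t))) x) (at t within {0..T})"
    if x: "x \<in> {0..l}" and t: "t \<in> {0..T}" for x t
    using derJ[OF bl(1) t x, of m] unfolding G_parts J_minus[OF x] \<zeta>_def .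

  text \<open>The extra unknown stays the inverse of the height, so that the polynomial system is the original one.\<close>
  have inv: "J ?n (K (u t)) x * (h0 + \<zeta> t x - b x) = 1" if x: "x \<in> {0..l}" and t: "t \<in> {0..T}" for x t
  proof -
    define r where "r t = J ?n (tlJ (Q (u t))) x" for t
    define \<kappa> where "\<kappa> t = J ?n (K (u t)) x" for t
    define E where "E t = \<kappa> t * (h0 + \<zeta> t x - b x) - 1" for t
    have d\<kappa>: "(\<kappa> has_real_derivative \<kappa> t * (\<kappa> t * r t)) (at t within {0..T})" if t: "t \<in> {0..T}" for t
      using derJ[OF bl(2) t x, of m] unfolding G_parts N(2)[OF x] \<kappa>_def[abs_def] r_def .
    have d\<zeta>': "((\<lambda>s. \<zeta> s x) has_real_derivative - r t) (at t within {0..T})" if t: "t \<in> {0..T}" for t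
      using d\<zeta>[OF x t] unfolding r_def .
    \<comment> \<open>From \<kappa>' = \<kappa>^2 r and h' = - r the defect \<kappa> h - 1 satisfies
      a homogeneous linear equation with continuous coefficient, hence vanishes with its initial
      value.\<close>
    have dE: "(E has_real_derivative \<kappa> t * r t * E t) (at t within {0..T})" if t: "t \<in> {0..T}" for t
      unfolding E_def[abs_def]
      by (rule derivative_eq_intros d\<kappa>[OF t] d\<zeta>'[OF t] refl)+ (simp add: algebra_simps)
    have cr: "continuous_on {0..T} r"
      unfolding r_def[abs_def]
      by (rule Ck_on_continuous[OF Ck_on_bounded_linear[OF bounded_linear_compose[OF bounded_linear_J_eval[OF x]
          bounded_linear_compose[OF bounded_linear_tlJ bl(3)]] uC[of 0]]])
    have "continuous_on {0..T} (\<lambda>t. \<kappa> t * r t)"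
      by (rule continuous_on_mult[OF C1_continuous[OF d\<kappa>] cr])
    from continuous_bounded_Icc[OF this] obtain M where M: "\<And>t. t \<in> {0..T} \<Longrightarrow> \<bar>\<kappa> t * r t\<bar> \<le> M" by blast
    from continuous_bounded_Icc[OF C1_continuous[OF dE]] obtain M0 where M0: "\<And>t. t \<in> {0..T} \<Longrightarrow> \<bar>E t\<bar> \<le> M0" by blast
    have M_nonneg: "0 \<le> M" by (rule order_trans[OF abs_ge_zero M[OF t]])
    have le: "\<bar>\<kappa> t * r t * E t\<bar> \<le> M * B" if "t \<in> {0..T}" "\<bar>E t\<bar> \<le> B" for t B
      unfolding abs_mult[of _ "E t"] by (rule mult_mono[OF M[OF that(1)] that(2) M_nonneg abs_ge_zero])
    have "E 0 = 0"
      using k0[OF x] pos[OF x] unfolding E_def \<kappa>_def \<zeta>_def u0_parts ch_z0[OF x] by (simp del: jval.simps)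
    then have "E t = 0"
      using family_gronwall[where J = "{()}" and D = "\<lambda>_. E" and D' = "\<lambda>_ t. \<kappa> t * r t * E t" and T = T and ?M0.0 = M0 and K = M and i = "()" and t = t]
        dE M0 M_nonneg le t by simp
    then show ?thesis by (simp add: E_def \<kappa>_def)
  qed
  have h_nz: "h0 + \<zeta> t x - b x \<noteq> 0" if "x \<in> {0..l}" "t \<in> {0..T}" for x t
    using inv[OF that] by auto
  have inv': "J ?n (K (u t)) x = 1 / (h0 + \<zeta> t x - b x)" if "x \<in> {0..l}" "t \<in> {0..T}" for x t
    using inv[OF that] h_nz[OF that] by (simp add: field_simps del: jval.simps)
  have FE_eq: "J ?n (FE (u t)) x = 1 / (H x)\<^sup>2 * fNSW h0 gr b x (\<zeta> t x) (q t x)"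
    if x: "x \<in> {0..l}" and t: "t \<in> {0..T}" for x t
    unfolding FE_def N(2)[OF x] J_add[OF x] J_scale[OF x] J_diff[OF x] I(2)[OF x] cH[OF x] c2[OF x] Ht_eq[OF x]
      inv'[OF x t] fNSW_def Let_def power2_eq_square q_def by simp
  have BE_eq: "J ?n (BE (u t)) x = Bsrc l h0 gr b (\<zeta> t) (q t) x"
    if x: "x \<in> {0..l}" and t: "t \<in> {0..T}" for x t
    unfolding BE_def N(2)[OF x] J_add[OF x] J_scale[OF x] cB[OF x] cBH[OF x] Ht_eq[OF x] FE_eq[OF x t] Bsrc_def
    using H_nz[OF x] by (simp add: power2_eq_square field_simps)
  have cF: "continuous_on {0..l} (\<lambda>x. 1 / (H x)\<^sup>2 * fNSW h0 gr b x (\<zeta> t x) (q t x))"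
    and cBs: "continuous_on {0..l} (Bsrc l h0 gr b (\<zeta> t) (q t))" if t: "t \<in> {0..T}" for t
    using continuous_on_eq[OF J_continuous FE_eq[OF _ t]] continuous_on_eq[OF J_continuous BE_eq[OF _ t]] by blast+
  have Rf_eq: "Rf l h0 gr b (\<zeta> t) (q t) x = J (Suc ?n) (Yv (FE (u t))) x"
    "sqrt 3 * (H x / \<alpha> x) * hbS_adj l h0 b (Rf l h0 gr b (\<zeta> t) (q t)) x = J (Suc ?n) (Yw (FE (u t))) x"
    if x: "x \<in> {0..l}" and t: "t \<in> {0..T}" for x t
    unfolding Rf_def R1_eq[OF cF[OF t] cF[OF t] x] Yv_eq[OF x, symmetric] Yw_eq[OF x, symmetric]
    by (rule F.dir_cong; (rule continuous_on_mult[OF continuous_on_const cF[OF t]]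
          continuous_on_mult[OF continuous_on_const J_continuous] continuous_on_const x refl)?; simp only: FE_eq[OF _ t])+
  have R0_eq: "R0 l h0 b (Bsrc l h0 gr b (\<zeta> t) (q t)) x = J (Suc ?n) (Yr (BE (u t))) x"
    "H x * Dw l (R0 l h0 b (Bsrc l h0 gr b (\<zeta> t) (q t))) x = J (Suc ?n) (Ys (BE (u t))) x"
    if x: "x \<in> {0..l}" and t: "t \<in> {0..T}" for x t
    unfolding R0_def dirichlet_sol_eq[OF cBs[OF t] cBs[OF t] x] Yr_eq[OF x, symmetric] Ys_eq[OF x, symmetric]
    by (rule D.dir_cong; (rule dirichlet_data_continuous[OF cBs[OF t]]
          dirichlet_data_continuous[OF J_continuous] continuous_on_const x refl)?; simp only: BE_eq[OF _ t])+
  let ?I = "{0..<T}"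
  have nt: "at t within ?I \<noteq> bot" if "t \<in> ?I" for t by (rule at_within_time_nontrivial[OF that])
  have sub: "?I \<subseteq> {0..T}" by auto
  have inT: "t \<in> {0..T}" if "t \<in> ?I" for t using that by auto
  have Dcl: "Dcl ?I f t = f'" if "(f has_real_derivative f') (at t within {0..T})" "t \<in> ?I" for f f' t
    by (rule Dcl_unique[OF nt[OF that(2)] has_field_derivative_subset[OF that(1) sub]])
  have dA: "Dcl ?I (\<lambda>t. A (u t)) t = P t (u t)" "Dcl ?I (\<lambda>t. C (u t)) t = P' t (u t)" if t: "t \<in> ?I" for t
    using Dcl[OF der[OF bl(4) inT[OF t], folded has_real_derivative_iff_has_vector_derivative] t]
      Dcl[OF der[OF bl(5) inT[OF t], folded has_real_derivative_iff_has_vector_derivative] t] unfolding G_parts .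
  note lC = Ck_on_subset[OF Ck_on_bounded_linear[OF _ uC] sub]
  have "is_solution l h0 gr b g0 gl ?n (J ?n z0) (J (Suc ?n) w0) (ereal T) \<zeta> q (\<lambda>t. A (u t)) (\<lambda>t. C (u t))"
    unfolding is_solution_def Let_def
  proof -
    have I: "time_ivl (ereal T) = ?I" by (auto simp: time_ivl_def)
    have 1: "smooth_curve l ?n ?I \<zeta>" "smooth_curve l (?n + 1) ?I q"
      using jet_smooth_curve[OF nt lC[OF bl(1)], of ?n] jet_smooth_curve[OF nt lC[OF bl(3)], of "Suc ?n"]
      unfolding \<zeta>_def[symmetric] q_def[symmetric] by simp_all
    have 2: "smooth_on ?I (\<lambda>t. A (u t))" "smooth_on ?I (\<lambda>t. C (u t))"
      by (rule Ck_on_smooth[OF nt, THEN iffD2], assumption, rule allI, rule lC, rule bl)+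
    have 3: "Dcl ?I (\<lambda>s. \<zeta> s x) t + Dw l (q t) x = 0" if t: "t \<in> ?I" and x: "x \<in> {0<..<l}" for t x
    proof -
      have x: "x \<in> {0..l}" using x by simp
      show ?thesis unfolding Dcl[OF d\<zeta>[OF x inT[OF t]] t] q_def Dw_J[OF x] by simp
    qed
    have 4: "Dcl ?I (\<lambda>s. q s x) t + sqrt 3 * (H x / \<alpha> x) * hbS_adj l h0 b (Rf l h0 gr b (\<zeta> t) (q t)) x
       = R0 l h0 b (Bsrc l h0 gr b (\<zeta> t) (q t)) x
         + Dcl ?I (\<lambda>t. A (u t)) t * s_left l h0 b x + Dcl ?I (\<lambda>t. C (u t)) t * s_right l h0 b x"
      if t: "t \<in> ?I" and x: "x \<in> {0<..<l}" for t x
    proof -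
      have x: "x \<in> {0..l}" using x by simp
      show ?thesis
        unfolding q_def Dcl[OF derJ[OF bl(3) inT[OF t] x] t] unfolding q_def[symmetric] Rf_eq[OF x inT[OF t]] R0_eq[OF x inT[OF t]]
          dA[OF t] G_parts J_add[OF x] J_minus[OF x] J_scale[OF x] cL[OF x] cR[OF x] s_eq(1,3)[OF x]
        by simp
    qed
    have 5: "Sb' l h0 b *v vector [Dcl ?I (\<lambda>t. A (u t)) t, Dcl ?I (\<lambda>t. C (u t)) t]
           + Vbdry l h0 gr b (g0 t) (A (u t)) (gl t) (C (u t))
         = Vint l h0 gr b (\<zeta> t) (q t)
           - vector [Dcl {0..} (Dcl {0..} g0) t, Dcl {0..} (Dcl {0..} gl) t]" if t: "t \<in> ?I" for t
    proof -
      have d: "inverse (H x) *\<^sub>R J (Suc ?n) (Ys (BE (u t))) x = Dw l (R0 l h0 b (Bsrc l h0 gr b (\<zeta> t) (q t))) x"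
        if x: "x \<in> {0..l}" for x
        unfolding R0_eq(2)[OF x inT[OF t], symmetric] using H_nz[OF x] by simp
      show ?thesis
        unfolding boundary_law_iff[OF refl refl refl refl] dA[OF t] P_def P'_def Rl_def Rr_def d[OF ends(1)] d[OF ends(2)]
          Rf_eq(1)[OF ends(1) inT[OF t]] Rf_eq(1)[OF ends(2) inT[OF t]]
        by (simp add: diff_divide_distrib del: jval.simps)
    qed
    show "smooth_curve l ?n (time_ivl (ereal T)) \<zeta> \<and> smooth_curve l (?n + 1) (time_ivl (ereal T)) q \<and>
      smooth_on (time_ivl (ereal T)) (\<lambda>t. A (u t)) \<and> smooth_on (time_ivl (ereal T)) (\<lambda>t. C (u t)) \<and>
      (\<forall>t\<in>time_ivl (ereal T). \<forall>x\<in>{0..l}. h0 + \<zeta> t x - b x \<noteq> 0) \<and>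
      (\<forall>t\<in>time_ivl (ereal T). h0 + g0 t - b 0 \<noteq> 0 \<and> h0 + gl t - b l \<noteq> 0) \<and>
      (\<forall>t\<in>time_ivl (ereal T). \<forall>x\<in>{0<..<l}.
         Dcl (time_ivl (ereal T)) (\<lambda>s. \<zeta> s x) t + Dw l (q t) x = 0 \<and>
         Dcl (time_ivl (ereal T)) (\<lambda>s. q s x) t
           + sqrt 3 * (hb h0 b x / alphab l b x) * hbS_adj l h0 b (Rf l h0 gr b (\<zeta> t) (q t)) x
         = R0 l h0 b (Bsrc l h0 gr b (\<zeta> t) (q t)) x
           + Dcl (time_ivl (ereal T)) (\<lambda>t. A (u t)) t * s_left l h0 b x + Dcl (time_ivl (ereal T)) (\<lambda>t. C (u t)) t * s_right l h0 b x) \<and>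
      (\<forall>t\<in>time_ivl (ereal T).
         Sb' l h0 b *v vector [Dcl (time_ivl (ereal T)) (\<lambda>t. A (u t)) t, Dcl (time_ivl (ereal T)) (\<lambda>t. C (u t)) t]
           + Vbdry l h0 gr b (g0 t) (A (u t)) (gl t) (C (u t))
         = Vint l h0 gr b (\<zeta> t) (q t)
           - vector [Dcl {0..} (Dcl {0..} g0) t, Dcl {0..} (Dcl {0..} gl) t]) \<and>
      (\<forall>x\<in>{0..l}. \<zeta> 0 x = J ?n z0 x \<and> q 0 x = J (Suc ?n) w0 x) \<and>
      A (u 0) = J (Suc ?n) w0 0 \<and> C (u 0) = J (Suc ?n) w0 l"
      unfolding I
      by (intro conjI ballI 1 2 3 4 5; (rule h_nz[OF _ inT] T0(2)[OF TT[OF inT]] T0(3)[OF TT[OF inT]] u0_parts(4,5))?;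
          (assumption | simp only: \<zeta>_def q_def u0_parts)?)
  qed
  then show ?thesis using T(1) by blast
qed

end

lemma is_solution_initial_cong:
  assumes "\<And>x. x \<in> {0..l} \<Longrightarrow> z0 x = \<zeta>in x" "\<And>x. x \<in> {0..l} \<Longrightarrow> w0 x = qin x" "0 \<le> l"
  shows "is_solution l h0 gr b g0 gl n z0 w0 T \<zeta> q q0 ql \<longleftrightarrow> is_solution l h0 gr b g0 gl n \<zeta>in qin T \<zeta> q q0 ql"
  using assms(1,2)[of 0] assms(1,2)[of l] assms by (simp add: is_solution_def)

theorem (in bottom) local_existence:
  assumes g0: "smooth_on {0..} g0" and gl: "smooth_on {0..} gl" and n: "n \<noteq> 0"
    and \<zeta>: "\<zeta>in \<in> Hs l n" and q: "qin \<in> Hs l (n + 1)"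
    and pos: "\<And>x. x \<in> {0..l} \<Longrightarrow> 0 < h0 - b x + \<zeta>in x"
    and g0_0: "\<zeta>in 0 = g0 0" and gl_0: "\<zeta>in l = gl 0"
  shows "\<exists>T>0. \<exists>\<zeta> q q0 ql. is_solution l h0 gr b g0 gl n \<zeta>in qin (ereal T) \<zeta> q q0 ql"
proof -
  obtain m where m: "n = Suc m" using n by (cases n) auto
  obtain p sz where p: "L2 l p" and
    z: "\<And>p' r t. jval p' r 0 (0, t) = p \<Longrightarrow> \<forall>x\<in>{0..l}. \<zeta>in x = jval p' r (Suc m) (sz, t) x"
    using Hs_jval[OF \<zeta>[unfolded m] l] by blast
  obtain r sw where r: "L2 l r" and
    w: "\<And>p' r' t. jval p' r' 0 (0, t) = r \<Longrightarrow> \<forall>x\<in>{0..l}. qin x = jval p' r' (Suc (Suc m)) (sw, t) x"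
    using Hs_jval[of qin l "Suc (Suc m)"] q l unfolding m by auto
  interpret wave_jets l h0 b p r by unfold_locales (fact l p r)+
  \<comment> \<open>The constant coefficient 1 on p here, and on r in \<open>w0\<close>, makes the
    highest derivatives of the initial data exactly p and r.\<close>
  define z0 where "z0 = (sz, (const_bcontfun 1, 0, 0) :: cfun \<times> cfun \<times> cfun)"
  define w0 where "w0 = (sw, (0, const_bcontfun 1, 0) :: cfun \<times> cfun \<times> cfun)"
  have "jval p r 0 (0, (const_bcontfun 1, 0, 0)) = p" "jval p r 0 (0, (0, const_bcontfun 1, 0)) = r"
    by (simp_all add: fun_eq_iff jval_0 const_bcontfun.rep_eq)
  note e = z[OF this(1), folded z0_def, rule_format] w[OF this(2), folded w0_def, rule_format]
  have c: "is_solution l h0 gr b g0 gl (Suc m) (J (Suc m) z0) (J (Suc (Suc m)) w0) T \<zeta> q q0 ql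
      \<longleftrightarrow> is_solution l h0 gr b g0 gl (Suc m) \<zeta>in qin T \<zeta> q q0 ql" for T \<zeta> q q0 ql
    by (rule is_solution_initial_cong) (simp_all only: e less_imp_le[OF l])
  have "\<exists>T>0. \<exists>\<zeta> q q0 ql. is_solution l h0 gr b g0 gl (Suc m) (J (Suc m) z0) (J (Suc (Suc m)) w0) (ereal T) \<zeta> q q0 ql"
  proof (rule jet_solution[OF g0 gl])
    show "0 < h0 + J (Suc m) z0 x - b x" if "x \<in> {0..l}" for x
      using pos[OF that] e(1)[OF that] by (simp del: jval.simps)
    show "g0 0 = J (Suc m) z0 0" "gl 0 = J (Suc m) z0 l"
      using g0_0 gl_0 e(1)[OF ends(1)] e(1)[OF ends(2)] by (simp_all del: jval.simps)
  qed
  then show ?thesis unfolding c m .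
qed

section \<open>Equations satisfied by an arbitrary solution\<close>

lemma time_ivl_Icc: "\<tau> \<in> time_ivl T \<Longrightarrow> {0..\<tau>} \<subseteq> time_ivl T"
  unfolding time_ivl_def by auto (metis ereal_less_eq(3) le_less_trans)

lemma time_ivl_nontrivial:
  assumes "t \<in> time_ivl T"
  shows "at t within time_ivl T \<noteq> bot"
proof -
  obtain r where r: "ereal t < r" "r < T" using assms dense[of "ereal t" T] by (auto simp: time_ivl_def)
  then obtain s where s: "t < s" "ereal s < T" by (cases r) auto
  have t: "0 \<le> t" using assms by (simp add: time_ivl_def)
  have "{0..<s} \<subseteq> time_ivl T"
    using time_ivl_Icc[of s T] s t atLeastLessThan_subseteq_atLeastAtMost_iff[of 0 s 0 s]
    unfolding time_ivl_def[of T] by force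
  then have "at t within {0..<s} \<le> at t within time_ivl T" by (rule at_le)
  then show ?thesis
    using at_within_time_nontrivial[of t s] s(1) t by (auto simp: bot_unique)
qed

lemma continuous_eq_closed_interval:
  fixes f g :: "real \<Rightarrow> real"
  assumes "continuous_on {a..c} f" "continuous_on {a..c} g" "\<And>x. x \<in> {a<..<c} \<Longrightarrow> f x = g x" "a < c" "x \<in> {a..c}"
  shows "f x = g x"
proof -
  have cl: "closure {a<..<c} = {a..c}" using assms(4) by (rule closure_greaterThanLessThan)
  have "continuous_on (closure {a<..<c}) (\<lambda>x. f x - g x)"
    unfolding cl by (rule continuous_on_diff[OF assms(1,2)])
  from continuous_constant_on_closure[OF this, of 0 x] assms(3,5) cl show ?thesis by simp
qed

text \<open>The embedding \<open>Hnorm_sup\<close> applied to the difference quotient itself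
  converts differentiability in the Sobolev norm into differentiability in the sup norm.\<close>

lemma Hs_quotient:
  assumes I: "\<And>s. s \<in> I \<Longrightarrow> u s \<in> Hs l (Suc k)" and t: "t \<in> I" and v: "v \<in> Hs l (Suc k)" and l: "l > 0"
    and lim: "((\<lambda>s. Hnorm l (Suc k) (\<lambda>x. (u s x - u t x) / (s - t) - v x)) \<longlongrightarrow> 0) (at t within I)"
  shows "((\<lambda>s. toC l (u s)) has_vector_derivative toC l v) (at t within I)"
proof -
  let ?C = "sqrt (1 / l + 1)"
  have le: "norm ((1 / (s - t)) *\<^sub>R (toC l (u s) - toC l (u t)) - toC l v)
      \<le> ?C * Hnorm l (Suc k) (\<lambda>x. (u s x - u t x) / (s - t) - v x)" if s: "s \<in> I" for s
  proof -
    let ?d = "\<lambda>x. 1 / (s - t) * u s x + (- 1 / (s - t)) * u t x"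
    let ?q = "\<lambda>x. 1 * ?d x + (- 1) * v x"
    have d: "?d \<in> Hs l (Suc k)" by (rule Hs_lin[OF l I[OF s] I[OF t]])
    have q: "?q \<in> Hs l (Suc k)" by (rule Hs_lin[OF l d v])
    have qe: "?q = (\<lambda>x. (u s x - u t x) / (s - t) - v x)" by (rule ext) (simp add: diff_divide_distrib)
    have "toC l ?d = (1 / (s - t)) *\<^sub>R toC l (u s) + (- 1 / (s - t)) *\<^sub>R toC l (u t)"
      by (rule toC_lin[OF Hs_continuous[OF I[OF s]] Hs_continuous[OF I[OF t]] less_imp_le[OF l] Hs_continuous[OF d]]) simp
    moreover have "toC l ?q = 1 *\<^sub>R toC l ?d + (- 1) *\<^sub>R toC l v"
      by (rule toC_lin[OF Hs_continuous[OF d] Hs_continuous[OF v] less_imp_le[OF l] Hs_continuous[OF q]]) simp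
    ultimately have "(1 / (s - t)) *\<^sub>R (toC l (u s) - toC l (u t)) - toC l v = toC l ?q"
      by (simp add: scaleR_diff_right)
    moreover have "norm (toC l ?q) \<le> ?C * Hnorm l (Suc k) ?q"
      by (rule toC_norm[OF Hs_continuous[OF q] Hnorm_sup[OF q l] less_imp_le[OF l]])
    ultimately show ?thesis unfolding qe by simp
  qed
  have "((\<lambda>s. ?C * Hnorm l (Suc k) (\<lambda>x. (u s x - u t x) / (s - t) - v x)) \<longlongrightarrow> ?C * 0) (at t within I)"
    by (intro tendsto_mult tendsto_const lim)
  note lim' = this[unfolded mult_zero_right]
  show ?thesis
    unfolding has_vector_derivative_iff_quotient
    by (rule tendsto_sandwich[OF _ _ tendsto_const lim']) (simp_all add: eventually_at_filter le)
qed

text \<open>With two orders \<open>Dw\<close> is linear at every point of {0..l}, so it commutes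
  with difference quotients, and its norm is part of the norm one order higher.\<close>

lemma Hs_quotient_Dw:
  assumes I: "\<And>s. s \<in> I \<Longrightarrow> u s \<in> Hs l (Suc (Suc k))" and t: "t \<in> I" and v: "v \<in> Hs l (Suc (Suc k))" and l: "l > 0"
    and lim: "((\<lambda>s. Hnorm l (Suc (Suc k)) (\<lambda>x. (u s x - u t x) / (s - t) - v x)) \<longlongrightarrow> 0) (at t within I)"
  shows "((\<lambda>s. Hnorm l (Suc k) (\<lambda>x. (Dw l (u s) x - Dw l (u t) x) / (s - t) - Dw l v x)) \<longlongrightarrow> 0) (at t within I)"
proof (rule tendsto_sandwich[OF _ _ tendsto_const lim])
  have "Hnorm l (Suc k) (\<lambda>x. (Dw l (u s) x - Dw l (u t) x) / (s - t) - Dw l v x)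
      \<le> Hnorm l (Suc (Suc k)) (\<lambda>x. (u s x - u t x) / (s - t) - v x)" if s: "s \<in> I" for s
  proof -
    let ?d = "\<lambda>x. 1 / (s - t) * u s x + (- 1 / (s - t)) * u t x"
    let ?q = "\<lambda>x. 1 * ?d x + (- 1) * v x"
    have d: "?d \<in> Hs l (Suc (Suc k))" by (rule Hs_lin[OF l I[OF s] I[OF t]])
    have qe: "?q = (\<lambda>x. (u s x - u t x) / (s - t) - v x)" by (rule ext) (simp add: diff_divide_distrib)
    have "Hnorm l (Suc k) (\<lambda>x. (Dw l (u s) x - Dw l (u t) x) / (s - t) - Dw l v x) = Hnorm l (Suc k) (Dw l ?q)"
    proof (rule Hnorm_AE_cong, rule AE_Ioo_all)
      fix x assume "x \<in> {0<..<l}"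
      then have x: "x \<in> {0..l}" by simp
      show "(Dw l (u s) x - Dw l (u t) x) / (s - t) - Dw l v x = Dw l ?q x"
        unfolding Dw_lin[OF d v l x] Dw_lin[OF I[OF s] I[OF t] l x] by (simp add: diff_divide_distrib)
    qed
    also have "\<dots> \<le> Hnorm l (Suc (Suc k)) ?q" by (rule Hnorm_Suc_ge)
    finally show ?thesis unfolding qe .
  qed
  then show "eventually (\<lambda>s. Hnorm l (Suc k) (\<lambda>x. (Dw l (u s) x - Dw l (u t) x) / (s - t) - Dw l v x)
      \<le> Hnorm l (Suc (Suc k)) (\<lambda>x. (u s x - u t x) / (s - t) - v x)) (at t within I)"
    by (simp add: eventually_at_filter)
qed (simp add: Hnorm_nonneg)

lemma smooth_curve_derivative:
  assumes "smooth_curve l k I u"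
  shows "\<exists>v. \<forall>t\<in>I. u t \<in> Hs l k \<and> v t \<in> Hs l k \<and>
    ((\<lambda>s. Hnorm l k (\<lambda>x. (u s x - u t x) / (s - t) - v t x)) \<longlongrightarrow> 0) (at t within I)"
proof -
  obtain U where U: "\<And>t. t \<in> I \<Longrightarrow> U (0::nat) t = u t" "\<And>k' t. t \<in> I \<Longrightarrow> U k' t \<in> Hs l k"
    "\<And>k' t. t \<in> I \<Longrightarrow> ((\<lambda>s. Hnorm l k (\<lambda>x. (U k' s x - U k' t x) / (s - t) - U (Suc k') t x)) \<longlongrightarrow> 0) (at t within I)"
    using assms unfolding smooth_curve_def by blast
  show ?thesis
  proof (rule exI, rule ballI, intro conjI)
    show "u t \<in> Hs l k" "U 1 t \<in> Hs l k" if "t \<in> I" for t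
      using U(2)[OF that, of 0] U(2)[OF that, of 1] U(1)[OF that] by simp_all
    show "((\<lambda>s. Hnorm l k (\<lambda>x. (u s x - u t x) / (s - t) - U 1 t x)) \<longlongrightarrow> 0) (at t within I)" if t: "t \<in> I" for t
    proof (rule Lim_transform_eventually[OF U(3)[OF t, of 0]])
      show "eventually (\<lambda>s. Hnorm l k (\<lambda>x. (U 0 s x - U 0 t x) / (s - t) - U (Suc 0) t x)
          = Hnorm l k (\<lambda>x. (u s x - u t x) / (s - t) - U 1 t x)) (at t within I)"
        by (simp add: eventually_at_filter U(1) t)
    qed
  qed
qed

lemma toC_pointwise:
  assumes "((\<lambda>s. toC l (u s)) has_vector_derivative toC l v) (at t within I)"
    and c: "\<And>s. s \<in> I \<Longrightarrow> continuous_on {0..l} (u s)" "continuous_on {0..l} v" and t: "t \<in> I" and x: "x \<in> {0..l}"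
  shows "((\<lambda>s. u s x) has_real_derivative v x) (at t within I)"
proof -
  have "((\<lambda>s. apply_bcontfun (toC l (u s)) x) has_real_derivative apply_bcontfun (toC l v) x) (at t within I)"
    unfolding has_real_derivative_iff_has_vector_derivative
    by (rule bounded_linear.has_vector_derivative[OF bounded_linear_apply_bcontfun assms(1)])
  then have "((\<lambda>s. apply_bcontfun (toC l (u s)) x) has_real_derivative v x) (at t within I)"
    by (simp only: toC_apply[OF c(2) x])
  then show ?thesis
    by (rule has_field_derivative_transform_within[OF _ zero_less_one t]) (simp only: toC_apply[OF c(1) x])
qed

context bottom
begin

text \<open>\<open>Vf\<close>, \<open>Wf\<close> are \<open>v = R\<^sub>b\<^sup>1(f/h\<^sub>b\<^sup>2)\<close> and the flux \<open>\<surd>3 (h\<^sub>b/\<alpha>\<^sub>b) (h\<^sub>bS)\<^sup>*v\<close>; \<open>Yf\<close>, \<open>Sf\<close> are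
  \<open>y = R\<^sub>b\<^sup>0B\<close> and \<open>h\<^sub>b y'\<close>; \<open>Pl\<close>, \<open>Pr\<close> are the time derivatives of \<open>q\<^sub>0\<close>, \<open>q\<^sub>\<ell>\<close> given by the boundary
  equations.\<close>

definition Ff :: "real \<Rightarrow> (real \<Rightarrow> real) \<Rightarrow> (real \<Rightarrow> real) \<Rightarrow> real \<Rightarrow> real" where
  "Ff gr z p x = 1 / (H x)\<^sup>2 * fNSW h0 gr b x (z x) (p x)"
definition "Wf gr z p = F.dir1 (\<lambda>x. - 3 * Ff gr z p x) (\<lambda>x. 0) 0 0"
definition "Vf gr z p = F.dir2 (\<lambda>x. - 3 * Ff gr z p x) (\<lambda>x. 0) 0 0"
definition "Yf gr z p = D.dir1 (\<lambda>x. 0) (\<lambda>x. - 3 * Bsrc l h0 gr b z p x / H x) 0 0"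
definition "Sf gr z p = D.dir2 (\<lambda>x. 0) (\<lambda>x. - 3 * Bsrc l h0 gr b z p x / H x) 0 0"
definition "Pl gr g0 gl t z p a c = (s22 * rhs_bdry gr g0 0 t (Vf gr z p 0) (Sf gr z p 0 / H 0) a
  - s12 * rhs_bdry gr gl l t (Vf gr z p l) (Sf gr z p l / H l) c) / sdet"
definition "Pr gr g0 gl t z p a c = (s11 * rhs_bdry gr gl l t (Vf gr z p l) (Sf gr z p l / H l) c
  - s21 * rhs_bdry gr g0 0 t (Vf gr z p 0) (Sf gr z p 0 / H 0) a) / sdet"

lemma Ff_Bsrc_continuous:
  assumes "continuous_on {0..l} z" "continuous_on {0..l} p" "\<And>x. x \<in> {0..l} \<Longrightarrow> h0 + z x - b x \<noteq> 0"
  shows "continuous_on {0..l} (Ff gr z p)" "continuous_on {0..l} (Bsrc l h0 gr b z p)"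
proof -
  have f: "continuous_on {0..l} (\<lambda>x. fNSW h0 gr b x (z x) (p x))"
    unfolding fNSW_def Let_def using assms Ck_on_continuous[OF b_Ck]
    by (intro continuous_intros) auto
  show "continuous_on {0..l} (Ff gr z p)"
    unfolding Ff_def[abs_def] using f conts H_nz by (intro continuous_intros) auto
  show "continuous_on {0..l} (Bsrc l h0 gr b z p)"
    unfolding Bsrc_def[abs_def] using f conts H_nz assms Ck_on_continuous[OF b_Ck]
    by (intro continuous_intros) auto
qed

text \<open>All that uniqueness uses of a solution: equations in t at fixed x, valid up to both ends
  by continuity in x. The third is the second differentiated in x; the first-order systems replace
  the derivatives of flux, Dirichlet solution and boundary functions, so no derivative of the
  elevation or of \<open>Dw l (q t)\<close> appears on the right.\<close>

lemma solution_equations: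
  assumes sol: "is_solution l h0 gr b g0 gl (Suc m) \<zeta>in qin T \<zeta> q q0 ql"
  shows "\<exists>\<zeta>' q'. (\<forall>t\<in>time_ivl T. \<zeta> t \<in> Hs l (Suc m) \<and> q t \<in> Hs l (Suc (Suc m)) \<and>
      ((\<lambda>s. toC l (\<zeta> s)) has_vector_derivative toC l (\<zeta>' t)) (at t within time_ivl T) \<and>
      ((\<lambda>s. toC l (q s)) has_vector_derivative toC l (q' t)) (at t within time_ivl T) \<and>
      ((\<lambda>s. toC l (Dw l (q s))) has_vector_derivative toC l (Dw l (q' t))) (at t within time_ivl T) \<and>
      (\<forall>x\<in>{0..l}.
        ((\<lambda>s. \<zeta> s x) has_real_derivative - Dw l (q t) x) (at t within time_ivl T) \<and>
        ((\<lambda>s. q s x) has_real_derivative - Wf gr (\<zeta> t) (q t) x + Yf gr (\<zeta> t) (q t) x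
          + Pl gr g0 gl t (\<zeta> t) (q t) (q0 t) (ql t) * sL1 x + Pr gr g0 gl t (\<zeta> t) (q t) (q0 t) (ql t) * sR1 x)
          (at t within time_ivl T) \<and>
        ((\<lambda>s. Dw l (q s) x) has_real_derivative
          - (B1 x / (2 * H x) * Wf gr (\<zeta> t) (q t) x + 3 * Vf gr (\<zeta> t) (q t) x - 3 * Ff gr (\<zeta> t) (q t) x)
          + 1 / H x * Sf gr (\<zeta> t) (q t) x
          + Pl gr g0 gl t (\<zeta> t) (q t) (q0 t) (ql t) * (1 / H x * sL2 x)
          + Pr gr g0 gl t (\<zeta> t) (q t) (q0 t) (ql t) * (1 / H x * sR2 x)) (at t within time_ivl T)) \<and>
      (q0 has_real_derivative Pl gr g0 gl t (\<zeta> t) (q t) (q0 t) (ql t)) (at t within time_ivl T) \<and>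
      (ql has_real_derivative Pr gr g0 gl t (\<zeta> t) (q t) (q0 t) (ql t)) (at t within time_ivl T))"
proof -
  let ?I = "time_ivl T"
  note S = sol[unfolded is_solution_def Let_def]
  note S4 = S[THEN conjunct2, THEN conjunct2, THEN conjunct2, THEN conjunct2]
  note c\<zeta> = S[THEN conjunct1]
  have cq: "smooth_curve l (Suc (Suc m)) ?I q" using S[THEN conjunct2, THEN conjunct1] by simp
  note q0 = S[THEN conjunct2, THEN conjunct2, THEN conjunct1]
  note ql = S[THEN conjunct2, THEN conjunct2, THEN conjunct2, THEN conjunct1]
  note nz = S4[THEN conjunct1, rule_format]
  note E12 = S4[THEN conjunct2, THEN conjunct2, THEN conjunct1, rule_format]
  note E1 = E12[THEN conjunct1] and E2 = E12[THEN conjunct2]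
  note E3 = S4[THEN conjunct2, THEN conjunct2, THEN conjunct2, THEN conjunct1, rule_format]
  note nt = time_ivl_nontrivial
  from smooth_curve_derivative[OF c\<zeta>] obtain \<zeta>' where z: "\<forall>t\<in>?I. \<zeta> t \<in> Hs l (Suc m) \<and> \<zeta>' t \<in> Hs l (Suc m) \<and>
    ((\<lambda>s. Hnorm l (Suc m) (\<lambda>x. (\<zeta> s x - \<zeta> t x) / (s - t) - \<zeta>' t x)) \<longlongrightarrow> 0) (at t within ?I)" by (rule exE)
  note \<zeta> = z[rule_format, THEN conjunct1] z[rule_format, THEN conjunct2, THEN conjunct1]
  note d\<zeta> = z[rule_format, THEN conjunct2, THEN conjunct2]
  from smooth_curve_derivative[OF cq] obtain q' where w: "\<forall>t\<in>?I. q t \<in> Hs l (Suc (Suc m)) \<and> q' t \<in> Hs l (Suc (Suc m)) \<and>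
    ((\<lambda>s. Hnorm l (Suc (Suc m)) (\<lambda>x. (q s x - q t x) / (s - t) - q' t x)) \<longlongrightarrow> 0) (at t within ?I)" by (rule exE)
  note q = w[rule_format, THEN conjunct1] w[rule_format, THEN conjunct2, THEN conjunct1]
  note dq = w[rule_format, THEN conjunct2, THEN conjunct2]
  note r = Hs_Dw(1)[OF q(1) l] Hs_Dw(1)[OF q(2) l]
  have C\<zeta>: "((\<lambda>s. toC l (\<zeta> s)) has_vector_derivative toC l (\<zeta>' t)) (at t within ?I)"
    and Cq: "((\<lambda>s. toC l (q s)) has_vector_derivative toC l (q' t)) (at t within ?I)"
    and Cr: "((\<lambda>s. toC l (Dw l (q s))) has_vector_derivative toC l (Dw l (q' t))) (at t within ?I)" if t: "t \<in> ?I" for t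
    using Hs_quotient[OF \<zeta>(1) t \<zeta>(2)[OF t] l d\<zeta>[OF t]] Hs_quotient[OF q(1) t q(2)[OF t] l dq[OF t]]
      Hs_quotient[where u = "\<lambda>s. Dw l (q s)", OF r(1) t r(2)[OF t] l Hs_quotient_Dw[OF q(1) t q(2)[OF t] l dq[OF t]]] by simp_all
  have P\<zeta>: "((\<lambda>s. \<zeta> s x) has_real_derivative \<zeta>' t x) (at t within ?I)"
    and Pq: "((\<lambda>s. q s x) has_real_derivative q' t x) (at t within ?I)"
    and Pr: "((\<lambda>s. Dw l (q s) x) has_real_derivative Dw l (q' t) x) (at t within ?I)" if t: "t \<in> ?I" and x: "x \<in> {0..l}" for t x
    using toC_pointwise[OF C\<zeta>[OF t] Hs_continuous[OF \<zeta>(1)] Hs_continuous[OF \<zeta>(2)[OF t]] t x]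
      toC_pointwise[OF Cq[OF t] Hs_continuous[OF q(1)] Hs_continuous[OF q(2)[OF t]] t x]
      toC_pointwise[OF Cr[OF t] Hs_continuous[OF r(1)] Hs_continuous[OF r(2)[OF t]] t x] by simp_all
  have e\<zeta>: "\<zeta>' t x = - Dw l (q t) x" if t: "t \<in> ?I" and x: "x \<in> {0..l}" for t x
  proof (rule continuous_eq_closed_interval[OF Hs_continuous[OF \<zeta>(2)[OF t]] continuous_on_minus[OF Hs_continuous[OF r(1)[OF t]]] _ l x])
    fix y assume y: "y \<in> {0<..<l}"
    show "\<zeta>' t y = - Dw l (q t) y"
      using E1[OF t y] Dcl_unique[OF nt[OF t] P\<zeta>[OF t, of y]] y by simp
  qed
  let ?Pl = "\<lambda>t. Pl gr g0 gl t (\<zeta> t) (q t) (q0 t) (ql t)"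
  let ?Pr = "\<lambda>t. Pr gr g0 gl t (\<zeta> t) (q t) (q0 t) (ql t)"
  have cF: "continuous_on {0..l} (Ff gr (\<zeta> t) (q t))" and cB: "continuous_on {0..l} (Bsrc l h0 gr b (\<zeta> t) (q t))"
    if t: "t \<in> ?I" for t
    using Ff_Bsrc_continuous[OF Hs_continuous[OF \<zeta>(1)[OF t]] Hs_continuous[OF q(1)[OF t]] nz[OF t]] by simp_all
  have Fe: "(\<lambda>x. 1 / (H x)\<^sup>2 * fNSW h0 gr b x (\<zeta> t x) (q t x)) = Ff gr (\<zeta> t) (q t)" for t
    by (simp add: Ff_def fun_eq_iff)
  have Rf: "Rf l h0 gr b (\<zeta> t) (q t) x = Vf gr (\<zeta> t) (q t) x"
    "sqrt 3 * (H x / \<alpha> x) * hbS_adj l h0 b (Rf l h0 gr b (\<zeta> t) (q t)) x = Wf gr (\<zeta> t) (q t) x"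
    if t: "t \<in> ?I" and x: "x \<in> {0..l}" for t x
    unfolding Rf_def Fe R1_eq[OF cF[OF t] cF[OF t] x] Vf_def Wf_def by (rule refl)+
  have R0: "R0 l h0 b (Bsrc l h0 gr b (\<zeta> t) (q t)) x = Yf gr (\<zeta> t) (q t) x"
    "Dw l (R0 l h0 b (Bsrc l h0 gr b (\<zeta> t) (q t))) x = Sf gr (\<zeta> t) (q t) x / H x"
    if t: "t \<in> ?I" and x: "x \<in> {0..l}" for t x
    using dirichlet_sol_eq[OF cB[OF t] cB[OF t] x, of 0 0] H_nz[OF x]
    unfolding R0_def Yf_def Sf_def by (simp_all add: field_simps)
  have dP: "Dcl ?I q0 t = ?Pl t" "Dcl ?I ql t = ?Pr t" if t: "t \<in> ?I" for t
    using E3[OF t] unfolding boundary_law_iff[OF Rf(1)[OF t ends(1), symmetric] Rf(1)[OF t ends(2), symmetric]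
      R0(2)[OF t ends(1), symmetric] R0(2)[OF t ends(2), symmetric]] Pl_def Pr_def by simp_all
  define rhs where "rhs t x = - Wf gr (\<zeta> t) (q t) x + Yf gr (\<zeta> t) (q t) x + ?Pl t * sL1 x + ?Pr t * sR1 x" for t x
  define rhs' where "rhs' t x = - (B1 x / (2 * H x) * Wf gr (\<zeta> t) (q t) x + 3 * Vf gr (\<zeta> t) (q t) x - 3 * Ff gr (\<zeta> t) (q t) x)
          + 1 / H x * Sf gr (\<zeta> t) (q t) x + ?Pl t * (1 / H x * sL2 x) + ?Pr t * (1 / H x * sR2 x)" for t x
  have solF: "F.sol (\<lambda>x. - 3 * Ff gr (\<zeta> t) (q t) x) (\<lambda>x. 0) (Wf gr (\<zeta> t) (q t)) (Vf gr (\<zeta> t) (q t))" if t: "t \<in> ?I" for t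
    unfolding Wf_def Vf_def by (rule F.dir_sol[OF continuous_on_mult[OF continuous_on_const cF[OF t]] continuous_on_const])
  have solD: "D.sol (\<lambda>x. 0) (\<lambda>x. - 3 * Bsrc l h0 gr b (\<zeta> t) (q t) x / H x) (Yf gr (\<zeta> t) (q t)) (Sf gr (\<zeta> t) (q t))" if t: "t \<in> ?I" for t
    unfolding Yf_def Sf_def by (rule D.dir_sol[OF continuous_on_const dirichlet_data_continuous[OF cB[OF t]]])
  have drhs: "(rhs t has_real_derivative rhs' t x) (at x within {0..l})" if t: "t \<in> ?I" and x: "x \<in> {0..l}" for t x
    unfolding rhs_def[abs_def] rhs'_def
    by (rule derivative_eq_intros F.solD(1)[OF solF[OF t] x] D.solD(1)[OF solD[OF t] x]
        D.solD(1)[OF s_sol(1) x] D.solD(1)[OF s_sol(2) x] refl)+ (simp add: algebra_simps)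
  have crhs': "continuous_on {0..l} (rhs' t)" if t: "t \<in> ?I" for t
    unfolding rhs'_def[abs_def]
    using F.sol_continuous[OF solF[OF t]] D.sol_continuous[OF solD[OF t]] D.sol_continuous[OF s_sol(1)]
      D.sol_continuous[OF s_sol(2)] conts cF[OF t] H_nz by (intro continuous_intros) auto
  have eq: "q' t x = rhs t x" if t: "t \<in> ?I" and x: "x \<in> {0..l}" for t x
  proof (rule continuous_eq_closed_interval[OF Hs_continuous[OF q(2)[OF t]] C1_continuous[OF drhs[OF t]] _ l x])
    fix y assume y: "y \<in> {0<..<l}"
    then have y': "y \<in> {0..l}" by simp
    show "q' t y = rhs t y"
      using E2[OF t y] unfolding Rf[OF t y'] R0[OF t y'] s_eq(1,3)[OF y'] dP[OF t] Dcl_unique[OF nt[OF t] Pq[OF t y']] rhs_def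
      by simp
  qed
  \<comment> \<open>The two sides of the second equation agree on the interval as functions of x,
    and the right-hand side is C^1 there; hence its classical derivative is the value of
    \<open>Dw\<close>.\<close>
  have er: "Dw l (q' t) x = rhs' t x" if t: "t \<in> ?I" and x: "x \<in> {0..l}" for t x
  proof -
    have "Dw l (q' t) = Dw l (rhs t)" by (rule Dw_cong) (simp add: eq[OF t])
    then show ?thesis using Dw_C1[OF drhs[OF t] crhs'[OF t] l x] by simp
  qed
  have dq0: "(q0 has_real_derivative ?Pl t) (at t within ?I)" "(ql has_real_derivative ?Pr t) (at t within ?I)" if t: "t \<in> ?I" for t
    using Dcl_smooth(2)[OF nt q0 t] Dcl_smooth(2)[OF nt ql t] unfolding dP[OF t] by simp_all
  show ?thesis
  proof (rule exI, rule exI, rule ballI, intro conjI ballI)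
    fix t assume t: "t \<in> ?I"
    show "\<zeta> t \<in> Hs l (Suc m)" "q t \<in> Hs l (Suc (Suc m))" by (rule \<zeta>(1)[OF t] q(1)[OF t])+
    show "((\<lambda>s. toC l (\<zeta> s)) has_vector_derivative toC l (\<zeta>' t)) (at t within ?I)"
      "((\<lambda>s. toC l (q s)) has_vector_derivative toC l (q' t)) (at t within ?I)"
      "((\<lambda>s. toC l (Dw l (q s))) has_vector_derivative toC l (Dw l (q' t))) (at t within ?I)"
      by (rule C\<zeta>[OF t] Cq[OF t] Cr[OF t])+
    show "(q0 has_real_derivative ?Pl t) (at t within ?I)" "(ql has_real_derivative ?Pr t) (at t within ?I)"
      by (rule dq0[OF t])+
    fix x assume x: "x \<in> {0..l}"
    show "((\<lambda>s. \<zeta> s x) has_real_derivative - Dw l (q t) x) (at t within ?I)"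
      using P\<zeta>[OF t x] unfolding e\<zeta>[OF t x] .
    show "((\<lambda>s. q s x) has_real_derivative - Wf gr (\<zeta> t) (q t) x + Yf gr (\<zeta> t) (q t) x
          + ?Pl t * sL1 x + ?Pr t * sR1 x) (at t within ?I)"
      using Pq[OF t x] unfolding eq[OF t x] rhs_def .
    show "((\<lambda>s. Dw l (q s) x) has_real_derivative
          - (B1 x / (2 * H x) * Wf gr (\<zeta> t) (q t) x + 3 * Vf gr (\<zeta> t) (q t) x - 3 * Ff gr (\<zeta> t) (q t) x)
          + 1 / H x * Sf gr (\<zeta> t) (q t) x + ?Pl t * (1 / H x * sL2 x) + ?Pr t * (1 / H x * sR2 x)) (at t within ?I)"
      using Pr[OF t x] unfolding er[OF t x] rhs'_def .
  qed
qed

end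

section \<open>Uniqueness\<close>

text \<open>Two evolutions \<open>f\<close>, \<open>g\<close> are compared on \<open>{0..\<tau>}\<close>; \<open>\<Psi> t M\<close> will say that the unknowns of two
  solutions differ by at most \<open>M\<close> at time \<open>t\<close>.\<close>

definition bnd :: "real \<Rightarrow> real \<Rightarrow> (real \<Rightarrow> real \<Rightarrow> real) \<Rightarrow> bool" where
  "bnd \<tau> l f \<longleftrightarrow> (\<exists>C\<ge>0. \<forall>t\<in>{0..\<tau>}. \<forall>x\<in>{0..l}. \<bar>f t x\<bar> \<le> C)"

definition gap :: "real \<Rightarrow> real \<Rightarrow> (real \<Rightarrow> real \<Rightarrow> bool) \<Rightarrow> (real \<Rightarrow> real \<Rightarrow> real) \<Rightarrow> (real \<Rightarrow> real \<Rightarrow> real) \<Rightarrow> bool" where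
  "gap \<tau> l \<Psi> f g \<longleftrightarrow> (\<exists>K\<ge>0. \<forall>t\<in>{0..\<tau>}. \<forall>M. \<Psi> t M \<longrightarrow> (\<forall>x\<in>{0..l}. \<bar>f t x - g t x\<bar> \<le> K * M))"

lemma bndI: "(\<And>t x. t \<in> {0..\<tau>} \<Longrightarrow> x \<in> {0..l} \<Longrightarrow> \<bar>f t x\<bar> \<le> C) \<Longrightarrow> bnd \<tau> l f"
  unfolding bnd_def by (intro exI[of _ "max 0 C"]) (auto simp: le_max_iff_disj)

lemma bnd_space:
  assumes "continuous_on {0..l} m"
  shows "bnd \<tau> l (\<lambda>t. m)"
proof -
  from continuous_bounded_Icc[OF assms] obtain C where "\<forall>x\<in>{0..l}. \<bar>m x\<bar> \<le> C" by blast
  then show ?thesis by (intro bndI[of _ _ _ C]) simp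
qed

lemma bnd_time:
  assumes "continuous_on {0..\<tau>} m"
  shows "bnd \<tau> l (\<lambda>t x. m t)"
proof -
  from continuous_bounded_Icc[OF assms] obtain C where "\<forall>x\<in>{0..\<tau>}. \<bar>m x\<bar> \<le> C" by blast
  then show ?thesis by (intro bndI[of _ _ _ C]) simp
qed

lemma bnd_mult:
  assumes "bnd \<tau> l f" "bnd \<tau> l g"
  shows "bnd \<tau> l (\<lambda>t x. f t x * g t x)"
proof -
  from assms(1) obtain C where C: "0 \<le> C" "\<And>t x. t \<in> {0..\<tau>} \<Longrightarrow> x \<in> {0..l} \<Longrightarrow> \<bar>f t x\<bar> \<le> C"
    unfolding bnd_def by blast
  from assms(2) obtain E where E: "0 \<le> E" "\<And>t x. t \<in> {0..\<tau>} \<Longrightarrow> x \<in> {0..l} \<Longrightarrow> \<bar>g t x\<bar> \<le> E"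
    unfolding bnd_def by blast
  show ?thesis
    by (rule bndI[of _ _ _ "C * E"]) (simp add: abs_mult mult_mono C E)
qed

lemma gapE:
  assumes "gap \<tau> l \<Psi> f g"
  obtains K where "0 \<le> K" "\<And>t M x. t \<in> {0..\<tau>} \<Longrightarrow> \<Psi> t M \<Longrightarrow> x \<in> {0..l} \<Longrightarrow> \<bar>f t x - g t x\<bar> \<le> K * M"
  using assms unfolding gap_def by blast

lemma gapI:
  assumes "0 \<le> K" "\<And>t M x. t \<in> {0..\<tau>} \<Longrightarrow> \<Psi> t M \<Longrightarrow> x \<in> {0..l} \<Longrightarrow> \<bar>f t x - g t x\<bar> \<le> K * M"
  shows "gap \<tau> l \<Psi> f g"
  using assms unfolding gap_def by blast

lemma gap_refl: "gap \<tau> l \<Psi> f f"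
  by (rule gapI[of 0]) simp_all

lemma gap_add:
  assumes "gap \<tau> l \<Psi> f g" "gap \<tau> l \<Psi> f' g'"
  shows "gap \<tau> l \<Psi> (\<lambda>t x. f t x + f' t x) (\<lambda>t x. g t x + g' t x)"
proof -
  from assms(1) obtain K where K: "0 \<le> K" "\<And>t M x. t \<in> {0..\<tau>} \<Longrightarrow> \<Psi> t M \<Longrightarrow> x \<in> {0..l} \<Longrightarrow> \<bar>f t x - g t x\<bar> \<le> K * M"
    by (rule gapE) blast
  from assms(2) obtain L where L: "0 \<le> L" "\<And>t M x. t \<in> {0..\<tau>} \<Longrightarrow> \<Psi> t M \<Longrightarrow> x \<in> {0..l} \<Longrightarrow> \<bar>f' t x - g' t x\<bar> \<le> L * M"
    by (rule gapE) blast
  show ?thesis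
  proof (rule gapI[of "K + L"])
    show "\<bar>f t x + f' t x - (g t x + g' t x)\<bar> \<le> (K + L) * M" if "t \<in> {0..\<tau>}" "\<Psi> t M" "x \<in> {0..l}" for t M x
      using K(2)[OF that] L(2)[OF that] by (simp add: distrib_right)
  qed (use K L in simp)
qed

lemma gap_mult:
  assumes "gap \<tau> l \<Psi> f g" "gap \<tau> l \<Psi> f' g'" "bnd \<tau> l f" "bnd \<tau> l g'"
  shows "gap \<tau> l \<Psi> (\<lambda>t x. f t x * f' t x) (\<lambda>t x. g t x * g' t x)"
proof -
  from assms(1) obtain K where K: "0 \<le> K" "\<And>t M x. t \<in> {0..\<tau>} \<Longrightarrow> \<Psi> t M \<Longrightarrow> x \<in> {0..l} \<Longrightarrow> \<bar>f t x - g t x\<bar> \<le> K * M"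
    by (rule gapE) blast
  from assms(2) obtain L where L: "0 \<le> L" "\<And>t M x. t \<in> {0..\<tau>} \<Longrightarrow> \<Psi> t M \<Longrightarrow> x \<in> {0..l} \<Longrightarrow> \<bar>f' t x - g' t x\<bar> \<le> L * M"
    by (rule gapE) blast
  from assms(3) obtain C where C: "0 \<le> C" "\<And>t x. t \<in> {0..\<tau>} \<Longrightarrow> x \<in> {0..l} \<Longrightarrow> \<bar>f t x\<bar> \<le> C"
    unfolding bnd_def by blast
  from assms(4) obtain E where E: "0 \<le> E" "\<And>t x. t \<in> {0..\<tau>} \<Longrightarrow> x \<in> {0..l} \<Longrightarrow> \<bar>g' t x\<bar> \<le> E"
    unfolding bnd_def by blast
  show ?thesis
  proof (rule gapI[of "C * L + K * E"])
    fix t M x assume a: "t \<in> {0..\<tau>}" "\<Psi> t M" "x \<in> {0..l}"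
    have "f t x * f' t x - g t x * g' t x = f t x * (f' t x - g' t x) + (f t x - g t x) * g' t x"
      by (simp add: algebra_simps)
    also have "\<bar>\<dots>\<bar> \<le> \<bar>f t x\<bar> * \<bar>f' t x - g' t x\<bar> + \<bar>f t x - g t x\<bar> * \<bar>g' t x\<bar>"
      using abs_triangle_ineq by (simp add: abs_mult[symmetric])
    also have "\<dots> \<le> C * (L * M) + (K * M) * E"
      using K(2)[OF a] L(2)[OF a] C(1) C(2)[OF a(1,3)] E(2)[OF a(1,3)]
      by (intro add_mono mult_mono) (auto intro: order_trans[OF abs_ge_zero])
    finally show "\<bar>f t x * f' t x - g t x * g' t x\<bar> \<le> (C * L + K * E) * M" by (simp add: algebra_simps)
  qed (use K L C E in simp)
qed

lemma gap_cmult: "gap \<tau> l \<Psi> f g \<Longrightarrow> bnd \<tau> l m \<Longrightarrow> gap \<tau> l \<Psi> (\<lambda>t x. m t x * f t x) (\<lambda>t x. m t x * g t x)"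
proof -
  assume "gap \<tau> l \<Psi> f g" "bnd \<tau> l m"
  then obtain K C where K: "0 \<le> K" "\<And>t M x. t \<in> {0..\<tau>} \<Longrightarrow> \<Psi> t M \<Longrightarrow> x \<in> {0..l} \<Longrightarrow> \<bar>f t x - g t x\<bar> \<le> K * M"
    and C: "0 \<le> C" "\<And>t x. t \<in> {0..\<tau>} \<Longrightarrow> x \<in> {0..l} \<Longrightarrow> \<bar>m t x\<bar> \<le> C"
    unfolding bnd_def gap_def by blast
  show "gap \<tau> l \<Psi> (\<lambda>t x. m t x * f t x) (\<lambda>t x. m t x * g t x)"
  proof (rule gapI[of "C * K"])
    fix t M x assume a: "t \<in> {0..\<tau>}" "\<Psi> t M" "x \<in> {0..l}"
    have "\<bar>m t x * (f t x - g t x)\<bar> \<le> C * (K * M)"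
      unfolding abs_mult by (rule mult_mono[OF C(2)[OF a(1,3)] K(2)[OF a] C(1) abs_ge_zero])
    then show "\<bar>m t x * f t x - m t x * g t x\<bar> \<le> C * K * M" by (simp add: algebra_simps)
  qed (use K C in simp)
qed

lemma gap_scale: "gap \<tau> l \<Psi> f g \<Longrightarrow> gap \<tau> l \<Psi> (\<lambda>t x. c * f t x) (\<lambda>t x. c * g t x)"
  by (rule gap_cmult) (auto intro: bndI[of _ _ _ "\<bar>c\<bar>"])

lemma gap_at: "x0 \<in> {0..l} \<Longrightarrow> gap \<tau> l \<Psi> f g \<Longrightarrow> gap \<tau> l \<Psi> (\<lambda>t x. f t x0) (\<lambda>t x. g t x0)"
  unfolding gap_def by blast

lemma gap_inverse:
  assumes gap: "gap \<tau> l \<Psi> f g" and \<delta>: "0 < \<delta>"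
    and fg: "\<And>t x. t \<in> {0..\<tau>} \<Longrightarrow> x \<in> {0..l} \<Longrightarrow> \<delta> \<le> f t x \<and> \<delta> \<le> g t x"
  shows "gap \<tau> l \<Psi> (\<lambda>t x. 1 / f t x) (\<lambda>t x. 1 / g t x)"
proof -
  from gap obtain K where K: "0 \<le> K" "\<And>t M x. t \<in> {0..\<tau>} \<Longrightarrow> \<Psi> t M \<Longrightarrow> x \<in> {0..l} \<Longrightarrow> \<bar>f t x - g t x\<bar> \<le> K * M"
    by (rule gapE) blast
  show ?thesis
  proof (rule gapI[of "K / (\<delta> * \<delta>)"])
    fix t M x assume a: "t \<in> {0..\<tau>}" "\<Psi> t M" "x \<in> {0..l}"
    have p: "\<delta> \<le> f t x" "\<delta> \<le> g t x" using fg[OF a(1,3)] by auto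
    then have "1 / f t x - 1 / g t x = (g t x - f t x) / (f t x * g t x)" using \<delta> by (simp add: field_simps)
    then have "\<bar>1 / f t x - 1 / g t x\<bar> = \<bar>f t x - g t x\<bar> / (f t x * g t x)" using p \<delta> by (simp add: abs_minus_commute)
    also have "\<dots> \<le> (K * M) / (\<delta> * \<delta>)"
      using K(2)[OF a] p \<delta> by (intro frac_le mult_mono) auto
    finally show "\<bar>1 / f t x - 1 / g t x\<bar> \<le> K / (\<delta> * \<delta>) * M" by simp
  qed (use K \<delta> in simp)
qed

text \<open>By linearity the difference of two solutions has the difference of the data as data and
  zero boundary values, so \<open>dir_bound\<close> applies to it.\<close>

lemma (in bvp) gap_dir:
  assumes gap: "gap \<tau> l \<Psi> d1 e1" "gap \<tau> l \<Psi> d2 e2"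
    and d: "\<And>t. t \<in> {0..\<tau>} \<Longrightarrow> continuous_on {0..l} (d1 t)" "\<And>t. t \<in> {0..\<tau>} \<Longrightarrow> continuous_on {0..l} (d2 t)"
    and e: "\<And>t. t \<in> {0..\<tau>} \<Longrightarrow> continuous_on {0..l} (e1 t)" "\<And>t. t \<in> {0..\<tau>} \<Longrightarrow> continuous_on {0..l} (e2 t)"
    and nonneg: "\<And>t M. \<Psi> t M \<Longrightarrow> 0 \<le> M"
  shows "gap \<tau> l \<Psi> (\<lambda>t. dir1 (d1 t) (d2 t) 0 0) (\<lambda>t. dir1 (e1 t) (e2 t) 0 0)"
    "gap \<tau> l \<Psi> (\<lambda>t. dir2 (d1 t) (d2 t) 0 0) (\<lambda>t. dir2 (e1 t) (e2 t) 0 0)"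
proof -
  from gap(1) obtain K where K: "0 \<le> K" "\<And>t M x. t \<in> {0..\<tau>} \<Longrightarrow> \<Psi> t M \<Longrightarrow> x \<in> {0..l} \<Longrightarrow> \<bar>d1 t x - e1 t x\<bar> \<le> K * M"
    by (rule gapE) blast
  from gap(2) obtain L where L: "0 \<le> L" "\<And>t M x. t \<in> {0..\<tau>} \<Longrightarrow> \<Psi> t M \<Longrightarrow> x \<in> {0..l} \<Longrightarrow> \<bar>d2 t x - e2 t x\<bar> \<le> L * M"
    by (rule gapE) blast
  have "\<exists>C\<ge>0. \<forall>d1 d2 M. continuous_on {0..l} d1 \<longrightarrow> continuous_on {0..l} d2 \<longrightarrow> (\<forall>x\<in>{0..l}. \<bar>d1 x\<bar> \<le> M \<and> \<bar>d2 x\<bar> \<le> M) \<longrightarrow>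
      (\<forall>x\<in>{0..l}. \<bar>dir1 d1 d2 0 0 x\<bar> \<le> C * M \<and> \<bar>dir2 d1 d2 0 0 x\<bar> \<le> C * M)"
    by (rule dir_bound) meson
  then obtain C where C: "0 \<le> C" "\<And>d1 d2 M x. continuous_on {0..l} d1 \<Longrightarrow> continuous_on {0..l} d2 \<Longrightarrow>
      \<forall>x\<in>{0..l}. \<bar>d1 x\<bar> \<le> M \<and> \<bar>d2 x\<bar> \<le> M \<Longrightarrow> x \<in> {0..l} \<Longrightarrow>
      \<bar>dir1 d1 d2 0 0 x\<bar> \<le> C * M \<and> \<bar>dir2 d1 d2 0 0 x\<bar> \<le> C * M" by blast
  have le: "\<bar>dir1 (d1 t) (d2 t) 0 0 x - dir1 (e1 t) (e2 t) 0 0 x\<bar> \<le> C * (K + L) * M \<and>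
      \<bar>dir2 (d1 t) (d2 t) 0 0 x - dir2 (e1 t) (e2 t) 0 0 x\<bar> \<le> C * (K + L) * M"
    if a: "t \<in> {0..\<tau>}" "\<Psi> t M" "x \<in> {0..l}" for t M x
  proof -
    let ?f1 = "\<lambda>x. 1 * d1 t x + (- 1) * e1 t x" and ?f2 = "\<lambda>x. 1 * d2 t x + (- 1) * e2 t x"
    have f: "continuous_on {0..l} ?f1" "continuous_on {0..l} ?f2"
      by (intro continuous_on_add continuous_on_mult continuous_on_const d[OF a(1)] e[OF a(1)])+
    note M = nonneg[OF a(2)]
    have "\<bar>?f1 y\<bar> \<le> (K + L) * M \<and> \<bar>?f2 y\<bar> \<le> (K + L) * M" if "y \<in> {0..l}" for y
      using K(2)[OF a(1,2) that] L(2)[OF a(1,2) that] mult_nonneg_nonneg[OF K(1) M] mult_nonneg_nonneg[OF L(1) M]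
      by (simp add: distrib_right)
    then have "\<forall>y\<in>{0..l}. \<bar>?f1 y\<bar> \<le> (K + L) * M \<and> \<bar>?f2 y\<bar> \<le> (K + L) * M" ..
    note * = C(2)[OF f this a(3)]
    have "dir1 ?f1 ?f2 0 0 x = 1 * dir1 (d1 t) (d2 t) 0 0 x + (- 1) * dir1 (e1 t) (e2 t) 0 0 x"
      "dir2 ?f1 ?f2 0 0 x = 1 * dir2 (d1 t) (d2 t) 0 0 x + (- 1) * dir2 (e1 t) (e2 t) 0 0 x"
      by (rule dir_lin[OF d[OF a(1)] e[OF a(1)] f refl refl a(3)])+
    then show ?thesis using * by (simp add: mult.assoc)
  qed
  have p: "0 \<le> C * (K + L)" using C(1) K(1) L(1) by simp
  show "gap \<tau> l \<Psi> (\<lambda>t. dir1 (d1 t) (d2 t) 0 0) (\<lambda>t. dir1 (e1 t) (e2 t) 0 0)"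
    by (rule gapI[OF p]) (use le in blast)
  show "gap \<tau> l \<Psi> (\<lambda>t. dir2 (d1 t) (d2 t) 0 0) (\<lambda>t. dir2 (e1 t) (e2 t) 0 0)"
    by (rule gapI[OF p]) (use le in blast)
qed

text \<open>Convergence of the curve is uniform in the second argument, which gives continuity in
  both arguments together; it is used for the minimum of the height over a compact
  rectangle.\<close>

lemma bcontfun_curve_jointly_continuous:
  fixes c :: "real \<Rightarrow> cfun"
  assumes c: "continuous_on A c"
  shows "continuous_on (A \<times> UNIV) (\<lambda>p. apply_bcontfun (c (fst p)) (snd p))"
  unfolding continuous_on_def
proof
  fix p :: "real \<times> real" assume p: "p \<in> A \<times> UNIV"
  have "continuous_on (A \<times> UNIV) (\<lambda>q. c (fst q))"
    by (rule continuous_on_compose2[OF c continuous_on_fst[OF continuous_on_id]]) auto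
  then have "((\<lambda>q. c (fst q)) \<longlongrightarrow> c (fst p)) (at p within A \<times> UNIV)" using p unfolding continuous_on_def by blast
  then have "((\<lambda>q. norm (c (fst q) - c (fst p))) \<longlongrightarrow> 0) (at p within A \<times> UNIV)"
    by (intro tendsto_norm_zero) (simp add: LIM_zero)
  then have 1: "((\<lambda>q. apply_bcontfun (c (fst q) - c (fst p)) (snd q)) \<longlongrightarrow> 0) (at p within A \<times> UNIV)"
    by (rule Lim_null_comparison[rotated]) (rule always_eventually, rule allI, rule norm_bounded)
  have "continuous_on UNIV (\<lambda>q :: real \<times> real. apply_bcontfun (c (fst p)) (snd q))"
    by (rule continuous_on_compose2[OF continuous_on_apply_bcontfun continuous_on_snd[OF continuous_on_id]]) auto
  then have 2: "((\<lambda>q. apply_bcontfun (c (fst p)) (snd q)) \<longlongrightarrow> apply_bcontfun (c (fst p)) (snd p)) (at p within A \<times> UNIV)"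
    by (meson UNIV_I continuous_on_def subset_UNIV tendsto_within_subset)
  from tendsto_add[OF 1 2]
  show "((\<lambda>q. apply_bcontfun (c (fst q)) (snd q)) \<longlongrightarrow> apply_bcontfun (c (fst p)) (snd p)) (at p within A \<times> UNIV)"
    by (simp add: minus_bcontfun.rep_eq)
qed

context bottom
begin

text \<open>A solution is only required to have non-vanishing height. At each x the height is
  continuous in time and starts positive, so the intermediate value theorem keeps it positive.
  Compactness of the rectangle then yields the lower bound that the Lipschitz estimate of 1 / h
  needs.\<close>

lemma solution_bounds:
  assumes sol: "is_solution l h0 gr b g0 gl (Suc m) \<zeta>in qin T \<zeta> q q0 ql" and \<tau>: "\<tau> \<in> time_ivl T"
    and pos: "\<And>x. x \<in> {0..l} \<Longrightarrow> 0 < h0 - b x + \<zeta>in x"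
  shows "\<And>t x. t \<in> {0..\<tau>} \<Longrightarrow> x \<in> {0..l} \<Longrightarrow> 0 < h0 + \<zeta> t x - b x"
    and "\<exists>\<delta>>0. \<forall>t\<in>{0..\<tau>}. \<forall>x\<in>{0..l}. \<delta> \<le> h0 + \<zeta> t x - b x"
    and "bnd \<tau> l \<zeta>" "bnd \<tau> l q" "bnd \<tau> l (\<lambda>t. Dw l (q t))" "bnd \<tau> l (\<lambda>t x. q0 t)" "bnd \<tau> l (\<lambda>t x. ql t)"
proof -
  let ?I = "time_ivl T"
  note sub = time_ivl_Icc[OF \<tau>]
  obtain \<zeta>' q' where e: "\<And>t. t \<in> ?I \<Longrightarrow> \<zeta> t \<in> Hs l (Suc m)" "\<And>t. t \<in> ?I \<Longrightarrow> q t \<in> Hs l (Suc (Suc m))"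
    "\<And>t. t \<in> ?I \<Longrightarrow> ((\<lambda>s. toC l (\<zeta> s)) has_vector_derivative toC l (\<zeta>' t)) (at t within ?I)"
    "\<And>t. t \<in> ?I \<Longrightarrow> ((\<lambda>s. toC l (q s)) has_vector_derivative toC l (q' t)) (at t within ?I)"
    "\<And>t. t \<in> ?I \<Longrightarrow> ((\<lambda>s. toC l (Dw l (q s))) has_vector_derivative toC l (Dw l (q' t))) (at t within ?I)"
    "\<And>t x. t \<in> ?I \<Longrightarrow> x \<in> {0..l} \<Longrightarrow> ((\<lambda>s. \<zeta> s x) has_real_derivative - Dw l (q t) x) (at t within ?I)"
    "\<And>t. t \<in> ?I \<Longrightarrow> (q0 has_real_derivative Pl gr g0 gl t (\<zeta> t) (q t) (q0 t) (ql t)) (at t within ?I)"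
    "\<And>t. t \<in> ?I \<Longrightarrow> (ql has_real_derivative Pr gr g0 gl t (\<zeta> t) (q t) (q0 t) (ql t)) (at t within ?I)"
    using solution_equations[OF sol] by blast
  note S = sol[unfolded is_solution_def Let_def]
  note S4 = S[THEN conjunct2, THEN conjunct2, THEN conjunct2, THEN conjunct2]
  note nz = S4[THEN conjunct1, rule_format]
  note init = S4[THEN conjunct2, THEN conjunct2, THEN conjunct2, THEN conjunct2, THEN conjunct1, rule_format, THEN conjunct1]
  have cC: "continuous_on {0..\<tau>} f" if "\<And>t. t \<in> ?I \<Longrightarrow> (f has_vector_derivative f' t) (at t within ?I)" for f f' :: "real \<Rightarrow> cfun"
    by (rule continuous_on_subset[OF _ sub])
       (auto simp: continuous_on_eq_continuous_within intro: has_vector_derivative_continuous[OF that])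
  have bC: "bnd \<tau> l u" if c: "\<And>t. t \<in> ?I \<Longrightarrow> continuous_on {0..l} (u t)"
    and d: "\<And>t. t \<in> ?I \<Longrightarrow> ((\<lambda>s. toC l (u s)) has_vector_derivative f' t) (at t within ?I)" for u f'
  proof -
    from continuous_bounded_Icc[OF continuous_on_norm[OF cC[OF d]]]
    obtain M where M: "\<forall>t\<in>{0..\<tau>}. \<bar>norm (toC l (u t))\<bar> \<le> M" by blast
    show ?thesis
    proof (rule bndI)
      fix t x assume t: "t \<in> {0..\<tau>}" and x: "x \<in> {0..l}"
      have "\<bar>apply_bcontfun (toC l (u t)) x\<bar> \<le> norm (toC l (u t))" using norm_bounded[of "toC l (u t)" x] by simp
      then show "\<bar>u t x\<bar> \<le> M" using M t toC_apply[OF c[OF subsetD[OF sub t]] x] by force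
    qed
  qed
  show "bnd \<tau> l \<zeta>" by (rule bC[OF Hs_continuous[OF e(1)] e(3)])
  show "bnd \<tau> l q" by (rule bC[OF Hs_continuous[OF e(2)] e(4)])
  show "bnd \<tau> l (\<lambda>t. Dw l (q t))" by (rule bC[OF Hs_continuous[OF Hs_Dw(1)[OF e(2) l]] e(5)])
  show "bnd \<tau> l (\<lambda>t x. q0 t)" by (rule bnd_time[OF continuous_on_subset[OF C1_continuous[OF e(7)] sub]])
  show "bnd \<tau> l (\<lambda>t x. ql t)" by (rule bnd_time[OF continuous_on_subset[OF C1_continuous[OF e(8)] sub]])
  show pos': "0 < h0 + \<zeta> t x - b x" if t: "t \<in> {0..\<tau>}" and x: "x \<in> {0..l}" for t x
  proof (rule ccontr)
    assume "\<not> ?thesis"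
    then have le: "h0 + \<zeta> t x - b x \<le> 0" by simp
    have "continuous_on {0..t} (\<lambda>s. h0 + \<zeta> s x - b x)"
      by (intro continuous_intros continuous_on_subset[OF C1_continuous[OF e(6)[OF _ x]]]) (use sub t in auto)
    moreover have "0 \<le> h0 + \<zeta> 0 x - b x" using pos[OF x] init[OF x] by simp
    ultimately obtain s where s: "0 \<le> s" "s \<le> t" "h0 + \<zeta> s x - b x = 0"
      using IVT2'[of "\<lambda>s. h0 + \<zeta> s x - b x" t 0 0] le t by auto
    then have "s \<in> ?I" using subsetD[OF sub, of s] t by auto
    then show False using nz[OF _ x] s(3) by blast
  qed
  let ?\<Phi> = "\<lambda>p. h0 + apply_bcontfun (toC l (\<zeta> (fst p))) (snd p) - b (snd p)"
  have "continuous_on ({0..\<tau>} \<times> {0..l}) (\<lambda>p. apply_bcontfun (toC l (\<zeta> (fst p))) (snd p))"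
    by (rule continuous_on_subset[OF bcontfun_curve_jointly_continuous[OF cC[OF e(3)]]]) auto
  moreover have "continuous_on ({0..\<tau>} \<times> {0..l}) (\<lambda>p. b (snd p))"
    by (rule continuous_on_compose2[OF Ck_on_continuous[OF b_Ck] continuous_on_snd[OF continuous_on_id]]) auto
  ultimately have "continuous_on ({0..\<tau>} \<times> {0..l}) ?\<Phi>"
    by (intro continuous_on_diff continuous_on_add continuous_on_const)
  moreover have "compact ({0..\<tau>} \<times> {0..l})" by (intro compact_Times compact_Icc)
  moreover have "{0..\<tau>} \<times> {0..l} \<noteq> {}" using \<tau> l by (auto simp: time_ivl_def)
  ultimately obtain p where p: "p \<in> {0..\<tau>} \<times> {0..l}" "\<And>y. y \<in> {0..\<tau>} \<times> {0..l} \<Longrightarrow> ?\<Phi> p \<le> ?\<Phi> y"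
    using continuous_attains_inf[of "{0..\<tau>} \<times> {0..l}" ?\<Phi>] by blast
  have \<Phi>: "?\<Phi> (t, x) = h0 + \<zeta> t x - b x" if "t \<in> {0..\<tau>}" "x \<in> {0..l}" for t x
    using toC_apply[OF Hs_continuous[OF e(1)[OF subsetD[OF sub that(1)]]] that(2)] by simp
  show "\<exists>\<delta>>0. \<forall>t\<in>{0..\<tau>}. \<forall>x\<in>{0..l}. \<delta> \<le> h0 + \<zeta> t x - b x"
  proof (rule exI[of _ "?\<Phi> p"], intro conjI ballI)
    show "0 < ?\<Phi> p" using p(1) \<Phi>[of "fst p" "snd p"] pos'[of "fst p" "snd p"] by (auto simp: mem_Times_iff)
    show "?\<Phi> p \<le> h0 + \<zeta> t x - b x" if "t \<in> {0..\<tau>}" "x \<in> {0..l}" for t x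
      using p(2)[of "(t, x)"] \<Phi>[OF that] that by auto
  qed
qed

text \<open>At an end point the flux and R0 B vanish and the two boundary functions are 1 and 0, so
  q there and the corresponding boundary discharge have the same time derivative, and the same
  initial value.\<close>

lemma solution_boundary_values:
  assumes sol: "is_solution l h0 gr b g0 gl (Suc m) \<zeta>in qin T \<zeta> q q0 ql" and t: "t \<in> time_ivl T"
  shows "q0 t = q t 0" "ql t = q t l"
proof -
  let ?I = "time_ivl T"
  note sub = time_ivl_Icc[OF t]
  obtain \<zeta>' q' where e:
    "\<And>t x. t \<in> ?I \<Longrightarrow> x \<in> {0..l} \<Longrightarrow> ((\<lambda>s. q s x) has_real_derivative - Wf gr (\<zeta> t) (q t) x + Yf gr (\<zeta> t) (q t) x
          + Pl gr g0 gl t (\<zeta> t) (q t) (q0 t) (ql t) * sL1 x + Pr gr g0 gl t (\<zeta> t) (q t) (q0 t) (ql t) * sR1 x) (at t within ?I)"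
    "\<And>t. t \<in> ?I \<Longrightarrow> (q0 has_real_derivative Pl gr g0 gl t (\<zeta> t) (q t) (q0 t) (ql t)) (at t within ?I)"
    "\<And>t. t \<in> ?I \<Longrightarrow> (ql has_real_derivative Pr gr g0 gl t (\<zeta> t) (q t) (q0 t) (ql t)) (at t within ?I)"
    using solution_equations[OF sol] by blast
  note S = sol[unfolded is_solution_def Let_def]
  note init = S[THEN conjunct2, THEN conjunct2, THEN conjunct2, THEN conjunct2, THEN conjunct2, THEN conjunct2, THEN conjunct2, THEN conjunct2]
  have zero: "f t = 0" if z: "f 0 = 0" "\<And>s. s \<in> ?I \<Longrightarrow> (f has_real_derivative 0) (at s within ?I)" for f
  proof -
    have "(f has_real_derivative 0) (at s within {0..t})" if "s \<in> {0..t}" for s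
      by (rule has_field_derivative_subset[OF z(2)[OF subsetD[OF sub that]] sub])
    then have "\<exists>c. \<forall>s\<in>{0..t}. f s = c" by (intro has_field_derivative_zero_constant) auto
    then show ?thesis using z(1) t by (auto simp: time_ivl_def)
  qed
  have "((\<lambda>s. q s 0 - q0 s) has_real_derivative 0) (at s within ?I)" if s: "s \<in> ?I" for s
    using DERIV_diff[OF e(1)[OF s ends(1)] e(2)[OF s]] by (simp add: Wf_def Yf_def F.dir_boundary D.dir_boundary)
  from zero[OF _ this] show "q0 t = q t 0" using init ends by simp
  have "((\<lambda>s. q s l - ql s) has_real_derivative 0) (at s within ?I)" if s: "s \<in> ?I" for s
    using DERIV_diff[OF e(1)[OF s ends(2)] e(3)[OF s]] by (simp add: Wf_def Yf_def F.dir_boundary D.dir_boundary)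
  from zero[OF _ this] show "ql t = q t l" using init ends by simp
qed

text \<open>Lipschitz dependence of the nonlocal terms on elevation and discharge in the sup norm.
  Flux function and source are made of bounded factors and 1 / h, where the common lower bound
  \<delta> enters; \<open>gap_dir\<close> passes the estimates through the elliptic
  operators.\<close>

lemma gap_state:
  assumes c: "\<And>t. t \<in> {0..\<tau>} \<Longrightarrow> continuous_on {0..l} (z t) \<and> continuous_on {0..l} (p t)"
      "\<And>t. t \<in> {0..\<tau>} \<Longrightarrow> continuous_on {0..l} (z' t) \<and> continuous_on {0..l} (p' t)"
    and bnd: "bnd \<tau> l z" "bnd \<tau> l p" "bnd \<tau> l z'" "bnd \<tau> l p'"
    and \<delta>: "0 < \<delta>" "\<And>t x. t \<in> {0..\<tau>} \<Longrightarrow> x \<in> {0..l} \<Longrightarrow> \<delta> \<le> h0 + z t x - b x \<and> \<delta> \<le> h0 + z' t x - b x"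
    and gap: "gap \<tau> l \<Psi> z z'" "gap \<tau> l \<Psi> p p'" and nonneg: "\<And>t M. \<Psi> t M \<Longrightarrow> 0 \<le> M"
  shows "gap \<tau> l \<Psi> (\<lambda>t. Ff gr (z t) (p t)) (\<lambda>t. Ff gr (z' t) (p' t))"
    and "gap \<tau> l \<Psi> (\<lambda>t. Wf gr (z t) (p t)) (\<lambda>t. Wf gr (z' t) (p' t))"
    and "gap \<tau> l \<Psi> (\<lambda>t. Vf gr (z t) (p t)) (\<lambda>t. Vf gr (z' t) (p' t))"
    and "gap \<tau> l \<Psi> (\<lambda>t. Yf gr (z t) (p t)) (\<lambda>t. Yf gr (z' t) (p' t))"
    and "gap \<tau> l \<Psi> (\<lambda>t. Sf gr (z t) (p t)) (\<lambda>t. Sf gr (z' t) (p' t))"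
proof -
  define h where "h t x = (h0 - b x) + z t x" for t x
  define h' where "h' t x = (h0 - b x) + z' t x" for t x
  have h\<delta>: "\<delta> \<le> h t x \<and> \<delta> \<le> h' t x" if "t \<in> {0..\<tau>}" "x \<in> {0..l}" for t x
    using \<delta>(2)[OF that] by (simp add: h_def h'_def algebra_simps)
  have gh: "gap \<tau> l \<Psi> h h'" unfolding h_def h'_def by (rule gap_add[OF gap_refl gap(1)])
  have bh: "bnd \<tau> l f" if "bnd \<tau> l w" "\<And>t x. f t x = (h0 - b x) + w t x" for f w
  proof -
    have "bnd \<tau> l (\<lambda>t x. h0 - b x)" by (rule bnd_space[OF continuous_on_diff[OF continuous_on_const Ck_on_continuous[OF b_Ck]]])
    then obtain A where A: "\<And>t x. t \<in> {0..\<tau>} \<Longrightarrow> x \<in> {0..l} \<Longrightarrow> \<bar>h0 - b x\<bar> \<le> A" unfolding bnd_def by blast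
    from that(1) obtain B where B: "\<And>t x. t \<in> {0..\<tau>} \<Longrightarrow> x \<in> {0..l} \<Longrightarrow> \<bar>w t x\<bar> \<le> B" unfolding bnd_def by blast
    show ?thesis
    proof (rule bndI[of _ _ _ "A + B"])
      show "\<bar>f t x\<bar> \<le> A + B" if "t \<in> {0..\<tau>}" "x \<in> {0..l}" for t x
        unfolding \<open>\<And>t x. f t x = (h0 - b x) + w t x\<close>
        by (rule order_trans[OF abs_triangle_ineq add_mono[OF A[OF that] B[OF that]]])
    qed
  qed
  note bh = bh[OF bnd(1) h_def] bh[OF bnd(3) h'_def]
  have bi: "bnd \<tau> l (\<lambda>t x. 1 / h t x)"
  proof (rule bndI[of _ _ _ "1 / \<delta>"])
    show "\<bar>1 / h t x\<bar> \<le> 1 / \<delta>" if "t \<in> {0..\<tau>}" "x \<in> {0..l}" for t x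
      using h\<delta>[OF that] \<delta>(1) by (auto simp: frac_le)
  qed
  have sp: "bnd \<tau> l (\<lambda>t x. 1 / (H x)\<^sup>2)" "bnd \<tau> l (\<lambda>t. B1)" "bnd \<tau> l (\<lambda>t x. B1 x / H x)" "bnd \<tau> l (\<lambda>t x. - 3 / H x)"
    using conts H_nz by (intro bnd_space continuous_intros; auto)+
  have gf: "gap \<tau> l \<Psi> (\<lambda>t x. 1/2 * gr * (h t x * h t x + - h0\<^sup>2) + 1 / h t x * (p t x * p t x))
      (\<lambda>t x. 1/2 * gr * (h' t x * h' t x + - h0\<^sup>2) + 1 / h' t x * (p' t x * p' t x))"
    by (rule gap_add[OF gap_scale[OF gap_add[OF gap_mult[OF gh gh bh] gap_refl]]
        gap_mult[OF gap_inverse[OF gh \<delta>(1) h\<delta>] gap_mult[OF gap(2) gap(2) bnd(2) bnd(4)] bi bnd_mult[OF bnd(4) bnd(4)]]])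
  have f_eq: "fNSW h0 gr b x (z t x) (p t x) = 1/2 * gr * (h t x * h t x + - h0\<^sup>2) + 1 / h t x * (p t x * p t x)"
    "fNSW h0 gr b x (z' t x) (p' t x) = 1/2 * gr * (h' t x * h' t x + - h0\<^sup>2) + 1 / h' t x * (p' t x * p' t x)" for t x
  proof -
    have e: "h0 + z t x - b x = h t x" "h0 + z' t x - b x = h' t x" by (simp_all add: h_def h'_def)
    show "fNSW h0 gr b x (z t x) (p t x) = 1/2 * gr * (h t x * h t x + - h0\<^sup>2) + 1 / h t x * (p t x * p t x)"
    "fNSW h0 gr b x (z' t x) (p' t x) = 1/2 * gr * (h' t x * h' t x + - h0\<^sup>2) + 1 / h' t x * (p' t x * p' t x)"
      unfolding fNSW_def Let_def e by (simp_all add: power2_eq_square)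
  qed
  note gf' = gf[folded f_eq]
  show gF: "gap \<tau> l \<Psi> (\<lambda>t. Ff gr (z t) (p t)) (\<lambda>t. Ff gr (z' t) (p' t))"
    unfolding Ff_def[abs_def] by (rule gap_cmult[OF gf' sp(1)])
  have e: "Bsrc l h0 gr b (z t) (p t) x = - gr * (B1 x * h t x) + 3/2 * (B1 x / H x * fNSW h0 gr b x (z t x) (p t x))"
    "Bsrc l h0 gr b (z' t) (p' t) x = - gr * (B1 x * h' t x) + 3/2 * (B1 x / H x * fNSW h0 gr b x (z' t x) (p' t x))" for t x
    by (simp_all add: Bsrc_def h_def h'_def algebra_simps)
  have gB: "gap \<tau> l \<Psi> (\<lambda>t x. - 3 / H x * Bsrc l h0 gr b (z t) (p t) x) (\<lambda>t x. - 3 / H x * Bsrc l h0 gr b (z' t) (p' t) x)"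
    unfolding e by (rule gap_cmult[OF gap_add[OF gap_scale[OF gap_cmult[OF gh sp(2)]] gap_scale[OF gap_cmult[OF gf' sp(3)]]] sp(4)])
  have k: "continuous_on {0..l} (Ff gr (z t) (p t))" "continuous_on {0..l} (Bsrc l h0 gr b (z t) (p t))"
    "continuous_on {0..l} (Ff gr (z' t) (p' t))" "continuous_on {0..l} (Bsrc l h0 gr b (z' t) (p' t))" if t: "t \<in> {0..\<tau>}" for t
  proof -
    have nz: "h0 + z t x - b x \<noteq> 0" "h0 + z' t x - b x \<noteq> 0" if "x \<in> {0..l}" for x
      using \<delta>(2)[OF t that] \<delta>(1) by auto
    note * = c(1)[OF t, THEN conjunct1] c(1)[OF t, THEN conjunct2] c(2)[OF t, THEN conjunct1] c(2)[OF t, THEN conjunct2]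
    show "continuous_on {0..l} (Ff gr (z t) (p t))" "continuous_on {0..l} (Bsrc l h0 gr b (z t) (p t))"
      by (rule Ff_Bsrc_continuous[OF *(1,2) nz(1)]; assumption)+
    show "continuous_on {0..l} (Ff gr (z' t) (p' t))" "continuous_on {0..l} (Bsrc l h0 gr b (z' t) (p' t))"
      by (rule Ff_Bsrc_continuous[OF *(3,4) nz(2)]; assumption)+
  qed
  note kF = continuous_on_mult[OF continuous_on_const[of _ "- 3 :: real"] k(1)] continuous_on_mult[OF continuous_on_const[of _ "- 3 :: real"] k(3)]
  note kD = dirichlet_data_continuous[OF k(2)] dirichlet_data_continuous[OF k(4)]
  show "gap \<tau> l \<Psi> (\<lambda>t. Wf gr (z t) (p t)) (\<lambda>t. Wf gr (z' t) (p' t))" "gap \<tau> l \<Psi> (\<lambda>t. Vf gr (z t) (p t)) (\<lambda>t. Vf gr (z' t) (p' t))"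
    unfolding Wf_def Vf_def
    by (rule F.gap_dir[OF gap_scale[OF gF] gap_refl kF(1) continuous_on_const kF(2) continuous_on_const nonneg]; assumption)+
  show "gap \<tau> l \<Psi> (\<lambda>t. Yf gr (z t) (p t)) (\<lambda>t. Yf gr (z' t) (p' t))" "gap \<tau> l \<Psi> (\<lambda>t. Sf gr (z t) (p t)) (\<lambda>t. Sf gr (z' t) (p' t))"
    unfolding Yf_def Sf_def
    by (rule D.gap_dir[OF gap_refl gB[unfolded times_divide_eq_left] continuous_on_const kD(1) continuous_on_const kD(2) nonneg]; assumption)+
qed

lemma gap_rhs_bdry:
  assumes g: "smooth_on {0..} g" and nz: "\<And>t. t \<in> {0..\<tau>} \<Longrightarrow> h0 + g t - b y \<noteq> 0"
    and gap: "gap \<tau> l \<Psi> v v'" "gap \<tau> l \<Psi> d d'" "gap \<tau> l \<Psi> a a'" and bnd: "bnd \<tau> l a" "bnd \<tau> l a'"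
  shows "gap \<tau> l \<Psi> (\<lambda>t x. rhs_bdry gr g y t (v t x) (d t x) (a t x)) (\<lambda>t x. rhs_bdry gr g y t (v' t x) (d' t x) (a' t x))"
proof -
  define c1 where "c1 t = - Dcl {0..} (Dcl {0..} g) t - 3 / (H y)\<^sup>2 * (1/2 * gr * ((h0 + g t - b y)\<^sup>2 - h0\<^sup>2))" for t
  define c2 where "c2 t = - 3 / (H y)\<^sup>2 * (1 / (h0 + g t - b y))" for t
  have e: "rhs_bdry gr g y t v d a = 3 * v + (- 1) * d + (c1 t + c2 t * (a * a))" for t v d a
    by (simp add: rhs_bdry_def c1_def c2_def algebra_simps)
  have "Ck_on 0 {0..} g"
    by (rule Ck_on_smooth[THEN iffD1, rule_format, OF _ g]) (simp add: at_within_Ici_nontrivial)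
  then have "continuous_on {0..\<tau>} g" by (auto intro: continuous_on_subset)
  then have "continuous_on {0..\<tau>} c2"
    unfolding c2_def[abs_def] using nz by (intro continuous_intros) auto
  note b2 = bnd_time[OF this]
  show ?thesis unfolding e
    by (rule gap_add[OF gap_add[OF gap_scale[OF gap(1)] gap_scale[OF gap(2)]]
        gap_add[OF gap_refl gap_cmult[OF gap_mult[OF gap(3,3) bnd] b2]]])
qed

text \<open>Elevation, discharge and its space derivative at all points x, together with the
  boundary discharges, form one family for \<open>family_gronwall\<close>. All constants come from
  the compact time interval {0..\<tau>}, on which both solutions live.\<close>

theorem solution_unique:
  assumes g0: "smooth_on {0..} g0" and gl: "smooth_on {0..} gl"
    and sol1: "is_solution l h0 gr b g0 gl (Suc m) \<zeta>in qin T1 \<zeta>1 q1 a1 c1"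
    and sol2: "is_solution l h0 gr b g0 gl (Suc m) \<zeta>in qin T2 \<zeta>2 q2 a2 c2"
    and \<tau>1: "\<tau> \<in> time_ivl T1" and \<tau>2: "\<tau> \<in> time_ivl T2"
    and pos: "\<And>x. x \<in> {0..l} \<Longrightarrow> 0 < h0 - b x + \<zeta>in x"
  shows "(\<forall>x\<in>{0..l}. \<zeta>1 \<tau> x = \<zeta>2 \<tau> x \<and> q1 \<tau> x = q2 \<tau> x) \<and> a1 \<tau> = a2 \<tau> \<and> c1 \<tau> = c2 \<tau>"
proof -
  define P where "P \<zeta> q a c t = Pl gr g0 gl t (\<zeta> t) (q t) (a t) (c t)" for \<zeta> q :: "real \<Rightarrow> real \<Rightarrow> real" and a c :: "real \<Rightarrow> real" and t
  define P' where "P' \<zeta> q a c t = Pr gr g0 gl t (\<zeta> t) (q t) (a t) (c t)" for \<zeta> q :: "real \<Rightarrow> real \<Rightarrow> real" and a c :: "real \<Rightarrow> real" and t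
  define Q where "Q \<zeta> q a c t x = (- 1) * Wf gr (\<zeta> t) (q t) x + Yf gr (\<zeta> t) (q t) x
      + (sL1 x * P \<zeta> q a c t + sR1 x * P' \<zeta> q a c t)" for \<zeta> q :: "real \<Rightarrow> real \<Rightarrow> real" and a c :: "real \<Rightarrow> real" and t x
  define R where "R \<zeta> q a c t x = (- B1 x / (2 * H x)) * Wf gr (\<zeta> t) (q t) x + (- 3) * Vf gr (\<zeta> t) (q t) x
      + 3 * Ff gr (\<zeta> t) (q t) x + 1 / H x * Sf gr (\<zeta> t) (q t) x
      + (1 / H x * sL2 x * P \<zeta> q a c t + 1 / H x * sR2 x * P' \<zeta> q a c t)" for \<zeta> q :: "real \<Rightarrow> real \<Rightarrow> real" and a c :: "real \<Rightarrow> real" and t x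
  have eqs: "continuous_on {0..l} (\<zeta> t) \<and> continuous_on {0..l} (q t)"
    "x \<in> {0..l} \<Longrightarrow> ((\<lambda>s. \<zeta> s x) has_real_derivative (- 1) * Dw l (q t) x) (at t within {0..\<tau>})"
    "x \<in> {0..l} \<Longrightarrow> ((\<lambda>s. q s x) has_real_derivative Q \<zeta> q a c t x) (at t within {0..\<tau>})"
    "x \<in> {0..l} \<Longrightarrow> ((\<lambda>s. Dw l (q s) x) has_real_derivative R \<zeta> q a c t x) (at t within {0..\<tau>})"
    "(a has_real_derivative P \<zeta> q a c t) (at t within {0..\<tau>})"
    "(c has_real_derivative P' \<zeta> q a c t) (at t within {0..\<tau>})"
    if sol: "is_solution l h0 gr b g0 gl (Suc m) \<zeta>in qin T \<zeta> q a c" and \<tau>: "\<tau> \<in> time_ivl T" and t: "t \<in> {0..\<tau>}"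
    for T \<zeta> q a c t x
  proof -
    note sub = time_ivl_Icc[OF \<tau>]
    note tI = subsetD[OF sub t]
    have e: "\<zeta> t \<in> Hs l (Suc m)" "q t \<in> Hs l (Suc (Suc m))"
      "x \<in> {0..l} \<Longrightarrow> ((\<lambda>s. \<zeta> s x) has_real_derivative - Dw l (q t) x) (at t within time_ivl T)"
      "x \<in> {0..l} \<Longrightarrow> ((\<lambda>s. q s x) has_real_derivative - Wf gr (\<zeta> t) (q t) x + Yf gr (\<zeta> t) (q t) x
          + Pl gr g0 gl t (\<zeta> t) (q t) (a t) (c t) * sL1 x + Pr gr g0 gl t (\<zeta> t) (q t) (a t) (c t) * sR1 x)
          (at t within time_ivl T)"
      "x \<in> {0..l} \<Longrightarrow> ((\<lambda>s. Dw l (q s) x) has_real_derivative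
          - (B1 x / (2 * H x) * Wf gr (\<zeta> t) (q t) x + 3 * Vf gr (\<zeta> t) (q t) x - 3 * Ff gr (\<zeta> t) (q t) x)
          + 1 / H x * Sf gr (\<zeta> t) (q t) x
          + Pl gr g0 gl t (\<zeta> t) (q t) (a t) (c t) * (1 / H x * sL2 x)
          + Pr gr g0 gl t (\<zeta> t) (q t) (a t) (c t) * (1 / H x * sR2 x)) (at t within time_ivl T)"
      "(a has_real_derivative Pl gr g0 gl t (\<zeta> t) (q t) (a t) (c t)) (at t within time_ivl T)"
      "(c has_real_derivative Pr gr g0 gl t (\<zeta> t) (q t) (a t) (c t)) (at t within time_ivl T)"
      using solution_equations[OF sol] tI by blast+
    note d = has_field_derivative_subset[OF _ sub]
    show "continuous_on {0..l} (\<zeta> t) \<and> continuous_on {0..l} (q t)"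
      by (rule conjI[OF Hs_continuous[OF e(1)] Hs_continuous[OF e(2)]])
    show "((\<lambda>s. \<zeta> s x) has_real_derivative (- 1) * Dw l (q t) x) (at t within {0..\<tau>})" if "x \<in> {0..l}"
      using d[OF e(3)[OF that]] by simp
    show "((\<lambda>s. q s x) has_real_derivative Q \<zeta> q a c t x) (at t within {0..\<tau>})" if "x \<in> {0..l}"
      by (rule DERIV_cong[OF d[OF e(4)[OF that]]]) (simp add: Q_def P_def P'_def algebra_simps)
    show "((\<lambda>s. Dw l (q s) x) has_real_derivative R \<zeta> q a c t x) (at t within {0..\<tau>})" if "x \<in> {0..l}"
      by (rule DERIV_cong[OF d[OF e(5)[OF that]]]) (simp add: R_def P_def P'_def algebra_simps)
    show "(a has_real_derivative P \<zeta> q a c t) (at t within {0..\<tau>})" "(c has_real_derivative P' \<zeta> q a c t) (at t within {0..\<tau>})"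
      unfolding P_def P'_def by (rule d[OF e(6)] d[OF e(7)])+
  qed
  note e1 = eqs[OF sol1 \<tau>1] and e2 = eqs[OF sol2 \<tau>2]
  note b1 = solution_bounds[OF sol1 \<tau>1 pos] and b2 = solution_bounds[OF sol2 \<tau>2 pos]
  define \<Psi> where "\<Psi> t M \<longleftrightarrow> (\<forall>x\<in>{0..l}. \<bar>\<zeta>1 t x - \<zeta>2 t x\<bar> \<le> M \<and> \<bar>q1 t x - q2 t x\<bar> \<le> M \<and>
      \<bar>Dw l (q1 t) x - Dw l (q2 t) x\<bar> \<le> M) \<and> \<bar>a1 t - a2 t\<bar> \<le> M \<and> \<bar>c1 t - c2 t\<bar> \<le> M" for t M
  have nonneg: "0 \<le> M" if "\<Psi> t M" for t M
    using that unfolding \<Psi>_def by (auto intro: order_trans[OF abs_ge_zero])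
  have base: "gap \<tau> l \<Psi> \<zeta>1 \<zeta>2" "gap \<tau> l \<Psi> q1 q2" "gap \<tau> l \<Psi> (\<lambda>t. Dw l (q1 t)) (\<lambda>t. Dw l (q2 t))"
    "gap \<tau> l \<Psi> (\<lambda>t x. a1 t) (\<lambda>t x. a2 t)" "gap \<tau> l \<Psi> (\<lambda>t x. c1 t) (\<lambda>t x. c2 t)"
    by (rule gapI[of 1]; simp add: \<Psi>_def)+
  from b1(2) obtain \<delta>1 where \<delta>1: "0 < \<delta>1" "\<And>t x. t \<in> {0..\<tau>} \<Longrightarrow> x \<in> {0..l} \<Longrightarrow> \<delta>1 \<le> h0 + \<zeta>1 t x - b x" by blast
  from b2(2) obtain \<delta>2 where \<delta>2: "0 < \<delta>2" "\<And>t x. t \<in> {0..\<tau>} \<Longrightarrow> x \<in> {0..l} \<Longrightarrow> \<delta>2 \<le> h0 + \<zeta>2 t x - b x" by blast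
  have \<delta>: "0 < min \<delta>1 \<delta>2" "min \<delta>1 \<delta>2 \<le> h0 + \<zeta>1 t x - b x \<and> min \<delta>1 \<delta>2 \<le> h0 + \<zeta>2 t x - b x"
    if "t \<in> {0..\<tau>}" "x \<in> {0..l}" for t x
    using \<delta>1(1) \<delta>2(1) \<delta>1(2)[OF that] \<delta>2(2)[OF that] by auto
  have \<delta>0: "0 < min \<delta>1 \<delta>2" using \<delta>1(1) \<delta>2(1) by simp
  note G = gap_state[OF e1(1) e2(1) b1(3,4) b2(3,4) \<delta>0 \<delta>(2) base(1,2) nonneg]
  have cs: "continuous_on {0..l} sL1" "continuous_on {0..l} sR1" "continuous_on {0..l} sL2" "continuous_on {0..l} sR2"
    using D.sol_continuous[OF s_sol(1)] D.sol_continuous[OF s_sol(2)] by simp_all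
  have sp: "bnd \<tau> l (\<lambda>t. sL1)" "bnd \<tau> l (\<lambda>t. sR1)" "bnd \<tau> l (\<lambda>t x. 1 / H x * sL2 x)" "bnd \<tau> l (\<lambda>t x. 1 / H x * sR2 x)"
    "bnd \<tau> l (\<lambda>t x. - B1 x / (2 * H x))" "bnd \<tau> l (\<lambda>t x. 1 / H x)"
    using conts H_nz cs by (intro bnd_space continuous_intros; auto)+
  note S6 = sol1[unfolded is_solution_def Let_def, THEN conjunct2, THEN conjunct2, THEN conjunct2, THEN conjunct2,
      THEN conjunct2, THEN conjunct1, rule_format]
  have nz: "h0 + g0 t - b 0 \<noteq> 0" "h0 + gl t - b l \<noteq> 0" if "t \<in> {0..\<tau>}" for t
    using S6[OF subsetD[OF time_ivl_Icc[OF \<tau>1] that]] by auto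
  have GS: "gap \<tau> l \<Psi> (\<lambda>t x. Sf gr (\<zeta>1 t) (q1 t) y / H y) (\<lambda>t x. Sf gr (\<zeta>2 t) (q2 t) y / H y)" if "y \<in> {0..l}" for y
    using gap_scale[OF gap_at[OF that G(5)], where c = "1 / H y"] by simp
  note G0 = gap_rhs_bdry[OF g0 nz(1) gap_at[OF ends(1) G(3)] GS[OF ends(1)] base(4) b1(6) b2(6)]
  note Gl = gap_rhs_bdry[OF gl nz(2) gap_at[OF ends(2) G(3)] GS[OF ends(2)] base(5) b1(7) b2(7)]
  have GP: "gap \<tau> l \<Psi> (\<lambda>t x. P \<zeta>1 q1 a1 c1 t) (\<lambda>t x. P \<zeta>2 q2 a2 c2 t)"
    using gap_add[OF gap_scale[OF G0, where c = "s22 / sdet"] gap_scale[OF Gl, where c = "- s12 / sdet"]]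
    unfolding P_def Pl_def by (simp add: diff_divide_distrib)
  have GP': "gap \<tau> l \<Psi> (\<lambda>t x. P' \<zeta>1 q1 a1 c1 t) (\<lambda>t x. P' \<zeta>2 q2 a2 c2 t)"
    using gap_add[OF gap_scale[OF Gl, where c = "s11 / sdet"] gap_scale[OF G0, where c = "- s21 / sdet"]]
    unfolding P'_def Pr_def by (simp add: diff_divide_distrib)
  have GQ: "gap \<tau> l \<Psi> (Q \<zeta>1 q1 a1 c1) (Q \<zeta>2 q2 a2 c2)"
    unfolding Q_def[abs_def]
    by (rule gap_add[OF gap_add[OF gap_scale[OF G(2)] G(4)] gap_add[OF gap_cmult[OF GP sp(1)] gap_cmult[OF GP' sp(2)]]])
  have GR: "gap \<tau> l \<Psi> (R \<zeta>1 q1 a1 c1) (R \<zeta>2 q2 a2 c2)"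
    unfolding R_def[abs_def]
    by (rule gap_add[OF gap_add[OF gap_add[OF gap_add[OF gap_cmult[OF G(2) sp(5)] gap_scale[OF G(3)]] gap_scale[OF G(1)]]
          gap_cmult[OF G(5) sp(6)]] gap_add[OF gap_cmult[OF GP sp(3)] gap_cmult[OF GP' sp(4)]]])
  \<comment> \<open>Each index is the pair of a difference and its time derivative, so that
    \<open>fst\<close> and \<open>snd\<close> serve as the two functions of the Gronwall
    lemma.\<close>
  define J where "J = (\<Union>x\<in>{0..l}. {(\<lambda>t. \<zeta>1 t x - \<zeta>2 t x, \<lambda>t. (- 1) * Dw l (q1 t) x - (- 1) * Dw l (q2 t) x),
      (\<lambda>t. q1 t x - q2 t x, \<lambda>t. Q \<zeta>1 q1 a1 c1 t x - Q \<zeta>2 q2 a2 c2 t x),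
      (\<lambda>t. Dw l (q1 t) x - Dw l (q2 t) x, \<lambda>t. R \<zeta>1 q1 a1 c1 t x - R \<zeta>2 q2 a2 c2 t x)}) \<union>
      {(\<lambda>t. a1 t - a2 t, \<lambda>t. P \<zeta>1 q1 a1 c1 t - P \<zeta>2 q2 a2 c2 t), (\<lambda>t. c1 t - c2 t, \<lambda>t. P' \<zeta>1 q1 a1 c1 t - P' \<zeta>2 q2 a2 c2 t)}"
  have Jx: "(\<lambda>t. \<zeta>1 t x - \<zeta>2 t x, \<lambda>t. (- 1) * Dw l (q1 t) x - (- 1) * Dw l (q2 t) x) \<in> J"
    "(\<lambda>t. q1 t x - q2 t x, \<lambda>t. Q \<zeta>1 q1 a1 c1 t x - Q \<zeta>2 q2 a2 c2 t x) \<in> J"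
    "(\<lambda>t. Dw l (q1 t) x - Dw l (q2 t) x, \<lambda>t. R \<zeta>1 q1 a1 c1 t x - R \<zeta>2 q2 a2 c2 t x) \<in> J"
    if "x \<in> {0..l}" for x
    using that unfolding J_def by blast+
  have Jb: "(\<lambda>t. a1 t - a2 t, \<lambda>t. P \<zeta>1 q1 a1 c1 t - P \<zeta>2 q2 a2 c2 t) \<in> J"
    "(\<lambda>t. c1 t - c2 t, \<lambda>t. P' \<zeta>1 q1 a1 c1 t - P' \<zeta>2 q2 a2 c2 t) \<in> J"
    unfolding J_def by blast+
  \<comment> \<open>A common bound for the family is a bound in the sense of \<Psi>, so the
    \<open>gap\<close> estimates supply the Lipschitz hypothesis of
    \<open>family_gronwall\<close>.\<close>
  have J\<Psi>: "\<Psi> t M" if M: "\<And>j. j \<in> J \<Longrightarrow> \<bar>fst j t\<bar> \<le> M" for t M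
    using M[OF Jx(1)] M[OF Jx(2)] M[OF Jx(3)] M[OF Jb(1)] M[OF Jb(2)]
    unfolding \<Psi>_def fst_conv by blast
  have Jcases: "\<Phi> (fst j) (snd j)" if "j \<in> J"
    and "\<And>x. x \<in> {0..l} \<Longrightarrow> \<Phi> (\<lambda>t. \<zeta>1 t x - \<zeta>2 t x) (\<lambda>t. (- 1) * Dw l (q1 t) x - (- 1) * Dw l (q2 t) x)"
    and "\<And>x. x \<in> {0..l} \<Longrightarrow> \<Phi> (\<lambda>t. q1 t x - q2 t x) (\<lambda>t. Q \<zeta>1 q1 a1 c1 t x - Q \<zeta>2 q2 a2 c2 t x)"
    and "\<And>x. x \<in> {0..l} \<Longrightarrow> \<Phi> (\<lambda>t. Dw l (q1 t) x - Dw l (q2 t) x) (\<lambda>t. R \<zeta>1 q1 a1 c1 t x - R \<zeta>2 q2 a2 c2 t x)"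
    and "\<Phi> (\<lambda>t. a1 t - a2 t) (\<lambda>t. P \<zeta>1 q1 a1 c1 t - P \<zeta>2 q2 a2 c2 t)"
    and "\<Phi> (\<lambda>t. c1 t - c2 t) (\<lambda>t. P' \<zeta>1 q1 a1 c1 t - P' \<zeta>2 q2 a2 c2 t)" for j \<Phi>
    using that unfolding J_def by (elim UnE UN_E insertE emptyE) simp_all
  have der: "(fst j has_real_derivative snd j t) (at t within {0..\<tau>})" if "j \<in> J" "t \<in> {0..\<tau>}" for j t
    by (rule Jcases[OF that(1)]; rule DERIV_diff; rule e1(2-6)[OF that(2)] e2(2-6)[OF that(2)]; assumption)
  have sumb: "\<exists>M0\<ge>0. \<forall>t\<in>{0..\<tau>}. \<forall>x\<in>{0..l}. \<bar>f t x - g t x\<bar> \<le> M0" if fg: "bnd \<tau> l f" "bnd \<tau> l g" for f g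
  proof -
    from fg obtain A B where AB: "0 \<le> A" "0 \<le> B" "\<And>t x. t \<in> {0..\<tau>} \<Longrightarrow> x \<in> {0..l} \<Longrightarrow> \<bar>f t x\<bar> \<le> A"
      "\<And>t x. t \<in> {0..\<tau>} \<Longrightarrow> x \<in> {0..l} \<Longrightarrow> \<bar>g t x\<bar> \<le> B" unfolding bnd_def by blast
    show ?thesis
    proof (intro exI[of _ "A + B"] conjI ballI)
      show "\<bar>f t x - g t x\<bar> \<le> A + B" if "t \<in> {0..\<tau>}" "x \<in> {0..l}" for t x
        by (rule order_trans[OF abs_triangle_ineq4 add_mono[OF AB(3)[OF that] AB(4)[OF that]]])
    qed (use AB in simp)
  qed
  from sumb[OF b1(3) b2(3)] obtain M1 where M1: "0 \<le> M1" "\<forall>t\<in>{0..\<tau>}. \<forall>x\<in>{0..l}. \<bar>\<zeta>1 t x - \<zeta>2 t x\<bar> \<le> M1" by blast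
  from sumb[OF b1(4) b2(4)] obtain M2 where M2: "0 \<le> M2" "\<forall>t\<in>{0..\<tau>}. \<forall>x\<in>{0..l}. \<bar>q1 t x - q2 t x\<bar> \<le> M2" by blast
  from sumb[OF b1(5) b2(5)] obtain M3 where M3: "0 \<le> M3" "\<forall>t\<in>{0..\<tau>}. \<forall>x\<in>{0..l}. \<bar>Dw l (q1 t) x - Dw l (q2 t) x\<bar> \<le> M3" by blast
  from sumb[OF b1(6) b2(6)] obtain M4 where M4: "0 \<le> M4" "\<forall>t\<in>{0..\<tau>}. \<forall>x\<in>{0..l}. \<bar>a1 t - a2 t\<bar> \<le> M4" by blast
  from sumb[OF b1(7) b2(7)] obtain M5 where M5: "0 \<le> M5" "\<forall>t\<in>{0..\<tau>}. \<forall>x\<in>{0..l}. \<bar>c1 t - c2 t\<bar> \<le> M5" by blast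
  have bd: "\<bar>fst j t\<bar> \<le> M1 + M2 + M3 + M4 + M5" if "j \<in> J" "t \<in> {0..\<tau>}" for j t
  proof (rule Jcases[OF that(1)])
    fix x assume x: "x \<in> {0..l}"
    show "\<bar>\<zeta>1 t x - \<zeta>2 t x\<bar> \<le> M1 + M2 + M3 + M4 + M5"
      using bspec[OF bspec[OF M1(2) that(2)] x] M2(1) M3(1) M4(1) M5(1) by linarith
    show "\<bar>q1 t x - q2 t x\<bar> \<le> M1 + M2 + M3 + M4 + M5"
      using bspec[OF bspec[OF M2(2) that(2)] x] M1(1) M3(1) M4(1) M5(1) by linarith
    show "\<bar>Dw l (q1 t) x - Dw l (q2 t) x\<bar> \<le> M1 + M2 + M3 + M4 + M5"
      using bspec[OF bspec[OF M3(2) that(2)] x] M1(1) M2(1) M4(1) M5(1) by linarith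
  next
    show "\<bar>a1 t - a2 t\<bar> \<le> M1 + M2 + M3 + M4 + M5"
      using bspec[OF bspec[OF M4(2) that(2)] ends(1)] M1(1) M2(1) M3(1) M5(1) by linarith
    show "\<bar>c1 t - c2 t\<bar> \<le> M1 + M2 + M3 + M4 + M5"
      using bspec[OF bspec[OF M5(2) that(2)] ends(1)] M1(1) M2(1) M3(1) M4(1) by linarith
  qed
  note i1 = sol1[unfolded is_solution_def Let_def, THEN conjunct2, THEN conjunct2, THEN conjunct2, THEN conjunct2,
      THEN conjunct2, THEN conjunct2, THEN conjunct2, THEN conjunct2]
  note i2 = sol2[unfolded is_solution_def Let_def, THEN conjunct2, THEN conjunct2, THEN conjunct2, THEN conjunct2,
      THEN conjunct2, THEN conjunct2, THEN conjunct2, THEN conjunct2]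
  \<comment> \<open>The two initial discharges are equal on the interval only, but the chosen
    derivatives are then literally the same function.\<close>
  have "Dw l (q1 0) = Dw l (q2 0)" by (rule Dw_cong) (use i1 i2 in simp)
  then have init: "fst j 0 = 0" if "j \<in> J" for j
    using that i1 i2 unfolding J_def by auto
  from gap_scale[OF base(3), where c = "- 1"] obtain K1 where K1: "0 \<le> K1"
    "\<And>t M x. t \<in> {0..\<tau>} \<Longrightarrow> \<Psi> t M \<Longrightarrow> x \<in> {0..l} \<Longrightarrow> \<bar>(- 1) * Dw l (q1 t) x - (- 1) * Dw l (q2 t) x\<bar> \<le> K1 * M" by (rule gapE) blast
  from GQ obtain K2 where K2: "0 \<le> K2"
    "\<And>t M x. t \<in> {0..\<tau>} \<Longrightarrow> \<Psi> t M \<Longrightarrow> x \<in> {0..l} \<Longrightarrow> \<bar>Q \<zeta>1 q1 a1 c1 t x - Q \<zeta>2 q2 a2 c2 t x\<bar> \<le> K2 * M" by (rule gapE) blast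
  from GR obtain K3 where K3: "0 \<le> K3"
    "\<And>t M x. t \<in> {0..\<tau>} \<Longrightarrow> \<Psi> t M \<Longrightarrow> x \<in> {0..l} \<Longrightarrow> \<bar>R \<zeta>1 q1 a1 c1 t x - R \<zeta>2 q2 a2 c2 t x\<bar> \<le> K3 * M" by (rule gapE) blast
  from GP obtain K4 where K4: "0 \<le> K4"
    "\<And>t M x. t \<in> {0..\<tau>} \<Longrightarrow> \<Psi> t M \<Longrightarrow> x \<in> {0..l} \<Longrightarrow> \<bar>P \<zeta>1 q1 a1 c1 t - P \<zeta>2 q2 a2 c2 t\<bar> \<le> K4 * M" by (rule gapE) blast
  from GP' obtain K5 where K5: "0 \<le> K5"
    "\<And>t M x. t \<in> {0..\<tau>} \<Longrightarrow> \<Psi> t M \<Longrightarrow> x \<in> {0..l} \<Longrightarrow> \<bar>P' \<zeta>1 q1 a1 c1 t - P' \<zeta>2 q2 a2 c2 t\<bar> \<le> K5 * M" by (rule gapE) blast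
  have le: "\<bar>snd j t\<bar> \<le> (K1 + K2 + K3 + K4 + K5) * M" if "j \<in> J" "t \<in> {0..\<tau>}" and M: "\<And>j. j \<in> J \<Longrightarrow> \<bar>fst j t\<bar> \<le> M" for j t M
  proof -
    note \<Psi> = J\<Psi>[OF M]
    note n = mult_nonneg_nonneg[OF K1(1) nonneg[OF \<Psi>]] mult_nonneg_nonneg[OF K2(1) nonneg[OF \<Psi>]]
      mult_nonneg_nonneg[OF K3(1) nonneg[OF \<Psi>]] mult_nonneg_nonneg[OF K4(1) nonneg[OF \<Psi>]] mult_nonneg_nonneg[OF K5(1) nonneg[OF \<Psi>]]
    show ?thesis
      unfolding distrib_right
    proof (rule Jcases[OF that(1)])
      fix x assume x: "x \<in> {0..l}"
      show "\<bar>(- 1) * Dw l (q1 t) x - (- 1) * Dw l (q2 t) x\<bar> \<le> K1 * M + K2 * M + K3 * M + K4 * M + K5 * M"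
        using K1(2)[OF that(2) \<Psi> x] n by linarith
      show "\<bar>Q \<zeta>1 q1 a1 c1 t x - Q \<zeta>2 q2 a2 c2 t x\<bar> \<le> K1 * M + K2 * M + K3 * M + K4 * M + K5 * M"
        using K2(2)[OF that(2) \<Psi> x] n by linarith
      show "\<bar>R \<zeta>1 q1 a1 c1 t x - R \<zeta>2 q2 a2 c2 t x\<bar> \<le> K1 * M + K2 * M + K3 * M + K4 * M + K5 * M"
        using K3(2)[OF that(2) \<Psi> x] n by linarith
    next
      show "\<bar>P \<zeta>1 q1 a1 c1 t - P \<zeta>2 q2 a2 c2 t\<bar> \<le> K1 * M + K2 * M + K3 * M + K4 * M + K5 * M"
        using K4(2)[OF that(2) \<Psi> ends(1)] n by linarith
      show "\<bar>P' \<zeta>1 q1 a1 c1 t - P' \<zeta>2 q2 a2 c2 t\<bar> \<le> K1 * M + K2 * M + K3 * M + K4 * M + K5 * M"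
        using K5(2)[OF that(2) \<Psi> ends(1)] n by linarith
    qed
  qed
  have \<tau>: "\<tau> \<in> {0..\<tau>}" using \<tau>1 by (simp add: time_ivl_def)
  have K0: "0 \<le> K1 + K2 + K3 + K4 + K5" using K1(1) K2(1) K3(1) K4(1) K5(1) by simp
  have zero: "fst j \<tau> = 0" if j: "j \<in> J" for j
    by (rule family_gronwall[where D = fst and D' = snd, OF der bd init K0 le j \<tau>])
  have "\<Psi> \<tau> 0" by (rule J\<Psi>) (simp add: zero)
  then show ?thesis unfolding \<Psi>_def by simp
qed

end

section \<open>Maximal solutions\<close>

text \<open>The time intervals are half-open, so the shorter is relatively open in the longer, and
  limits and derivatives at t do not distinguish them. Gluing rests on this.\<close>

lemma at_within_time_ivl:
  assumes "t \<in> time_ivl T'" "T' \<le> T"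
  shows "at t within time_ivl T = at t within time_ivl T'"
proof (rule at_within_nhd)
  show "open {s. ereal s < T'}" by (cases T') (auto simp: open_Collect_less)
  show "time_ivl T \<inter> {s. ereal s < T'} - {t} = time_ivl T' \<inter> {s. ereal s < T'} - {t}"
    using assms(2) by (auto simp: time_ivl_def)
qed (use assms in \<open>simp add: time_ivl_def\<close>)

lemma time_ivl_mono: "T' \<le> T \<Longrightarrow> time_ivl T' \<subseteq> time_ivl T"
  by (auto simp: time_ivl_def)

lemma time_ivl_min: "time_ivl (min T T') = time_ivl T \<inter> time_ivl T'"
  by (auto simp: time_ivl_def)

lemma Dcl_time_local:
  assumes "t \<in> time_ivl T'" "T' \<le> T" "\<And>s. s \<in> time_ivl T' \<Longrightarrow> f s = g s"
  shows "Dcl (time_ivl T) f t = Dcl (time_ivl T') g t"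
proof -
  have "(f has_vector_derivative v) (at t within time_ivl T') \<longleftrightarrow> (g has_vector_derivative v) (at t within time_ivl T')" for v
    using has_vector_derivative_transform[OF assms(1), of g f v] has_vector_derivative_transform[OF assms(1), of f g v] assms(3)
    by auto
  then show ?thesis
    unfolding Dcl_def vector_derivative_def at_within_time_ivl[OF assms(1,2)] by simp
qed

text \<open>The condition in \<open>smooth_curve\<close> with the sequence of time derivatives made
  explicit, so that sequences of different local solutions can be compared.\<close>

definition hs_curve :: "real \<Rightarrow> nat \<Rightarrow> real set \<Rightarrow> (nat \<Rightarrow> real \<Rightarrow> real \<Rightarrow> real) \<Rightarrow> bool" where
  "hs_curve l n I U \<longleftrightarrow> (\<forall>k. \<forall>t\<in>I. U k t \<in> Hs l n \<and>
     ((\<lambda>s. Hnorm l n (\<lambda>x. (U k s x - U k t x) / (s - t) - U (Suc k) t x)) \<longlongrightarrow> 0) (at t within I))"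

lemma hs_curve_pointwise:
  assumes U: "hs_curve l (Suc n) I U" and l: "l > 0" and t: "t \<in> I" and x: "x \<in> {0..l}"
  shows "((\<lambda>s. U k s x) has_real_derivative U (Suc k) t x) (at t within I)"
proof -
  have m: "\<And>k s. s \<in> I \<Longrightarrow> U k s \<in> Hs l (Suc n)"
    and lim: "((\<lambda>s. Hnorm l (Suc n) (\<lambda>x. (U k s x - U k t x) / (s - t) - U (Suc k) t x)) \<longlongrightarrow> 0) (at t within I)"
    using U t unfolding hs_curve_def by simp_all
  show ?thesis
    by (rule toC_pointwise[OF Hs_quotient[OF m t m[OF t] l lim] Hs_continuous[OF m] Hs_continuous[OF m[OF t]] t x])
qed

text \<open>Derivatives in the norm are pointwise derivatives in t, and these are unique on the
  common interval; agreement therefore passes from each order to the next.\<close>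

lemma hs_curve_unique:
  assumes U: "hs_curve l (Suc n) (time_ivl T) U" "hs_curve l (Suc n) (time_ivl T') U'" and l: "l > 0" and x: "x \<in> {0..l}"
    and eq: "\<And>t. t \<in> time_ivl T \<Longrightarrow> t \<in> time_ivl T' \<Longrightarrow> U 0 t x = U' 0 t x"
    and t: "t \<in> time_ivl T" "t \<in> time_ivl T'"
  shows "U k t x = U' k t x"
  using t
proof (induction k arbitrary: t)
  case 0
  then show ?case by (rule eq)
next
  case (Suc k)
  let ?I = "time_ivl (min T T')"
  have t: "t \<in> ?I" using Suc.prems by (simp add: time_ivl_min)
  note sub = time_ivl_mono[of "min T T'" T] time_ivl_mono[of "min T T'" T']
  have 1: "((\<lambda>s. U k s x) has_real_derivative U (Suc k) t x) (at t within ?I)"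
    by (rule has_field_derivative_subset[OF hs_curve_pointwise[OF U(1) l Suc.prems(1) x] sub(1)]) simp
  have "((\<lambda>s. U' k s x) has_real_derivative U' (Suc k) t x) (at t within ?I)"
    by (rule has_field_derivative_subset[OF hs_curve_pointwise[OF U(2) l Suc.prems(2) x] sub(2)]) simp
  then have 2: "((\<lambda>s. U k s x) has_real_derivative U' (Suc k) t x) (at t within ?I)"
    by (rule has_field_derivative_transform_within[OF _ zero_less_one t])
       (use Suc.IH in \<open>simp add: time_ivl_min\<close>)
  show ?case
    by (rule has_vector_derivative_unique_within[OF time_ivl_nontrivial[OF t]
          1[unfolded has_real_derivative_iff_has_vector_derivative] 2[unfolded has_real_derivative_iff_has_vector_derivative]])
qed

text \<open>For every t a local curve is chosen, and the derivatives at t are read from it. By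
  \<open>hs_curve_unique\<close> the choices are consistent on overlaps, so near t the glued
  sequence coincides on {0..l} with the one chosen for t.\<close>

lemma smooth_curve_glue:
  assumes l: "l > 0" and loc: "\<And>t. t \<in> time_ivl T \<Longrightarrow> \<exists>T' u'. T' \<le> T \<and> t \<in> time_ivl T' \<and>
      smooth_curve l (Suc n) (time_ivl T') u' \<and> (\<forall>s\<in>time_ivl T'. \<forall>x\<in>{0..l}. u' s x = u s x)"
  shows "smooth_curve l (Suc n) (time_ivl T) u"
proof -
  let ?P = "\<lambda>t p. fst p \<le> T \<and> t \<in> time_ivl (fst p) \<and> hs_curve l (Suc n) (time_ivl (fst p)) (snd p) \<and>
      (\<forall>s\<in>time_ivl (fst p). \<forall>x\<in>{0..l}. snd p 0 s x = u s x)"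
  have "\<exists>p. ?P t p" if t: "t \<in> time_ivl T" for t
  proof -
    from loc[OF t] obtain T' u' where T': "T' \<le> T" "t \<in> time_ivl T'" and c: "smooth_curve l (Suc n) (time_ivl T') u'"
      and e: "\<forall>s\<in>time_ivl T'. \<forall>x\<in>{0..l}. u' s x = u s x" by blast
    from c obtain U where U: "\<forall>s\<in>time_ivl T'. U (0::nat) s = u' s" "hs_curve l (Suc n) (time_ivl T') U"
      unfolding smooth_curve_def hs_curve_def by blast
    show ?thesis by (rule exI[of _ "(T', U)"]) (use T' e U in simp)
  qed
  then have "\<forall>t\<in>time_ivl T. \<exists>p. ?P t p" by simp
  from bchoice[OF this] obtain f where f: "\<forall>t\<in>time_ivl T. ?P t (f t)" by (rule exE)
  define W where "W t = fst (f t)" for t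
  define V where "V t = snd (f t)" for t
  have W: "W t \<le> T" "t \<in> time_ivl (W t)" and V: "hs_curve l (Suc n) (time_ivl (W t)) (V t)"
    and V0: "\<And>s x. s \<in> time_ivl (W t) \<Longrightarrow> x \<in> {0..l} \<Longrightarrow> V t 0 s x = u s x" if "t \<in> time_ivl T" for t
    using bspec[OF f that] unfolding W_def V_def by blast+
  \<comment> \<open>Order 0 has to be u itself, also outside {0..l}, where the local curves may
    differ from it.\<close>
  define U where "U k t = (if k = 0 then u t else V t k t)" for k t
  have UV: "U k s x = V t k s x" if t: "t \<in> time_ivl T" and s: "s \<in> time_ivl (W t)" and x: "x \<in> {0..l}" for k s t x
  proof -
    have sT: "s \<in> time_ivl T" using s time_ivl_mono[OF W(1)[OF t]] by blast
    have "V s k s x = V t k s x"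
      by (rule hs_curve_unique[OF V[OF sT] V[OF t] l x _ W(2)[OF sT] s]) (simp add: V0[OF sT _ x] V0[OF t _ x])
    then show ?thesis using V0[OF t s x] V0[OF sT W(2)[OF sT] x] by (simp add: U_def)
  qed
  show ?thesis
    unfolding smooth_curve_def
  proof (rule exI[of _ U], intro conjI allI ballI)
    fix t assume "t \<in> time_ivl T"
    show "U 0 t = u t" by (simp add: U_def)
  next
    fix k t assume t: "t \<in> time_ivl T"
    have V': "V t k t \<in> Hs l (Suc n)"
      "((\<lambda>s. Hnorm l (Suc n) (\<lambda>x. (V t k s x - V t k t x) / (s - t) - V t (Suc k) t x)) \<longlongrightarrow> 0) (at t within time_ivl (W t))"
      using V[OF t] W(2)[OF t] unfolding hs_curve_def by blast+
    show "U k t \<in> Hs l (Suc n)"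
      by (rule Hs_cong[OF V'(1)]) (rule UV[OF t W(2)[OF t], symmetric])
    show "((\<lambda>s. Hnorm l (Suc n) (\<lambda>x. (U k s x - U k t x) / (s - t) - U (Suc k) t x)) \<longlongrightarrow> 0) (at t within time_ivl T)"
      unfolding at_within_time_ivl[OF W(2)[OF t] W(1)[OF t]]
    proof (rule Lim_transform_eventually[OF V'(2)])
      have "Hnorm l (Suc n) (\<lambda>x. (V t k s x - V t k t x) / (s - t) - V t (Suc k) t x)
          = Hnorm l (Suc n) (\<lambda>x. (U k s x - U k t x) / (s - t) - U (Suc k) t x)" if "s \<in> time_ivl (W t)" for s
        by (rule Hnorm_AE_cong, rule AE_Ioo_all) (simp add: UV[OF t that] UV[OF t W(2)[OF t]])
      then show "eventually (\<lambda>s. Hnorm l (Suc n) (\<lambda>x. (V t k s x - V t k t x) / (s - t) - V t (Suc k) t x)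
          = Hnorm l (Suc n) (\<lambda>x. (U k s x - U k t x) / (s - t) - U (Suc k) t x)) (at t within time_ivl (W t))"
        by (simp add: eventually_at_filter)
    qed
  qed
qed

lemma smooth_on_glue:
  assumes loc: "\<And>t. t \<in> time_ivl T \<Longrightarrow> \<exists>T' f'. T' \<le> T \<and> t \<in> time_ivl T' \<and>
      smooth_on (time_ivl T') f' \<and> (\<forall>s\<in>time_ivl T'. f' s = f s)"
  shows "smooth_on (time_ivl T) f"
proof (rule Ck_on_smooth[OF time_ivl_nontrivial, THEN iffD2], assumption, rule allI, rule Ck_on_local[OF time_ivl_nontrivial], assumption)
  fix k t assume t: "t \<in> time_ivl T"
  from loc[OF t] obtain T' f' where T': "T' \<le> T" "t \<in> time_ivl T'" and c: "smooth_on (time_ivl T') f'"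
    and e: "\<And>s. s \<in> time_ivl T' \<Longrightarrow> f' s = f s" by blast
  have "Ck_on k (time_ivl T') f'"
    using Ck_on_smooth[OF time_ivl_nontrivial, of T' f'] c by blast
  then have "Ck_on k (time_ivl T') f" by (rule Ck_on_cong) (simp add: e)
  moreover have "time_ivl T \<inter> {s. ereal s < T'} = time_ivl T'" using T'(1) by (auto simp: time_ivl_def)
  moreover have "open {s. ereal s < T'}" by (cases T') (auto simp: open_Collect_less)
  ultimately show "\<exists>V. open V \<and> t \<in> V \<and> Ck_on k (time_ivl T \<inter> V) f"
    using T'(2) by (intro exI[of _ "{s. ereal s < T'}"]) (simp add: time_ivl_def)
qed

lemma AE_eq_cong:
  assumes "\<And>x. x \<in> {0<..<l::real} \<Longrightarrow> f x = g x"
  shows "(AE x in lebesgue_on {0<..<l}. h x = f x) \<longleftrightarrow> (AE x in lebesgue_on {0<..<l}. h x = g x)"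
proof -
  have "{x \<in> {0<..<l}. \<not> h x = f x} = {x \<in> {0<..<l}. \<not> h x = g x}" using assms by auto
  then show ?thesis unfolding AE_Ioo_iff by (simp only:)
qed

text \<open>The predicate under the choice sees the data only on the open interval, so equal data
  there give literally the same function, which may then be rewritten under further
  operators.\<close>

lemma R1_cong:
  assumes "\<And>x. x \<in> {0<..<l} \<Longrightarrow> f x = g x"
  shows "R1 l h0 b f = R1 l h0 b g"
proof -
  note e = AE_eq_cong[of l f g, OF assms]
  show ?thesis unfolding R1_def by (rule arg_cong[where f = Eps], rule ext, subst e) simp_all
qed

lemma dirichlet_sol_cong:
  assumes "\<And>x. x \<in> {0<..<l} \<Longrightarrow> f x = g x"
  shows "dirichlet_sol l h0 b f c d = dirichlet_sol l h0 b g c d"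
proof -
  note e = AE_eq_cong[of l f g, OF assms]
  show ?thesis unfolding dirichlet_sol_def by (rule arg_cong[where f = Eps], rule ext, subst e) simp_all
qed

lemma Rf_R0_cong:
  assumes "\<And>x. x \<in> {0..l} \<Longrightarrow> z x = z' x \<and> p x = p' x"
  shows "Rf l h0 gr b z p = Rf l h0 gr b z' p'"
    "R0 l h0 b (Bsrc l h0 gr b z p) = R0 l h0 b (Bsrc l h0 gr b z' p')"
  unfolding Rf_def R0_def
  by (rule R1_cong, use assms in simp) (rule dirichlet_sol_cong, use assms in \<open>simp add: Bsrc_def\<close>)

text \<open>Besides smoothness and the initial values, all conditions concern one time t. Their
  terms depend on the values of the unknowns on {0..l} at times near t, where one local solution
  supplies them.\<close>

lemma is_solution_glue:
  assumes l: "l > 0" and T: "T > 0"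
    and loc: "\<And>t. t \<in> time_ivl T \<Longrightarrow> \<exists>T' \<zeta>' q' a' c'. T' \<le> T \<and> t \<in> time_ivl T' \<and>
      is_solution l h0 gr b g0 gl (Suc m) \<zeta>in qin T' \<zeta>' q' a' c' \<and>
      (\<forall>s\<in>time_ivl T'. (\<forall>x\<in>{0..l}. \<zeta>' s x = \<zeta> s x \<and> q' s x = q s x) \<and> a' s = a s \<and> c' s = c s)"
  shows "is_solution l h0 gr b g0 gl (Suc m) \<zeta>in qin T \<zeta> q a c"
proof -
  let ?I = "time_ivl T"
  have 1: "smooth_curve l (Suc m) ?I \<zeta>"
  proof (rule smooth_curve_glue[OF l])
    fix t assume "t \<in> ?I"
    from loc[OF this] obtain T' \<zeta>' q' a' c' where "T' \<le> T \<and> t \<in> time_ivl T'" and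
      s: "is_solution l h0 gr b g0 gl (Suc m) \<zeta>in qin T' \<zeta>' q' a' c'" and
      "\<forall>s\<in>time_ivl T'. (\<forall>x\<in>{0..l}. \<zeta>' s x = \<zeta> s x \<and> q' s x = q s x) \<and> a' s = a s \<and> c' s = c s" by blast
    then show "\<exists>T' u'. T' \<le> T \<and> t \<in> time_ivl T' \<and> smooth_curve l (Suc m) (time_ivl T') u' \<and>
        (\<forall>s\<in>time_ivl T'. \<forall>x\<in>{0..l}. u' s x = \<zeta> s x)"
      using s[unfolded is_solution_def Let_def, THEN conjunct1] by blast
  qed
  have 2: "smooth_curve l (Suc (Suc m)) ?I q"
  proof (rule smooth_curve_glue[OF l])
    fix t assume "t \<in> ?I"
    from loc[OF this] obtain T' \<zeta>' q' a' c' where "T' \<le> T \<and> t \<in> time_ivl T'" and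
      s: "is_solution l h0 gr b g0 gl (Suc m) \<zeta>in qin T' \<zeta>' q' a' c'" and
      "\<forall>s\<in>time_ivl T'. (\<forall>x\<in>{0..l}. \<zeta>' s x = \<zeta> s x \<and> q' s x = q s x) \<and> a' s = a s \<and> c' s = c s" by blast
    moreover have "smooth_curve l (Suc (Suc m)) (time_ivl T') q'"
      using s[unfolded is_solution_def Let_def, THEN conjunct2, THEN conjunct1] by simp
    ultimately show "\<exists>T' u'. T' \<le> T \<and> t \<in> time_ivl T' \<and> smooth_curve l (Suc (Suc m)) (time_ivl T') u' \<and>
        (\<forall>s\<in>time_ivl T'. \<forall>x\<in>{0..l}. u' s x = q s x)" by blast
  qed
  have 3: "smooth_on ?I a"
  proof (rule smooth_on_glue)
    fix t assume "t \<in> ?I"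
    from loc[OF this] obtain T' \<zeta>' q' a' c' where "T' \<le> T \<and> t \<in> time_ivl T'" and
      s: "is_solution l h0 gr b g0 gl (Suc m) \<zeta>in qin T' \<zeta>' q' a' c'" and
      "\<forall>s\<in>time_ivl T'. (\<forall>x\<in>{0..l}. \<zeta>' s x = \<zeta> s x \<and> q' s x = q s x) \<and> a' s = a s \<and> c' s = c s" by blast
    then show "\<exists>T' f'. T' \<le> T \<and> t \<in> time_ivl T' \<and> smooth_on (time_ivl T') f' \<and> (\<forall>s\<in>time_ivl T'. f' s = a s)"
      using s[unfolded is_solution_def Let_def, THEN conjunct2, THEN conjunct2, THEN conjunct1] by blast
  qed
  have 4: "smooth_on ?I c"
  proof (rule smooth_on_glue)
    fix t assume "t \<in> ?I"
    from loc[OF this] obtain T' \<zeta>' q' a' c' where "T' \<le> T \<and> t \<in> time_ivl T'" and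
      s: "is_solution l h0 gr b g0 gl (Suc m) \<zeta>in qin T' \<zeta>' q' a' c'" and
      "\<forall>s\<in>time_ivl T'. (\<forall>x\<in>{0..l}. \<zeta>' s x = \<zeta> s x \<and> q' s x = q s x) \<and> a' s = a s \<and> c' s = c s" by blast
    then show "\<exists>T' f'. T' \<le> T \<and> t \<in> time_ivl T' \<and> smooth_on (time_ivl T') f' \<and> (\<forall>s\<in>time_ivl T'. f' s = c s)"
      using s[unfolded is_solution_def Let_def, THEN conjunct2, THEN conjunct2, THEN conjunct2, THEN conjunct1] by blast
  qed
  have pt: "(\<forall>x\<in>{0..l}. h0 + \<zeta> t x - b x \<noteq> 0) \<and> (h0 + g0 t - b 0 \<noteq> 0 \<and> h0 + gl t - b l \<noteq> 0) \<and>
      (\<forall>x\<in>{0<..<l}.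
         Dcl ?I (\<lambda>s. \<zeta> s x) t + Dw l (q t) x = 0 \<and>
         Dcl ?I (\<lambda>s. q s x) t
           + sqrt 3 * (hb h0 b x / alphab l b x) * hbS_adj l h0 b (Rf l h0 gr b (\<zeta> t) (q t)) x
         = R0 l h0 b (Bsrc l h0 gr b (\<zeta> t) (q t)) x
           + Dcl ?I a t * s_left l h0 b x + Dcl ?I c t * s_right l h0 b x) \<and>
      Sb' l h0 b *v vector [Dcl ?I a t, Dcl ?I c t] + Vbdry l h0 gr b (g0 t) (a t) (gl t) (c t)
         = Vint l h0 gr b (\<zeta> t) (q t) - vector [Dcl {0..} (Dcl {0..} g0) t, Dcl {0..} (Dcl {0..} gl) t]"
    if t: "t \<in> ?I" for t
  proof -
    from loc[OF t] obtain T' \<zeta>' q' a' c' where T': "T' \<le> T" "t \<in> time_ivl T'" and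
      s: "is_solution l h0 gr b g0 gl (Suc m) \<zeta>in qin T' \<zeta>' q' a' c'" and
      e: "\<And>s x. s \<in> time_ivl T' \<Longrightarrow> x \<in> {0..l} \<Longrightarrow> \<zeta> s x = \<zeta>' s x \<and> q s x = q' s x"
        "\<And>s. s \<in> time_ivl T' \<Longrightarrow> a s = a' s" "\<And>s. s \<in> time_ivl T' \<Longrightarrow> c s = c' s" by fastforce
    note S4 = s[unfolded is_solution_def Let_def, THEN conjunct2, THEN conjunct2, THEN conjunct2, THEN conjunct2]
    note S5 = S4[THEN conjunct1, THEN bspec, OF T'(2)] S4[THEN conjunct2, THEN conjunct1, THEN bspec, OF T'(2)]
      S4[THEN conjunct2, THEN conjunct2, THEN conjunct1, THEN bspec, OF T'(2)]
      S4[THEN conjunct2, THEN conjunct2, THEN conjunct2, THEN conjunct1, THEN bspec, OF T'(2)]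
    have d: "Dcl ?I (\<lambda>s. \<zeta> s x) t = Dcl (time_ivl T') (\<lambda>s. \<zeta>' s x) t" "Dcl ?I (\<lambda>s. q s x) t = Dcl (time_ivl T') (\<lambda>s. q' s x) t"
      if "x \<in> {0..l}" for x
      using e(1)[OF _ that] by (auto intro!: Dcl_time_local[OF T'(2,1)])
    have d': "Dcl ?I a t = Dcl (time_ivl T') a' t" "Dcl ?I c t = Dcl (time_ivl T') c' t"
      by (rule Dcl_time_local[OF T'(2,1)]; simp add: e)+
    have dw: "Dw l (q t) = Dw l (q' t)" by (rule Dw_cong) (use e(1)[OF T'(2)] in simp)
    have R: "Rf l h0 gr b (\<zeta> t) (q t) = Rf l h0 gr b (\<zeta>' t) (q' t)"
      "R0 l h0 b (Bsrc l h0 gr b (\<zeta> t) (q t)) = R0 l h0 b (Bsrc l h0 gr b (\<zeta>' t) (q' t))"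
      by (rule Rf_R0_cong, rule e(1)[OF T'(2)], assumption)+
    have V: "Vint l h0 gr b (\<zeta> t) (q t) = Vint l h0 gr b (\<zeta>' t) (q' t)" unfolding Vint_def R ..
    show ?thesis
      unfolding d' dw R V e(2)[OF T'(2)] e(3)[OF T'(2)]
    proof (intro conjI ballI)
      fix x assume x: "x \<in> {0..l}"
      show "h0 + \<zeta> t x - b x \<noteq> 0" using bspec[OF S5(1) x] e(1)[OF T'(2) x] by simp
    next
      fix x assume x: "x \<in> {0<..<l}"
      then have x': "x \<in> {0..l}" by simp
      show "Dcl ?I (\<lambda>s. \<zeta> s x) t + Dw l (q' t) x = 0" unfolding d[OF x'] by (rule bspec[OF S5(3) x, THEN conjunct1])
      show "Dcl ?I (\<lambda>s. q s x) t
           + sqrt 3 * (hb h0 b x / alphab l b x) * hbS_adj l h0 b (Rf l h0 gr b (\<zeta>' t) (q' t)) x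
         = R0 l h0 b (Bsrc l h0 gr b (\<zeta>' t) (q' t)) x
           + Dcl (time_ivl T') a' t * s_left l h0 b x + Dcl (time_ivl T') c' t * s_right l h0 b x"
        unfolding d[OF x'] by (rule bspec[OF S5(3) x, THEN conjunct2])
    qed (rule S5(2)[THEN conjunct1] S5(2)[THEN conjunct2] S5(4))+
  qed
  have "0 \<in> ?I" using T by (simp add: time_ivl_def zero_ereal_def)
  from loc[OF this] obtain T' \<zeta>' q' a' c' where T': "0 \<in> time_ivl T'" and
    s: "is_solution l h0 gr b g0 gl (Suc m) \<zeta>in qin T' \<zeta>' q' a' c'" and
    e: "\<forall>s\<in>time_ivl T'. (\<forall>x\<in>{0..l}. \<zeta>' s x = \<zeta> s x \<and> q' s x = q s x) \<and> a' s = a s \<and> c' s = c s" by blast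
  note S8 = s[unfolded is_solution_def Let_def, THEN conjunct2, THEN conjunct2, THEN conjunct2, THEN conjunct2,
      THEN conjunct2, THEN conjunct2, THEN conjunct2, THEN conjunct2]
  have 5: "(\<forall>x\<in>{0..l}. \<zeta> 0 x = \<zeta>in x \<and> q 0 x = qin x) \<and> a 0 = qin 0 \<and> c 0 = qin l"
    using S8 bspec[OF e T'] by auto
  show ?thesis
    unfolding is_solution_def Let_def Suc_eq_plus1[symmetric] using 1 2 3 4 5 pt by simp
qed

lemma smooth_on_continuous:
  assumes "\<And>t. t \<in> I \<Longrightarrow> at t within I \<noteq> bot" "smooth_on I f"
  shows "continuous_on I f"
proof -
  have "Ck_on 0 I f" by (rule Ck_on_smooth[THEN iffD1, rule_format, OF assms])
  then show ?thesis by simp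
qed

lemma continuous_bdd_below:
  fixes f :: "real \<Rightarrow> real"
  assumes "continuous_on {a..c} f" "A \<subseteq> {a..c}"
  shows "bdd_below (f ` A)"
proof -
  from continuous_bounded_Icc[OF assms(1)] obtain M where "\<forall>x\<in>{a..c}. \<bar>f x\<bar> \<le> M" by blast
  then show ?thesis using assms(2) by (intro bdd_belowI[of _ "- M"]) (force simp: abs_le_iff)
qed

text \<open>The infimum over the open interval bounds the interior values from below, and continuity
  extends the bound to the end points.\<close>

lemma INF_interior_pos:
  fixes f :: "real \<Rightarrow> real"
  assumes f: "continuous_on {a..c} f" and inf: "0 < (INF x\<in>{a<..<c}. f x)" and ac: "a < c" and x: "x \<in> {a..c}"
  shows "0 < f x"
proof -
  have cl: "closure {a<..<c} = {a..c}" using ac by (rule closure_greaterThanLessThan)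
  have "bdd_below (f ` {a<..<c})" by (rule continuous_bdd_below[OF f]) auto
  then have "(INF x\<in>{a<..<c}. f x) \<le> f y" if "y \<in> {a<..<c}" for y using that by (rule cINF_lower)
  from continuous_ge_on_closure[of "{a<..<c}" f x, unfolded cl, OF f x this] inf show ?thesis by simp
qed

lemma INF_compact_pos:
  fixes f :: "real \<Rightarrow> real"
  assumes f: "continuous_on {a..c} f" and ac: "a \<le> c"
  shows "0 < (INF x\<in>{a..c}. f x) \<longleftrightarrow> (\<forall>x\<in>{a..c}. 0 < f x)"
proof
  assume "0 < (INF x\<in>{a..c}. f x)"
  moreover have "(INF x\<in>{a..c}. f x) \<le> f y" if "y \<in> {a..c}" for y
    using continuous_bdd_below[OF f order_refl] that by (rule cINF_lower)
  ultimately show "\<forall>x\<in>{a..c}. 0 < f x" by force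
next
  assume p: "\<forall>x\<in>{a..c}. 0 < f x"
  obtain y where y: "y \<in> {a..c}" "\<And>x. x \<in> {a..c} \<Longrightarrow> f y \<le> f x"
    using continuous_attains_inf[OF compact_Icc _ f] ac by auto
  then have "f y \<le> (INF x\<in>{a..c}. f x)" by (intro cINF_greatest) auto
  then show "0 < (INF x\<in>{a..c}. f x)" using p y(1) by force
qed

theorem proposition2p11:
  fixes l h0 gr :: real and b g0 gl \<zeta>in qin :: "real \<Rightarrow> real" and n :: nat
  assumes "l > 0" and "h0 > 0" and "gr > 0"
    and "smooth_on {0..l} b"
    and "(INF x\<in>{0<..<l}. hb h0 b x) > 0"
    and "(INF x\<in>{0<..<l}. 1 + 1/4 * (Dcl {0..l} b x)\<^sup>2
            + 1/6 * hb h0 b x * Dcl {0..l} (Dcl {0..l} b) x) > 0"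
    and "smooth_on {0..} g0" and "smooth_on {0..} gl"
    and "n \<noteq> 0"
    and "\<zeta>in \<in> Hs l n" and "qin \<in> Hs l (n + 1)"
    and "(INF x\<in>{0..l}. h0 - b x + \<zeta>in x) > 0"
    and "\<zeta>in 0 = g0 0" and "- Dw l qin 0 = Dcl {0..} g0 0"
    and "\<zeta>in l = gl 0" and "- Dw l qin l = Dcl {0..} gl 0"
  shows "\<exists>T::ereal. T > 0 \<and> (\<exists>\<zeta> q q0 ql.
     is_solution l h0 gr b g0 gl n \<zeta>in qin T \<zeta> q q0 ql \<and>
     (\<forall>T' \<zeta>' q' q0' ql'. T' > 0 \<and> is_solution l h0 gr b g0 gl n \<zeta>in qin T' \<zeta>' q' q0' ql' \<longrightarrow>
        T' \<le> T \<and>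
        (\<forall>t\<in>time_ivl T'. (\<forall>x\<in>{0..l}. \<zeta>' t x = \<zeta> t x \<and> q' t x = q t x) \<and>
                          q0' t = q0 t \<and> ql' t = ql t)) \<and>
     (\<forall>t\<in>time_ivl T. q0 t = q t 0 \<and> ql t = q t l \<and> (INF x\<in>{0..l}. h0 - b x + \<zeta> t x) > 0))"
proof -
  note l = \<open>l > 0\<close> and g0 = \<open>smooth_on {0..} g0\<close> and gl = \<open>smooth_on {0..} gl\<close>
  have nt: "x \<in> {0..l} \<Longrightarrow> at x within {0..l} \<noteq> bot" for x
    using at_within_Icc_nontrivial[of x l] l by simp
  note sm0 = \<open>smooth_on {0..l} b\<close>
  have sm1: "smooth_on {0..l} (Dcl {0..l} b)" by (rule Dcl_smooth(1)[OF nt sm0])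
  have sm2: "smooth_on {0..l} (Dcl {0..l} (Dcl {0..l} b))" by (rule Dcl_smooth(1)[OF nt sm1])
  have cb: "continuous_on {0..l} b" "continuous_on {0..l} (Dcl {0..l} b)" "continuous_on {0..l} (Dcl {0..l} (Dcl {0..l} b))"
    by (rule smooth_on_continuous[OF nt sm0] smooth_on_continuous[OF nt sm1] smooth_on_continuous[OF nt sm2]; assumption)+
  have ch: "continuous_on {0..l} (hb h0 b)" unfolding hb_def[abs_def] by (intro continuous_intros cb)
  have bot: "bottom l h0 b"
  proof
    show "0 < hb h0 b x" if "x \<in> {0..l}" for x
      by (rule INF_interior_pos[OF ch assms(5) l that])
    show "0 < 1 + 1/4 * (Dcl {0..l} b x)\<^sup>2 + 1/6 * hb h0 b x * Dcl {0..l} (Dcl {0..l} b) x" if "x \<in> {0..l}" for x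
      by (rule INF_interior_pos[OF _ assms(6) l that]) (intro continuous_intros cb ch)
  qed (fact l sm0)+
  interpret bottom l h0 b by (rule bot)
  obtain m where n: "n = Suc m" using \<open>n \<noteq> 0\<close> by (cases n) auto
  have "continuous_on {0..l} \<zeta>in" using \<open>\<zeta>in \<in> Hs l n\<close> unfolding n by (rule Hs_continuous)
  then have "continuous_on {0..l} (\<lambda>x. h0 - b x + \<zeta>in x)" by (intro continuous_intros cb)
  from INF_compact_pos[OF this] assms(12) l have pos: "\<And>x. x \<in> {0..l} \<Longrightarrow> 0 < h0 - b x + \<zeta>in x" by simp
  let ?sol = "\<lambda>T \<zeta> q a c. is_solution l h0 gr b g0 gl (Suc m) \<zeta>in qin T \<zeta> q a c"
  \<comment> \<open>The existence times of all solutions compete, so their supremum T bounds each of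
    them at once; it remains to build a solution that lives up to T.\<close>
  define \<T> where "\<T> = {T. 0 < T \<and> (\<exists>\<zeta> q a c. ?sol T \<zeta> q a c)}"
  define T where "T = Sup \<T>"
  obtain T0 where T0: "0 < T0" "\<exists>\<zeta> q a c. ?sol (ereal T0) \<zeta> q a c"
    using local_existence[OF g0 gl \<open>n \<noteq> 0\<close> assms(10,11) pos assms(13,15), of gr] unfolding n by blast
  then have "ereal T0 \<in> \<T>" by (simp add: \<T>_def zero_ereal_def)
  then have "ereal T0 \<le> T" unfolding T_def by (rule Sup_upper)
  then have T: "0 < T" using T0(1) by (auto intro: less_le_trans[of 0 "ereal T0"])
  \<comment> \<open>Every time below the supremum lies in the interval of some solution, and one
    such solution is chosen for each time.\<close>
  have "\<forall>t\<in>time_ivl T. \<exists>s. t \<in> time_ivl (fst s) \<and> fst s \<in> \<T> \<and>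
      ?sol (fst s) (fst (snd s)) (fst (snd (snd s))) (fst (snd (snd (snd s)))) (snd (snd (snd (snd s))))"
  proof
    fix t assume t: "t \<in> time_ivl T"
    then have "ereal t < Sup \<T>" by (simp add: time_ivl_def T_def)
    then obtain T' where T': "T' \<in> \<T>" "ereal t < T'" unfolding less_Sup_iff by blast
    then obtain \<zeta> q a c where "?sol T' \<zeta> q a c" unfolding \<T>_def by blast
    then show "\<exists>s. t \<in> time_ivl (fst s) \<and> fst s \<in> \<T> \<and>
      ?sol (fst s) (fst (snd s)) (fst (snd (snd s))) (fst (snd (snd (snd s)))) (snd (snd (snd (snd s))))"
      using T' t by (intro exI[of _ "(T', \<zeta>, q, a, c)"]) (simp add: time_ivl_def)
  qed
  from bchoice[OF this] obtain f where f: "\<forall>t\<in>time_ivl T. t \<in> time_ivl (fst (f t)) \<and> fst (f t) \<in> \<T> \<and>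
      ?sol (fst (f t)) (fst (snd (f t))) (fst (snd (snd (f t)))) (fst (snd (snd (snd (f t))))) (snd (snd (snd (snd (f t)))))"
    by (rule exE)
  \<comment> \<open>The value at time t is that of the solution chosen for t; by uniqueness every
    other solution alive at t has the same value, so the pieces fit together.\<close>
  define \<zeta> where "\<zeta> t = fst (snd (f t)) t" for t
  define q where "q t = fst (snd (snd (f t))) t" for t
  define a where "a t = fst (snd (snd (snd (f t)))) t" for t
  define c where "c t = snd (snd (snd (snd (f t)))) t" for t
  have T'_le: "T' \<le> T" if "0 < T'" "?sol T' \<zeta>' q' a' c'" for T' \<zeta>' q' a' c'
    unfolding T_def by (rule Sup_upper) (use that in \<open>auto simp: \<T>_def\<close>)
  have agree: "(\<forall>x\<in>{0..l}. \<zeta>' t x = \<zeta> t x \<and> q' t x = q t x) \<and> a' t = a t \<and> c' t = c t"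
    if T': "T' \<le> T" and s: "?sol T' \<zeta>' q' a' c'" and t: "t \<in> time_ivl T'" for T' \<zeta>' q' a' c' t
  proof -
    have "t \<in> time_ivl T" using time_ivl_mono[OF T'] t by blast
    note ft = bspec[OF f this]
    show ?thesis unfolding \<zeta>_def q_def a_def c_def
      by (rule solution_unique[OF g0 gl s ft[THEN conjunct2, THEN conjunct2] t ft[THEN conjunct1] pos])
  qed
  have sol: "?sol T \<zeta> q a c"
  proof (rule is_solution_glue[OF l T])
    fix t assume "t \<in> time_ivl T"
    note ft = bspec[OF f this]
    have le: "fst (f t) \<le> T" unfolding T_def by (rule Sup_upper[OF ft[THEN conjunct2, THEN conjunct1]])
    show "\<exists>T' \<zeta>' q' a' c'. T' \<le> T \<and> t \<in> time_ivl T' \<and> ?sol T' \<zeta>' q' a' c' \<and>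
      (\<forall>s\<in>time_ivl T'. (\<forall>x\<in>{0..l}. \<zeta>' s x = \<zeta> s x \<and> q' s x = q s x) \<and> a' s = a s \<and> c' s = c s)"
      by (rule exI, rule exI, rule exI, rule exI, rule exI, rule conjI[OF le], rule conjI[OF ft[THEN conjunct1]],
          rule conjI[OF ft[THEN conjunct2, THEN conjunct2]], rule ballI, rule agree[OF le ft[THEN conjunct2, THEN conjunct2]])
  qed
  have "q t 0 = a t \<and> q t l = c t \<and> 0 < (INF x\<in>{0..l}. h0 - b x + \<zeta> t x)" if t: "t \<in> time_ivl T" for t
  proof -
    have tt: "t \<in> {0..t}" using t by (simp add: time_ivl_def)
    have p: "0 < h0 - b x + \<zeta> t x" if "x \<in> {0..l}" for x
      using solution_bounds(1)[OF sol t pos tt that] by simp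
    have "\<zeta> t \<in> Hs l (Suc m)" using solution_equations[OF sol] t by blast
    then have "continuous_on {0..l} (\<lambda>x. h0 - b x + \<zeta> t x)" by (intro continuous_intros cb Hs_continuous)
    from INF_compact_pos[OF this] p l solution_boundary_values[OF sol t] show ?thesis by simp
  qed
  then have 1: "\<forall>t\<in>time_ivl T. a t = q t 0 \<and> c t = q t l \<and> (INF x\<in>{0..l}. h0 - b x + \<zeta> t x) > 0" by simp
  have 2: "\<forall>T' \<zeta>' q' a' c'. T' > 0 \<and> ?sol T' \<zeta>' q' a' c' \<longrightarrow> T' \<le> T \<and>
      (\<forall>t\<in>time_ivl T'. (\<forall>x\<in>{0..l}. \<zeta>' t x = \<zeta> t x \<and> q' t x = q t x) \<and> a' t = a t \<and> c' t = c t)"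
  proof (intro allI impI, elim conjE, rule conjI)
    fix T' \<zeta>' q' a' c' assume s: "0 < T'" "?sol T' \<zeta>' q' a' c'"
    show le: "T' \<le> T" by (rule T'_le[OF s])
    show "\<forall>t\<in>time_ivl T'. (\<forall>x\<in>{0..l}. \<zeta>' t x = \<zeta> t x \<and> q' t x = q t x) \<and> a' t = a t \<and> c' t = c t"
      by (rule ballI, rule agree[OF le s(2)])
  qed
  show ?thesis
    unfolding n
    by (rule exI[of _ T], rule conjI[OF T], rule exI[of _ \<zeta>], rule exI[of _ q], rule exI[of _ a], rule exI[of _ c],
        rule conjI[OF sol], rule conjI[OF 2 1])
qed

end
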